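(* Let $n\in\mathbb{N}$ and let $\rho:\mathbb{R}^n\setminus\{0\}\to[0,\infty)$ be a radial kernel with $\rho\in L^1_{\mathrm{loc}}(\mathbb{R}^n)$, $\int_{\mathbb{R}^n}\min\{1,|x|^{-1}\}\rho(x)\,dx<\infty$ and $\inf_{\overline{B(0,\varepsilon)}}\rho>0$ for some $\varepsilon>0$. Assume that $K_\rho(x)\ge0$ for $x\neq0$. Then $W^{\rho,2}(\mathbb{R}^n)=H^{\rho,2}(\mathbb{R}^n)$, with equivalence of norms.
   Context: Fourier transform convention: $\widehat f(\xi)=\int_{\mathbb{R}^n}f(x)e^{-2\pi i x\cdot\xi}\,dx$, extended to tempered distributions. $\overline\rho$ is the radial representation of $\rho$, $\rho(x)=\overline\rho(|x|)$. For $u\in C_c^\infty(\mathbb{R}^n)$, $D_\rho u(x)=\int_{\mathbb{R}^n}\frac{u(x)-u(y)}{|x-y|}\frac{x-y}{|x-y|}\rho(x-y)\,dy$. The space $H^{\rho,2}(\mathbb{R}^n)$ is the closure (completion within $L^2(\mathbb{R}^n)$) of $C_c^\infty(\mathbb{R}^n)$ under the norm $\|u\|_{\rho,2}=\|u\|_{L^2}+\|D_\rho u\|_{L^2}$, with $D_\rho$ extended by density; equivalently $H^{\rho,2}(\mathbb{R}^n)=\{u\in L^2(\mathbb{R}^n): D_\rho u\in L^2(\mathbb{R}^n;\mathbb{R}^n)\}$. $Q_\rho(x):=\int_{|x|}^\infty\frac{\overline\rho(t)}{t}\,dt$ ($x\ne0$) is a locally integrable tempered distribution; its Fourier transform is the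 function $\widehat{Q_\rho}(\xi)=\frac{1}{2\pi|\xi|}\int_{\mathbb{R}^n}\frac{\rho(x)x_1}{|x|^2}\sin(2\pi|\xi|x_1)\,dx$, $\xi\ne0$, and $\lambda_\rho(\xi):=2\pi i\,\xi\,\widehat{Q_\rho}(\xi)$. $K_\rho$ is the tempered distribution $K_\rho=\sum_{j}\partial_jQ_\rho*\partial_jQ_\rho$, equivalently the one with $\widehat{K_\rho}(\xi)=-|\lambda_\rho(\xi)|^2$. The assumption "$K_\rho(x)\ge0$ for $x\ne0$" means that the restriction of $K_\rho$ to $\mathbb{R}^n\setminus\{0\}$ is given by a nonnegative function in $L^1_{\mathrm{loc}}(\mathbb{R}^n\setminus\{0\})$, again denoted $K_\rho$. The nonlocal Gagliardo space is $W^{\rho,2}(\mathbb{R}^n)=\{u\in L^2(\mathbb{R}^n):[u]_{\rho,2}<\infty\}$, where $[u]_{\rho,2}:=\int_{\mathbb{R}^n}\int_{\mathbb{R}^n}|u(x)-u(y)|^2K_\rho(x-y)\,dy\,dx$, with norm $\|u\|_{W^{\rho,2}}=(\|u\|_{L^2}^2+[u]_{\rho,2})^{1/2}$. *)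

theory Defs
  imports "HOL-Analysis.Analysis"
begin

section \<open>Function spaces\<close>

text \<open>Functions are total on \<^typ>\<open>real^'n\<close>; no definition below depends on the value of a
  kernel at the origin. Measurability is always Lebesgue measurability.\<close>

definition square_integrable :: "(real^'n \<Rightarrow> 'b::euclidean_space) \<Rightarrow> bool" where
  "square_integrable f \<longleftrightarrow>
     f \<in> borel_measurable lebesgue \<and> integrable lebesgue (\<lambda>x. (norm (f x))\<^sup>2)"

definition L2_norm :: "(real^'n \<Rightarrow> 'b::euclidean_space) \<Rightarrow> real" where
  "L2_norm f = sqrt (LINT x|lebesgue. (norm (f x))\<^sup>2)"

text \<open>Stated with the nonnegative integral, so that a difference that is not square integrable
  counts as infinitely far away (a Bochner integral would be \<open>0\<close> there).\<close>

definition L2_tendsto :: "(nat \<Rightarrow> real^'n \<Rightarrow> 'b::euclidean_space) \<Rightarrow> (real^'n \<Rightarrow> 'b) \<Rightarrow> bool" where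
  "L2_tendsto F f \<longleftrightarrow>
     (\<lambda>k. \<integral>\<^sup>+x. ennreal ((norm (F k x - f x))\<^sup>2) \<partial>lebesgue) \<longlonglongrightarrow> 0"

definition locally_integrable_on :: "(real^'n) set \<Rightarrow> (real^'n \<Rightarrow> 'b::euclidean_space) \<Rightarrow> bool" where
  "locally_integrable_on S f \<longleftrightarrow> (\<forall>C. compact C \<and> C \<subseteq> S \<longrightarrow> set_integrable lebesgue C f)"

primrec iter_partial ::
    "(real^'n) list \<Rightarrow> (real^'n \<Rightarrow> 'b::real_normed_vector) \<Rightarrow> real^'n \<Rightarrow> 'b" where
  "iter_partial [] f = f"
| "iter_partial (b # bs) f = (\<lambda>x. frechet_derivative (iter_partial bs f) (at x) b)"

definition smooth :: "(real^'n \<Rightarrow> 'b::real_normed_vector) \<Rightarrow> bool" where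
  "smooth f \<longleftrightarrow>
     (\<forall>bs. set bs \<subseteq> Basis \<longrightarrow> (\<forall>x. iter_partial bs f differentiable (at x)))"

definition fun_support :: "(real^'n \<Rightarrow> 'b::real_normed_vector) \<Rightarrow> (real^'n) set" where
  "fun_support f = closure {x. f x \<noteq> 0}"

definition test_function :: "(real^'n \<Rightarrow> 'b::real_normed_vector) \<Rightarrow> bool" where
  "test_function f \<longleftrightarrow> smooth f \<and> compact (fun_support f)"


section \<open>Distributions and the Fourier transform\<close>

definition fourier :: "(real^'n \<Rightarrow> complex) \<Rightarrow> real^'n \<Rightarrow> complex" where
  "fourier f \<xi> = (LINT x|lebesgue. f x * exp (- 2 * of_real pi * \<i> * of_real (x \<bullet> \<xi>)))"

definition inv_fourier :: "(real^'n \<Rightarrow> complex) \<Rightarrow> real^'n \<Rightarrow> complex" where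
  "inv_fourier f x = (LINT \<xi>|lebesgue. f \<xi> * exp (2 * of_real pi * \<i> * of_real (x \<bullet> \<xi>)))"

text \<open>A tempered distribution is given by its pairing \<open>T \<phi>\<close> with Schwartz functions \<open>\<phi>\<close>; the
  values of \<open>T\<close> at other arguments are never used.\<close>

type_synonym 'n distribution = "(real^'n \<Rightarrow> complex) \<Rightarrow> complex"

definition distr_of_fun :: "(real^'n \<Rightarrow> complex) \<Rightarrow> 'n distribution" where
  "distr_of_fun f = (\<lambda>\<phi>. LINT x|lebesgue. f x * \<phi> x)"

definition fourier_distr :: "'n distribution \<Rightarrow> 'n::finite distribution" where
  "fourier_distr T = (\<lambda>\<phi>. T (fourier \<phi>))"

definition inv_fourier_distr :: "'n distribution \<Rightarrow> 'n::finite distribution" where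
  "inv_fourier_distr T = (\<lambda>\<phi>. T (inv_fourier \<phi>))"

text \<open>The restriction of \<open>T\<close> to the complement of the origin is the function \<open>f\<close>.\<close>

definition given_off_origin_by :: "'n::finite distribution \<Rightarrow> (real^'n \<Rightarrow> complex) \<Rightarrow> bool" where
  "given_off_origin_by T f \<longleftrightarrow>
     locally_integrable_on (- {0}) f \<and>
     (\<forall>\<phi>. test_function \<phi> \<and> 0 \<notin> fun_support \<phi> \<longrightarrow> T \<phi> = (LINT x|lebesgue. f x * \<phi> x))"


section \<open>The nonlocal gradient and the space H\<close>

definition nonlocal_grad :: "(real^'n \<Rightarrow> real) \<Rightarrow> (real^'n \<Rightarrow> real) \<Rightarrow> real^'n \<Rightarrow> real^'n" where
  "nonlocal_grad \<rho> u x =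
     (LINT y|lebesgue. ((u x - u y) / norm (x - y) * \<rho> (x - y)) *\<^sub>R ((x - y) /\<^sub>R norm (x - y)))"

definition grad_closure :: "(real^'n \<Rightarrow> real) \<Rightarrow> (real^'n \<Rightarrow> real) \<Rightarrow> (real^'n \<Rightarrow> real^'n) \<Rightarrow> bool" where
  "grad_closure \<rho> u v \<longleftrightarrow>
     square_integrable u \<and> square_integrable v \<and>
     (\<exists>\<phi>. (\<forall>k. test_function (\<phi> k)) \<and> L2_tendsto \<phi> u \<and>
          L2_tendsto (\<lambda>k. nonlocal_grad \<rho> (\<phi> k)) v)"

definition H_space :: "(real^'n \<Rightarrow> real) \<Rightarrow> (real^'n \<Rightarrow> real) set" where
  "H_space \<rho> = {u. \<exists>v. grad_closure \<rho> u v}"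

text \<open>The extension by density is unique only up to null sets (the gradient is closable),
  so its norm does not depend on the choice.\<close>

definition nonlocal_grad_ext :: "(real^'n \<Rightarrow> real) \<Rightarrow> (real^'n \<Rightarrow> real) \<Rightarrow> real^'n \<Rightarrow> real^'n" where
  "nonlocal_grad_ext \<rho> u = (SOME v. grad_closure \<rho> u v)"

definition H_norm :: "(real^'n \<Rightarrow> real) \<Rightarrow> (real^'n \<Rightarrow> real) \<Rightarrow> real" where
  "H_norm \<rho> u = L2_norm u + L2_norm (nonlocal_grad_ext \<rho> u)"


section \<open>The distribution K\<close>

definition radial :: "(real^'n \<Rightarrow> real) \<Rightarrow> bool" where
  "radial \<rho> \<longleftrightarrow> (\<forall>x y. x \<noteq> 0 \<and> y \<noteq> 0 \<and> norm x = norm y \<longrightarrow> \<rho> x = \<rho> y)"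

definition radial_rep :: "(real^'n \<Rightarrow> real) \<Rightarrow> real \<Rightarrow> real" where
  "radial_rep \<rho> t = \<rho> (t *\<^sub>R (SOME e. norm e = 1))"

definition Q_fun :: "(real^'n \<Rightarrow> real) \<Rightarrow> real^'n \<Rightarrow> real" where
  "Q_fun \<rho> x = (LINT t:{norm x<..}|lebesgue. radial_rep \<rho> t / t)"

text \<open>The Fourier transform of \<open>Q\<close>, as a function of \<open>\<xi> \<noteq> 0\<close>. Continuity pins it down
  uniquely off the origin, where it is
  \<open>1 / (2 \<pi> |\<xi>|) \<integral> \<rho>(x) x\<^sub>1 / |x|\<^sup>2 sin (2 \<pi> |\<xi>| x\<^sub>1) dx\<close>.
  It is only compared with the distribution off the origin because in
  dimension one this function need not be absolutely integrable near \<open>0\<close>.\<close>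

definition Q_hat :: "(real^'n \<Rightarrow> real) \<Rightarrow> real^'n \<Rightarrow> complex" where
  "Q_hat \<rho> = (SOME g. continuous_on (- {0}) g \<and>
     given_off_origin_by (fourier_distr (distr_of_fun (\<lambda>x. of_real (Q_fun \<rho> x)))) g)"

definition lam :: "(real^'n \<Rightarrow> real) \<Rightarrow> real^'n \<Rightarrow> complex^'n" where
  "lam \<rho> \<xi> = (\<chi> j. 2 * of_real pi * \<i> * of_real (\<xi> $ j) * Q_hat \<rho> \<xi>)"

text \<open>\<open>K = \<Sum>\<^sub>j \<partial>\<^sub>jQ * \<partial>\<^sub>jQ\<close>, the convolution of tempered distributions being the inverse Fourier
  transform of the product of the transforms \<open>(2 \<pi> \<i> \<xi>\<^sub>j Q_hat)\<^sup>2\<close>; their sum over \<open>j\<close> is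
  \<open>- |lam|\<^sup>2\<close>, as \<open>Q_hat\<close> is real.\<close>

definition K_distr :: "(real^'n \<Rightarrow> real) \<Rightarrow> 'n distribution" where
  "K_distr \<rho> = inv_fourier_distr (distr_of_fun (\<lambda>\<xi>. - of_real ((norm (lam \<rho> \<xi>))\<^sup>2)))"


section \<open>The nonlocal Gagliardo space W\<close>

text \<open>The argument \<open>K\<close> is the density of \<^const>\<open>K_distr\<close> off the origin.
  Note that \<open>gagliardo\<close> is the quadratic form itself, not its square root.\<close>

definition gagliardo :: "(real^'n \<Rightarrow> real) \<Rightarrow> (real^'n \<Rightarrow> real) \<Rightarrow> ennreal" where
  "gagliardo K u = (\<integral>\<^sup>+x. \<integral>\<^sup>+y. ennreal (\<bar>u x - u y\<bar>\<^sup>2 * K (x - y)) \<partial>lebesgue \<partial>lebesgue)"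

definition W_space :: "(real^'n \<Rightarrow> real) \<Rightarrow> (real^'n \<Rightarrow> real) set" where
  "W_space K = {u. square_integrable u \<and> gagliardo K u < \<infinity>}"

definition W_norm :: "(real^'n \<Rightarrow> real) \<Rightarrow> (real^'n \<Rightarrow> real) \<Rightarrow> real" where
  "W_norm K u = sqrt ((L2_norm u)\<^sup>2 + enn2real (gagliardo K u))"

end

theory Submission
  imports Defs "HOL-Probability.Probability"
begin

text \<open>Let \<open>\<Lambda>(\<xi>) = \<integral> sin(2 \<pi> z \<bullet> \<xi>) z \<rho>(z) / |z|^2 dz\<close>. On test functions the nonlocal gradient is the
  Fourier multiplier \<open>i \<Lambda>\<close>, and \<open>lam = i \<Lambda>\<close>. The key identity is
  \<open>\<integral> K(h) (1 - cos(2 \<pi> h \<bullet> \<eta>)) dh = |\<Lambda>(\<eta>)|^2\<close>. To prove it, test \<open>K\<close> against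
  \<open>(\<theta>(h/k) - \<theta>(k h)) (1 - cos(2 \<pi> h \<bullet> \<eta>))\<close> with a cutoff \<open>\<theta>\<close> and let \<open>k\<close> tend to infinity: the
  transform of \<open>\<theta>(h/k)\<close> concentrates at the origin, which yields \<open>|\<Lambda>(\<eta>)|^2\<close>, while the part near
  \<open>h = 0\<close> is a second difference of the transform of \<open>\<theta>\<close>, which beats \<open>|\<Lambda>(\<xi>)|^2 = o(|\<xi>|^2)\<close>.
  By Plancherel, the Gagliardo form of a test function is twice the squared norm of its nonlocal
  gradient. Lower semicontinuity of the form carries this, up to constants, to the closure H.
  Conversely a function of finite energy is approximated in energy by truncation (the commutator
  with \<open>\<theta>(x/R)\<close> is controlled by the key identity) and mollification, so that the
  gradients of the approximants form a Cauchy sequence in \<open>L^2\<close>.\<close>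

section \<open>Smooth functions\<close>

text \<open>The density describes K only against test functions that vanish near the origin. A
  priori K could carry a part concentrated there, such as second derivatives of a point mass, which
  would add a multiple of |\<xi>|^2 to the multiplier. Excluding this takes growth of |\<Lambda>|^2
  slower than |\<xi>|^2, which dominated convergence extracts from the integrability of min(1,
  1/|x|) \<rho>(x). Moreover the density may fail to be integrable near the origin, so L2 errors
  cannot simply be integrated against it; this shapes the semicontinuity estimate, and limits in
  energy are reached through Cauchy sequences. Squared norms in the extended reals are compared by
  |a + b|^2 \<le> 2|a|^2 + 2|b|^2, which costs only constants. Radial symmetry enters without
  rotations or surface measure: integration by parts against R^2 - |x|^2 on balls, followed by a
  comparison of image measures under the norm, replaces polar coordinates. The analysis is carried
  out for Borel versions, because Fubini is applied to products of Borel measures.\<close>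

lemma smooth_coinduct:
  fixes f :: "real^'n \<Rightarrow> 'b::real_normed_vector"
  assumes "f \<in> S"
    and diff: "\<And>g x. g \<in> S \<Longrightarrow> g differentiable (at x)"
    and closed: "\<And>g b. g \<in> S \<Longrightarrow> b \<in> Basis \<Longrightarrow> (\<lambda>x. frechet_derivative g (at x) b) \<in> S"
  shows "smooth f"
proof -
  have "set bs \<subseteq> Basis \<Longrightarrow> iter_partial bs f \<in> S" for bs
    by (induction bs) (auto intro: assms(1) closed)
  with diff show ?thesis by (auto simp: smooth_def)
qed

lemma smooth_imp_differentiable: "smooth f \<Longrightarrow> f differentiable (at x)"
  unfolding smooth_def by (metis empty_set empty_subsetI iter_partial.simps(1))

lemma smooth_partial:
  fixes f :: "real^'n \<Rightarrow> 'b::real_normed_vector"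
  assumes "smooth f" "b \<in> Basis"
  shows "smooth (\<lambda>x. frechet_derivative f (at x) b)"
proof -
  have *: "iter_partial bs (\<lambda>x. frechet_derivative f (at x) b) = iter_partial (bs @ [b]) f" for bs :: "(real^'n) list"
    by (induction bs) auto
  show ?thesis
    unfolding smooth_def *
  proof (intro allI impI)
    fix bs x assume "set (bs :: (real^'n) list) \<subseteq> Basis"
    with assms have "set (bs @ [b]) \<subseteq> Basis" by auto
    with assms(1) show "iter_partial (bs @ [b]) f differentiable at x"
      unfolding smooth_def by blast
  qed
qed

lemma smooth_imp_continuous: "smooth f \<Longrightarrow> continuous_on UNIV f"
  by (meson continuous_at_imp_continuous_on differentiable_imp_continuous_within
      smooth_imp_differentiable)

text \<open>The derivative of a product is a sum of two products, so a set of functions that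
  contains products and is invariant under partial derivatives has to be closed under sums as well.
  Constants are not built in; they enter as generators where needed.\<close>

inductive alg_gen :: "(real^'n \<Rightarrow> 'b::real_normed_algebra) set \<Rightarrow> (real^'n \<Rightarrow> 'b) \<Rightarrow> bool"
  for G where
  base: "f \<in> G \<Longrightarrow> alg_gen G f"
| add: "alg_gen G f \<Longrightarrow> alg_gen G g \<Longrightarrow> alg_gen G (\<lambda>x. f x + g x)"
| mult: "alg_gen G f \<Longrightarrow> alg_gen G g \<Longrightarrow> alg_gen G (\<lambda>x. f x * g x)"

text \<open>By the sum and Leibniz rules the partial derivatives of an element stay in the algebra
  once those of the generators do, so the algebra is an invariant set in the sense of
  \<open>smooth_coinduct\<close>.\<close>

lemma smooth_alg_gen:
  fixes f :: "real^'n \<Rightarrow> 'b::real_normed_algebra"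
  assumes "alg_gen G f"
    and diff: "\<And>g x. g \<in> G \<Longrightarrow> g differentiable (at x)"
    and closed: "\<And>g b. g \<in> G \<Longrightarrow> b \<in> Basis \<Longrightarrow> alg_gen G (\<lambda>x. frechet_derivative g (at x) b)"
  shows "smooth f"
proof (rule smooth_coinduct)
  show "f \<in> Collect (alg_gen G)" using assms by simp
next
  fix g x assume "g \<in> Collect (alg_gen G)"
  then have "alg_gen G g" by simp
  then show "g differentiable (at x)"
    by induction (auto intro: diff)
  note gd = this
next
  fix g and b :: "real^'n" assume "g \<in> Collect (alg_gen G)" and b: "b \<in> Basis"
  then have "alg_gen G g" by simp
  then have "(\<forall>x. g differentiable at x) \<and> alg_gen G (\<lambda>x. frechet_derivative g (at x) b)"
  proof induction
    case (base f)
    then show ?case using diff closed b by auto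
  next
    case (add f g)
    have "frechet_derivative (\<lambda>x. f x + g x) (at x) b
        = frechet_derivative f (at x) b + frechet_derivative g (at x) b" for x
    proof -
      have "((\<lambda>x. f x + g x) has_derivative
        (\<lambda>h. frechet_derivative f (at x) h + frechet_derivative g (at x) h)) (at x)"
        using add.IH by (intro derivative_intros) (auto simp: frechet_derivative_works)
      from frechet_derivative_at[OF this, symmetric] show ?thesis by simp
    qed
    then show ?case using add by (auto intro: alg_gen.add)
  next
    case (mult f g)
    have "frechet_derivative (\<lambda>x. f x * g x) (at x) b
        = f x * frechet_derivative g (at x) b + frechet_derivative f (at x) b * g x" for x
    proof -
      have "((\<lambda>x. f x * g x) has_derivative
        (\<lambda>h. f x * frechet_derivative g (at x) h + frechet_derivative f (at x) h * g x)) (at x)"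
        using mult.IH by (intro derivative_intros) (auto simp: frechet_derivative_works)
      from frechet_derivative_at[OF this, symmetric] show ?thesis by simp
    qed
    then show ?case using mult by (auto intro!: alg_gen.add alg_gen.mult)
  qed
  then show "(\<lambda>x. frechet_derivative g (at x) b) \<in> Collect (alg_gen G)" by simp
qed

lemma alg_gen_smooth: "alg_gen {f. smooth f} f \<Longrightarrow> smooth f"
  by (erule smooth_alg_gen)
    (simp_all add: smooth_imp_differentiable smooth_partial alg_gen.base)

lemma smooth_add:
  fixes f g :: "real^'n \<Rightarrow> 'b::real_normed_algebra"
  shows "smooth f \<Longrightarrow> smooth g \<Longrightarrow> smooth (\<lambda>x. f x + g x)"
  by (rule alg_gen_smooth, rule alg_gen.add; rule alg_gen.base, simp)

lemma smooth_mult: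
  fixes f g :: "real^'n \<Rightarrow> 'b::real_normed_algebra"
  shows "smooth f \<Longrightarrow> smooth g \<Longrightarrow> smooth (\<lambda>x. f x * g x)"
  by (rule alg_gen_smooth, rule alg_gen.mult; rule alg_gen.base, simp)

lemma smooth_const: "smooth (\<lambda>x::real^'n. c::'b::real_normed_vector)"
  by (rule smooth_coinduct[where S="range (\<lambda>c x. c)"]) auto

text \<open>The outer factor \<open>a\<close> is there because every differentiation produces one
  more factor \<open>c\<close>: only with it is the family of functions invariant under partial
  derivatives.\<close>

lemma smooth_scaleR_affine:
  fixes f :: "real^'n \<Rightarrow> 'b::real_normed_vector"
  assumes "smooth f"
  shows "smooth (\<lambda>x. a *\<^sub>R f (t + c *\<^sub>R x))"
proof (rule smooth_coinduct)
  let ?S = "{(\<lambda>x. a *\<^sub>R f (t + c *\<^sub>R x)) |a (f :: real^'n \<Rightarrow> 'b). smooth f}"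
  show "(\<lambda>x. a *\<^sub>R f (t + c *\<^sub>R x)) \<in> ?S" using assms by blast
  have D: "((\<lambda>x. a *\<^sub>R f (t + c *\<^sub>R x)) has_derivative
      (\<lambda>h. (a * c) *\<^sub>R frechet_derivative f (at (t + c *\<^sub>R x)) h)) (at x)"
    if "smooth f" for a x and f :: "real^'n \<Rightarrow> 'b"
  proof -
    have f: "(f has_derivative frechet_derivative f (at (t + c *\<^sub>R x))) (at (t + c *\<^sub>R x))"
      using smooth_imp_differentiable[OF that] frechet_derivative_works by blast
    then have l: "linear (frechet_derivative f (at (t + c *\<^sub>R x)))"
      by (rule has_derivative_linear)
    have "((\<lambda>x. f (t + c *\<^sub>R x)) has_derivative
        (\<lambda>h. frechet_derivative f (at (t + c *\<^sub>R x)) (c *\<^sub>R h))) (at x)"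
      by (rule has_derivative_compose[where g=f and f="\<lambda>x. t + c *\<^sub>R x", OF _ f])
         (auto intro!: derivative_eq_intros)
    from has_derivative_scaleR_right[OF this, of a] show ?thesis
      by (simp add: linear_scale[OF l])
  qed
  show "g differentiable at x" if "g \<in> ?S" for g x
  proof -
    from that obtain a f where "g = (\<lambda>x. a *\<^sub>R f (t + c *\<^sub>R x))" and f: "smooth f" by auto
    then show ?thesis using differentiableI[OF D[OF f]] by simp
  qed
  show "(\<lambda>x. frechet_derivative g (at x) b) \<in> ?S" if "g \<in> ?S" "b \<in> Basis" for g b
  proof -
    from that obtain a f where g: "g = (\<lambda>x. a *\<^sub>R f (t + c *\<^sub>R x))" and f: "smooth f" by auto
    have "(\<lambda>x. frechet_derivative g (at x) b)
      = (\<lambda>x. (a * c) *\<^sub>R (\<lambda>y. frechet_derivative f (at y) b) (t + c *\<^sub>R x))"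
      unfolding g by (simp add: frechet_derivative_at[OF D[OF f], symmetric])
    then show ?thesis using smooth_partial[OF f that(2)]
      by (intro CollectI exI[of _ "a * c"] exI[of _ "\<lambda>y. frechet_derivative f (at y) b"]) simp
  qed
qed

lemma smooth_affine: "smooth f \<Longrightarrow> smooth (\<lambda>x. f (t + c *\<^sub>R x))"
  using smooth_scaleR_affine[of f 1 t c] by simp

lemma smooth_scaleR: "smooth f \<Longrightarrow> smooth (\<lambda>x. a *\<^sub>R f x)"
  using smooth_scaleR_affine[of f a 0 1] by simp

lemma smooth_uminus: "smooth f \<Longrightarrow> smooth (\<lambda>x. - f x)"
  using smooth_scaleR[of f "-1"] by simp

lemma smooth_diff:
  fixes f g :: "real^'n \<Rightarrow> 'b::real_normed_algebra"
  shows "smooth f \<Longrightarrow> smooth g \<Longrightarrow> smooth (\<lambda>x. f x - g x)"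
  using smooth_add[OF _ smooth_uminus, of f g] by simp

lemma smooth_bounded_linear:
  fixes f :: "real^'n \<Rightarrow> 'b::real_normed_vector"
  assumes "smooth f" "bounded_linear L"
  shows "smooth (\<lambda>x. L (f x))"
proof (rule smooth_coinduct)
  let ?S = "{(\<lambda>x. L (f x)) |f :: real^'n \<Rightarrow> 'b. smooth f}"
  show "(\<lambda>x. L (f x)) \<in> ?S" using assms by blast
  have D: "((\<lambda>x. L (f x)) has_derivative (\<lambda>h. L (frechet_derivative f (at x) h))) (at x)"
    if "smooth f" for x and f :: "real^'n \<Rightarrow> 'b"
    by (rule bounded_linear.has_derivative[OF assms(2)])
      (use smooth_imp_differentiable[OF that] frechet_derivative_works in blast)
  show "g differentiable at x" if "g \<in> ?S" for g x
  proof -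
    from that obtain f where "g = (\<lambda>x. L (f x))" and f: "smooth f" by auto
    then show ?thesis using differentiableI[OF D[OF f]] by simp
  qed
  show "(\<lambda>x. frechet_derivative g (at x) b) \<in> ?S" if "g \<in> ?S" "b \<in> Basis" for g b
  proof -
    from that obtain f where g: "g = (\<lambda>x. L (f x))" and f: "smooth f" by auto
    have "(\<lambda>x. frechet_derivative g (at x) b) = (\<lambda>x. L ((\<lambda>y. frechet_derivative f (at y) b) x))"
      unfolding g by (simp add: frechet_derivative_at[OF D[OF f], symmetric])
    then show ?thesis using smooth_partial[OF f that(2)]
      by (intro CollectI exI[of _ "\<lambda>y. frechet_derivative f (at y) b"]) simp
  qed
qed

lemma smooth_prod:
  fixes f :: "'i \<Rightarrow> real^'n \<Rightarrow> 'b::{real_normed_algebra_1,comm_monoid_mult}"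
  shows "(\<And>i. i \<in> I \<Longrightarrow> smooth (f i)) \<Longrightarrow> smooth (\<lambda>x. \<Prod>i\<in>I. f i x)"
  by (induction I rule: infinite_finite_induct) (auto intro: smooth_const smooth_mult)

lemma smooth_inner: "smooth (\<lambda>x::real^'n. x \<bullet> v)"
proof (rule smooth_coinduct)
  let ?S = "insert (\<lambda>x. x \<bullet> v) (range (\<lambda>c x. c))"
  show "(\<lambda>x. x \<bullet> v) \<in> ?S" by simp
  have D: "((\<lambda>x::real^'n. x \<bullet> v) has_derivative (\<lambda>h. h \<bullet> v)) (at x)" for x
    by (auto intro!: derivative_eq_intros)
  show "g differentiable at x" if "g \<in> ?S" for g x
    using that by (auto intro: differentiableI[OF D])
  show "(\<lambda>x. frechet_derivative g (at x) b) \<in> ?S" if "g \<in> ?S" "b \<in> Basis" for g b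
    using that(1) by (auto simp: frechet_derivative_at[OF D, symmetric])
qed

text \<open>Each profile \<open>F k\<close> has its derivative in the span of the family, so the
  algebra generated by the ridge functions and the constants is closed under partial derivatives. It
  is meant for two families: the phase shifts of the cosine, and \<open>expinv\<close>.\<close>

lemma smooth_ridge:
  fixes F :: "nat \<Rightarrow> real \<Rightarrow> real" and v :: "real^'n"
  assumes D: "\<And>k t. (F k has_real_derivative (\<Sum>j\<in>J k. a k j * F j t)) (at t)"
    and fin: "\<And>k. finite (J k)"
  shows "smooth (\<lambda>x. F k (c + x \<bullet> v))"
proof -
  let ?G = "{(\<lambda>x. F k (c + x \<bullet> v)) |k. True} \<union> range (\<lambda>c x. c)"
  have D': "((\<lambda>x. F k (c + x \<bullet> v)) has_derivative
      (\<lambda>h. (\<Sum>j\<in>J k. a k j * F j (c + x \<bullet> v)) * (h \<bullet> v))) (at x)" for k x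
  proof -
    have 1: "((\<lambda>x. c + x \<bullet> v) has_derivative (\<lambda>h. h \<bullet> v)) (at x)"
      by (auto intro!: derivative_eq_intros)
    show ?thesis
      using has_derivative_compose[OF 1 D[of k "c + x \<bullet> v", unfolded has_field_derivative_def]]
      by (simp add: mult.commute)
  qed
  have sum: "alg_gen ?G (\<lambda>x. \<Sum>j\<in>I. a k j * F j (c + x \<bullet> v))" if "finite I" for I k
    using that
  proof induction
    case empty
    then show ?case by (auto intro!: alg_gen.base)
  next
    case (insert j I)
    have "alg_gen ?G (\<lambda>x. a k j * F j (c + x \<bullet> v) + (\<Sum>j\<in>I. a k j * F j (c + x \<bullet> v)))"
      by (intro alg_gen.add alg_gen.mult insert.IH) (auto intro: alg_gen.base)
    with insert.hyps show ?case by simp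
  qed
  show ?thesis
  proof (rule smooth_alg_gen)
    show "alg_gen ?G (\<lambda>x. F k (c + x \<bullet> v))" by (rule alg_gen.base) auto
    show "g differentiable at x" if "g \<in> ?G" for g x
      using that D' unfolding differentiable_def by (auto intro: exI[of _ "\<lambda>_. 0"])
    show "alg_gen ?G (\<lambda>x. frechet_derivative g (at x) b)" if "g \<in> ?G" "b \<in> Basis" for g b
      using that(1)
    proof
      assume "g \<in> range (\<lambda>c x. c)"
      then show ?thesis by (auto intro: alg_gen.base)
    next
      assume "g \<in> {(\<lambda>x. F k (c + x \<bullet> v)) |k. True}"
      then obtain k where g: "g = (\<lambda>x. F k (c + x \<bullet> v))" by auto
      have eq: "(\<lambda>x. frechet_derivative g (at x) b) = (\<lambda>x. (\<Sum>j\<in>J k. a k j * F j (c + x \<bullet> v)) * (b \<bullet> v))"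
        unfolding g by (simp add: frechet_derivative_at[OF D', symmetric])
      show ?thesis unfolding eq
        by (intro alg_gen.mult sum fin) (auto intro: alg_gen.base)
    qed
  qed
qed

lemma smooth_cos_inner: "smooth (\<lambda>x::real^'n. cos (x \<bullet> v))"
proof -
  \<comment> \<open>Differentiating the cosine advances its phase by a quarter turn, so each
    derivative is the next member of the family.\<close>
  have D: "((\<lambda>t. cos (t + real k * (pi / 2))) has_real_derivative
      (\<Sum>j\<in>{Suc k}. 1 * cos (t + real j * (pi / 2)))) (at t)" for k t
  proof -
    have "cos (t + real (Suc k) * (pi / 2)) = cos ((t + real k * (pi / 2)) + pi / 2)"
      by (simp add: algebra_simps add_divide_distrib)
    also have "\<dots> = - sin (t + real k * (pi / 2))"
      by (simp add: cos_add)
    finally show ?thesis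
      by (auto intro!: derivative_eq_intros)
  qed
  have "smooth (\<lambda>x::real^'n. cos ((0 + x \<bullet> v) + real 0 * (pi / 2)))"
    by (rule smooth_ridge[OF D]) simp
  then show ?thesis by simp
qed


section \<open>Test functions\<close>

lemma test_function_iff:
  fixes f :: "real^'n \<Rightarrow> 'b::real_normed_vector"
  shows "test_function f \<longleftrightarrow> smooth f \<and> (\<exists>R. \<forall>x. norm x > R \<longrightarrow> f x = 0)"
proof -
  have "compact (fun_support f) \<longleftrightarrow> bounded {x. f x \<noteq> 0}"
    by (simp add: fun_support_def compact_closure)
  also have "\<dots> \<longleftrightarrow> (\<exists>R. \<forall>x. norm x > R \<longrightarrow> f x = 0)"
    by (auto simp: bounded_iff) (metis not_le)+
  finally show ?thesis by (simp add: test_function_def)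
qed

lemma test_functionI: "smooth f \<Longrightarrow> (\<And>x. norm x > R \<Longrightarrow> f x = 0) \<Longrightarrow> test_function f"
  unfolding test_function_iff by auto

lemma test_functionE:
  assumes "test_function f"
  obtains R where "R > 0" "smooth f" "\<And>x. norm x > R \<Longrightarrow> f x = 0"
proof -
  from assms obtain R where R: "smooth f" "\<And>x. norm x > R \<Longrightarrow> f x = 0"
    unfolding test_function_iff by blast
  show ?thesis by (rule that[of "max R 1"]) (use R in auto)
qed

lemma test_function_imp_continuous: "test_function f \<Longrightarrow> continuous_on UNIV f"
  by (simp add: test_function_def smooth_imp_continuous)

lemma test_function_measurable:
  fixes f :: "real^'n \<Rightarrow> 'b::euclidean_space"
  shows "test_function f \<Longrightarrow> f \<in> borel_measurable borel"
  by (simp add: borel_measurable_continuous_onI test_function_imp_continuous)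

lemma test_function_partial:
  fixes f :: "real^'n \<Rightarrow> 'b::real_normed_vector"
  assumes "test_function f" "b \<in> Basis"
  shows "test_function (\<lambda>x. frechet_derivative f (at x) b)"
proof -
  from assms(1) obtain R where R: "R > 0" "smooth f" "\<And>x. norm x > R \<Longrightarrow> f x = 0"
    using test_functionE by blast
  have "frechet_derivative f (at x) b = 0" if "norm x > R" for x
  proof -
    have "((\<lambda>x. 0::'b) has_derivative (\<lambda>h. 0)) (at x)" by simp
    then have "(f has_derivative (\<lambda>h. 0)) (at x)"
      by (rule has_derivative_transform_within_open[where s="- cball 0 R"]) (use that R in auto)
    from frechet_derivative_at[OF this, symmetric] show ?thesis by simp
  qed
  then show ?thesis
    by (intro test_functionI smooth_partial R assms)
qed

lemma compactly_supported_bounded: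
  fixes f :: "real^'n \<Rightarrow> 'b::real_normed_vector"
  assumes "continuous_on UNIV f" "\<And>x. norm x > R \<Longrightarrow> f x = 0"
  obtains B where "B > 0" "\<And>x. norm (f x) \<le> B"
proof -
  have "bounded (f ` cball 0 R)"
    by (intro compact_imp_bounded compact_continuous_image continuous_on_subset[OF assms(1)]) auto
  then obtain B where B: "B > 0" "\<And>x. x \<in> cball 0 R \<Longrightarrow> norm (f x) \<le> B"
    unfolding bounded_pos by auto
  have "norm (f x) \<le> B" for x
  proof (cases "norm x \<le> R")
    case False
    with assms(2)[of x] B(1) show ?thesis by simp
  qed (use B in auto)
  with B(1) show ?thesis by (rule that)
qed

lemma test_function_bounded:
  fixes f :: "real^'n \<Rightarrow> 'b::real_normed_vector"
  assumes "test_function f"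
  obtains B where "B > 0" "\<And>x. norm (f x) \<le> B"
  using assms test_functionE compactly_supported_bounded test_function_imp_continuous by metis

lemma integrable_cball_bounded:
  fixes f :: "'a::euclidean_space \<Rightarrow> 'b::{banach, second_countable_topology}"
  assumes [measurable]: "f \<in> borel_measurable borel"
    and "\<And>x. norm (f x) \<le> B" "\<And>x. norm x > R \<Longrightarrow> f x = 0"
  shows "integrable lborel f"
proof (rule Bochner_Integration.integrable_bound)
  show "integrable lborel (\<lambda>x::'a. indicator (cball 0 R) x * B)"
    using emeasure_bounded_finite[of "cball 0 R :: 'a set"] by (intro integrable_mult_left) auto
  show "AE x in lborel. norm (f x) \<le> norm (indicator (cball 0 R) x * B)"
    using assms by (auto simp: indicator_def not_le intro!: AE_I2) (meson abs_ge_self order_trans)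
qed auto

lemma test_function_integrable:
  fixes f :: "real^'n \<Rightarrow> 'b::euclidean_space"
  assumes "test_function f"
  shows "integrable lborel f"
proof -
  from assms obtain R where "R > 0" "smooth f" "\<And>x. norm x > R \<Longrightarrow> f x = 0" 
    using test_functionE by blast
  moreover from assms obtain B where "B > 0" "\<And>x. norm (f x) \<le> B"
    using test_function_bounded by blast
  ultimately show ?thesis
    using test_function_measurable[OF assms] by (intro integrable_cball_bounded) auto
qed

lemma test_function_has_derivative:
  "test_function f \<Longrightarrow> (f has_derivative frechet_derivative f (at x)) (at x)"
  unfolding test_function_def frechet_derivative_works[symmetric]
  by (simp add: smooth_imp_differentiable)

lemma frechet_derivative_basis_sum:
  fixes f :: "real^'n \<Rightarrow> 'b::real_normed_vector"
  assumes "f differentiable (at x)"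
  shows "frechet_derivative f (at x) h = (\<Sum>b\<in>Basis. (h \<bullet> b) *\<^sub>R frechet_derivative f (at x) b)"
proof -
  have l: "linear (frechet_derivative f (at x))"
    using assms by (rule linear_frechet_derivative)
  have "frechet_derivative f (at x) h = frechet_derivative f (at x) (\<Sum>b\<in>Basis. (h \<bullet> b) *\<^sub>R b)"
    by (simp add: euclidean_representation)
  also have "\<dots> = (\<Sum>b\<in>Basis. (h \<bullet> b) *\<^sub>R frechet_derivative f (at x) b)"
    by (simp add: linear_sum[OF l] linear_scale[OF l])
  finally show ?thesis .
qed

lemma test_function_lipschitz:
  fixes f :: "real^'n \<Rightarrow> 'b::real_normed_vector"
  assumes "test_function f"
  obtains L where "L > 0" "\<And>x y. norm (f x - f y) \<le> L * norm (x - y)"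
proof -
  have "\<forall>b\<in>Basis. \<exists>B>0. \<forall>x. norm (frechet_derivative f (at x) b) \<le> B"
    using test_function_bounded[OF test_function_partial[OF assms]] by metis
  then obtain B where B: "\<And>b. b \<in> Basis \<Longrightarrow> B b > 0"
      "\<And>b x. b \<in> Basis \<Longrightarrow> norm (frechet_derivative f (at x) b) \<le> B b"
    by metis
  let ?L = "\<Sum>b\<in>(Basis::(real^'n) set). B b"
  have "norm (f x - f y) \<le> ?L * norm (x - y)" for x y
  proof (rule differentiable_bound[where S=UNIV])
    show "(f has_derivative frechet_derivative f (at x)) (at x within UNIV)" for x
      by (rule test_function_has_derivative[OF assms])
    show "onorm (frechet_derivative f (at x)) \<le> ?L" for x
    proof (rule onorm_le)
      fix h
      have "norm (frechet_derivative f (at x) h)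
          \<le> (\<Sum>b\<in>Basis. norm ((h \<bullet> b) *\<^sub>R frechet_derivative f (at x) b))"
        using assms unfolding test_function_def
        by (subst frechet_derivative_basis_sum) (auto intro: smooth_imp_differentiable simp del: norm_scaleR intro!: norm_sum)
      also have "\<dots> \<le> (\<Sum>b\<in>Basis. norm h * B b)"
        by (intro sum_mono) (auto intro!: mult_mono B Basis_le_norm)
      finally show "norm (frechet_derivative f (at x) h) \<le> ?L * norm h"
        by (simp add: sum_distrib_left mult.commute)
    qed
  qed auto
  moreover have "?L > 0" by (intro sum_pos B) auto
  ultimately show ?thesis by (rule that[rotated])
qed

text \<open>On the ball of radius |h| the map y -> f (x + y) - Df(x) y has a derivative of size
  O(|h|), because the partial derivatives are again test functions and hence Lipschitz. The mean
  value inequality supplies the second factor |h|.\<close>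

lemma test_function_taylor1:
  fixes f :: "real^'n \<Rightarrow> 'b::real_normed_vector"
  assumes "test_function f"
  obtains M where "M > 0"
    "\<And>x h. norm (f (x + h) - f x - frechet_derivative f (at x) h) \<le> M * (norm h)\<^sup>2"
proof -
  have "\<forall>b\<in>Basis. \<exists>L>0. \<forall>x y. norm (frechet_derivative f (at x) b - frechet_derivative f (at y) b)
      \<le> L * norm (x - y)"
    using test_function_lipschitz[OF test_function_partial[OF assms]] by metis
  then obtain L where L: "\<And>b. b \<in> Basis \<Longrightarrow> L b > 0"
      "\<And>b x y. b \<in> Basis \<Longrightarrow> norm (frechet_derivative f (at x) b - frechet_derivative f (at y) b)
          \<le> L b * norm (x - y)"
    by metis
  let ?L = "\<Sum>b\<in>(Basis::(real^'n) set). L b"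
  have df: "f differentiable at x" for x
    using assms by (auto simp: test_function_def smooth_imp_differentiable)
  have "norm (f (x + h) - f x - frechet_derivative f (at x) h) \<le> ?L * (norm h)\<^sup>2" for x h
  proof -
    let ?k = "\<lambda>y. f (x + y) - frechet_derivative f (at x) y"
    have "norm (?k h - ?k 0) \<le> (?L * norm h) * norm (h - 0)"
    proof (rule differentiable_bound[where S="cball 0 (norm h)"])
      fix y :: "real^'n" assume y: "y \<in> cball 0 (norm h)"
      have "((\<lambda>y. f (x + y)) has_derivative frechet_derivative f (at (x + y))) (at y)"
        by (rule has_derivative_compose[where g=f and f="\<lambda>y. x + y" and f'="\<lambda>y. y", simplified])
           (auto intro!: derivative_eq_intros test_function_has_derivative assms)
      moreover have "(frechet_derivative f (at x) has_derivative frechet_derivative f (at x)) (at y)"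
        using has_derivative_bounded_linear[OF test_function_has_derivative[OF assms]]
        by (rule bounded_linear_imp_has_derivative)
      ultimately show "(?k has_derivative
          (\<lambda>k. frechet_derivative f (at (x + y)) k - frechet_derivative f (at x) k))
          (at y within cball 0 (norm h))"
        by (intro has_derivative_diff) (auto intro: has_derivative_at_withinI)
      show "onorm (\<lambda>k. frechet_derivative f (at (x + y)) k - frechet_derivative f (at x) k)
          \<le> ?L * norm h"
      proof (rule onorm_le)
        fix k :: "real^'n"
        have "norm (frechet_derivative f (at (x + y)) k - frechet_derivative f (at x) k)
          = norm (\<Sum>b\<in>Basis. (k \<bullet> b) *\<^sub>R
              (frechet_derivative f (at (x + y)) b - frechet_derivative f (at x) b))"
          by (subst (1 2) frechet_derivative_basis_sum[OF df])
            (simp add: sum_subtractf scaleR_diff_right)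
        also have "\<dots> \<le> (\<Sum>b\<in>Basis. norm ((k \<bullet> b) *\<^sub>R
              (frechet_derivative f (at (x + y)) b - frechet_derivative f (at x) b)))"
          by (rule norm_sum)
        also have "\<dots> \<le> (\<Sum>b\<in>Basis. norm k * (L b * norm h))"
        proof (intro sum_mono)
          fix b :: "real^'n" assume b: "b \<in> Basis"
          have "norm (frechet_derivative f (at (x + y)) b - frechet_derivative f (at x) b)
              \<le> L b * norm h"
            using L(2)[OF b, of "x + y" x] y L(1)[OF b]
            by (auto intro: order_trans mult_left_mono)
          with b show "norm ((k \<bullet> b) *\<^sub>R
              (frechet_derivative f (at (x + y)) b - frechet_derivative f (at x) b))
              \<le> norm k * (L b * norm h)"
            by (auto intro!: mult_mono Basis_le_norm)
        qed
        finally show "norm (frechet_derivative f (at (x + y)) k - frechet_derivative f (at x) k)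
            \<le> ?L * norm h * norm k"
          by (simp add: sum_distrib_left sum_distrib_right mult_ac)
      qed
    qed auto
    then show ?thesis
      using linear_0[OF linear_frechet_derivative[OF df]]
      by (simp add: power2_eq_square mult.assoc algebra_simps)
  qed
  moreover have "?L > 0" by (intro sum_pos L) auto
  ultimately show ?thesis by (rule that[rotated])
qed


lemma test_function_mult:
  fixes f g :: "real^'n \<Rightarrow> 'b::real_normed_algebra"
  assumes "smooth f" "test_function g"
  shows "test_function (\<lambda>x. f x * g x)"
  using assms unfolding test_function_iff by (metis mult_zero_right smooth_mult)

lemma test_function_add:
  fixes f g :: "real^'n \<Rightarrow> 'b::real_normed_algebra"
  assumes "test_function f" "test_function g"
  shows "test_function (\<lambda>x. f x + g x)"
proof -
  from assms obtain R S where "\<And>x. norm x > R \<Longrightarrow> f x = 0" "\<And>x. norm x > S \<Longrightarrow> g x = 0"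
    unfolding test_function_iff by blast
  then show ?thesis using assms
    by (intro test_functionI[where R="max R S"]) (auto simp: test_function_def intro: smooth_add)
qed

lemma test_function_scaleR:
  fixes f :: "real^'n \<Rightarrow> 'b::real_normed_vector"
  shows "test_function f \<Longrightarrow> test_function (\<lambda>x. a *\<^sub>R f x)"
  unfolding test_function_iff by (auto intro: smooth_scaleR)

lemma test_function_diff:
  fixes f g :: "real^'n \<Rightarrow> 'b::real_normed_algebra"
  assumes "test_function f" "test_function g"
  shows "test_function (\<lambda>x. f x - g x)"
  using test_function_add[OF assms(1) test_function_scaleR[OF assms(2), of "-1"]] by simp

lemma test_function_sum:
  fixes f :: "'i \<Rightarrow> real^'n \<Rightarrow> 'b::real_normed_algebra"
  shows "(\<And>i. i \<in> I \<Longrightarrow> test_function (f i)) \<Longrightarrow> test_function (\<lambda>x. \<Sum>i\<in>I. f i x)"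
  by (induction I rule: infinite_finite_induct)
    (simp_all add: test_function_add, simp_all add: test_function_iff smooth_const)

lemma test_function_affine:
  fixes f :: "real^'n \<Rightarrow> 'b::real_normed_vector"
  assumes "test_function f" "c \<noteq> 0"
  shows "test_function (\<lambda>x. f (t + c *\<^sub>R x))"
proof -
  from assms(1) obtain R where R: "R > 0" "smooth f" "\<And>x. norm x > R \<Longrightarrow> f x = 0"
    using test_functionE by blast
  show ?thesis
  proof (rule test_functionI[where R="(R + norm t) / \<bar>c\<bar>"])
    fix x :: "real^'n" assume "norm x > (R + norm t) / \<bar>c\<bar>"
    then have "R + norm t < norm (c *\<^sub>R x)"
      using assms(2) by (simp add: field_simps)
    with norm_diff_ineq[of "c *\<^sub>R x" t] have "norm (t + c *\<^sub>R x) > R"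
      by (simp add: add.commute)
    then show "f (t + c *\<^sub>R x) = 0" by (rule R)
  qed (intro smooth_affine R)
qed

lemma test_function_bounded_linear:
  fixes f :: "real^'n \<Rightarrow> 'b::real_normed_vector"
  assumes "test_function f" "bounded_linear L"
  shows "test_function (\<lambda>x. L (f x))"
proof -
  from assms(1) obtain R where R: "R > 0" "smooth f" "\<And>x. norm x > R \<Longrightarrow> f x = 0"
    using test_functionE by blast
  then show ?thesis
    using linear_0[OF bounded_linear.linear[OF assms(2)]] smooth_bounded_linear[of f L] assms(2)
    by (intro test_functionI[where R=R]) auto
qed

lemma test_function_of_real:
  fixes f :: "real^'n \<Rightarrow> real"
  shows "test_function f \<Longrightarrow> test_function (\<lambda>x. complex_of_real (f x))"
  using test_function_bounded_linear[of f complex_of_real] bounded_linear_of_real by blast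


section \<open>Translations and dilations of Lebesgue measure\<close>

lemma nn_integral_lborel_affine:
  fixes f :: "'a::euclidean_space \<Rightarrow> ennreal"
  assumes [measurable]: "f \<in> borel_measurable borel" and c: "c \<noteq> 0"
  shows "(\<integral>\<^sup>+x. f x \<partial>lborel) = ennreal (\<bar>c\<bar> ^ DIM('a)) * (\<integral>\<^sup>+x. f (t + c *\<^sub>R x) \<partial>lborel)"
  by (subst lborel_affine[OF c, of t])
    (simp add: nn_integral_density nn_integral_distr nn_integral_cmult)

lemma integrable_lborel_affine:
  fixes f :: "'a::euclidean_space \<Rightarrow> 'b::{banach, second_countable_topology}"
  assumes f: "integrable lborel f" and c: "c \<noteq> 0"
  shows "integrable lborel (\<lambda>x. f (t + c *\<^sub>R x))"
proof -
  have [measurable]: "f \<in> borel_measurable borel" using borel_measurable_integrable[OF f] by simp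
  have "(\<integral>\<^sup>+x. norm (f x) \<partial>lborel) < \<infinity>" using f by (simp add: integrable_iff_bounded)
  then have "ennreal (\<bar>c\<bar> ^ DIM('a)) * (\<integral>\<^sup>+x. norm (f (t + c *\<^sub>R x)) \<partial>lborel) < \<infinity>"
    by (subst (asm) nn_integral_lborel_affine[OF _ c, of _ t]) auto
  then have "(\<integral>\<^sup>+x. norm (f (t + c *\<^sub>R x)) \<partial>lborel) < \<infinity>"
    using c by (auto simp: ennreal_mult_less_top)
  then show ?thesis by (auto simp: integrable_iff_bounded)
qed

lemma integrable_lborel_affine_iff:
  fixes f :: "'a::euclidean_space \<Rightarrow> 'b::{banach, second_countable_topology}"
  assumes c: "c \<noteq> 0"
  shows "integrable lborel (\<lambda>x. f (t + c *\<^sub>R x)) \<longleftrightarrow> integrable lborel f"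
  using integrable_lborel_affine[OF _ c, of f t]
    integrable_lborel_affine[of "\<lambda>x. f (t + c *\<^sub>R x)" "1 / c" "- (t /\<^sub>R c)"] c
  by (auto simp: scaleR_right_distrib divide_inverse scaleR_diff_right)

lemma integral_lborel_affine:
  fixes f :: "'a::euclidean_space \<Rightarrow> 'b::{banach, second_countable_topology}"
  assumes c: "c \<noteq> 0"
  shows "(LINT x|lborel. f x) = (\<bar>c\<bar> ^ DIM('a)) *\<^sub>R (LINT x|lborel. f (t + c *\<^sub>R x))"
proof (cases "integrable lborel f")
  case True
  then have [measurable]: "f \<in> borel_measurable borel" using borel_measurable_integrable by auto
  show ?thesis using integrable_lborel_affine[OF True c, of t] c
    by (subst lborel_affine[OF c, of t]) (simp add: integral_density integral_distr)
next
  case False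
  then show ?thesis using integrable_lborel_affine_iff[OF c, of f t]
    by (simp add: not_integrable_integral_eq)
qed

lemma integral_lborel_translate:
  fixes f :: "'a::euclidean_space \<Rightarrow> 'b::{banach, second_countable_topology}"
  shows "(LINT x|lborel. f (x + t)) = (LINT x|lborel. f x)"
  using integral_lborel_affine[of 1 f t] by (simp add: add.commute)

lemma integral_lborel_reflect:
  fixes f :: "'a::euclidean_space \<Rightarrow> 'b::{banach, second_countable_topology}"
  shows "(LINT x|lborel. f (t - x)) = (LINT x|lborel. f x)"
  using integral_lborel_affine[of "-1" f t] by simp

lemma integrable_lborel_translate:
  fixes f :: "'a::euclidean_space \<Rightarrow> 'b::{banach, second_countable_topology}"
  shows "integrable lborel (\<lambda>x. f (x + t)) \<longleftrightarrow> integrable lborel f"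
  using integrable_lborel_affine_iff[of 1 f t] by (simp add: add.commute)

lemma integrable_lborel_reflect:
  fixes f :: "'a::euclidean_space \<Rightarrow> 'b::{banach, second_countable_topology}"
  shows "integrable lborel (\<lambda>x. f (t - x)) \<longleftrightarrow> integrable lborel f"
  using integrable_lborel_affine_iff[of "-1" f t] by simp

lemma nn_integral_lborel_translate:
  fixes f :: "'a::euclidean_space \<Rightarrow> ennreal"
  assumes "f \<in> borel_measurable borel"
  shows "(\<integral>\<^sup>+x. f (x + t) \<partial>lborel) = (\<integral>\<^sup>+x. f x \<partial>lborel)"
  using nn_integral_lborel_affine[OF assms, of 1 t] by (simp add: add.commute)

lemma nn_integral_lborel_reflect:
  fixes f :: "'a::euclidean_space \<Rightarrow> ennreal"
  assumes "f \<in> borel_measurable borel"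
  shows "(\<integral>\<^sup>+x. f (t - x) \<partial>lborel) = (\<integral>\<^sup>+x. f x \<partial>lborel)"
  using nn_integral_lborel_affine[OF assms, of "-1" t] by simp

lemma has_vector_derivative_quotient:
  fixes f :: "real^'n \<Rightarrow> 'b::real_normed_vector"
  assumes "((\<lambda>t. f (x + t *\<^sub>R v)) has_vector_derivative d) (at 0)"
  shows "((\<lambda>t. (f (x + t *\<^sub>R v) - f x) /\<^sub>R t) \<longlongrightarrow> d) (at 0)"
proof -
  have "(\<lambda>h. norm (f (x + h *\<^sub>R v) - f x - h *\<^sub>R d) / norm h) \<midarrow>0\<rightarrow> 0"
    using assms by (simp add: has_vector_derivative_def has_derivative_at)
  then have "(\<lambda>h. norm ((f (x + h *\<^sub>R v) - f x) /\<^sub>R h - d)) \<midarrow>0\<rightarrow> 0"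
  proof (rule Lim_transform_eventually)
    have "norm (f (x + h *\<^sub>R v) - f x - h *\<^sub>R d) / norm h = norm ((f (x + h *\<^sub>R v) - f x) /\<^sub>R h - d)"
      if "h \<noteq> 0" for h
    proof -
      have "(f (x + h *\<^sub>R v) - f x) /\<^sub>R h - d = (f (x + h *\<^sub>R v) - f x - h *\<^sub>R d) /\<^sub>R h"
        using that by (simp add: scaleR_diff_right)
      then show ?thesis by (simp add: divide_inverse mult.commute)
    qed
    then show "\<forall>\<^sub>F h in at 0. norm (f (x + h *\<^sub>R v) - f x - h *\<^sub>R d) / norm h
        = norm ((f (x + h *\<^sub>R v) - f x) /\<^sub>R h - d)"
      by (auto simp: eventually_at_filter)
  qed
  then have "((\<lambda>h. (f (x + h *\<^sub>R v) - f x) /\<^sub>R h - d) \<longlongrightarrow> 0) (at 0)"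
    by (subst tendsto_norm_zero_iff[symmetric])
  from LIM_zero_cancel[where f="\<lambda>h. (f (x + h *\<^sub>R v) - f x) /\<^sub>R h", OF this]
  show ?thesis .
qed

text \<open>Translation invariance makes the integral of every difference quotient zero, and the
  quotients are bounded by L |v| on a fixed ball, so dominated convergence passes this on to the
  derivative. The setting is Lipschitz functions with a derivative almost everywhere, because the
  paraboloids used later have a kink on a sphere.\<close>

lemma integral_directional_derivative:
  fixes f :: "real^'n \<Rightarrow> 'b::euclidean_space"
  assumes lip: "\<And>x y. norm (f x - f y) \<le> L * norm (x - y)" and "L \<ge> 0"
    and supp: "\<And>x. norm x > R \<Longrightarrow> f x = 0"
    and g[measurable]: "g \<in> borel_measurable borel"
    and deriv: "AE x in lborel. ((\<lambda>t. f (x + t *\<^sub>R v)) has_vector_derivative g x) (at 0)"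
  shows "integrable lborel g" "integral\<^sup>L lborel g = 0"
proof -
  have "continuous_on UNIV f"
    by (rule lipschitz_on_continuous_on[of L])
      (use lip \<open>L \<ge> 0\<close> in \<open>auto simp: lipschitz_on_def dist_norm\<close>)
  then have f[measurable]: "f \<in> borel_measurable borel" by (rule borel_measurable_continuous_onI)
  obtain B where B: "\<And>x. norm (f x) \<le> B"
    using compactly_supported_bounded[OF \<open>continuous_on UNIV f\<close> supp] by blast
  have fi: "integrable lborel f" by (rule integrable_cball_bounded[OF f B supp])
  let ?s = "\<lambda>k x. (f (x + (1 / real (Suc k)) *\<^sub>R v) - f x) /\<^sub>R (1 / real (Suc k))"
  let ?w = "\<lambda>x::real^'n. indicator (cball 0 (R + norm v)) x * (L * norm v) :: real"
  have w: "integrable lborel ?w"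
    using emeasure_bounded_finite[of "cball 0 (R + norm v) :: (real^'n) set"]
    by (intro integrable_mult_left) auto
  have lim: "AE x in lborel. (\<lambda>k. ?s k x) \<longlonglongrightarrow> g x"
    using deriv
  proof eventually_elim
    case (elim x)
    then have "((\<lambda>t. (f (x + t *\<^sub>R v) - f x) /\<^sub>R t) \<longlongrightarrow> g x) (at 0)"
      by (rule has_vector_derivative_quotient)
    moreover have "filterlim (\<lambda>k. 1 / real (Suc k)) (at 0) sequentially"
      unfolding filterlim_at using LIMSEQ_Suc[OF lim_1_over_n] by auto
    ultimately show ?case by (rule filterlim_compose)
  qed
  have bound: "AE x in lborel. norm (?s k x) \<le> ?w x" for k
  proof (rule AE_I2)
    fix x
    have n: "norm ((1 / real (Suc k)) *\<^sub>R v) \<le> norm v"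
      by (simp add: field_simps mult_left_le)
    show "norm (?s k x) \<le> ?w x"
    proof (cases "norm x \<le> R + norm v")
      case True
      have "norm (?s k x) = real (Suc k) * norm (f (x + (1 / real (Suc k)) *\<^sub>R v) - f x)"
        by simp
      also have "\<dots> \<le> real (Suc k) * (L * norm ((1 / real (Suc k)) *\<^sub>R v))"
        using lip[of "x + (1 / real (Suc k)) *\<^sub>R v" x] by (intro mult_left_mono) auto
      also have "\<dots> = L * norm v" by simp
      finally show ?thesis using True by simp
    next
      case False
      have "f x = 0" "f (x + (1 / real (Suc k)) *\<^sub>R v) = 0"
        using False n norm_triangle_ineq2[of x "- ((1 / real (Suc k)) *\<^sub>R v)"] norm_ge_zero[of v]
        by (auto intro!: supp simp del: norm_scaleR norm_ge_zero)
      then show ?thesis using False by simp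
    qed
  qed
  show "integrable lborel g"
    by (rule integrable_dominated_convergence[OF _ _ w lim bound]) auto
  have "(\<lambda>k. LINT x|lborel. ?s k x) \<longlonglongrightarrow> LINT x|lborel. g x"
    by (rule integral_dominated_convergence[OF _ _ w lim bound]) auto
  moreover have "(LINT x|lborel. ?s k x) = 0" for k
    using fi integrable_lborel_translate[of f] by (simp add: integral_lborel_translate)
  ultimately show "integral\<^sup>L lborel g = 0"
    by (simp add: LIMSEQ_const_iff)
qed



section \<open>Cutoff functions and mollifiers\<close>

text \<open>The function exp(-1/t), extended by zero, together with the powers of 1/t that
  differentiation brings in: the derivative of index k combines the indices k + 1 and k + 2, which
  is the closure property that \<open>smooth_ridge\<close> asks for.\<close>

definition expinv :: "nat \<Rightarrow> real \<Rightarrow> real" where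
  "expinv k t = (if t \<le> 0 then 0 else exp (- inverse t) * inverse t ^ k)"

lemma expinv_has_derivative:
  "(expinv k has_real_derivative
     (\<Sum>j\<in>{k + 1, k + 2}. (if j = k + 2 then 1 else - real k) * expinv j t)) (at t)"
proof -
  consider "t < 0" | "t = 0" | "t > 0" by linarith
  then show ?thesis
  proof cases
    case 1
    have "((\<lambda>t. 0) has_real_derivative 0) (at t)" by simp
    then have "(expinv k has_real_derivative 0) (at t)"
      by (rule has_field_derivative_transform_within_open[where S="{..<0}"])
        (use 1 in \<open>auto simp: expinv_def\<close>)
    then show ?thesis using 1 by (simp add: expinv_def)
  next
    case 2
    \<comment> \<open>At the origin the right difference quotient is x^(k+1) / exp x with x = 1/h,
      and the left one is zero.\<close>
    have "((\<lambda>x::real. x ^ (k + 1) / exp x) \<longlongrightarrow> 0) at_top"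
      by (rule tendsto_power_div_exp_0)
    then have "((\<lambda>h::real. inverse h ^ (k + 1) / exp (inverse h)) \<longlongrightarrow> 0) (at_right 0)"
      by (rule filterlim_compose[OF _ filterlim_inverse_at_top_right])
    then have "((\<lambda>h. expinv k h / h) \<longlongrightarrow> 0) (at_right 0)"
      by (rule Lim_transform_eventually)
        (auto simp: expinv_def eventually_at_filter exp_minus field_simps)
    moreover have "((\<lambda>h. expinv k h / h) \<longlongrightarrow> 0) (at_left 0)"
      by (rule Lim_transform_eventually[OF tendsto_const])
        (auto simp: expinv_def eventually_at_filter)
    ultimately have "((\<lambda>h. expinv k h / h) \<longlongrightarrow> 0) (at 0)"
      by (simp add: filterlim_at_split)
    then have "(expinv k has_real_derivative 0) (at 0)"
      by (simp add: DERIV_def expinv_def)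
    with 2 show ?thesis by (simp add: expinv_def)
  next
    case 3
    have "((\<lambda>t. exp (- inverse t) * inverse t ^ k) has_real_derivative
        exp (- inverse t) * (inverse t ^ (k + 2) - real k * inverse t ^ (k + 1))) (at t)"
    proof -
      have i: "(inverse has_real_derivative - (inverse t)\<^sup>2) (at t)"
        using DERIV_inverse[of t] 3 by (simp add: numeral_2_eq_2)
      have "((\<lambda>t. inverse t ^ k) has_real_derivative - (real k * inverse t ^ (k + 1))) (at t)"
        using DERIV_power[OF i, of k] by (cases k) (simp_all add: power2_eq_square mult_ac)
      note p = this
      have "((\<lambda>t. exp (- inverse t)) has_real_derivative exp (- inverse t) * (inverse t)\<^sup>2) (at t)"
        using DERIV_fun_exp[OF DERIV_minus[OF i]] by simp
      from DERIV_mult[OF this p] show ?thesis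
        by (simp add: algebra_simps power2_eq_square)
    qed
    then have "(expinv k has_real_derivative
        exp (- inverse t) * (inverse t ^ (k + 2) - real k * inverse t ^ (k + 1))) (at t)"
      by (rule has_field_derivative_transform_within_open[where S="{0<..}"])
        (use 3 in \<open>auto simp: expinv_def\<close>)
    then show ?thesis using 3 by (simp add: expinv_def algebra_simps)
  qed
qed

lemma expinv_pos_iff: "expinv k t > 0 \<longleftrightarrow> t > 0"
  by (auto simp: expinv_def)

lemma expinv_nonneg: "expinv k t \<ge> 0"
  by (auto simp: expinv_def)

text \<open>A bump on a cube instead of a ball is a product of ridge functions, so its smoothness
  needs no composition with the norm. The cube (-1,1)^n contains the unit ball and, by the l1 bound
  on the norm, lies in the ball of radius n.\<close>

definition cube_bump :: "real^'n \<Rightarrow> real" where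
  "cube_bump x = (\<Prod>b\<in>Basis. expinv 0 (1 + x \<bullet> b) * expinv 0 (1 + x \<bullet> (- b)))"

lemma smooth_cube_bump: "smooth (cube_bump :: real^'n \<Rightarrow> real)"
  unfolding cube_bump_def[abs_def]
  by (intro smooth_prod smooth_mult smooth_ridge[of expinv, OF expinv_has_derivative]
      finite.intros)

lemma cube_bump_nonneg: "cube_bump x \<ge> 0"
  unfolding cube_bump_def by (intro prod_nonneg ballI mult_nonneg_nonneg expinv_nonneg)

lemma cube_bump_pos:
  fixes x :: "real^'n"
  assumes "norm x < 1"
  shows "cube_bump x > 0"
  unfolding cube_bump_def
proof (intro prod_pos mult_pos_pos)
  fix b :: "real^'n" assume "b \<in> Basis"
  then have "\<bar>x \<bullet> b\<bar> < 1" using Basis_le_norm[of b x] assms by linarith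
  then show "expinv 0 (1 + x \<bullet> b) > 0" "expinv 0 (1 + x \<bullet> (- b)) > 0"
    by (auto simp: expinv_pos_iff)
qed

lemma cube_bump_eq_0:
  fixes x :: "real^'n"
  assumes "norm x > DIM(real^'n)"
  shows "cube_bump x = 0"
proof -
  have "\<exists>b\<in>Basis. \<bar>x \<bullet> b\<bar> > 1"
  proof (rule ccontr)
    assume "\<not> ?thesis"
    then have "(\<Sum>b\<in>Basis. \<bar>x \<bullet> b\<bar>) \<le> (\<Sum>b\<in>(Basis::(real^'n) set). 1)"
      by (intro sum_mono) (auto simp: not_less)
    with norm_le_l1[of x] assms show False by simp
  qed
  then obtain b where b: "b \<in> Basis" "\<bar>x \<bullet> b\<bar> > 1" by blast
  then have "expinv 0 (1 + x \<bullet> b) * expinv 0 (1 + x \<bullet> (- b)) = 0"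
    by (auto simp: expinv_def)
  with b(1) show ?thesis
    unfolding cube_bump_def by (intro prod_zero) auto
qed

lemma mollifier_exists:
  obtains \<eta> :: "real^'n \<Rightarrow> real" where "test_function \<eta>" "\<And>x. \<eta> x \<ge> 0"
    "\<And>x. norm x > 1 \<Longrightarrow> \<eta> x = 0" "integral\<^sup>L lborel \<eta> = 1"
proof -
  \<comment> \<open>The bump vanishes outside the ball of radius \<open>?d\<close>, so dilating by
    \<open>?d\<close> brings its support into the unit ball.\<close>
  let ?d = "real DIM(real^'n)"
  let ?f = "\<lambda>x::real^'n. cube_bump (?d *\<^sub>R x)"
  have t: "test_function (cube_bump :: real^'n \<Rightarrow> real)"
    using smooth_cube_bump cube_bump_eq_0 by (rule test_functionI)
  have tf: "test_function ?f"
    using test_function_affine[OF t, of ?d 0] by simp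
  have i: "integrable lborel ?f" by (rule test_function_integrable[OF tf])
  have pos: "integral\<^sup>L lborel ?f > 0"
  proof -
    have "integral\<^sup>L lborel ?f \<noteq> 0"
    proof
      assume "integral\<^sup>L lborel ?f = 0"
      then have "AE x in lborel. ?f x = 0"
        using integral_nonneg_eq_0_iff_AE[OF i] by (simp add: cube_bump_nonneg)
      then have "AE x in lebesgue. x \<notin> ball (0::real^'n) (1 / ?d)"
      proof (intro AE_completion, eventually_elim)
        case (elim x)
        show ?case
        proof
          assume "x \<in> ball 0 (1 / ?d)"
          then have "norm (?d *\<^sub>R x) < 1" by (simp add: field_simps)
          from cube_bump_pos[OF this] elim show False by simp
        qed
      qed
      then have "negligible (ball (0::real^'n) (1 / ?d))"
        by (simp add: AE_iff_null_sets negligible_iff_null_sets)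
      then show False
        using open_not_negligible[of "ball (0::real^'n) (1 / ?d)"] by simp
    qed
    moreover have "integral\<^sup>L lborel ?f \<ge> 0"
      by (intro integral_nonneg_AE AE_I2 cube_bump_nonneg)
    ultimately show ?thesis by linarith
  qed
  show ?thesis
  proof (rule that)
    show "test_function (\<lambda>x. inverse (integral\<^sup>L lborel ?f) *\<^sub>R ?f x)"
      by (rule test_function_scaleR[OF tf])
    show "inverse (integral\<^sup>L lborel ?f) *\<^sub>R ?f x \<ge> 0" for x
      using pos by (simp add: cube_bump_nonneg)
    show "inverse (integral\<^sup>L lborel ?f) *\<^sub>R ?f x = 0" if "norm x > 1" for x
      using that cube_bump_eq_0[of "?d *\<^sub>R x"] by simp
    show "(LINT x|lborel. inverse (integral\<^sup>L lborel ?f) *\<^sub>R ?f x) = 1"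
      using pos by simp
  qed
qed

lemma integral_norm_bound_le:
  fixes f :: "'a \<Rightarrow> 'b::{banach, second_countable_topology}"
  assumes "integrable M g" "\<And>x. norm (f x) \<le> g x"
  shows "norm (integral\<^sup>L M f) \<le> integral\<^sup>L M g"
proof -
  have "norm (integral\<^sup>L M f) \<le> (LINT x|M. norm (f x))" by (rule integral_norm_bound)
  also have "\<dots> \<le> integral\<^sup>L M g"
    using assms order_trans[OF norm_ge_zero assms(2)] by (intro integral_mono') auto
  finally show ?thesis .
qed

text \<open>Every derivative falls on the test function, so the convolutions of the fixed
  \<open>f\<close> with all test functions form an invariant set. The Taylor remainder of the test
  function is quadratic uniformly in the base point, which justifies differentiating under the
  integral for merely integrable \<open>f\<close>.\<close>

lemma smooth_convolution:
  fixes g :: "real^'n \<Rightarrow> real"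
  assumes f: "integrable lborel f" and g: "test_function g"
  shows "smooth (\<lambda>x. LINT y|lborel. f y * g (x - y))"
proof (rule smooth_coinduct)
  let ?S = "{(\<lambda>x. LINT y|lborel. f y * g (x - y)) |g. test_function g}"
  show "(\<lambda>x. LINT y|lborel. f y * g (x - y)) \<in> ?S" using g by blast
  have i: "integrable lborel (\<lambda>y. f y * g (x - y))" if g: "test_function g" for x and g :: "real^'n \<Rightarrow> real"
  proof -
    obtain B where B: "\<And>x. norm (g x) \<le> B" using test_function_bounded[OF g] by metis
    have [measurable]: "g \<in> borel_measurable borel" by (rule test_function_measurable[OF g])
    show ?thesis
      by (rule Bochner_Integration.integrable_bound[OF integrable_mult_left[OF f, of B]])
        (use f B in \<open>auto intro!: AE_I2 simp: abs_mult intro!: mult_left_mono intro: order_trans[OF _ abs_ge_self]\<close>)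
  qed
  have D: "((\<lambda>x. LINT y|lborel. f y * g (x - y)) has_derivative
      (\<lambda>h. \<Sum>b\<in>Basis. (h \<bullet> b) * (LINT y|lborel. f y * frechet_derivative g (at (x - y)) b))) (at x)"
    if g: "test_function g" for x and g :: "real^'n \<Rightarrow> real"
    unfolding has_derivative_at
  proof
    let ?D = "\<lambda>h. \<Sum>b\<in>Basis. (h \<bullet> b) * (LINT y|lborel. f y * frechet_derivative g (at (x - y)) b)"
    let ?c = "\<lambda>x. LINT y|lborel. f y * g (x - y)"
    show "bounded_linear ?D"
      by (intro bounded_linear_sum bounded_linear_mult_left[THEN bounded_linear_compose]
          bounded_linear_inner_left)
    obtain M where M: "M > 0"
        "\<And>x h. norm (g (x + h) - g x - frechet_derivative g (at x) h) \<le> M * (norm h)\<^sup>2"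
      using test_function_taylor1[OF g] by blast
    have dg: "g differentiable at x" for x
      using g by (auto simp: test_function_def smooth_imp_differentiable)
    have b: "norm (?c (x + h) - ?c x - ?D h) \<le> (LINT y|lborel. \<bar>f y\<bar>) * M * (norm h)\<^sup>2" for h
    proof -
      have "?D h = (LINT y|lborel. (\<Sum>b\<in>Basis. (h \<bullet> b) * (f y * frechet_derivative g (at (x - y)) b)))"
        using i[OF test_function_partial[OF g]] by (subst Bochner_Integration.integral_sum) auto
      then have "?c (x + h) - ?c x - ?D h = (LINT y|lborel. f y * g (x + h - y) - f y * g (x - y)
          - (\<Sum>b\<in>Basis. (h \<bullet> b) * (f y * frechet_derivative g (at (x - y)) b)))"
        using i[OF g] i[OF test_function_partial[OF g]] by simp
      also have "\<dots> = (LINT y|lborel. f y * (g (x - y + h) - g (x - y) - frechet_derivative g (at (x - y)) h))"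
        by (intro Bochner_Integration.integral_cong refl)
          (subst frechet_derivative_basis_sum[OF dg], simp add: algebra_simps sum_distrib_left)
      also have "norm \<dots> \<le> (LINT y|lborel. \<bar>f y\<bar> * (M * (norm h)\<^sup>2))"
        using M(2) f by (intro integral_norm_bound_le) (auto simp: abs_mult intro!: mult_left_mono)
      finally show ?thesis by (simp add: mult.assoc)
    qed
    show "(\<lambda>h. norm (?c (x + h) - ?c x - ?D h) / norm h) \<midarrow>0\<rightarrow> 0"
    proof (rule tendsto_sandwich[OF _ _ tendsto_const])
      show "\<forall>\<^sub>F h in at 0. norm (?c (x + h) - ?c x - ?D h) / norm h \<le> (LINT y|lborel. \<bar>f y\<bar>) * M * norm h"
        using b by (auto simp: eventually_at_filter divide_le_eq power2_eq_square mult.assoc)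
      show "((\<lambda>h::real^'n. (LINT y|lborel. \<bar>f y\<bar>) * M * norm h) \<longlongrightarrow> 0) (at 0)"
        by (intro tendsto_mult_right_zero tendsto_norm_zero) (simp add: tendsto_ident_at)
    qed auto
  qed
  show "h differentiable at x" if "h \<in> ?S" for h x
  proof -
    from that obtain g where h: "h = (\<lambda>x. LINT y|lborel. f y * g (x - y))" and g: "test_function g" by auto
    show ?thesis unfolding h by (rule differentiableI[OF D[OF g]])
  qed
  show "(\<lambda>x. frechet_derivative h (at x) b) \<in> ?S" if "h \<in> ?S" and b: "b \<in> Basis" for h b
  proof -
    from that obtain g where h: "h = (\<lambda>x. LINT y|lborel. f y * g (x - y))" and g: "test_function g" by auto
    have "(\<lambda>x. frechet_derivative h (at x) b)
        = (\<lambda>x. LINT y|lborel. f y * (\<lambda>z. frechet_derivative g (at z) b) (x - y))"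
    proof
      fix x
      have "frechet_derivative h (at x) b
        = (\<Sum>c\<in>Basis. (b \<bullet> c) * (LINT y|lborel. f y * frechet_derivative g (at (x - y)) c))"
        unfolding h by (simp add: frechet_derivative_at[OF D[OF g], symmetric])
      also have "\<dots> = (\<Sum>c\<in>Basis. (if c = b then LINT y|lborel. f y * frechet_derivative g (at (x - y)) c else 0))"
        using b by (intro sum.cong) (auto simp: inner_Basis)
      finally show "frechet_derivative h (at x) b
        = (LINT y|lborel. f y * (\<lambda>z. frechet_derivative g (at z) b) (x - y))"
        using b by (simp add: sum.delta)
    qed
    with test_function_partial[OF g b] show ?thesis
      by (intro CollectI exI[of _ "\<lambda>z. frechet_derivative g (at z) b"]) simp
  qed
qed

lemma test_function_convolution:
  fixes g :: "real^'n \<Rightarrow> real"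
  assumes f: "integrable lborel f" and g: "test_function g" and supp: "\<And>x. norm x > R \<Longrightarrow> f x = 0"
  shows "test_function (\<lambda>x. LINT y|lborel. f y * g (x - y))"
proof -
  obtain S where S: "\<And>x. norm x > S \<Longrightarrow> g x = 0"
    using g unfolding test_function_iff by blast
  show ?thesis
  proof (rule test_functionI[where R="R + S"])
    fix x :: "real^'n" assume x: "norm x > R + S"
    have "f y * g (x - y) = 0" for y
      using supp[of y] S[of "x - y"] x norm_triangle_ineq2[of x y] by force
    then show "(LINT y|lborel. f y * g (x - y)) = 0"
      by (intro integral_eq_zero_AE AE_I2)
  qed (rule smooth_convolution[OF f g])
qed

text \<open>Averaging the indicator of the ball of radius 2 over distances at most 1 keeps it equal
  to one on the unit ball and equal to zero beyond radius 3.\<close>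

lemma cutoff_exists:
  obtains \<theta> :: "real^'n \<Rightarrow> real" where "test_function \<theta>" "\<And>x. 0 \<le> \<theta> x" "\<And>x. \<theta> x \<le> 1"
    "\<And>x. norm x \<le> 1 \<Longrightarrow> \<theta> x = 1" "\<And>x. norm x > 3 \<Longrightarrow> \<theta> x = 0"
proof -
  obtain \<eta> :: "real^'n \<Rightarrow> real" where \<eta>: "test_function \<eta>" "\<And>x. \<eta> x \<ge> 0"
    "\<And>x. norm x > 1 \<Longrightarrow> \<eta> x = 0" "integral\<^sup>L lborel \<eta> = 1"
    using mollifier_exists by blast
  have [measurable]: "\<eta> \<in> borel_measurable borel" by (rule test_function_measurable[OF \<eta>(1)])
  let ?I = "indicator (cball (0::real^'n) 2) :: real^'n \<Rightarrow> real"
  let ?c = "\<lambda>x. LINT y|lborel. ?I y * \<eta> (x - y)"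
  have I: "integrable lborel ?I"
    using emeasure_bounded_finite[of "cball 0 2 :: (real^'n) set"] by auto
  have e: "integrable lborel (\<lambda>y. \<eta> (x - y))" for x
    using test_function_integrable[OF \<eta>(1)] by (simp add: integrable_lborel_reflect)
  have i: "integrable lborel (\<lambda>y. ?I y * \<eta> (x - y))" for x
    using e by (rule Bochner_Integration.integrable_bound) (auto simp: indicator_def)
  have one: "(LINT y|lborel. \<eta> (x - y)) = 1" for x
    using \<eta>(4) by (simp add: integral_lborel_reflect)
  show ?thesis
  proof (rule that)
    show "test_function ?c"
      by (rule test_function_convolution[OF I \<eta>(1), of 2]) (auto simp: indicator_def)
    show "0 \<le> ?c x" for x
      by (intro integral_nonneg_AE AE_I2) (simp add: \<eta>)
    show "?c x \<le> 1" for x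
    proof -
      have "?c x \<le> (LINT y|lborel. \<eta> (x - y))"
        by (rule integral_mono[OF i e]) (auto simp: \<eta>(2) indicator_def)
      then show ?thesis by (simp add: one)
    qed
    show "?c x = 1" if "norm x \<le> 1" for x
    proof -
      have "?I y * \<eta> (x - y) = \<eta> (x - y)" for y
        using \<eta>(3)[of "x - y"] that norm_triangle_ineq2[of y x]
        by (cases "norm y \<le> 2") (auto simp: norm_minus_commute)
      then have "?c x = (LINT y|lborel. \<eta> (x - y))"
        by (intro Bochner_Integration.integral_cong refl)
      then show ?thesis by (simp add: one)
    qed
    show "?c x = 0" if "norm x > 3" for x
    proof -
      have "?I y * \<eta> (x - y) = 0" for y
        using \<eta>(3)[of "x - y"] that norm_triangle_ineq2[of x y]
        by (cases "norm y \<le> 2") auto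
      then show ?thesis by (intro integral_eq_zero_AE AE_I2)
    qed
  qed
qed

section \<open>The Fourier transform of integrable functions\<close>

lemma integrable_pair_bound:
  fixes h :: "'a::euclidean_space \<times> 'b::euclidean_space \<Rightarrow> 'c::{banach, second_countable_topology}"
  assumes h[measurable]: "h \<in> borel_measurable (lborel \<Otimes>\<^sub>M lborel)"
    and a: "integrable lborel a" and b: "integrable lborel b"
    and bound: "\<And>x y. norm (h (x, y)) \<le> a x * b y"
  shows "integrable (lborel \<Otimes>\<^sub>M lborel) h"
proof (rule integrableI_bounded[OF h])
  have [measurable]: "a \<in> borel_measurable borel" "b \<in> borel_measurable borel"
    using a b borel_measurable_integrable by auto
  have "(\<integral>\<^sup>+z. norm (h z) \<partial>(lborel \<Otimes>\<^sub>M lborel))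
      \<le> (\<integral>\<^sup>+z. ennreal (norm (a (fst z))) * ennreal (norm (b (snd z))) \<partial>(lborel \<Otimes>\<^sub>M lborel))"
  proof (intro nn_integral_mono)
    fix z :: "'a \<times> 'b"
    have "norm (h z) \<le> norm (a (fst z)) * norm (b (snd z))"
      using bound[of "fst z" "snd z"] by (simp add: abs_mult[symmetric])
    then show "ennreal (norm (h z)) \<le> ennreal (norm (a (fst z))) * ennreal (norm (b (snd z)))"
      by (simp add: ennreal_mult'[symmetric])
  qed
  also have "\<dots> = (\<integral>\<^sup>+x. \<integral>\<^sup>+y. ennreal (norm (a x)) * ennreal (norm (b y)) \<partial>lborel \<partial>lborel)"
    by (subst lborel.nn_integral_fst[symmetric]) auto
  also have "\<dots> = (\<integral>\<^sup>+x. norm (a x) \<partial>lborel) * (\<integral>\<^sup>+y. norm (b y) \<partial>lborel)"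
    by (simp add: nn_integral_cmult nn_integral_multc)
  also have "\<dots> < \<infinity>"
    using a b by (simp add: integrable_iff_bounded ennreal_mult_less_top)
  finally show "(\<integral>\<^sup>+z. norm (h z) \<partial>(lborel \<Otimes>\<^sub>M lborel)) < \<infinity>" .
qed

lemma integrable_integral_cong_bound:
  fixes f :: "'a \<Rightarrow> 'b::{banach, second_countable_topology}"
  assumes "integrable M g" "f \<in> borel_measurable M" "\<And>x. norm (f x) \<le> g x"
  shows "integrable M f"
  using assms(1,2)
  by (rule Bochner_Integration.integrable_bound)
    (auto intro!: AE_I2 order_trans[OF assms(3)])

lemma continuous_on_integral_param:
  fixes f :: "'a::euclidean_space \<Rightarrow> 'p::{first_countable_topology,t2_space} \<Rightarrow> 'b::{banach, second_countable_topology}"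
  assumes w: "integrable lborel w"
    and meas: "\<And>p. (\<lambda>x. f x p) \<in> borel_measurable borel"
    and cont: "\<And>x. continuous_on UNIV (f x)"
    and bound: "\<And>x p. norm (f x p) \<le> w x"
  shows "continuous_on UNIV (\<lambda>p. LINT x|lborel. f x p)"
proof (rule continuous_at_imp_continuous_on, rule ballI)
  fix p :: 'p
  show "isCont (\<lambda>p. LINT x|lborel. f x p) p"
  proof (rule continuous_at_sequentiallyI)
    fix u assume u: "u \<longlonglongrightarrow> p"
    show "(\<lambda>n. LINT x|lborel. f x (u n)) \<longlonglongrightarrow> (LINT x|lborel. f x p)"
    proof (rule integral_dominated_convergence[OF _ _ w])
      show "AE x in lborel. (\<lambda>n. f x (u n)) \<longlonglongrightarrow> f x p"
        using cont u by (auto intro!: AE_I2 simp: continuous_on_eq_continuous_at intro: isCont_tendsto_compose)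
    qed (use meas bound in auto)
  qed
qed

lemma exp_eq_cis: "exp (- 2 * of_real pi * \<i> * of_real t) = cis (- (2 * pi * t))"
  "exp (2 * of_real pi * \<i> * of_real t) = cis (2 * pi * t)"
  by (simp_all add: cis_conv_exp mult_ac)

lemma borel_measurable_cis[measurable (raw)]:
  assumes "f \<in> borel_measurable M"
  shows "(\<lambda>x. cis (f x)) \<in> borel_measurable M"
proof -
  have "cis \<in> borel_measurable borel"
    by (intro borel_measurable_continuous_onI continuous_intros)
  with assms show ?thesis by (rule measurable_compose)
qed

lemma borel_measurable_cnj[measurable (raw)]:
  assumes "f \<in> borel_measurable M"
  shows "(\<lambda>x. cnj (f x)) \<in> borel_measurable M"
proof -
  have "cnj \<in> borel_measurable borel"
    by (intro borel_measurable_continuous_onI continuous_intros)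
  with assms show ?thesis by (rule measurable_compose)
qed

lemma fourier_eq:
  assumes "f \<in> borel_measurable borel"
  shows "fourier f \<xi> = (LINT x|lborel. f x * cis (- (2 * pi * (x \<bullet> \<xi>))))"
  unfolding fourier_def exp_eq_cis
  by (rule integral_completion) (use assms in measurable)

lemma inv_fourier_eq: "inv_fourier f \<xi> = fourier f (- \<xi>)"
  by (simp add: fourier_def inv_fourier_def inner_commute)

lemma norm_cis_diff: "norm (cis a - cis b) \<le> \<bar>a - b\<bar>"
proof -
  have "cis a - cis b = cis b * (exp (\<i> * of_real (a - b)) - 1)"
    by (simp add: cis_conv_exp exp_add[symmetric] algebra_simps)
  then have "norm (cis a - cis b) = 2 * \<bar>sin ((a - b) / 2)\<bar>"
    by (simp only: norm_mult norm_cis dist_exp_i_1 mult_1_left)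
  also have "\<dots> \<le> \<bar>a - b\<bar>"
    using abs_sin_x_le_abs_x[of "(a - b) / 2"] by simp
  finally show ?thesis .
qed

lemma norm_fourier_le:
  assumes "integrable lborel f"
  shows "norm (fourier f \<xi>) \<le> (LINT x|lborel. norm (f x))"
proof -
  have [measurable]: "f \<in> borel_measurable borel" using borel_measurable_integrable[OF assms] by simp
  show ?thesis
    unfolding fourier_eq[OF \<open>f \<in> borel_measurable borel\<close>]
    by (rule integral_norm_bound_le) (use assms in \<open>auto simp: norm_mult\<close>)
qed

lemma integrable_mult_cis:
  assumes "integrable lborel f" "g \<in> borel_measurable borel"
  shows "integrable lborel (\<lambda>x::'a::euclidean_space. f x * cis (g x))"
proof -
  have [measurable]: "f \<in> borel_measurable borel" using borel_measurable_integrable[OF assms(1)] by simp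
  show ?thesis
    by (rule integrable_integral_cong_bound[OF integrable_norm[OF assms(1)]])
      (use assms(2) in \<open>auto simp: norm_mult\<close>)
qed

lemma continuous_on_fourier:
  assumes "integrable lborel f"
  shows "continuous_on UNIV (fourier f)"
proof -
  have f: "f \<in> borel_measurable borel" using borel_measurable_integrable[OF assms] by simp
  have "continuous_on UNIV (\<lambda>\<xi>. LINT x|lborel. f x * cis (- (2 * pi * (x \<bullet> \<xi>))))"
    by (rule continuous_on_integral_param[OF integrable_norm[OF assms]])
      (use f in \<open>auto simp: norm_mult intro!: continuous_intros\<close>)
  moreover have "fourier f = (\<lambda>\<xi>. LINT x|lborel. f x * cis (- (2 * pi * (x \<bullet> \<xi>))))"
    using fourier_eq[OF f] by auto
  ultimately show ?thesis by simp
qed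

text \<open>Integration by parts: \<open>integral_directional_derivative\<close> is applied to the
  product of \<open>f\<close> with the character, whose two product rule terms are the two sides of
  the identity.\<close>

lemma fourier_partial:
  assumes "test_function f" "b \<in> Basis"
  shows "fourier (\<lambda>x. frechet_derivative f (at x) b) \<xi> = 2 * of_real pi * \<i> * of_real (\<xi> \<bullet> b) * fourier f \<xi>"
proof -
  let ?e = "\<lambda>x. cis (- (2 * pi * (x \<bullet> \<xi>)))"
  let ?d = "\<lambda>x. frechet_derivative f (at x) b"
  let ?g = "\<lambda>x. ?d x * ?e x - 2 * of_real pi * \<i> * of_real (\<xi> \<bullet> b) * (f x * ?e x)"
  obtain R where R: "R > 0" "\<And>x. norm x > R \<Longrightarrow> f x = 0" using assms(1) test_functionE by metis
  obtain L where L: "L > 0" "\<And>x y. norm (f x - f y) \<le> L * norm (x - y)"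
    using test_function_lipschitz[OF assms(1)] by metis
  obtain B where B: "B > 0" "\<And>x. norm (f x) \<le> B" using test_function_bounded[OF assms(1)] by metis
  have [measurable]: "f \<in> borel_measurable borel" "?d \<in> borel_measurable borel"
    using assms by (auto intro: test_function_measurable test_function_partial)
  have i: "integrable lborel (\<lambda>x. f x * ?e x)" "integrable lborel (\<lambda>x. ?d x * ?e x)"
    by (intro integrable_mult_cis test_function_integrable test_function_partial assms; measurable)+
  have "integral\<^sup>L lborel ?g = 0"
  proof (rule integral_directional_derivative(2)[where v=b and R=R and L="L + B * (2 * pi * norm \<xi>)"])
    show "norm (f x * ?e x - f y * ?e y) \<le> (L + B * (2 * pi * norm \<xi>)) * norm (x - y)" for x y
    proof -
      have "norm (f x * ?e x - f y * ?e y) = norm ((f x - f y) * ?e x + f y * (?e x - ?e y))"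
        by (simp add: algebra_simps)
      also have "\<dots> \<le> norm (f x - f y) + norm (f y) * norm (?e x - ?e y)"
        by (rule order_trans[OF norm_triangle_ineq]) (simp add: norm_mult)
      also have "\<dots> \<le> L * norm (x - y) + B * (2 * pi * norm \<xi> * norm (x - y))"
      proof (intro add_mono mult_mono L B)
        have "norm (?e x - ?e y) \<le> \<bar>2 * pi * ((x - y) \<bullet> \<xi>)\<bar>"
          using norm_cis_diff[of "- (2 * pi * (x \<bullet> \<xi>))" "- (2 * pi * (y \<bullet> \<xi>))"]
          by (simp add: algebra_simps abs_minus_commute)
        also have "\<dots> \<le> 2 * pi * (norm (x - y) * norm \<xi>)"
          using Cauchy_Schwarz_ineq2[of "x - y" \<xi>] by (simp add: abs_mult)
        finally show "norm (?e x - ?e y) \<le> 2 * pi * norm \<xi> * norm (x - y)"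
          by (simp add: mult_ac)
      qed (use B in auto)
      finally show ?thesis by (simp add: algebra_simps)
    qed
    show "0 \<le> L + B * (2 * pi * norm \<xi>)" using L B by simp
    show "f x * ?e x = 0" if "norm x > R" for x using R(2)[OF that] by simp
    show "?g \<in> borel_measurable borel" by measurable
    show "AE x in lborel. ((\<lambda>t. f (x + t *\<^sub>R b) * ?e (x + t *\<^sub>R b)) has_vector_derivative ?g x) (at 0)"
    proof (rule AE_I2)
      fix x
      have "((\<lambda>t. x + t *\<^sub>R b) has_derivative (\<lambda>t. t *\<^sub>R b)) (at (0::real))"
        by (auto intro!: derivative_eq_intros)
      then have "((\<lambda>t. f (x + t *\<^sub>R b)) has_derivative (\<lambda>t. frechet_derivative f (at x) (t *\<^sub>R b))) (at (0::real))"
        by (rule has_derivative_compose[where g=f]) (simp add: test_function_has_derivative[OF assms(1)])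
      then have 1: "((\<lambda>t. f (x + t *\<^sub>R b)) has_vector_derivative ?d x) (at 0)"
        using linear_scale[OF has_derivative_linear[OF test_function_has_derivative[OF assms(1), of x]]]
        by (simp add: has_vector_derivative_def)
      have 2: "((\<lambda>t. ?e (x + t *\<^sub>R b)) has_vector_derivative
          (- 2 * of_real pi * \<i> * of_real (\<xi> \<bullet> b)) * ?e x) (at 0)"
      proof -
        let ?k = "- 2 * of_real pi * \<i> * of_real (\<xi> \<bullet> b)"
        have "?e (x + t *\<^sub>R b) = ?e x * exp (t *\<^sub>R ?k)" for t
          by (simp add: cis_conv_exp exp_add[symmetric] inner_add_left inner_commute[of b]
              scaleR_conv_of_real[where 'a=complex] algebra_simps)
        then show ?thesis
          using has_vector_derivative_mult_right[OF exp_scaleR_has_vector_derivative_right[of ?k 0 UNIV], of "?e x"]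
          by (simp add: mult.commute)
      qed
      have "((\<lambda>t. f (x + t *\<^sub>R b) * ?e (x + t *\<^sub>R b)) has_vector_derivative
          (f (x + 0 *\<^sub>R b) * ((- 2 * of_real pi * \<i> * of_real (\<xi> \<bullet> b)) * ?e x) + ?d x * ?e (x + 0 *\<^sub>R b))) (at 0)"
        by (rule has_vector_derivative_mult[OF 1 2])
      then show "((\<lambda>t. f (x + t *\<^sub>R b) * ?e (x + t *\<^sub>R b)) has_vector_derivative ?g x) (at 0)"
        by (simp add: algebra_simps)
    qed
  qed
  then have "(LINT x|lborel. ?d x * ?e x) = 2 * of_real pi * \<i> * of_real (\<xi> \<bullet> b) * (LINT x|lborel. f x * ?e x)"
    using i by simp
  then show ?thesis
    by (simp add: fourier_eq)
qed

lemma norm_square_Basis: "(norm x)\<^sup>2 = (\<Sum>b\<in>Basis. (x \<bullet> b)\<^sup>2)" for x :: "'a::euclidean_space"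
proof -
  have "(norm x)\<^sup>2 = x \<bullet> x" by (rule power2_norm_eq_inner)
  also have "\<dots> = (\<Sum>b\<in>Basis. (x \<bullet> b) * (x \<bullet> b))" by (rule euclidean_inner)
  finally show ?thesis by (simp only: power2_eq_square)
qed

text \<open>The operator 1 - Laplacian/(4 pi^2) maps test functions to test functions and multiplies
  the transform by 1 + |\<xi>|^2, so each application gains one factor of decay.\<close>

lemma fourier_test_decay:
  assumes "test_function (f :: real^'n \<Rightarrow> complex)"
  obtains C where "C > 0" "\<And>\<xi>. norm (fourier f \<xi>) \<le> C / (1 + (norm \<xi>)\<^sup>2) ^ N"
proof -
  have "\<exists>C>0. \<forall>\<xi>. norm (fourier f \<xi>) * (1 + (norm \<xi>)\<^sup>2) ^ N \<le> C"
    using assms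
  proof (induction N arbitrary: f)
    case 0
    let ?C = "LINT x|lborel. norm (f x)"
    have "norm (fourier f \<xi>) * (1 + (norm \<xi>)\<^sup>2) ^ 0 \<le> ?C + 1" for \<xi>
      using norm_fourier_le[OF test_function_integrable[OF 0], of \<xi>] by simp
    moreover have "?C + 1 > 0"
      by (intro add_nonneg_pos integral_nonneg_AE) auto
    ultimately show ?case by blast
  next
    case (Suc N)
    let ?D = "\<lambda>b f x. frechet_derivative f (at x) b"
    let ?g = "\<lambda>b x. ?D b (?D b f) x"
    let ?f = "\<lambda>x. f x - (1 / (4 * pi\<^sup>2)) *\<^sub>R (\<Sum>b\<in>Basis. ?g b x)"
    have tg: "test_function (?g b)" if "b \<in> Basis" for b :: "real^'n"
      by (intro test_function_partial that Suc.prems)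
    have tf: "test_function ?f"
      by (intro test_function_diff Suc.prems test_function_scaleR test_function_sum tg)
    have "fourier ?f \<xi> = (1 + (norm \<xi>)\<^sup>2) * fourier f \<xi>" for \<xi>
    proof -
      let ?e = "\<lambda>x. cis (- (2 * pi * (x \<bullet> \<xi>)))"
      have i: "integrable lborel (\<lambda>x. h x * ?e x)" if "test_function h" for h
        by (intro integrable_mult_cis test_function_integrable that) measurable
      have "fourier (?g b) \<xi> = - (4 * of_real (pi\<^sup>2) * of_real ((\<xi> \<bullet> b)\<^sup>2)) * fourier f \<xi>"
        if "b \<in> Basis" for b
        using that Suc.prems
        by (simp add: fourier_partial test_function_partial power2_eq_square algebra_simps)
      then have "(LINT x|lborel. ?g b x * ?e x) = - (4 * of_real (pi\<^sup>2) * of_real ((\<xi> \<bullet> b)\<^sup>2)) * fourier f \<xi>"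
        if "b \<in> Basis" for b
        using that test_function_measurable[OF tg] by (simp add: fourier_eq)
      then have "(LINT x|lborel. (\<Sum>b\<in>Basis. ?g b x * ?e x))
          = (\<Sum>b\<in>Basis. - (4 * of_real (pi\<^sup>2) * of_real ((\<xi> \<bullet> b)\<^sup>2)) * fourier f \<xi>)"
        using i[OF tg] by (subst Bochner_Integration.integral_sum) auto
      also have "\<dots> = - (4 * of_real (pi\<^sup>2)) * of_real ((norm \<xi>)\<^sup>2) * fourier f \<xi>"
      proof -
        show ?thesis
          unfolding norm_square_Basis by (simp add: sum_distrib_left sum_distrib_right sum_negf mult_ac)
      qed
      finally have s: "(LINT x|lborel. (\<Sum>b\<in>Basis. ?g b x * ?e x))
          = - (4 * of_real (pi\<^sup>2)) * of_real ((norm \<xi>)\<^sup>2) * fourier f \<xi>" .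
      have "fourier ?f \<xi> = (LINT x|lborel. f x * ?e x - (1 / (4 * pi\<^sup>2)) *\<^sub>R (\<Sum>b\<in>Basis. ?g b x * ?e x))"
        by (subst fourier_eq[OF test_function_measurable[OF tf]])
          (simp add: left_diff_distrib sum_distrib_right)
      also have "\<dots> = fourier f \<xi> - (1 / (4 * pi\<^sup>2)) *\<^sub>R (LINT x|lborel. (\<Sum>b\<in>Basis. ?g b x * ?e x))"
        using i[OF Suc.prems] i[OF tg]
        by (subst Bochner_Integration.integral_diff)
          (auto simp: fourier_eq[OF test_function_measurable[OF Suc.prems]])
      also have "\<dots> = (1 + (norm \<xi>)\<^sup>2) * fourier f \<xi>"
        unfolding s by (simp add: scaleR_conv_of_real field_simps)
      finally show ?thesis .
    qed
    moreover obtain C where "C > 0" "\<And>\<xi>. norm (fourier ?f \<xi>) * (1 + (norm \<xi>)\<^sup>2) ^ N \<le> C"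
      using Suc.IH[OF tf] by blast
    moreover have "norm ((1 + of_real ((norm \<xi>)\<^sup>2)) :: complex) = 1 + (norm \<xi>)\<^sup>2" for \<xi> :: "real^'n"
      by (metis abs_of_nonneg add_nonneg_nonneg norm_of_real of_real_1 of_real_add zero_le_one zero_le_power2)
    ultimately show ?case
      by (intro exI[of _ C]) (auto simp: norm_mult mult_ac simp del: of_real_power)
  qed
  then obtain C where C: "C > 0" "\<And>\<xi>. norm (fourier f \<xi>) * (1 + (norm \<xi>)\<^sup>2) ^ N \<le> C" by blast
  show ?thesis
  proof (rule that[OF C(1)])
    fix \<xi> :: "real^'n"
    have "(1 + (norm \<xi>)\<^sup>2) ^ N > 0" by (intro zero_less_power add_pos_nonneg) auto
    with C(2)[of \<xi>] show "norm (fourier f \<xi>) \<le> C / (1 + (norm \<xi>)\<^sup>2) ^ N"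
      by (simp add: pos_le_divide_eq)
  qed
qed

text \<open>The n-th power of 1 + |\<xi>|^2 dominates the product of the n factors 1 + (\<xi>
  \<bullet> b)^2, and the reciprocal of that product is integrable by Tonelli and the
  one-dimensional case.\<close>

lemma integrable_weight:
  assumes "N \<ge> DIM('a::euclidean_space)"
  shows "integrable lborel (\<lambda>\<xi>::'a. 1 / (1 + (norm \<xi>)\<^sup>2) ^ N)"
proof -
  let ?p = "\<lambda>\<xi>::'a. \<Prod>b\<in>Basis. 1 / (1 + (\<xi> \<bullet> b)\<^sup>2)"
  have p: "integrable lborel ?p"
  proof (rule integrableI_bounded)
    have one: "(\<integral>\<^sup>+t. ennreal (1 / (1 + t\<^sup>2)) \<partial>lborel) < \<infinity>"
    proof -
      have "integrable lborel (\<lambda>t::real. 1 / (1 + t\<^sup>2))"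
        using integrable_inverse_1_plus_square
        by (simp add: set_integrable_def inverse_eq_divide)
      then show ?thesis by (simp add: integrable_iff_bounded)
    qed
    have "(\<integral>\<^sup>+\<xi>. norm (?p \<xi>) \<partial>lborel) = (\<integral>\<^sup>+\<xi>. (\<Prod>b\<in>(Basis::'a set). ennreal (1 / (1 + (\<xi> \<bullet> b)\<^sup>2))) \<partial>lborel)"
      by (simp add: prod_ennreal abs_prod)
    also have "\<dots> = (\<Prod>b\<in>(Basis::'a set). (\<integral>\<^sup>+t. ennreal (1 / (1 + t\<^sup>2)) \<partial>lborel))"
      by (rule nn_integral_lborel_prod) auto
    also have "\<dots> < \<infinity>"
      using one by (auto simp: less_top[symmetric] prod_constant power_eq_top_ennreal)
    finally show "(\<integral>\<^sup>+\<xi>. norm (?p \<xi>) \<partial>lborel) < \<infinity>" .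
  qed auto
  show ?thesis
  proof (rule integrable_integral_cong_bound[OF p])
    fix \<xi> :: 'a
    have ge: "1 + (norm \<xi>)\<^sup>2 \<ge> 1" by simp
    have "(\<Prod>b\<in>(Basis::'a set). 1 + (\<xi> \<bullet> b)\<^sup>2) \<le> (\<Prod>b\<in>(Basis::'a set). 1 + (norm \<xi>)\<^sup>2)"
    proof (intro prod_mono conjI)
      fix b :: 'a assume "b \<in> Basis"
      then have "\<bar>\<xi> \<bullet> b\<bar>\<^sup>2 \<le> (norm \<xi>)\<^sup>2" by (intro power_mono Basis_le_norm) auto
      then show "1 + (\<xi> \<bullet> b)\<^sup>2 \<le> 1 + (norm \<xi>)\<^sup>2" by simp
    qed auto
    also have "\<dots> \<le> (1 + (norm \<xi>)\<^sup>2) ^ N"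
      using assms ge by (simp add: power_increasing)
    finally have "1 / (1 + (norm \<xi>)\<^sup>2) ^ N \<le> 1 / (\<Prod>b\<in>(Basis::'a set). 1 + (\<xi> \<bullet> b)\<^sup>2)"
      by (intro divide_left_mono mult_pos_pos prod_pos) (auto intro!: add_pos_nonneg zero_less_power)
    then show "norm (1 / (1 + (norm \<xi>)\<^sup>2) ^ N) \<le> ?p \<xi>"
      by (simp add: prod_dividef)
  qed auto
qed

lemma integrable_weight_fourier:
  fixes f :: "real^'n \<Rightarrow> complex"
  assumes "test_function f"
  shows "integrable lborel (\<lambda>\<xi>. (1 + (norm \<xi>)\<^sup>2) ^ m * norm (fourier f \<xi>))"
proof -
  let ?N = "DIM(real^'n)"
  obtain C where C: "C > 0" "\<And>\<xi>. norm (fourier f \<xi>) \<le> C / (1 + (norm \<xi>)\<^sup>2) ^ (m + ?N)"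
    using fourier_test_decay[OF assms] by metis
  have [measurable]: "fourier f \<in> borel_measurable borel"
    by (intro borel_measurable_continuous_onI continuous_on_fourier test_function_integrable assms)
  show ?thesis
  proof (rule integrable_integral_cong_bound[OF integrable_mult_right[OF integrable_weight[of ?N], of C]])
    fix \<xi> :: "real^'n"
    have pos: "1 + (norm \<xi>)\<^sup>2 > 0" by (rule add_pos_nonneg) auto
    have "(1 + (norm \<xi>)\<^sup>2) ^ m * norm (fourier f \<xi>) \<le> (1 + (norm \<xi>)\<^sup>2) ^ m * (C / (1 + (norm \<xi>)\<^sup>2) ^ (m + ?N))"
      using pos by (intro mult_left_mono C) auto
    also have "\<dots> = C * (1 / (1 + (norm \<xi>)\<^sup>2) ^ ?N)"
      using pos by (simp add: power_add)
    finally show "norm ((1 + (norm \<xi>)\<^sup>2) ^ m * norm (fourier f \<xi>)) \<le> C * (1 / (1 + (norm \<xi>)\<^sup>2) ^ ?N)"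
      using pos by (simp add: abs_mult)
  qed auto
qed

lemma fourier_test_measurable:
  "test_function f \<Longrightarrow> fourier f \<in> borel_measurable borel"
  by (intro borel_measurable_continuous_onI continuous_on_fourier test_function_integrable)

lemma integrable_fourier_test:
  assumes "test_function f"
  shows "integrable lborel (fourier f)"
  using integrable_weight_fourier[OF assms, of 0] fourier_test_measurable[OF assms]
  by (simp add: integrable_norm_iff)


section \<open>Fourier inversion\<close>

lemma integral_lborel_prod:
  fixes f :: "'a::euclidean_space \<Rightarrow> real \<Rightarrow> 'b::{real_normed_field,banach,second_countable_topology}"
  assumes "\<And>b. b \<in> Basis \<Longrightarrow> integrable lborel (f b)"
  shows "integrable lborel (\<lambda>x::'a. \<Prod>b\<in>Basis. f b (x \<bullet> b))"
    and "(LINT x|lborel. (\<Prod>b\<in>Basis. f b (x \<bullet> b))) = (\<Prod>b\<in>Basis. LINT t|lborel. f b t)"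
proof -
  interpret sigma_finite_measure "interval_measure (\<lambda>x. x)"
    by (rule sigma_finite_interval_measure) auto
  interpret finite_product_sigma_finite "\<lambda>_. interval_measure (\<lambda>x. x)" "Basis :: 'a set"
    by standard auto
  have i: "integrable (interval_measure (\<lambda>x. x)) (f b)" if "b \<in> Basis" for b
    using assms[OF that] by (simp add: lborel_eq_real)
  have [measurable]: "f b \<in> borel_measurable borel" if "b \<in> Basis" for b
    using borel_measurable_integrable[OF assms[OF that]] by simp
  have m: "(\<lambda>x::'a. \<Prod>b\<in>Basis. f b (x \<bullet> b)) \<in> borel_measurable borel"
    by measurable
  have eq: "(\<Prod>b\<in>Basis. f b ((\<Sum>c\<in>Basis. x c *\<^sub>R c) \<bullet> b)) = (\<Prod>b\<in>Basis. f b (x b))" for x :: "'a \<Rightarrow> real"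
    by (intro prod.cong refl) simp
  show "integrable lborel (\<lambda>x::'a. \<Prod>b\<in>Basis. f b (x \<bullet> b))"
    unfolding lborel_def using product_integrable_prod[OF finite_Basis i]
    by (subst integrable_distr_eq[OF _ m]) (simp_all add: eq)
  show "(LINT x|lborel. (\<Prod>b\<in>Basis. f b (x \<bullet> b))) = (\<Prod>b\<in>Basis. LINT t|lborel. f b t)"
    using product_integral_prod[OF finite_Basis i]
    unfolding lborel_eq_real[symmetric]
    unfolding lborel_def[where 'a='a]
    by (subst integral_distr[OF _ m]) (simp_all add: eq lborel_eq_real)
qed

text \<open>This is the characteristic function of the standard normal law at the point sqrt(2 pi)
  s; the substitution x = sqrt(2 pi) t turns exp(-x^2/2) into exp(-pi t^2).\<close>

lemma gaussian_real:
  "integrable lborel (\<lambda>t::real. exp (- pi * t\<^sup>2) * cis (2 * pi * (s * t)))"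
  "(LINT t|lborel. exp (- pi * t\<^sup>2) * cis (2 * pi * (s * t))) = complex_of_real (exp (- pi * s\<^sup>2))"
proof -
  let ?c = "sqrt (2 * pi)"
  let ?t = "?c * s"
  let ?f = "\<lambda>x::real. std_normal_density x *\<^sub>R cis (?t * x)"
  have i: "integrable lborel ?f"
    by (rule integrable_integral_cong_bound[OF integrable_norm[OF integrable_normal_density[of 1 0]]]) auto
  have eq: "?f (?c * t) = (exp (- pi * t\<^sup>2) * cis (2 * pi * (s * t))) /\<^sub>R ?c" for t
    by (simp add: std_normal_density_def power_mult_distrib scaleR_conv_of_real field_simps)
  have "char std_normal_distribution ?t = (LINT x|lborel. ?f x)"
    unfolding char_def
    by (subst integral_density) (auto simp: cis_conv_exp)
  also have "\<dots> = ?c *\<^sub>R (LINT x|lborel. ?f (0 + ?c * x))"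
    by (subst lborel_integral_real_affine[where c="?c" and t=0]) auto
  also have "\<dots> = (LINT t|lborel. exp (- pi * t\<^sup>2) * cis (2 * pi * (s * t)))"
    unfolding add_0 eq by simp
  finally show "(LINT t|lborel. exp (- pi * t\<^sup>2) * cis (2 * pi * (s * t))) = complex_of_real (exp (- pi * s\<^sup>2))"
    by (simp add: char_std_normal_distribution power_mult_distrib)
  have "integrable lborel (\<lambda>t. ?c *\<^sub>R ?f (0 + ?c * t))"
    by (intro integrable_scaleR_right lborel_integrable_real_affine i) auto
  then show "integrable lborel (\<lambda>t::real. exp (- pi * t\<^sup>2) * cis (2 * pi * (s * t)))"
    unfolding add_0 eq by simp
qed

lemma prod_cis: "finite I \<Longrightarrow> (\<Prod>i\<in>I. cis (f i)) = cis (\<Sum>i\<in>I. f i)"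
  by (induction I rule: finite_induct) (auto simp: cis_mult)

lemma gaussian_fourier:
  fixes x :: "'a::euclidean_space"
  shows "integrable lborel (\<lambda>\<xi>. exp (- pi * (norm \<xi>)\<^sup>2) * cis (2 * pi * (x \<bullet> \<xi>)))"
    and "(LINT \<xi>|lborel. exp (- pi * (norm \<xi>)\<^sup>2) * cis (2 * pi * (x \<bullet> \<xi>))) = complex_of_real (exp (- pi * (norm x)\<^sup>2))"
proof -
  have g: "complex_of_real (exp (- pi * (norm \<xi>)\<^sup>2)) = (\<Prod>b\<in>Basis. complex_of_real (exp (- pi * (\<xi> \<bullet> b)\<^sup>2)))" for \<xi> :: 'a
    by (simp add: norm_square_Basis sum_distrib_left exp_sum[symmetric] sum_negf flip: of_real_prod)
  have c: "cis (2 * pi * (x \<bullet> \<xi>)) = (\<Prod>b\<in>Basis. cis (2 * pi * ((x \<bullet> b) * (\<xi> \<bullet> b))))" for \<xi>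
    by (subst euclidean_inner) (simp add: prod_cis sum_distrib_left)
  have e: "exp (- pi * (norm \<xi>)\<^sup>2) * cis (2 * pi * (x \<bullet> \<xi>))
      = (\<Prod>b\<in>Basis. exp (- pi * (\<xi> \<bullet> b)\<^sup>2) * cis (2 * pi * ((x \<bullet> b) * (\<xi> \<bullet> b))))" for \<xi>
    unfolding g c by (simp add: prod.distrib)
  show "integrable lborel (\<lambda>\<xi>. exp (- pi * (norm \<xi>)\<^sup>2) * cis (2 * pi * (x \<bullet> \<xi>)))"
    unfolding e
    by (rule integral_lborel_prod(1)[where f="\<lambda>b t. exp (- pi * t\<^sup>2) * cis (2 * pi * ((x \<bullet> b) * t))"])
      (rule gaussian_real)
  have "(LINT \<xi>|lborel. exp (- pi * (norm \<xi>)\<^sup>2) * cis (2 * pi * (x \<bullet> \<xi>)))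
    = (\<Prod>b\<in>Basis. LINT t|lborel. exp (- pi * t\<^sup>2) * cis (2 * pi * ((x \<bullet> b) * t)))"
    unfolding e
    by (rule integral_lborel_prod(2)[where f="\<lambda>b t. exp (- pi * t\<^sup>2) * cis (2 * pi * ((x \<bullet> b) * t))"])
      (rule gaussian_real)
  also have "\<dots> = complex_of_real (exp (- pi * (norm x)\<^sup>2))"
    unfolding gaussian_real(2) g ..
  finally show "(LINT \<xi>|lborel. exp (- pi * (norm \<xi>)\<^sup>2) * cis (2 * pi * (x \<bullet> \<xi>))) = complex_of_real (exp (- pi * (norm x)\<^sup>2))" .
qed

text \<open>The inversion integral is damped by a Gaussian of width m = k + 1. As m grows, dominated
  convergence removes the damping. By Fubini and the self-duality of the Gaussian the same quantity
  is the average of \<open>f\<close> over a Gaussian of width 1/m around \<open>x\<close>, which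
  tends to \<open>f x\<close> by continuity.\<close>

theorem fourier_inversion:
  fixes f :: "real^'n \<Rightarrow> complex"
  assumes f: "integrable lborel f" and cont: "continuous_on UNIV f" and bd: "\<And>x. norm (f x) \<le> B"
    and ff: "integrable lborel (fourier f)"
  shows "f x = (LINT \<xi>|lborel. fourier f \<xi> * cis (2 * pi * (x \<bullet> \<xi>)))"
proof -
  have fm[measurable]: "f \<in> borel_measurable borel" by (rule borel_measurable_continuous_onI[OF cont])
  have [measurable]: "fourier f \<in> borel_measurable borel"
    using borel_measurable_integrable[OF ff] by simp
  let ?g = "\<lambda>\<xi>::real^'n. exp (- pi * (norm \<xi>)\<^sup>2)"
  have gi: "integrable lborel ?g"
    using integrable_norm[OF gaussian_fourier(1)[of 0]] by (simp add: norm_mult)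
  have g1: "(LINT \<xi>|lborel. complex_of_real (?g \<xi>)) = 1"
    using gaussian_fourier(2)[of "0::real^'n"] by simp
  define I where "I k = (LINT \<xi>|lborel. fourier f \<xi> * cis (2 * pi * (x \<bullet> \<xi>)) * ?g (\<xi> /\<^sub>R real (Suc k)))" for k
  have lim1: "I \<longlonglongrightarrow> (LINT \<xi>|lborel. fourier f \<xi> * cis (2 * pi * (x \<bullet> \<xi>)))"
    unfolding I_def
  proof (rule integral_dominated_convergence[OF _ _ integrable_norm[OF ff]])
    show "AE \<xi> in lborel. (\<lambda>k. fourier f \<xi> * cis (2 * pi * (x \<bullet> \<xi>)) * ?g (\<xi> /\<^sub>R real (Suc k)))
        \<longlonglongrightarrow> fourier f \<xi> * cis (2 * pi * (x \<bullet> \<xi>))"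
    proof (rule AE_I2)
      fix \<xi> :: "real^'n"
      have "(\<lambda>k. \<xi> /\<^sub>R real (Suc k)) \<longlonglongrightarrow> 0 *\<^sub>R \<xi>"
        by (intro tendsto_scaleR tendsto_const LIMSEQ_inverse_real_of_nat)
      then have "(\<lambda>k. ?g (\<xi> /\<^sub>R real (Suc k))) \<longlonglongrightarrow> ?g (0 *\<^sub>R \<xi>)"
        by (intro tendsto_intros LIMSEQ_inverse_real_of_nat)
      then have "(\<lambda>k. fourier f \<xi> * cis (2 * pi * (x \<bullet> \<xi>)) * ?g (\<xi> /\<^sub>R real (Suc k)))
        \<longlonglongrightarrow> fourier f \<xi> * cis (2 * pi * (x \<bullet> \<xi>)) * complex_of_real (?g (0 *\<^sub>R \<xi>))"
        by (intro tendsto_mult tendsto_const tendsto_of_real)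
      then show "(\<lambda>k. fourier f \<xi> * cis (2 * pi * (x \<bullet> \<xi>)) * ?g (\<xi> /\<^sub>R real (Suc k)))
        \<longlonglongrightarrow> fourier f \<xi> * cis (2 * pi * (x \<bullet> \<xi>))" by simp
    qed
  qed (auto simp: norm_mult mult_left_le)
  have I_eq: "I k = (LINT z|lborel. f (x + z /\<^sub>R real (Suc k)) * ?g z)" for k
  proof -
    let ?m = "real (Suc k)"
    have gk: "integrable lborel (\<lambda>\<xi>. ?g (\<xi> /\<^sub>R ?m))"
      using integrable_lborel_affine[OF gi, of "inverse ?m" 0] by simp
    have inner: "(LINT \<xi>|lborel. cis (- (2 * pi * (y \<bullet> \<xi>))) * cis (2 * pi * (x \<bullet> \<xi>)) * ?g (\<xi> /\<^sub>R ?m))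
        = ?m ^ DIM(real^'n) * ?g (?m *\<^sub>R (x - y))" for y
    proof -
      have "(LINT \<xi>|lborel. cis (- (2 * pi * (y \<bullet> \<xi>))) * cis (2 * pi * (x \<bullet> \<xi>)) * ?g (\<xi> /\<^sub>R ?m))
        = (LINT \<xi>|lborel. cis (2 * pi * ((x - y) \<bullet> \<xi>)) * ?g (\<xi> /\<^sub>R ?m))"
        by (simp add: cis_mult inner_diff_left algebra_simps)
      also have "\<dots> = \<bar>?m\<bar> ^ DIM(real^'n) *\<^sub>R (LINT \<xi>|lborel. cis (2 * pi * ((x - y) \<bullet> (0 + ?m *\<^sub>R \<xi>))) * ?g ((0 + ?m *\<^sub>R \<xi>) /\<^sub>R ?m))"
        by (subst integral_lborel_affine[of ?m _ 0]) simp_all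
      also have "\<dots> = \<bar>?m\<bar> ^ DIM(real^'n) *\<^sub>R (LINT \<xi>|lborel. ?g \<xi> * cis (2 * pi * ((?m *\<^sub>R (x - y)) \<bullet> \<xi>)))"
        by (simp add: mult.commute del: of_nat_Suc)
      also have "\<dots> = ?m ^ DIM(real^'n) * ?g (?m *\<^sub>R (x - y))"
        unfolding gaussian_fourier(2) by (simp add: scaleR_conv_of_real del: of_nat_Suc)
      finally show ?thesis .
    qed
    have "I k = (LINT \<xi>|lborel. (LINT y|lborel. f y * cis (- (2 * pi * (y \<bullet> \<xi>))) * cis (2 * pi * (x \<bullet> \<xi>)) * ?g (\<xi> /\<^sub>R ?m)))"
      unfolding I_def fourier_eq[OF fm] integral_mult_left_zero ..
    also have "\<dots> = (LINT y|lborel. (LINT \<xi>|lborel. f y * cis (- (2 * pi * (y \<bullet> \<xi>))) * cis (2 * pi * (x \<bullet> \<xi>)) * ?g (\<xi> /\<^sub>R ?m)))"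
      by (rule lborel_pair.Fubini_integral, rule integrable_pair_bound[OF _ integrable_norm[OF f] gk])
        (auto simp: norm_mult split_beta')
    also have "\<dots> = (LINT y|lborel. f y * (?m ^ DIM(real^'n) * ?g (?m *\<^sub>R (x - y))))"
      unfolding mult.assoc integral_mult_right_zero inner[unfolded mult.assoc] by simp
    also have "\<dots> = (1 / ?m) ^ DIM(real^'n) *\<^sub>R (LINT z|lborel. f (x + (1 / ?m) *\<^sub>R z) * (?m ^ DIM(real^'n) * ?g (?m *\<^sub>R (x - (x + (1 / ?m) *\<^sub>R z)))))"
      by (subst integral_lborel_affine[of "1 / ?m" _ x]) simp_all
    also have "\<dots> = (LINT z|lborel. (1 / ?m) ^ DIM(real^'n) *\<^sub>R (f (x + (1 / ?m) *\<^sub>R z) * (?m ^ DIM(real^'n) * ?g (?m *\<^sub>R (x - (x + (1 / ?m) *\<^sub>R z))))))"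
      by simp
    also have "\<dots> = (LINT z|lborel. f (x + z /\<^sub>R ?m) * ?g z)"
    proof (intro Bochner_Integration.integral_cong refl)
      fix z :: "real^'n"
      have "?m *\<^sub>R (x - (x + (1 / ?m) *\<^sub>R z)) = - z" by simp
      moreover have "(1 / ?m) ^ DIM(real^'n) * ?m ^ DIM(real^'n) = 1"
        by (simp add: power_mult_distrib[symmetric] del: of_nat_Suc)
      ultimately show "(1 / ?m) ^ DIM(real^'n) *\<^sub>R (f (x + (1 / ?m) *\<^sub>R z) * (?m ^ DIM(real^'n) * ?g (?m *\<^sub>R (x - (x + (1 / ?m) *\<^sub>R z)))))
          = f (x + z /\<^sub>R ?m) * ?g z"
        by (simp add: scaleR_conv_of_real inverse_eq_divide field_simps del: of_nat_Suc)
    qed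
    finally show ?thesis .
  qed
  have "I \<longlonglongrightarrow> (LINT z|lborel. f x * ?g z)"
    unfolding I_eq
  proof (rule integral_dominated_convergence[OF _ _ integrable_mult_right[OF gi, of B]])
    show "AE z in lborel. (\<lambda>k. f (x + z /\<^sub>R real (Suc k)) * ?g z) \<longlonglongrightarrow> f x * ?g z"
    proof (rule AE_I2)
      fix z :: "real^'n"
      have "(\<lambda>k. x + z /\<^sub>R real (Suc k)) \<longlonglongrightarrow> x + 0 *\<^sub>R z"
        by (intro tendsto_intros LIMSEQ_inverse_real_of_nat)
      then have "(\<lambda>k. f (x + z /\<^sub>R real (Suc k))) \<longlonglongrightarrow> f (x + 0 *\<^sub>R z)"
        using cont by (intro isCont_tendsto_compose[of _ f]) (auto simp: continuous_on_eq_continuous_at)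
      then show "(\<lambda>k. f (x + z /\<^sub>R real (Suc k)) * ?g z) \<longlonglongrightarrow> f x * ?g z"
        by (intro tendsto_intros) simp
    qed
    show "AE z in lborel. norm (f (x + z /\<^sub>R real (Suc k)) * ?g z) \<le> B * ?g z" for k
      using bd by (auto simp: norm_mult intro!: AE_I2 mult_right_mono)
  qed auto
  then have "I \<longlonglongrightarrow> f x" using g1 by simp
  with lim1 show ?thesis by (rule LIMSEQ_unique[symmetric])
qed

lemma fourier_inversion_test:
  fixes f :: "real^'n \<Rightarrow> complex"
  assumes "test_function f"
  shows "f x = (LINT \<xi>|lborel. fourier f \<xi> * cis (2 * pi * (x \<bullet> \<xi>)))"
proof -
  obtain B where "\<And>x. norm (f x) \<le> B" using test_function_bounded[OF assms] by metis
  then show ?thesis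
    using assms by (intro fourier_inversion test_function_integrable
        test_function_imp_continuous integrable_fourier_test)
qed

text \<open>The statement concerns a pair of integrable functions that are transforms of each other,
  not a test function, because it is applied to nonlocal difference operators, whose values need not
  have compact support. Integrability of each function bounds the other, so both are square
  integrable and the identity is Fubini's theorem.\<close>

theorem plancherel:
  fixes f F :: "real^'n \<Rightarrow> complex"
  assumes f: "integrable lborel f" and F: "integrable lborel F"
    and inv: "\<And>x. f x = (LINT \<xi>|lborel. F \<xi> * cis (2 * pi * (x \<bullet> \<xi>)))"
    and trans: "\<And>\<xi>. F \<xi> = (LINT x|lborel. f x * cis (- (2 * pi * (x \<bullet> \<xi>))))"
  shows "integrable lborel (\<lambda>x. (norm (f x))\<^sup>2)" "integrable lborel (\<lambda>\<xi>. (norm (F \<xi>))\<^sup>2)"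
    and "(LINT x|lborel. (norm (f x))\<^sup>2) = (LINT \<xi>|lborel. (norm (F \<xi>))\<^sup>2)"
proof -
  have [measurable]: "f \<in> borel_measurable borel" "F \<in> borel_measurable borel"
    using f F borel_measurable_integrable by auto
  have bf: "norm (f x) \<le> (LINT \<xi>|lborel. norm (F \<xi>))" for x
    unfolding inv by (rule integral_norm_bound_le) (use F in \<open>auto simp: norm_mult\<close>)
  have bF: "norm (F \<xi>) \<le> (LINT x|lborel. norm (f x))" for \<xi>
    unfolding trans by (rule integral_norm_bound_le) (use f in \<open>auto simp: norm_mult\<close>)
  show i: "integrable lborel (\<lambda>x. (norm (f x))\<^sup>2)"
    by (rule integrable_integral_cong_bound[OF integrable_mult_right[OF integrable_norm[OF f]]])
      (use bf in \<open>auto simp: power2_eq_square intro!: mult_right_mono\<close>)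
  show i': "integrable lborel (\<lambda>\<xi>. (norm (F \<xi>))\<^sup>2)"
    by (rule integrable_integral_cong_bound[OF integrable_mult_right[OF integrable_norm[OF F]]])
      (use bF in \<open>auto simp: power2_eq_square intro!: mult_right_mono\<close>)
  have "complex_of_real (LINT x|lborel. (norm (f x))\<^sup>2) = (LINT x|lborel. cnj (f x) * f x)"
    unfolding integral_complex_of_real[symmetric] complex_norm_square
    by (intro Bochner_Integration.integral_cong refl mult.commute)
  also have "\<dots> = (LINT x|lborel. (LINT \<xi>|lborel. cnj (F \<xi>) * cis (- (2 * pi * (x \<bullet> \<xi>))) * f x))"
    by (subst inv) (simp add: cis_cnj flip: Bochner_Integration.integral_cnj)
  also have "\<dots> = (LINT \<xi>|lborel. (LINT x|lborel. cnj (F \<xi>) * cis (- (2 * pi * (x \<bullet> \<xi>))) * f x))"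
    by (rule lborel_pair.Fubini_integral[symmetric],
        rule integrable_pair_bound[OF _ integrable_norm[OF f] integrable_norm[OF F]])
      (auto simp: norm_mult split_beta' mult.commute)
  also have "\<dots> = (LINT \<xi>|lborel. cnj (F \<xi>) * (LINT x|lborel. f x * cis (- (2 * pi * (x \<bullet> \<xi>)))))"
    by (simp add: mult_ac flip: integral_mult_right_zero)
  also have "\<dots> = (LINT \<xi>|lborel. cnj (F \<xi>) * F \<xi>)"
    unfolding trans[symmetric] ..
  also have "\<dots> = complex_of_real (LINT \<xi>|lborel. (norm (F \<xi>))\<^sup>2)"
    unfolding integral_complex_of_real[symmetric] complex_norm_square
    by (intro Bochner_Integration.integral_cong refl mult.commute)
  finally show "(LINT x|lborel. (norm (f x))\<^sup>2) = (LINT \<xi>|lborel. (norm (F \<xi>))\<^sup>2)"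
    by (simp only: of_real_eq_iff)
qed

section \<open>Fourier multipliers of singular difference operators\<close>

lemma integrable_pair_slice:
  fixes h :: "'a::euclidean_space \<times> 'b::euclidean_space \<Rightarrow> 'c::{banach, second_countable_topology}"
  assumes h[measurable]: "h \<in> borel_measurable (lborel \<Otimes>\<^sub>M lborel)"
    and w: "integrable lborel w"
    and bound: "\<And>z. (\<integral>\<^sup>+x. norm (h (x, z)) \<partial>lborel) \<le> ennreal (w z)"
  shows "integrable (lborel \<Otimes>\<^sub>M lborel) h"
proof (rule integrableI_bounded[OF h])
  have "(\<integral>\<^sup>+p. norm (h p) \<partial>(lborel \<Otimes>\<^sub>M lborel)) = (\<integral>\<^sup>+z. \<integral>\<^sup>+x. norm (h (x, z)) \<partial>lborel \<partial>lborel)"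
    by (rule lborel_pair.nn_integral_snd[symmetric]) auto
  also have "\<dots> \<le> (\<integral>\<^sup>+z. norm (w z) \<partial>lborel)"
    by (intro nn_integral_mono order_trans[OF bound] ennreal_leI) auto
  also have "\<dots> < \<infinity>" using w by (simp add: integrable_iff_bounded)
  finally show "(\<integral>\<^sup>+p. norm (h p) \<partial>(lborel \<Otimes>\<^sub>M lborel)) < \<infinity>" .
qed

lemma min_norm_le: "min 2 (2 * pi * \<bar>z \<bullet> \<xi>\<bar>) \<le> min 1 (norm z) * (2 + 2 * pi * norm \<xi>)"
  for z \<xi> :: "'a::real_inner"
proof (cases "norm z \<le> 1")
  case True
  have "2 * pi * \<bar>z \<bullet> \<xi>\<bar> \<le> 2 * pi * (norm z * norm \<xi>)"
    by (intro mult_left_mono Cauchy_Schwarz_ineq2) auto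
  also have "\<dots> \<le> norm z * (2 + 2 * pi * norm \<xi>)"
    by (simp add: algebra_simps)
  finally show ?thesis using True by simp
next
  case False
  then show ?thesis by (simp add: min.coboundedI1)
qed

lemma norm_one_minus_cis: "norm (1 - cis (- (2 * pi * (z \<bullet> \<xi>)))) \<le> min 1 (norm z) * (2 + 2 * pi * norm \<xi>)"
  for z \<xi> :: "'a::real_inner"
proof -
  have "norm (1 - cis (- (2 * pi * (z \<bullet> \<xi>)))) \<le> 2"
    by (rule order_trans[OF norm_triangle_ineq4]) simp
  moreover have "norm (1 - cis (- (2 * pi * (z \<bullet> \<xi>)))) \<le> 2 * pi * \<bar>z \<bullet> \<xi>\<bar>"
    using norm_cis_diff[of 0 "- (2 * pi * (z \<bullet> \<xi>))"] by (simp add: abs_mult)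
  ultimately have "norm (1 - cis (- (2 * pi * (z \<bullet> \<xi>)))) \<le> min 2 (2 * pi * \<bar>z \<bullet> \<xi>\<bar>)"
    by simp
  then show ?thesis using min_norm_le by (rule order_trans)
qed

lemma integrable_linear_weight_fourier:
  fixes f :: "real^'n \<Rightarrow> complex"
  assumes "test_function f"
  shows "integrable lborel (\<lambda>\<xi>. (2 + 2 * pi * norm \<xi>) * norm (fourier f \<xi>))"
proof -
  have [measurable]: "fourier f \<in> borel_measurable borel" by (rule fourier_test_measurable[OF assms])
  show ?thesis
  proof (rule integrable_integral_cong_bound[OF integrable_mult_right[OF integrable_weight_fourier[OF assms, of 1], of "2 + 2 * pi"]])
    fix \<xi> :: "real^'n"
    have "2 * norm \<xi> \<le> 1 + (norm \<xi>)\<^sup>2"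
      using zero_le_power2[of "norm \<xi> - 1"] by (simp add: power2_diff)
    then have "norm \<xi> \<le> 1 + (norm \<xi>)\<^sup>2" using norm_ge_zero[of \<xi>] by linarith
    then have "2 + 2 * pi * norm \<xi> \<le> 2 * (1 + (norm \<xi>)\<^sup>2) + 2 * pi * (1 + (norm \<xi>)\<^sup>2)"
      by (intro add_mono mult_left_mono) auto
    then have "(2 + 2 * pi * norm \<xi>) * norm (fourier f \<xi>)
      \<le> (2 * (1 + (norm \<xi>)\<^sup>2) + 2 * pi * (1 + (norm \<xi>)\<^sup>2)) * norm (fourier f \<xi>)"
      by (intro mult_right_mono) auto
    then show "norm ((2 + 2 * pi * norm \<xi>) * norm (fourier f \<xi>)) \<le> (2 + 2 * pi) * ((1 + (norm \<xi>)\<^sup>2) ^ 1 * norm (fourier f \<xi>))"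
      by (simp add: abs_mult algebra_simps)
  qed measurable
qed

lemma fourier_difference:
  assumes "test_function f"
  shows "(LINT x|lborel. (f x - f (x - z)) * cis (- (2 * pi * (x \<bullet> \<xi>)))) = fourier f \<xi> * (1 - cis (- (2 * pi * (z \<bullet> \<xi>))))"
proof -
  have [measurable]: "f \<in> borel_measurable borel" by (rule test_function_measurable[OF assms])
  have i: "integrable lborel (\<lambda>x. f x * cis (- (2 * pi * (x \<bullet> \<xi>))))"
    by (intro integrable_mult_cis test_function_integrable assms) measurable
  have i': "integrable lborel (\<lambda>x. f (x - z) * cis (- (2 * pi * (x \<bullet> \<xi>))))"
    using integrable_lborel_translate[of f "- z"] assms
    by (intro integrable_mult_cis) (auto simp: test_function_integrable)
  have "(LINT x|lborel. f (x - z) * cis (- (2 * pi * (x \<bullet> \<xi>))))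
      = (LINT x|lborel. f (x - z) * cis (- (2 * pi * ((x - z) \<bullet> \<xi>))) * cis (- (2 * pi * (z \<bullet> \<xi>))))"
    by (simp add: mult.assoc cis_mult inner_diff_left algebra_simps)
  also have "\<dots> = fourier f \<xi> * cis (- (2 * pi * (z \<bullet> \<xi>)))"
    using integral_lborel_translate[of "\<lambda>x. f x * cis (- (2 * pi * (x \<bullet> \<xi>)))" "- z"]
    by (simp add: fourier_eq)
  finally show ?thesis
    using i i' by (simp add: left_diff_distrib right_diff_distrib fourier_eq)
qed

text \<open>For large z the bound is twice the L1 norm; for |z| \<le> 1 it is the Lipschitz constant
  times |z| on one fixed ball. The resulting weight min(1, |z|) is the one against which the
  singular kernels are integrable.\<close>

lemma nn_integral_difference_le:
  fixes f :: "real^'n \<Rightarrow> complex"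
  assumes "test_function f"
  obtains C where "C \<ge> 0" "\<And>z. (\<integral>\<^sup>+x. norm (f x - f (x - z)) \<partial>lborel) \<le> ennreal (C * min 1 (norm z))"
proof -
  have [measurable]: "f \<in> borel_measurable borel" by (rule test_function_measurable[OF assms])
  obtain R where R: "R > 0" "\<And>x. norm x > R \<Longrightarrow> f x = 0" using assms test_functionE by metis
  obtain L where L: "L > 0" "\<And>x y. norm (f x - f y) \<le> L * norm (x - y)"
    using test_function_lipschitz[OF assms] by metis
  let ?B = "cball (0::real^'n) (R + 1)"
  let ?C1 = "2 * (LINT x|lborel. norm (f x))" and ?C2 = "L * measure lborel ?B"
  have fi: "integrable lborel (\<lambda>x. norm (f x))" using test_function_integrable[OF assms] by simp
  have C1: "(\<integral>\<^sup>+x. norm (f x - f (x - z)) \<partial>lborel) \<le> ennreal ?C1" for z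
  proof -
    have "(\<integral>\<^sup>+x. norm (f x - f (x - z)) \<partial>lborel) \<le> (\<integral>\<^sup>+x. ennreal (norm (f x)) + ennreal (norm (f (x + - z))) \<partial>lborel)"
      by (intro nn_integral_mono) (auto simp flip: ennreal_plus intro!: ennreal_leI norm_triangle_ineq4)
    also have "\<dots> = (\<integral>\<^sup>+x. norm (f x) \<partial>lborel) + (\<integral>\<^sup>+x. norm (f (x + - z)) \<partial>lborel)"
      by (intro nn_integral_add) auto
    also have "(\<integral>\<^sup>+x. norm (f (x + - z)) \<partial>lborel) = (\<integral>\<^sup>+x. norm (f x) \<partial>lborel)"
      using nn_integral_lborel_translate[of "\<lambda>x. ennreal (norm (f x))" "- z"] by simp
    also have "(\<integral>\<^sup>+x. norm (f x) \<partial>lborel) = ennreal (LINT x|lborel. norm (f x))"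
      by (intro nn_integral_eq_integral fi) auto
    also have "ennreal (LINT x|lborel. norm (f x)) + ennreal (LINT x|lborel. norm (f x)) = ennreal ?C1"
      by (subst ennreal_plus[symmetric]) (auto intro: integral_nonneg_AE)
    finally show ?thesis .
  qed
  have C2: "(\<integral>\<^sup>+x. norm (f x - f (x - z)) \<partial>lborel) \<le> ennreal (?C2 * norm z)" if "norm z \<le> 1" for z
  proof -
    have "(\<integral>\<^sup>+x. norm (f x - f (x - z)) \<partial>lborel) \<le> (\<integral>\<^sup>+x. ennreal (L * norm z) * indicator ?B x \<partial>lborel)"
    proof (intro nn_integral_mono)
      fix x
      show "ennreal (norm (f x - f (x - z))) \<le> ennreal (L * norm z) * indicator ?B x"
      proof (cases "x \<in> ?B")
        case True
        then show ?thesis using L(2)[of x "x - z"] by (auto intro!: ennreal_leI)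
      next
        case False
        then have "norm x > R" "norm (x - z) > R"
          using that norm_triangle_ineq2[of x z] by auto
        then show ?thesis using R(2) by simp
      qed
    qed
    also have "\<dots> = ennreal (L * norm z) * emeasure lborel ?B"
      by (simp add: nn_integral_cmult_indicator)
    also have "emeasure lborel ?B = ennreal (measure lborel ?B)"
      by (intro emeasure_eq_ennreal_measure) (use emeasure_bounded_finite[of ?B] in auto)
    finally show ?thesis using L by (simp add: ennreal_mult'[symmetric] mult_ac)
  qed
  show ?thesis
  proof (rule that[of "max ?C1 ?C2"])
    have "?C1 \<ge> 0" by (simp add: integral_nonneg_AE)
    then show "max ?C1 ?C2 \<ge> 0" by (rule max.coboundedI1)
    fix z :: "real^'n"
    show "(\<integral>\<^sup>+x. norm (f x - f (x - z)) \<partial>lborel) \<le> ennreal (max ?C1 ?C2 * min 1 (norm z))"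
    proof (cases "norm z \<le> 1")
      case True
      have "?C2 * norm z \<le> max ?C1 ?C2 * norm z" by (intro mult_right_mono) auto
      with C2[OF True] True show ?thesis by (auto intro: order_trans ennreal_leI)
    next
      case False
      then show ?thesis by (intro order_trans[OF C1[of z]] ennreal_leI) auto
    qed
  qed
qed

section \<open>Difference operators with a kernel integrable against min(1, |z|)\<close>

context
  fixes k w :: "real^'n \<Rightarrow> real" and u :: "real^'n \<Rightarrow> complex"
  assumes k: "k \<in> borel_measurable borel" and w: "integrable lborel w"
    and kw: "\<And>z. \<bar>k z\<bar> * min 1 (norm z) \<le> w z" and u: "test_function u"
begin

private lemma u_meas: "u \<in> borel_measurable borel"
  by (rule test_function_measurable[OF u])

private lemma Fu_meas: "fourier u \<in> borel_measurable borel"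
  by (rule fourier_test_measurable[OF u])

lemma kernel_multiplier_integrable: "integrable lborel (\<lambda>z. (1 - cis (- (2 * pi * (z \<bullet> \<xi>)))) * k z)"
proof (rule integrable_integral_cong_bound[OF integrable_mult_right[OF w]])
  fix z
  have "norm ((1 - cis (- (2 * pi * (z \<bullet> \<xi>)))) * k z) \<le> (min 1 (norm z) * (2 + 2 * pi * norm \<xi>)) * \<bar>k z\<bar>"
    using norm_one_minus_cis[of z \<xi>] by (auto simp: norm_mult intro!: mult_right_mono)
  also have "\<dots> = (2 + 2 * pi * norm \<xi>) * (\<bar>k z\<bar> * min 1 (norm z))" by (simp add: mult_ac)
  also have "\<dots> \<le> (2 + 2 * pi * norm \<xi>) * w z" by (intro mult_left_mono kw) auto
  finally show "norm ((1 - cis (- (2 * pi * (z \<bullet> \<xi>)))) * k z) \<le> (2 + 2 * pi * norm \<xi>) * w z" .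
qed (use k in measurable)

lemma kernel_difference_integrable: "integrable lborel (\<lambda>z. (u x - u (x - z)) * k z)"
proof -
  note [measurable] = k u_meas
  obtain L where L: "L > 0" "\<And>x y. norm (u x - u y) \<le> L * norm (x - y)"
    using test_function_lipschitz[OF u] by metis
  obtain B where B: "B > 0" "\<And>x. norm (u x) \<le> B" using test_function_bounded[OF u] by metis
  show ?thesis
  proof (rule integrable_integral_cong_bound[OF integrable_mult_right[OF w]])
    fix z
    have "norm (u x - u (x - z)) \<le> (L + 2 * B) * min 1 (norm z)"
    proof (cases "norm z \<le> 1")
      case True
      have "norm (u x - u (x - z)) \<le> L * norm z" using L(2)[of x "x - z"] by simp
      also have "\<dots> \<le> (L + 2 * B) * norm z" using B by (intro mult_right_mono) auto
      finally show ?thesis using True by simp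
    next
      case False
      have "norm (u x - u (x - z)) \<le> 2 * B"
        using norm_triangle_ineq4[of "u x" "u (x - z)"] B(2)[of x] B(2)[of "x - z"] by linarith
      then show ?thesis using False L by simp
    qed
    then have "norm ((u x - u (x - z)) * k z) \<le> ((L + 2 * B) * min 1 (norm z)) * \<bar>k z\<bar>"
      by (auto simp: norm_mult intro!: mult_right_mono)
    also have "\<dots> = (L + 2 * B) * (\<bar>k z\<bar> * min 1 (norm z))" by (simp add: mult_ac)
    also have "\<dots> \<le> (L + 2 * B) * w z" using L B by (intro mult_left_mono kw) auto
    finally show "norm ((u x - u (x - z)) * k z) \<le> (L + 2 * B) * w z" .
  qed measurable
qed

text \<open>\<open>D\<close> is the difference operator with kernel \<open>k\<close> and
  \<open>M\<close> is its symbol. The weight \<open>w\<close> makes \<open>D\<close> integrable, and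
  it bounds \<open>M\<close> by a multiple of 1 + |\<xi>|, so that \<open>M\<close> times the
  rapidly decreasing transform of \<open>u\<close> is integrable too. Both transform relations
  required by \<open>plancherel\<close> are then interchanges of the integral over z with a Fourier
  integral.\<close>

lemma kernel_plancherel:
  defines "D \<equiv> \<lambda>x. LINT z|lborel. (u x - u (x - z)) * k z"
  defines "M \<equiv> \<lambda>\<xi>. LINT z|lborel. (1 - cis (- (2 * pi * (z \<bullet> \<xi>)))) * k z"
  shows "integrable lborel (\<lambda>x. (norm (D x))\<^sup>2)"
    and "integrable lborel (\<lambda>\<xi>. (norm (fourier u \<xi> * M \<xi>))\<^sup>2)"
    and "(LINT x|lborel. (norm (D x))\<^sup>2) = (LINT \<xi>|lborel. (norm (fourier u \<xi> * M \<xi>))\<^sup>2)"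
proof -
  note [measurable] = k u_meas Fu_meas
  have Mm[measurable]: "M \<in> borel_measurable borel"
    unfolding M_def by measurable
  obtain C where C: "C \<ge> 0" "\<And>z. (\<integral>\<^sup>+x. norm (u x - u (x - z)) \<partial>lborel) \<le> ennreal (C * min 1 (norm z))"
    using nn_integral_difference_le[OF u] by metis
  have pair: "integrable (lborel \<Otimes>\<^sub>M lborel) (\<lambda>(x, z). (u x - u (x - z)) * k z)"
  proof (rule integrable_pair_slice[OF _ integrable_mult_right[OF w, of C]])
    fix z
    have "(\<integral>\<^sup>+x. norm ((u x - u (x - z)) * k z) \<partial>lborel) = ennreal \<bar>k z\<bar> * (\<integral>\<^sup>+x. norm (u x - u (x - z)) \<partial>lborel)"
      by (simp add: norm_mult ennreal_mult' mult.commute[of _ "ennreal \<bar>k z\<bar>"] nn_integral_cmult mult.commute)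
    also have "\<dots> \<le> ennreal \<bar>k z\<bar> * ennreal (C * min 1 (norm z))" by (intro mult_left_mono C) auto
    also have "\<dots> \<le> ennreal (C * w z)"
      using C(1) kw[of z] by (subst ennreal_mult'[symmetric]) (auto intro!: ennreal_leI simp: mult.left_commute mult_left_mono)
    finally show "(\<integral>\<^sup>+x. norm (case (x, z) of (x, z) \<Rightarrow> (u x - u (x - z)) * k z) \<partial>lborel) \<le> ennreal (C * w z)" by simp
  qed (auto simp: split_beta')
  have Di: "integrable lborel D"
    using lborel_pair.integrable_fst'[OF pair] by (simp add: D_def)
  have Mb: "norm (M \<xi>) \<le> (2 + 2 * pi * norm \<xi>) * integral\<^sup>L lborel w" for \<xi>
  proof -
    have "norm (M \<xi>) \<le> (LINT z|lborel. (2 + 2 * pi * norm \<xi>) * w z)"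
      unfolding M_def
    proof (rule integral_norm_bound_le[OF integrable_mult_right[OF w]])
      fix z
      have "norm ((1 - cis (- (2 * pi * (z \<bullet> \<xi>)))) * k z) \<le> (min 1 (norm z) * (2 + 2 * pi * norm \<xi>)) * \<bar>k z\<bar>"
        using norm_one_minus_cis[of z \<xi>] by (auto simp: norm_mult intro!: mult_right_mono)
      also have "\<dots> = (2 + 2 * pi * norm \<xi>) * (\<bar>k z\<bar> * min 1 (norm z))" by (simp add: mult_ac)
      also have "\<dots> \<le> (2 + 2 * pi * norm \<xi>) * w z" by (intro mult_left_mono kw) auto
      finally show "norm ((1 - cis (- (2 * pi * (z \<bullet> \<xi>)))) * k z) \<le> (2 + 2 * pi * norm \<xi>) * w z" .
    qed
    then show ?thesis by simp
  qed
  let ?F = "\<lambda>\<xi>. fourier u \<xi> * M \<xi>"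
  have Fi: "integrable lborel ?F"
  proof (rule integrable_integral_cong_bound[OF integrable_mult_right[OF integrable_linear_weight_fourier[OF u], of "integral\<^sup>L lborel w"]])
    fix \<xi>
    have "norm (?F \<xi>) \<le> norm (fourier u \<xi>) * ((2 + 2 * pi * norm \<xi>) * integral\<^sup>L lborel w)"
      using Mb[of \<xi>] by (auto simp: norm_mult intro!: mult_left_mono)
    then show "norm (?F \<xi>) \<le> integral\<^sup>L lborel w * ((2 + 2 * pi * norm \<xi>) * norm (fourier u \<xi>))"
      by (simp add: mult_ac)
  qed measurable
  have inv: "D x = (LINT \<xi>|lborel. ?F \<xi> * cis (2 * pi * (x \<bullet> \<xi>)))" for x
  proof -
    have "u x - u (x - z) = (LINT \<xi>|lborel. fourier u \<xi> * cis (2 * pi * (x \<bullet> \<xi>)) * (1 - cis (- (2 * pi * (z \<bullet> \<xi>)))))" for z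
    proof -
      have i: "integrable lborel (\<lambda>\<xi>. fourier u \<xi> * cis (2 * pi * (x \<bullet> \<xi>)))" for x
        by (intro integrable_mult_cis integrable_fourier_test u) measurable
      have "u x - u (x - z) = (LINT \<xi>|lborel. fourier u \<xi> * cis (2 * pi * (x \<bullet> \<xi>)) - fourier u \<xi> * cis (2 * pi * ((x - z) \<bullet> \<xi>)))"
        using i[of x] i[of "x - z"] fourier_inversion_test[OF u, of x] fourier_inversion_test[OF u, of "x - z"] by simp
      also have "\<dots> = (LINT \<xi>|lborel. fourier u \<xi> * cis (2 * pi * (x \<bullet> \<xi>)) * (1 - cis (- (2 * pi * (z \<bullet> \<xi>)))))"
        by (simp add: right_diff_distrib mult.assoc cis_mult inner_diff_left)
      finally show ?thesis .
    qed
    then have "D x = (LINT z|lborel. (LINT \<xi>|lborel. fourier u \<xi> * cis (2 * pi * (x \<bullet> \<xi>)) * (1 - cis (- (2 * pi * (z \<bullet> \<xi>)))) * k z))"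
      by (simp add: D_def)
    also have "\<dots> = (LINT \<xi>|lborel. (LINT z|lborel. fourier u \<xi> * cis (2 * pi * (x \<bullet> \<xi>)) * (1 - cis (- (2 * pi * (z \<bullet> \<xi>)))) * k z))"
    proof (rule lborel_pair.Fubini_integral[symmetric], rule integrable_pair_bound[OF _ w integrable_linear_weight_fourier[OF u]])
      fix z \<xi>
      have "norm (fourier u \<xi> * cis (2 * pi * (x \<bullet> \<xi>)) * (1 - cis (- (2 * pi * (z \<bullet> \<xi>)))) * k z)
        \<le> norm (fourier u \<xi>) * (min 1 (norm z) * (2 + 2 * pi * norm \<xi>)) * \<bar>k z\<bar>"
        unfolding norm_mult norm_cis norm_of_real mult_1_right
        by (intro mult_right_mono mult_left_mono norm_one_minus_cis) auto
      also have "\<dots> = (\<bar>k z\<bar> * min 1 (norm z)) * ((2 + 2 * pi * norm \<xi>) * norm (fourier u \<xi>))"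
        by (simp add: mult_ac)
      also have "\<dots> \<le> w z * ((2 + 2 * pi * norm \<xi>) * norm (fourier u \<xi>))"
        by (intro mult_right_mono kw) auto
      finally show "norm (case (z, \<xi>) of (z, \<xi>) \<Rightarrow> fourier u \<xi> * cis (2 * pi * (x \<bullet> \<xi>)) * (1 - cis (- (2 * pi * (z \<bullet> \<xi>)))) * k z)
        \<le> w z * ((2 + 2 * pi * norm \<xi>) * norm (fourier u \<xi>))" by simp
    qed (auto simp: split_beta')
    also have "\<dots> = (LINT \<xi>|lborel. ?F \<xi> * cis (2 * pi * (x \<bullet> \<xi>)))"
      unfolding M_def mult.assoc integral_mult_right_zero by (simp add: mult_ac)
    finally show ?thesis .
  qed
  have trans: "?F \<xi> = (LINT x|lborel. D x * cis (- (2 * pi * (x \<bullet> \<xi>))))" for \<xi>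
  proof -
    have "(LINT x|lborel. D x * cis (- (2 * pi * (x \<bullet> \<xi>))))
      = (LINT x|lborel. (LINT z|lborel. (u x - u (x - z)) * k z * cis (- (2 * pi * (x \<bullet> \<xi>)))))"
      by (simp add: D_def)
    also have "\<dots> = (LINT z|lborel. (LINT x|lborel. (u x - u (x - z)) * k z * cis (- (2 * pi * (x \<bullet> \<xi>)))))"
    proof (rule lborel_pair.Fubini_integral[symmetric])
      show "integrable (lborel \<Otimes>\<^sub>M lborel) (\<lambda>(x, z). (u x - u (x - z)) * k z * cis (- (2 * pi * (x \<bullet> \<xi>))))"
        by (rule integrable_integral_cong_bound[OF integrable_norm[OF pair]]) (auto simp: split_beta' norm_mult)
    qed
    also have "\<dots> = (LINT z|lborel. (LINT x|lborel. (u x - u (x - z)) * cis (- (2 * pi * (x \<bullet> \<xi>)))) * k z)"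
      by (simp add: mult_ac flip: integral_mult_left_zero)
    also have "\<dots> = (LINT z|lborel. fourier u \<xi> * ((1 - cis (- (2 * pi * (z \<bullet> \<xi>)))) * k z))"
      by (simp only: fourier_difference[OF u] mult.assoc[of "fourier u \<xi>"])
    also have "\<dots> = ?F \<xi>" unfolding M_def integral_mult_right_zero ..
    finally show ?thesis ..
  qed
  show "integrable lborel (\<lambda>x. (norm (D x))\<^sup>2)"
    "integrable lborel (\<lambda>\<xi>. (norm (?F \<xi>))\<^sup>2)"
    "(LINT x|lborel. (norm (D x))\<^sup>2) = (LINT \<xi>|lborel. (norm (?F \<xi>))\<^sup>2)"
    using plancherel[OF Di Fi inv trans] by auto
qed

end

lemma difference_plancherel:
  fixes u :: "real^'n \<Rightarrow> complex"
  assumes u: "test_function u"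
  shows "integrable lborel (\<lambda>x. (norm (u x - u (x - z)))\<^sup>2)"
    and "integrable lborel (\<lambda>\<xi>. (norm (fourier u \<xi> * (1 - cis (- (2 * pi * (z \<bullet> \<xi>))))))\<^sup>2)"
    and "(LINT x|lborel. (norm (u x - u (x - z)))\<^sup>2)
      = (LINT \<xi>|lborel. (norm (fourier u \<xi> * (1 - cis (- (2 * pi * (z \<bullet> \<xi>))))))\<^sup>2)"
proof -
  have [measurable]: "fourier u \<in> borel_measurable borel" by (rule fourier_test_measurable[OF u])
  have i: "integrable lborel (\<lambda>\<xi>. fourier u \<xi> * cis (2 * pi * (x \<bullet> \<xi>)))" for x
    by (intro integrable_mult_cis integrable_fourier_test u) measurable
  have 1: "integrable lborel (\<lambda>x. u x - u (x - z))"
    using integrable_lborel_translate[of u "- z"] test_function_integrable[OF u] by auto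
  have 2: "integrable lborel (\<lambda>\<xi>. fourier u \<xi> * (1 - cis (- (2 * pi * (z \<bullet> \<xi>)))))"
    unfolding right_diff_distrib
    by (intro Bochner_Integration.integrable_diff integrable_mult_cis)
      (auto simp: integrable_fourier_test[OF u])
  have 3: "u x - u (x - z) = (LINT \<xi>|lborel. fourier u \<xi> * (1 - cis (- (2 * pi * (z \<bullet> \<xi>)))) * cis (2 * pi * (x \<bullet> \<xi>)))" for x
  proof -
    have "u x - u (x - z) = (LINT \<xi>|lborel. fourier u \<xi> * cis (2 * pi * (x \<bullet> \<xi>)) - fourier u \<xi> * cis (2 * pi * ((x - z) \<bullet> \<xi>)))"
      using i[of x] i[of "x - z"] fourier_inversion_test[OF u, of x] fourier_inversion_test[OF u, of "x - z"] by simp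
    also have "\<dots> = (LINT \<xi>|lborel. fourier u \<xi> * (1 - cis (- (2 * pi * (z \<bullet> \<xi>)))) * cis (2 * pi * (x \<bullet> \<xi>)))"
      by (simp add: left_diff_distrib right_diff_distrib mult.assoc cis_mult inner_diff_left algebra_simps)
    finally show ?thesis .
  qed
  note p = plancherel[OF 1 2 3 fourier_difference[OF u, symmetric]]
  show "integrable lborel (\<lambda>x. (norm (u x - u (x - z)))\<^sup>2)"
    "integrable lborel (\<lambda>\<xi>. (norm (fourier u \<xi> * (1 - cis (- (2 * pi * (z \<bullet> \<xi>))))))\<^sup>2)"
    "(LINT x|lborel. (norm (u x - u (x - z)))\<^sup>2)
      = (LINT \<xi>|lborel. (norm (fourier u \<xi> * (1 - cis (- (2 * pi * (z \<bullet> \<xi>))))))\<^sup>2)"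
    using p by auto
qed

lemma norm_one_minus_cis_square: "(norm (1 - cis (- t)))\<^sup>2 = 2 * (1 - cos t)"
proof -
  have "(norm (1 - cis (- t)))\<^sup>2 = (1 - cos t)\<^sup>2 + (sin t)\<^sup>2"
    by (simp add: cmod_power2)
  also have "\<dots> = 2 * (1 - cos t)"
    using sin_cos_squared_add[of t] by (simp add: power2_eq_square algebra_simps)
  finally show ?thesis .
qed

section \<open>Integration of radial functions\<close>

text \<open>Inside the ball its gradient is -2x, and it vanishes on the sphere. Integration by parts
  against it therefore relates integrals of derivatives to integrals with the weight x over the
  ball, without a boundary term.\<close>

definition paraboloid :: "real \<Rightarrow> 'a::euclidean_space \<Rightarrow> real" where
  "paraboloid R x = R\<^sup>2 - (min (norm x) R)\<^sup>2"

lemma paraboloid_measurable[measurable]: "paraboloid R \<in> borel_measurable borel"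
  unfolding paraboloid_def[abs_def] by measurable

lemma paraboloid_eq_0: "norm x \<ge> R \<Longrightarrow> paraboloid R x = 0"
  by (simp add: paraboloid_def)

lemma paraboloid_bounds:
  assumes "R > 0"
  shows "0 \<le> paraboloid R x" "paraboloid R x \<le> R\<^sup>2"
  using assms by (auto simp: paraboloid_def min_def intro!: power_mono)

lemma paraboloid_lipschitz:
  assumes "R > 0"
  shows "\<bar>paraboloid R x - paraboloid R y\<bar> \<le> 2 * R * norm (x - y)"
proof -
  let ?s = "min (norm x) R" and ?t = "min (norm y) R"
  have "paraboloid R x - paraboloid R y = (?t - ?s) * (?s + ?t)"
    by (simp add: paraboloid_def power2_eq_square algebra_simps)
  then have "\<bar>paraboloid R x - paraboloid R y\<bar> = \<bar>?s - ?t\<bar> * (?s + ?t)"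
    using assms by (simp add: abs_mult abs_minus_commute)
  also have "\<dots> \<le> norm (x - y) * (2 * R)"
    using assms norm_triangle_ineq3[of x y] by (intro mult_mono) (auto simp: min_def abs_if)
  finally show ?thesis by (simp add: mult_ac)
qed

text \<open>The integrand is the derivative in direction \<open>v\<close> of the paraboloid times
  \<open>h\<close>. This product is Lipschitz with compact support, and the only points where its
  derivative may fail to exist lie on the sphere, a null set.\<close>

lemma paraboloid_ibp:
  fixes h h' :: "real^'n \<Rightarrow> real"
  assumes R: "R > 0" and L: "L \<ge> 0" and lip: "\<And>x y. \<bar>h x - h y\<bar> \<le> L * norm (x - y)"
    and h[measurable]: "h \<in> borel_measurable borel" and h'[measurable]: "h' \<in> borel_measurable borel"
    and D: "\<And>x. ((\<lambda>t. h (x + t *\<^sub>R v)) has_real_derivative h' x) (at 0)"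
    and B: "\<And>x. norm x \<le> R \<Longrightarrow> \<bar>h x\<bar> \<le> B"
  shows "integrable lborel (\<lambda>x. paraboloid R x * h' x - indicator (cball 0 R) x * (2 * (x \<bullet> v) * h x))"
    and "(LINT x|lborel. paraboloid R x * h' x - indicator (cball 0 R) x * (2 * (x \<bullet> v) * h x)) = 0"
proof -
  let ?f = "\<lambda>x. paraboloid R x * h x"
  let ?g = "\<lambda>x. paraboloid R x * h' x - indicator (cball 0 R) x * (2 * (x \<bullet> v) * h x)"
  have B0: "B \<ge> 0" using B[of 0] R by simp
  have one: "\<bar>?f x - ?f y\<bar> \<le> (2 * R * B + R\<^sup>2 * L) * norm (x - y)" if "norm x \<le> R" for x y
  proof -
    have "\<bar>?f x - ?f y\<bar> = \<bar>(paraboloid R x - paraboloid R y) * h x + paraboloid R y * (h x - h y)\<bar>"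
      by (simp add: algebra_simps)
    also have "\<dots> \<le> \<bar>paraboloid R x - paraboloid R y\<bar> * \<bar>h x\<bar> + \<bar>paraboloid R y\<bar> * \<bar>h x - h y\<bar>"
      by (rule order_trans[OF abs_triangle_ineq]) (simp add: abs_mult)
    also have "\<dots> \<le> (2 * R * norm (x - y)) * B + R\<^sup>2 * (L * norm (x - y))"
      using R that paraboloid_bounds[OF R, of y]
      by (intro add_mono mult_mono paraboloid_lipschitz lip B) auto
    finally show ?thesis by (simp add: algebra_simps)
  qed
  have lipf: "norm (?f x - ?f y) \<le> (2 * R * B + R\<^sup>2 * L) * norm (x - y)" for x y
  proof -
    consider "norm x \<le> R" | "norm y \<le> R" | "norm x > R" "norm y > R" by linarith
    then show ?thesis
    proof cases
      case 2
      from one[OF 2, of x] show ?thesis by (simp add: norm_minus_commute abs_minus_commute)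
    next
      case 3
      then show ?thesis using R L B0 by (simp add: paraboloid_eq_0)
    qed (use one in auto)
  qed
  have "sphere (0::real^'n) R \<in> null_sets lborel"
    using negligible_sphere[of "0::real^'n" R]
    by (simp add: negligible_iff_null_sets null_sets_completion_iff)
  then have "AE x in lborel. x \<notin> sphere (0::real^'n) R" by (rule AE_not_in)
  then have deriv: "AE x in lborel. ((\<lambda>t. ?f (x + t *\<^sub>R v)) has_vector_derivative ?g x) (at 0)"
  proof eventually_elim
    case (elim x)
    consider "norm x < R" | "norm x > R" using elim by (force simp: dist_norm)
    then show ?case
    proof cases
      case 1
      have op: "open {t::real. norm (x + t *\<^sub>R v) < R}"
        by (intro open_Collect_less continuous_intros)
      have "((\<lambda>t. (R\<^sup>2 - (x + t *\<^sub>R v) \<bullet> (x + t *\<^sub>R v)) * h (x + t *\<^sub>R v)) has_real_derivative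
          (R\<^sup>2 - x \<bullet> x) * h' x - 2 * (x \<bullet> v) * h x) (at 0)"
        by (auto intro!: derivative_eq_intros D simp: inner_simps inner_commute)
      then have "((\<lambda>t. ?f (x + t *\<^sub>R v)) has_real_derivative
          (R\<^sup>2 - x \<bullet> x) * h' x - 2 * (x \<bullet> v) * h x) (at 0)"
        by (rule has_field_derivative_transform_within_open[OF _ op])
          (use 1 in \<open>auto simp: paraboloid_def min_def power2_norm_eq_inner\<close>)
      then show ?thesis using 1
        by (simp add: has_real_derivative_iff_has_vector_derivative paraboloid_def min_def power2_norm_eq_inner)
    next
      case 2
      have op: "open {t::real. norm (x + t *\<^sub>R v) > R}"
        by (intro open_Collect_less continuous_intros)
      have "((\<lambda>t. ?f (x + t *\<^sub>R v)) has_real_derivative 0) (at 0)"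
        by (rule has_field_derivative_transform_within_open[OF DERIV_const op])
          (use 2 in \<open>auto simp: paraboloid_eq_0\<close>)
      then show ?thesis using 2
        by (simp add: has_real_derivative_iff_has_vector_derivative paraboloid_eq_0)
    qed
  qed
  have s: "norm x > R \<Longrightarrow> ?f x = 0" for x by (simp add: paraboloid_eq_0)
  have L': "0 \<le> 2 * R * B + R\<^sup>2 * L" using R L B0 by simp
  have gm: "?g \<in> borel_measurable borel"
    by (intro borel_measurable_diff borel_measurable_times borel_measurable_indicator) auto
  show "integrable lborel ?g" "integral\<^sup>L lborel ?g = 0"
    by (rule integral_directional_derivative[OF lipf L' s gm deriv], assumption)+
qed

lemma measure_eqI_atMost:
  fixes M N :: "real measure"
  assumes sets: "sets M = sets borel" "sets N = sets borel"
    and eq: "\<And>R. emeasure M {..R} = emeasure N {..R}"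
    and fin: "\<And>R. emeasure M {..R} < \<infinity>"
  shows "M = N"
proof (rule measure_eqI_generator_eq[where \<Omega>=UNIV and E="range atMost" and A="\<lambda>i. {..real i}"])
  show "Int_stable (range (atMost :: real \<Rightarrow> _))"
    by (auto simp: Int_stable_def)
  show "sets M = sigma_sets UNIV (range atMost)" "sets N = sigma_sets UNIV (range atMost)"
    using sets by (simp_all add: borel_eq_atMost)
  show "(\<Union>i. {..real i}) = UNIV"
    by (auto intro: real_arch_simple)
qed (use eq fin in \<open>auto simp: less_top\<close>)

text \<open>The images under the norm of the measures with densities \<open>p\<close> and
  \<open>q\<close> agree on all half lines, hence everywhere. This takes the place of a comparison
  of spherical means.\<close>

lemma nn_integral_radial_eq:
  fixes p q :: "'a::euclidean_space \<Rightarrow> real"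
  assumes [measurable]: "p \<in> borel_measurable borel" "q \<in> borel_measurable borel" "f \<in> borel_measurable borel"
    and eq: "\<And>R. (\<integral>\<^sup>+x. ennreal (p x) * indicator (cball 0 R) x \<partial>lborel) = (\<integral>\<^sup>+x. ennreal (q x) * indicator (cball 0 R) x \<partial>lborel)"
    and fin: "\<And>R. (\<integral>\<^sup>+x. ennreal (p x) * indicator (cball 0 R) x \<partial>lborel) < \<infinity>"
  shows "(\<integral>\<^sup>+x. f (norm x) * ennreal (p x) \<partial>lborel) = (\<integral>\<^sup>+x. f (norm x) * ennreal (q x) \<partial>lborel)"
proof -
  let ?M = "\<lambda>p. distr (density lborel (\<lambda>x::'a. ennreal (p x))) borel norm"
  have e: "emeasure (?M p) {..R} = (\<integral>\<^sup>+x. ennreal (p x) * indicator (cball 0 R) x \<partial>lborel)"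
    if [measurable]: "p \<in> borel_measurable borel" for p :: "'a \<Rightarrow> real" and R
  proof -
    have "norm -` {..R} = (cball 0 R :: 'a set)" by auto
    then show ?thesis by (simp add: emeasure_distr emeasure_density)
  qed
  have "?M p = ?M q"
    by (rule measure_eqI_atMost) (use eq fin in \<open>auto simp: e\<close>)
  then have "nn_integral (?M p) f = nn_integral (?M q) f" by simp
  then show ?thesis
    by (simp add: nn_integral_distr nn_integral_density mult.commute)
qed


lemma integrable_indicator_cball:
  fixes h :: "'a::euclidean_space \<Rightarrow> real"
  assumes [measurable]: "h \<in> borel_measurable borel" and B: "\<And>x. norm x \<le> R \<Longrightarrow> \<bar>h x\<bar> \<le> B"
  shows "integrable lborel (\<lambda>x. indicator (cball 0 R) x * h x)"
  by (rule integrable_cball_bounded[where R=R and B="\<bar>B\<bar>"])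
    (use B in \<open>auto simp: indicator_def intro: order_trans[OF _ abs_ge_self]\<close>)

section \<open>The nonlocal gradient of a radial kernel\<close>

text \<open>The profile \<open>b\<close> is Borel measurable and nonnegative on the whole line;
  \<open>radial_borel_version\<close> produces such a kernel from a Lebesgue measurable one, with
  equality almost everywhere. The convention \<open>inverse 0 = 0\<close> makes the weighted kernel
  vanish at the origin, whatever \<open>b 0\<close> is.\<close>

locale radial_kernel =
  fixes b :: "real \<Rightarrow> real" and r :: "real^'n \<Rightarrow> real"
  assumes r_eq: "\<And>x. r x = b (norm x)"
    and b_measurable[measurable]: "b \<in> borel_measurable borel"
    and b_nonneg: "\<And>t. b t \<ge> 0"
    and w_integrable: "integrable lborel (\<lambda>x. min 1 (inverse (norm x)) * r x)"
begin

definition w :: "real^'n \<Rightarrow> real" where "w x = min 1 (inverse (norm x)) * r x"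

lemma r_measurable[measurable]: "r \<in> borel_measurable borel"
proof -
  have "r = (\<lambda>x. b (norm x))" using r_eq by auto
  then show ?thesis by simp
qed

lemma r_nonneg: "r x \<ge> 0" by (simp add: r_eq b_nonneg)

lemma r_minus: "r (- x) = r x" by (simp add: r_eq)

lemma w_int: "integrable lborel w"
  using w_integrable by (simp add: w_def[abs_def])

lemma w_nonneg: "w x \<ge> 0" by (simp add: w_def r_nonneg)

text \<open>The scalar kernel of the component of the nonlocal gradient in direction
  \<open>v\<close>. It is odd, and \<open>norm v * w\<close> is its weight in the results on
  difference operators.\<close>

definition kcomp :: "real^'n \<Rightarrow> real^'n \<Rightarrow> real" where
  "kcomp v z = r z * (z \<bullet> v) / (norm z)\<^sup>2"

lemma kcomp_measurable[measurable]: "kcomp v \<in> borel_measurable borel"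
  unfolding kcomp_def[abs_def] by measurable

lemma kcomp_bound: "\<bar>kcomp v z\<bar> * min 1 (norm z) \<le> norm v * w z"
proof (cases "z = 0")
  case False
  have "\<bar>kcomp v z\<bar> \<le> r z * (norm z * norm v) / (norm z)\<^sup>2"
    unfolding kcomp_def abs_mult abs_divide
    by (auto intro!: divide_right_mono mult_mono Cauchy_Schwarz_ineq2 simp: r_nonneg)
  also have "\<dots> = norm v * r z * inverse (norm z)"
    using False by (simp add: power2_eq_square field_simps)
  finally have "\<bar>kcomp v z\<bar> * min 1 (norm z) \<le> norm v * r z * inverse (norm z) * min 1 (norm z)"
    by (intro mult_right_mono) auto
  also have "\<dots> = norm v * w z"
    using False by (auto simp: w_def min_def field_simps)
  finally show ?thesis .
qed (simp add: w_def)

lemma kcomp_minus: "kcomp v (- z) = - kcomp v z"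
  by (simp add: kcomp_def r_minus)

text \<open>The multiplier: \<open>lam \<rho> = \<i> Lam\<close> off the origin.\<close>

definition Lam :: "real^'n \<Rightarrow> real^'n" where
  "Lam \<xi> = (LINT z|lborel. (sin (2 * pi * (z \<bullet> \<xi>)) * r z / (norm z)\<^sup>2) *\<^sub>R z)"

lemma Lam_integrand_bound:
  "norm ((sin (2 * pi * (z \<bullet> \<xi>)) * r z / (norm z)\<^sup>2) *\<^sub>R z) \<le> (1 + 2 * pi * norm \<xi>) * w z"
proof (cases "z = 0")
  case False
  have s: "\<bar>sin (2 * pi * (z \<bullet> \<xi>))\<bar> \<le> (1 + 2 * pi * norm \<xi>) * min 1 (norm z)"
  proof (cases "norm z \<le> 1")
    case True
    have "\<bar>sin (2 * pi * (z \<bullet> \<xi>))\<bar> \<le> \<bar>2 * pi * (z \<bullet> \<xi>)\<bar>" by (rule abs_sin_x_le_abs_x)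
    also have "\<dots> \<le> 2 * pi * (norm z * norm \<xi>)"
      using Cauchy_Schwarz_ineq2[of z \<xi>] by (simp add: abs_mult)
    also have "\<dots> \<le> (1 + 2 * pi * norm \<xi>) * norm z" by (simp add: algebra_simps)
    finally show ?thesis using True by simp
  next
    case False
    have "\<bar>sin (2 * pi * (z \<bullet> \<xi>))\<bar> \<le> 1" by simp
    also have "1 \<le> 1 + 2 * pi * norm \<xi>" by simp
    finally show ?thesis using False by simp
  qed
  have "norm ((sin (2 * pi * (z \<bullet> \<xi>)) * r z / (norm z)\<^sup>2) *\<^sub>R z) = \<bar>sin (2 * pi * (z \<bullet> \<xi>))\<bar> * (r z * inverse (norm z))"
    using False r_nonneg[of z] by (simp add: abs_mult power2_eq_square field_simps)
  also have "\<dots> \<le> ((1 + 2 * pi * norm \<xi>) * min 1 (norm z)) * (r z * inverse (norm z))"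
    by (intro mult_right_mono s) (simp add: r_nonneg)
  also have "\<dots> = (1 + 2 * pi * norm \<xi>) * w z"
    using False by (auto simp: w_def min_def field_simps)
  finally show ?thesis .
qed (simp add: w_def)

lemma Lam_integrable: "integrable lborel (\<lambda>z. (sin (2 * pi * (z \<bullet> \<xi>)) * r z / (norm z)\<^sup>2) *\<^sub>R z)"
  by (rule integrable_integral_cong_bound[OF integrable_mult_right[OF w_int] _ Lam_integrand_bound]) measurable

lemma Lam_bound: "norm (Lam \<xi>) \<le> (1 + 2 * pi * norm \<xi>) * integral\<^sup>L lborel w"
proof -
  have "norm (Lam \<xi>) \<le> (LINT z|lborel. (1 + 2 * pi * norm \<xi>) * w z)"
    unfolding Lam_def
    by (rule integral_norm_bound_le[OF integrable_mult_right[OF w_int] Lam_integrand_bound])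
  then show ?thesis by simp
qed

lemma Lam_square_bound:
  obtains C where "C \<ge> 0" "\<And>\<xi>. (norm (Lam \<xi>))\<^sup>2 \<le> C * (1 + (norm \<xi>)\<^sup>2)"
proof (rule that)
  let ?W = "integral\<^sup>L lborel w"
  show "2 * (1 + 4 * pi\<^sup>2) * ?W\<^sup>2 \<ge> 0" by simp
  fix \<xi>
  have "(norm (Lam \<xi>))\<^sup>2 \<le> ((1 + 2 * pi * norm \<xi>) * ?W)\<^sup>2"
    by (intro power_mono Lam_bound) auto
  also have "\<dots> = (1 + 2 * pi * norm \<xi>)\<^sup>2 * ?W\<^sup>2" by (simp add: power_mult_distrib)
  also have "\<dots> \<le> (2 * (1 + 4 * pi\<^sup>2) * (1 + (norm \<xi>)\<^sup>2)) * ?W\<^sup>2"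
  proof (intro mult_right_mono)
    have "(1 + 2 * pi * norm \<xi>)\<^sup>2 \<le> 2 * 1\<^sup>2 + 2 * (2 * pi * norm \<xi>)\<^sup>2"
      using zero_le_power2[of "1 - 2 * pi * norm \<xi>"] by (simp add: power2_eq_square algebra_simps)
    also have "\<dots> \<le> 2 * (1 + 4 * pi\<^sup>2) * (1 + (norm \<xi>)\<^sup>2)"
      by (simp add: power_mult_distrib algebra_simps)
    finally show "(1 + 2 * pi * norm \<xi>)\<^sup>2 \<le> 2 * (1 + 4 * pi\<^sup>2) * (1 + (norm \<xi>)\<^sup>2)" .
  qed simp
  finally show "(norm (Lam \<xi>))\<^sup>2 \<le> 2 * (1 + 4 * pi\<^sup>2) * ?W\<^sup>2 * (1 + (norm \<xi>)\<^sup>2)" by (simp add: mult_ac)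
qed

lemma continuous_on_Lam: "continuous_on UNIV Lam"
proof (rule continuous_at_imp_continuous_on, rule ballI)
  fix p :: "real^'n"
  show "isCont Lam p"
  proof (rule continuous_at_sequentiallyI)
    fix u assume u: "u \<longlonglongrightarrow> p"
    obtain B where B: "\<And>n. norm (u n) \<le> B"
      using convergent_imp_Bseq[of u] u unfolding Bseq_def convergent_def by blast
    show "(\<lambda>n. Lam (u n)) \<longlonglongrightarrow> Lam p"
      unfolding Lam_def
    proof (rule integral_dominated_convergence[OF _ _ integrable_mult_right[OF w_int, of "1 + 2 * pi * B"]])
      show "AE z in lborel. (\<lambda>n. (sin (2 * pi * (z \<bullet> u n)) * r z / (norm z)\<^sup>2) *\<^sub>R z)
          \<longlonglongrightarrow> (sin (2 * pi * (z \<bullet> p)) * r z / (norm z)\<^sup>2) *\<^sub>R z"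
        using u by (auto intro!: AE_I2 tendsto_intros simp: divide_inverse)
      fix n
      have "norm ((sin (2 * pi * (z \<bullet> u n)) * r z / (norm z)\<^sup>2) *\<^sub>R z) \<le> (1 + 2 * pi * B) * w z" for z
        by (rule order_trans[OF Lam_integrand_bound])
          (auto intro!: mult_right_mono B simp: w_nonneg)
      then show "AE z in lborel. norm ((sin (2 * pi * (z \<bullet> u n)) * r z / (norm z)\<^sup>2) *\<^sub>R z) \<le> (1 + 2 * pi * B) * w z"
        by simp
    qed measurable
  qed
qed

lemma Lam_measurable[measurable]: "Lam \<in> borel_measurable borel"
  by (rule borel_measurable_continuous_onI[OF continuous_on_Lam])

lemma Lam_0[simp]: "Lam 0 = 0" by (simp add: Lam_def)

lemma Lam_minus: "Lam (- \<xi>) = - Lam \<xi>"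
  unfolding Lam_def by (simp flip: Bochner_Integration.integral_minus)

text \<open>For fixed z the sine stays bounded while it is divided by a growing factor, and the
  scaled integrands keep the common majorant (1 + 2 pi |\<xi>|) w. This is the gain over quadratic
  growth of the squared multiplier that rules out a contribution of K at the origin.\<close>

lemma Lam_sublinear: "(\<lambda>k. (norm (Lam (real (Suc k) *\<^sub>R \<xi>)))\<^sup>2 / (real (Suc k))\<^sup>2) \<longlonglongrightarrow> 0"
proof -
  let ?g = "\<lambda>z \<xi>. (sin (2 * pi * (z \<bullet> \<xi>)) * r z / (norm z)\<^sup>2) *\<^sub>R z"
  have "(\<lambda>k. LINT z|lborel. ?g z (real (Suc k) *\<^sub>R \<xi>) /\<^sub>R real (Suc k)) \<longlonglongrightarrow> (LINT z|(lborel :: (real^'n) measure). 0 :: real^'n)"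
  proof (rule integral_dominated_convergence[OF _ _ integrable_mult_right[OF w_int, of "1 + 2 * pi * norm \<xi>"]])
    show "AE z in lborel. (\<lambda>k. ?g z (real (Suc k) *\<^sub>R \<xi>) /\<^sub>R real (Suc k)) \<longlonglongrightarrow> 0"
    proof (rule AE_I2)
      fix z
      show "(\<lambda>k. ?g z (real (Suc k) *\<^sub>R \<xi>) /\<^sub>R real (Suc k)) \<longlonglongrightarrow> 0"
      proof (rule Lim_null_comparison)
        show "\<forall>\<^sub>F k in sequentially. norm (?g z (real (Suc k) *\<^sub>R \<xi>) /\<^sub>R real (Suc k))
            \<le> inverse (real (Suc k)) * (\<bar>r z\<bar> / (norm z)\<^sup>2 * norm z)"
          by (auto simp: abs_mult intro!: always_eventually mult_left_mono mult_right_mono divide_right_mono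
              mult_left_le_one_le)
        show "(\<lambda>k. inverse (real (Suc k)) * (\<bar>r z\<bar> / (norm z)\<^sup>2 * norm z)) \<longlonglongrightarrow> 0"
          by (intro tendsto_mult_left_zero LIMSEQ_inverse_real_of_nat)
      qed
    qed
    fix k
    have "norm (?g z (real (Suc k) *\<^sub>R \<xi>) /\<^sub>R real (Suc k)) \<le> (1 + 2 * pi * norm \<xi>) * w z" for z
    proof -
      have "norm (?g z (real (Suc k) *\<^sub>R \<xi>) /\<^sub>R real (Suc k))
          = inverse (real (Suc k)) * norm (?g z (real (Suc k) *\<^sub>R \<xi>))"
        by (subst norm_scaleR) simp
      also have "\<dots> \<le> inverse (real (Suc k)) * ((1 + 2 * pi * norm (real (Suc k) *\<^sub>R \<xi>)) * w z)"
        by (intro mult_left_mono Lam_integrand_bound) auto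
      also have "\<dots> = (inverse (real (Suc k)) + 2 * pi * norm \<xi>) * w z"
        by (simp add: field_simps del: of_nat_Suc)
      also have "\<dots> \<le> (1 + 2 * pi * norm \<xi>) * w z"
        by (intro mult_right_mono add_right_mono w_nonneg) (simp add: field_simps)
      finally show ?thesis .
    qed
    then show "AE z in lborel. norm (?g z (real (Suc k) *\<^sub>R \<xi>) /\<^sub>R real (Suc k)) \<le> (1 + 2 * pi * norm \<xi>) * w z"
      by simp
  qed auto
  then have "(\<lambda>k. Lam (real (Suc k) *\<^sub>R \<xi>) /\<^sub>R real (Suc k)) \<longlonglongrightarrow> 0"
    by (simp only: Lam_def integral_scaleR_right Bochner_Integration.integral_zero)
  then have "(\<lambda>k. (norm (Lam (real (Suc k) *\<^sub>R \<xi>) /\<^sub>R real (Suc k)))\<^sup>2) \<longlonglongrightarrow> 0"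
    by (intro tendsto_null_power tendsto_norm_zero) auto
  then show ?thesis
    by (simp add: power_mult_distrib divide_inverse power_inverse mult.commute del: of_nat_Suc)
qed

lemma Lam_inner: "Lam \<xi> \<bullet> v = (LINT z|lborel. sin (2 * pi * (z \<bullet> \<xi>)) * kcomp v z)"
  unfolding Lam_def
  by (subst integral_inner_left[symmetric], rule Lam_integrable, simp add: kcomp_def mult.assoc)

text \<open>The function sin(2 pi x \<bullet> \<xi>) is constant in a direction \<open>v\<close>
  orthogonal to \<xi>, so integration by parts along \<open>v\<close> against the paraboloid shows
  that its product with x \<bullet> v has integral zero over every ball. Comparison of image
  measures under the norm carries this over to the radial weight b(|x|)/|x|^2.\<close>

lemma Lam_orthogonal:
  assumes "v \<bullet> \<xi> = 0"
  shows "Lam \<xi> \<bullet> v = 0"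
proof -
  let ?s = "\<lambda>x. (x \<bullet> v) * sin (2 * pi * (x \<bullet> \<xi>))"
  \<comment> \<open>Comparing measures requires nonnegative densities, so \<open>?s\<close> is
    lifted by the radial majorant \<open>?q\<close>. Since \<open>?s\<close> has integral zero over
    balls, \<open>?p\<close> and \<open>?q\<close> have equal mass on each ball. The minimum in
    \<open>?q\<close> keeps it integrable against the singular weight.\<close>
  let ?q = "\<lambda>x::real^'n. norm x * norm v * min 1 (2 * pi * norm \<xi> * norm x)"
  let ?p = "\<lambda>x. ?q x + ?s x"
  have le: "\<bar>?s x\<bar> \<le> ?q x" for x
  proof -
    have "\<bar>sin (2 * pi * (x \<bullet> \<xi>))\<bar> \<le> 2 * pi * (norm x * norm \<xi>)"
      using abs_sin_x_le_abs_x[of "2 * pi * (x \<bullet> \<xi>)"] Cauchy_Schwarz_ineq2[of x \<xi>]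
      by (auto simp: abs_mult intro: order_trans)
    then have "\<bar>sin (2 * pi * (x \<bullet> \<xi>))\<bar> \<le> min 1 (2 * pi * norm \<xi> * norm x)"
      by (simp add: mult_ac)
    then show ?thesis
      unfolding abs_mult by (intro mult_mono Cauchy_Schwarz_ineq2) auto
  qed
  have q0: "?q x \<ge> 0" for x by simp
  have p0: "?p x \<ge> 0" for x using le[of x] by linarith
  have q_le: "?q x \<le> R * norm v" if "norm x \<le> R" for x R
    using mult_mono[OF mult_right_mono[OF that norm_ge_zero[of v]], of "min 1 (2 * pi * norm \<xi> * norm x)" 1] that norm_ge_zero[of x]
    by (auto intro: order_trans[OF _ that])
  have iq: "integrable lborel (\<lambda>x. indicator (cball 0 R) x * ?q x)" for R
    by (rule integrable_indicator_cball[where h="?q" and R=R and B="R * norm v"]) (use q_le in auto)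
  have iss: "integrable lborel (\<lambda>x. indicator (cball 0 R) x * ?s x)" for R
    by (rule integrable_indicator_cball[where h="?s" and R=R and B="R * norm v"], measurable) (rule order_trans[OF le q_le])
  have s0: "(LINT x|lborel. indicator (cball 0 R) x * ?s x) = 0" for R
  proof (cases "R > 0")
    case True
    have "(LINT x|lborel. paraboloid R x * 0 - indicator (cball 0 R) x * (2 * (x \<bullet> v) * sin (2 * pi * (x \<bullet> \<xi>)))) = 0"
    proof (rule paraboloid_ibp(2)[OF True, where L="2 * pi * norm \<xi>" and B=1])
      fix x y :: "real^'n"
      have "\<bar>sin a - sin c\<bar> \<le> \<bar>a - c\<bar>" for a c :: real
        using norm_cis_diff[of a c] abs_Im_le_cmod[of "cis a - cis c"] by simp
      from this[of "2 * pi * (x \<bullet> \<xi>)" "2 * pi * (y \<bullet> \<xi>)"]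
      have "\<bar>sin (2 * pi * (x \<bullet> \<xi>)) - sin (2 * pi * (y \<bullet> \<xi>))\<bar> \<le> \<bar>2 * pi * ((x - y) \<bullet> \<xi>)\<bar>"
        by (simp add: inner_diff_left right_diff_distrib)
      also have "\<dots> \<le> 2 * pi * (norm (x - y) * norm \<xi>)"
        using Cauchy_Schwarz_ineq2[of "x - y" \<xi>] by (simp add: abs_mult)
      finally show "\<bar>sin (2 * pi * (x \<bullet> \<xi>)) - sin (2 * pi * (y \<bullet> \<xi>))\<bar> \<le> 2 * pi * norm \<xi> * norm (x - y)"
        by (simp add: mult_ac)
      show "((\<lambda>t. sin (2 * pi * ((x + t *\<^sub>R v) \<bullet> \<xi>))) has_real_derivative 0) (at 0)"
        using assms by (simp add: inner_simps)
    qed auto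
    then have "(LINT x|lborel. (- 2) * (indicator (cball 0 R) x * ?s x)) = 0"
      by (simp add: mult_ac)
    then show ?thesis by (simp only: integral_mult_right_zero)
  next
    case False
    then have "indicator (cball 0 R) x * ?s x = 0" for x
      using zero_less_norm_iff[of x] by (cases "x = 0") (auto simp: indicator_def simp del: zero_less_norm_iff)
    then show ?thesis by (simp only: Bochner_Integration.integral_zero)
  qed
  have nn: "(\<integral>\<^sup>+x. ennreal (g x) * indicator (cball 0 R) x \<partial>lborel) = ennreal (LINT x|lborel. indicator (cball 0 R) x * g x)"
    if "integrable lborel (\<lambda>x. indicator (cball 0 R) x * g x)" "\<And>x. g x \<ge> 0" for g :: "real^'n \<Rightarrow> real" and R
    using that by (subst nn_integral_eq_integral[symmetric])
      (auto intro!: nn_integral_cong simp: indicator_def)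
  have ip: "integrable lborel (\<lambda>x. indicator (cball 0 R) x * ?p x)" for R
    unfolding distrib_left by (rule Bochner_Integration.integrable_add[OF iq iss])
  have pq: "(LINT x|lborel. indicator (cball 0 R) x * ?p x) = (LINT x|lborel. indicator (cball 0 R) x * ?q x)" for R
  proof -
    have "(LINT x|lborel. indicator (cball 0 R) x * ?p x)
        = (LINT x|lborel. indicator (cball 0 R) x * ?q x) + (LINT x|lborel. indicator (cball 0 R) x * ?s x)"
      unfolding distrib_left by (rule Bochner_Integration.integral_add[OF iq iss])
    then show ?thesis by (simp only: s0 add_0_right)
  qed
  let ?f = "\<lambda>t. ennreal (b t / t\<^sup>2)"
  have eq: "(\<integral>\<^sup>+x. ?f (norm x) * ennreal (?p x) \<partial>lborel) = (\<integral>\<^sup>+x. ?f (norm x) * ennreal (?q x) \<partial>lborel)"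
    by (rule nn_integral_radial_eq) (auto simp: nn[OF ip p0] nn[OF iq q0] pq)
  have fq: "b (norm x) / (norm x)\<^sup>2 * ?q x \<le> (norm v * (1 + 2 * pi * norm \<xi>)) * w x" for x
  proof (cases "x = 0")
    case False
    have "b (norm x) / (norm x)\<^sup>2 * ?q x = norm v * r x * (inverse (norm x) * min 1 (2 * pi * norm \<xi> * norm x))"
      using False by (simp add: r_eq power2_eq_square field_simps)
    also have "inverse (norm x) * min 1 (2 * pi * norm \<xi> * norm x) \<le> (1 + 2 * pi * norm \<xi>) * min 1 (inverse (norm x))"
    proof (cases "norm x \<le> 1")
      case True
      have "inverse (norm x) * min 1 (2 * pi * norm \<xi> * norm x) \<le> inverse (norm x) * (2 * pi * norm \<xi> * norm x)"
        by (intro mult_left_mono) auto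
      also have "\<dots> = 2 * pi * norm \<xi>" using False by (simp add: field_simps)
      also have "\<dots> \<le> 1 + 2 * pi * norm \<xi>" by simp
      finally show ?thesis using True False by (simp add: min_def one_le_inverse)
    next
      case F: False
      have "inverse (norm x) * min 1 (2 * pi * norm \<xi> * norm x) \<le> inverse (norm x) * (1 + 2 * pi * norm \<xi>)"
        by (intro mult_left_mono) (auto intro: min.coboundedI1)
      moreover have "min 1 (inverse (norm x)) = inverse (norm x)"
        using F by (intro min_absorb2) (simp add: inverse_le_1_iff)
      ultimately show ?thesis by (simp only: mult.commute)
    qed
    then have "norm v * r x * (inverse (norm x) * min 1 (2 * pi * norm \<xi> * norm x))
        \<le> norm v * r x * ((1 + 2 * pi * norm \<xi>) * min 1 (inverse (norm x)))"
      by (intro mult_left_mono) (auto simp: r_nonneg)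
    finally show ?thesis by (simp add: w_def mult_ac)
  qed (simp add: w_nonneg)
  have iq': "integrable lborel (\<lambda>x. b (norm x) / (norm x)\<^sup>2 * ?q x)"
    by (rule integrable_integral_cong_bound[OF integrable_mult_right[OF w_int]])
      (use fq in \<open>auto simp: b_nonneg\<close>)
  have iss': "integrable lborel (\<lambda>x. b (norm x) / (norm x)\<^sup>2 * ?s x)"
  proof (rule integrable_integral_cong_bound[OF iq'])
    fix x :: "real^'n"
    have n: "b (norm x) / (norm x)\<^sup>2 \<ge> 0" by (simp add: b_nonneg)
    then have "norm (b (norm x) / (norm x)\<^sup>2 * ?s x) = b (norm x) / (norm x)\<^sup>2 * \<bar>?s x\<bar>"
      by (simp only: real_norm_def abs_mult[of "b (norm x) / (norm x)\<^sup>2"] abs_of_nonneg)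
    also have "\<dots> \<le> b (norm x) / (norm x)\<^sup>2 * ?q x" by (rule mult_left_mono[OF le n])
    finally show "norm (b (norm x) / (norm x)\<^sup>2 * ?s x) \<le> b (norm x) / (norm x)\<^sup>2 * ?q x" .
  qed measurable
  have ip': "integrable lborel (\<lambda>x. b (norm x) / (norm x)\<^sup>2 * ?p x)"
    using Bochner_Integration.integrable_add[OF iq' iss'] by (simp only: distrib_left)
  have "(LINT x|lborel. b (norm x) / (norm x)\<^sup>2 * ?p x) = (LINT x|lborel. b (norm x) / (norm x)\<^sup>2 * ?q x)"
  proof -
    have n: "0 \<le> b (norm x) / (norm x)\<^sup>2 * ?p x" "0 \<le> b (norm x) / (norm x)\<^sup>2 * ?q x" for x
      using p0[of x] q0[of x] b_nonneg[of "norm x"] by (auto intro!: mult_nonneg_nonneg)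
    have "?f (norm x) * ennreal (?p x) = ennreal (b (norm x) / (norm x)\<^sup>2 * ?p x)"
      "?f (norm x) * ennreal (?q x) = ennreal (b (norm x) / (norm x)\<^sup>2 * ?q x)" for x
      by (rule ennreal_mult'[symmetric], simp add: b_nonneg)+
    with eq have "(\<integral>\<^sup>+x. ennreal (b (norm x) / (norm x)\<^sup>2 * ?p x) \<partial>lborel)
        = (\<integral>\<^sup>+x. ennreal (b (norm x) / (norm x)\<^sup>2 * ?q x) \<partial>lborel)"
      by (simp only:)
    then have "ennreal (LINT x|lborel. b (norm x) / (norm x)\<^sup>2 * ?p x) = ennreal (LINT x|lborel. b (norm x) / (norm x)\<^sup>2 * ?q x)"
      using nn_integral_eq_integral[OF ip' AE_I2[OF n(1)]] nn_integral_eq_integral[OF iq' AE_I2[OF n(2)]]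
      by (simp only:)
    then show ?thesis
      using n by (subst (asm) ennreal_inj) (auto intro: integral_nonneg_AE)
  qed
  then have "(LINT x|lborel. b (norm x) / (norm x)\<^sup>2 * ?s x) = 0"
    using Bochner_Integration.integral_add[OF iq' iss'] unfolding distrib_left by linarith
  then show ?thesis
    unfolding Lam_inner by (simp add: kcomp_def r_eq mult_ac)
qed

text \<open>The component of \<open>Lam \<xi>\<close> orthogonal to \<xi> is orthogonal to
  \<open>Lam \<xi>\<close> by \<open>Lam_orthogonal\<close>, hence to itself, so it vanishes and
  Cauchy-Schwarz holds with equality.\<close>

lemma norm_Lam: "norm (Lam \<xi>) * norm \<xi> = \<bar>Lam \<xi> \<bullet> \<xi>\<bar>"
proof (cases "\<xi> = 0")
  case False
  let ?v = "Lam \<xi> - ((Lam \<xi> \<bullet> \<xi>) / (\<xi> \<bullet> \<xi>)) *\<^sub>R \<xi>"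
  have "?v \<bullet> \<xi> = 0" using False by (simp add: inner_diff_left)
  moreover from this have "Lam \<xi> \<bullet> ?v = 0" by (rule Lam_orthogonal)
  ultimately have "?v \<bullet> ?v = 0" by (simp add: inner_diff_left inner_diff_right inner_commute)
  then have "Lam \<xi> = ((Lam \<xi> \<bullet> \<xi>) / (\<xi> \<bullet> \<xi>)) *\<^sub>R \<xi>" by simp
  then have "norm (Lam \<xi>) = norm (((Lam \<xi> \<bullet> \<xi>) / (\<xi> \<bullet> \<xi>)) *\<^sub>R \<xi>)"
    by simp
  then have "norm (Lam \<xi>) = \<bar>Lam \<xi> \<bullet> \<xi>\<bar> / (\<xi> \<bullet> \<xi>) * norm \<xi>"
    by simp
  then show ?thesis using False by (simp add: power2_norm_eq_inner[symmetric] power2_eq_square)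
qed simp

text \<open>The kernel is odd, so averaging the integral over z and -z leaves only the sine part of
  the symbol.\<close>

lemma multiplier_kcomp:
  "(LINT z|lborel. (1 - cis (- (2 * pi * (z \<bullet> \<xi>)))) * kcomp v z) = \<i> * of_real (Lam \<xi> \<bullet> v)"
proof -
  let ?f = "\<lambda>z. (1 - cis (- (2 * pi * (z \<bullet> \<xi>)))) * complex_of_real (kcomp v z)"
  have i: "integrable lborel ?f"
    by (rule kernel_multiplier_integrable[OF _ integrable_mult_right[OF w_int] kcomp_bound test_function_of_real])
      (auto simp: test_function_iff smooth_const)
  then have i': "integrable lborel (\<lambda>z. ?f (- z))"
    using integrable_lborel_reflect[of ?f 0] by simp
  have "2 * (LINT z|lborel. ?f z) = (LINT z|lborel. ?f z) + (LINT z|lborel. ?f (- z))"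
    using integral_lborel_reflect[of ?f 0] by simp
  also have "\<dots> = (LINT z|lborel. ?f z + ?f (- z))" using i i' by simp
  also have "\<dots> = (LINT z|lborel. (2 * \<i>) * of_real (sin (2 * pi * (z \<bullet> \<xi>)) * kcomp v z))"
    by (intro Bochner_Integration.integral_cong refl) (simp add: kcomp_minus complex_eq_iff algebra_simps)
  also have "\<dots> = 2 * \<i> * of_real (Lam \<xi> \<bullet> v)"
    by (simp only: integral_mult_right_zero integral_complex_of_real Lam_inner)
  finally show ?thesis by simp
qed

text \<open>The nonlocal gradient after the substitution z = x - y, which exhibits it as a
  difference operator; \<open>nonlocal_grad_eq\<close> identifies the two on test functions.\<close>

definition G :: "(real^'n \<Rightarrow> real) \<Rightarrow> real^'n \<Rightarrow> real^'n" where
  "G u x = (LINT z|lborel. ((u x - u (x - z)) * r z / (norm z)\<^sup>2) *\<^sub>R z)"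

lemma G_integrable:
  assumes "test_function u"
  shows "integrable lborel (\<lambda>z. ((u x - u (x - z)) * r z / (norm z)\<^sup>2) *\<^sub>R z)"
proof -
  have [measurable]: "u \<in> borel_measurable borel" by (rule test_function_measurable[OF assms])
  have "integrable lborel (\<lambda>z. (complex_of_real (u x) - complex_of_real (u (x - z))) * kcomp v z)" for v
    by (rule kernel_difference_integrable[OF _ integrable_mult_right[OF w_int] kcomp_bound test_function_of_real[OF assms]])
      measurable
  then have "integrable lborel (\<lambda>z. (u x - u (x - z)) * kcomp v z)" for v
    by (simp only: of_real_diff[symmetric] of_real_mult[symmetric] complex_of_real_integrable_eq)
  then have "integrable lborel (\<lambda>z. \<Sum>v\<in>Basis. ((u x - u (x - z)) * kcomp v z) *\<^sub>R v)"
    by (intro Bochner_Integration.integrable_sum integrable_scaleR_left) auto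
  moreover have "(\<Sum>v\<in>Basis. ((u x - u (x - z)) * kcomp v z) *\<^sub>R v) = ((u x - u (x - z)) * r z / (norm z)\<^sup>2) *\<^sub>R z" for z
  proof -
    have "((u x - u (x - z)) * r z / (norm z)\<^sup>2) *\<^sub>R z = ((u x - u (x - z)) * r z / (norm z)\<^sup>2) *\<^sub>R (\<Sum>v\<in>Basis. (z \<bullet> v) *\<^sub>R v)"
      by (simp add: euclidean_representation)
    then show ?thesis by (simp add: scaleR_sum_right kcomp_def mult.assoc)
  qed
  ultimately show ?thesis by simp
qed

lemma G_measurable:
  assumes "test_function u"
  shows "G u \<in> borel_measurable borel"
proof -
  have [measurable]: "u \<in> borel_measurable borel" by (rule test_function_measurable[OF assms])
  show ?thesis unfolding G_def[abs_def] by measurable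
qed

lemma G_diff:
  assumes "test_function u" "test_function v"
  shows "G (\<lambda>x. u x - v x) x = G u x - G v x"
proof -
  have "((u x - v x - (u (x - z) - v (x - z))) * r z / (norm z)\<^sup>2) *\<^sub>R z
    = ((u x - u (x - z)) * r z / (norm z)\<^sup>2) *\<^sub>R z - ((v x - v (x - z)) * r z / (norm z)\<^sup>2) *\<^sub>R z" for z
    unfolding scaleR_diff_left[symmetric] diff_divide_distrib[symmetric] left_diff_distrib[symmetric]
    by (simp add: algebra_simps)
  then show ?thesis
    unfolding G_def by (simp add: G_integrable assms)
qed

text \<open>In each coordinate direction this is \<open>kernel_plancherel\<close> for the kernel
  \<open>kcomp\<close>, with symbol \<open>\<i>\<close> times a component of \<open>Lam\<close>; the
  squares are summed over the basis.\<close>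

theorem G_plancherel:
  assumes u: "test_function u"
  shows "integrable lborel (\<lambda>x. (norm (G u x))\<^sup>2)"
    and "integrable lborel (\<lambda>\<xi>. (norm (fourier (\<lambda>x. of_real (u x)) \<xi>))\<^sup>2 * (norm (Lam \<xi>))\<^sup>2)"
    and "(LINT x|lborel. (norm (G u x))\<^sup>2)
      = (LINT \<xi>|lborel. (norm (fourier (\<lambda>x. of_real (u x)) \<xi>))\<^sup>2 * (norm (Lam \<xi>))\<^sup>2)"
proof -
  let ?F = "fourier (\<lambda>x. complex_of_real (u x))"
  have G: "G u x \<bullet> v = (LINT z|lborel. (u x - u (x - z)) * kcomp v z)" for x v
    unfolding G_def
    by (subst integral_inner_left[symmetric], rule G_integrable[OF u], simp add: kcomp_def mult.assoc)
  have D: "(LINT z|lborel. (complex_of_real (u x) - complex_of_real (u (x - z))) * kcomp v z) = of_real (G u x \<bullet> v)" for x v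
    unfolding G by (simp flip: integral_complex_of_real)
  note p = kernel_plancherel[OF kcomp_measurable integrable_mult_right[OF w_int] kcomp_bound test_function_of_real[OF u],
      unfolded D multiplier_kcomp]
  have p': "integrable lborel (\<lambda>x. (G u x \<bullet> v)\<^sup>2)" "integrable lborel (\<lambda>\<xi>. (norm (?F \<xi>))\<^sup>2 * (Lam \<xi> \<bullet> v)\<^sup>2)"
    "(LINT x|lborel. (G u x \<bullet> v)\<^sup>2) = (LINT \<xi>|lborel. (norm (?F \<xi>))\<^sup>2 * (Lam \<xi> \<bullet> v)\<^sup>2)" for v
    using p[of v] by (simp_all add: norm_mult power_mult_distrib)
  show "integrable lborel (\<lambda>x. (norm (G u x))\<^sup>2)"
    "integrable lborel (\<lambda>\<xi>. (norm (?F \<xi>))\<^sup>2 * (norm (Lam \<xi>))\<^sup>2)"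
    using p' by (auto simp: norm_square_Basis[where 'a="real^'n"] sum_distrib_left)
  show "(LINT x|lborel. (norm (G u x))\<^sup>2) = (LINT \<xi>|lborel. (norm (?F \<xi>))\<^sup>2 * (norm (Lam \<xi>))\<^sup>2)"
    unfolding norm_square_Basis[where 'a="real^'n"] sum_distrib_left
    by (subst (1 2) Bochner_Integration.integral_sum) (auto simp: p')
qed

end

section \<open>Layer-cake integration in polar form\<close>

text \<open>For the profile of the kernel this is the function Q. It takes extended real values
  because the integral may diverge at some points, for instance at the origin.\<close>

definition layer :: "(real \<Rightarrow> ennreal) \<Rightarrow> 'a::euclidean_space \<Rightarrow> ennreal" where
  "layer c x = (\<integral>\<^sup>+t. c t * ennreal (1 / t) * indicator {norm x<..} t \<partial>lborel)"

lemma indicator_greaterThan_measurable[measurable (raw)]: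
  fixes f g :: "'a \<Rightarrow> real"
  assumes [measurable]: "f \<in> borel_measurable M" "g \<in> borel_measurable M"
  shows "(\<lambda>x. indicator {f x<..} (g x) :: ennreal) \<in> borel_measurable M"
proof -
  have "(\<lambda>x. indicator {f x<..} (g x) :: ennreal) = (\<lambda>x. if f x < g x then 1 else 0)"
    by (auto simp: indicator_def)
  then show ?thesis by simp
qed

lemma layer_measurable[measurable]:
  assumes [measurable]: "c \<in> borel_measurable borel"
  shows "layer c \<in> borel_measurable borel"
  unfolding layer_def[abs_def] by measurable

lemma nn_integral_linear_Ioc:
  assumes "0 \<le> a"
  shows "(\<integral>\<^sup>+t. ennreal t * indicator {a<..R} t \<partial>lborel) = ennreal ((R\<^sup>2 - (min a R)\<^sup>2) / 2)"
proof (cases "a \<le> R")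
  case True
  have "(\<integral>\<^sup>+t. ennreal t * indicator {a<..R} t \<partial>lborel) = (\<integral>\<^sup>+t. ennreal t * indicator {a..R} t \<partial>lborel)"
    using AE_lborel_singleton[of a] by (intro nn_integral_cong_AE) (auto simp: indicator_def elim!: eventually_mono)
  also have "\<dots> = ennreal (R\<^sup>2 / 2 - a\<^sup>2 / 2)"
    by (rule nn_integral_FTC_Icc[where F="\<lambda>t. t\<^sup>2 / 2"])
      (use True assms in \<open>auto intro!: derivative_eq_intros\<close>)
  finally show ?thesis using True by (simp add: diff_divide_distrib)
qed simp

text \<open>Since \<open>paraboloid R x / 2\<close> is the integral of \<open>t\<close> from \<open>norm x\<close> to \<open>R\<close>, the first
  hypothesis is the conclusion for \<open>c t = t^2 * indicator {..R} t\<close>; no surface measure is needed.\<close>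

lemma layer_formula:
  fixes p f :: "'a::euclidean_space \<Rightarrow> real" and c :: "real \<Rightarrow> ennreal"
  assumes [measurable]: "p \<in> borel_measurable borel" "f \<in> borel_measurable borel" "c \<in> borel_measurable borel"
    and eq: "\<And>R. R > 0 \<Longrightarrow> (\<integral>\<^sup>+x. ennreal ((norm x)\<^sup>2 * p x) * indicator (cball 0 R) x \<partial>lborel)
      = (\<integral>\<^sup>+x. ennreal (f x) * ennreal (paraboloid R x / 2) \<partial>lborel)"
    and fin: "\<And>R. (\<integral>\<^sup>+x. ennreal ((norm x)\<^sup>2 * p x) * indicator (cball 0 R) x \<partial>lborel) < \<infinity>"
  shows "(\<integral>\<^sup>+x. c (norm x) * ennreal (p x) \<partial>lborel) = (\<integral>\<^sup>+x. ennreal (f x) * layer c x \<partial>lborel)"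
proof -
  \<comment> \<open>\<open>?M\<close> and \<open>?N\<close> are two descriptions of one measure on
    the half line: the image of |x|^2 p(x) dx under the norm, and the density t \<open>?F\<close> t
    that the layers produce. The hypothesis makes them agree on all sets {..R}, and the claim is
    obtained by integrating c(t)/t^2 against both.\<close>
  let ?M = "distr (density lborel (\<lambda>x. ennreal ((norm x)\<^sup>2 * p x))) borel norm"
  let ?F = "\<lambda>t. \<integral>\<^sup>+x. ennreal (f x) * indicator {norm x<..} t \<partial>lborel"
  let ?N = "density lborel (\<lambda>t. ennreal t * ?F t)"
  have swap: "(\<integral>\<^sup>+t. d t * ennreal t * ?F t \<partial>lborel) = (\<integral>\<^sup>+x. ennreal (f x) * (\<integral>\<^sup>+t. d t * ennreal t * indicator {norm x<..} t \<partial>lborel) \<partial>lborel)"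
    if [measurable]: "d \<in> borel_measurable borel" for d :: "real \<Rightarrow> ennreal"
  proof -
    have "(\<integral>\<^sup>+t. d t * ennreal t * ?F t \<partial>lborel) = (\<integral>\<^sup>+t. (\<integral>\<^sup>+x. d t * ennreal t * (ennreal (f x) * indicator {norm x<..} t) \<partial>lborel) \<partial>lborel)"
      by (simp add: nn_integral_cmult)
    also have "\<dots> = (\<integral>\<^sup>+x. (\<integral>\<^sup>+t. d t * ennreal t * (ennreal (f x) * indicator {norm x<..} t) \<partial>lborel) \<partial>lborel)"
      by (rule lborel_pair.Fubini') measurable
    also have "\<dots> = (\<integral>\<^sup>+x. (\<integral>\<^sup>+t. ennreal (f x) * (d t * ennreal t * indicator {norm x<..} t) \<partial>lborel) \<partial>lborel)"
      by (simp add: mult_ac)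
    also have "\<dots> = (\<integral>\<^sup>+x. ennreal (f x) * (\<integral>\<^sup>+t. d t * ennreal t * indicator {norm x<..} t \<partial>lborel) \<partial>lborel)"
      by (simp add: nn_integral_cmult)
    finally show ?thesis .
  qed
  have e: "emeasure ?M {..R} = (\<integral>\<^sup>+x. ennreal ((norm x)\<^sup>2 * p x) * indicator (cball 0 R) x \<partial>lborel)" for R
  proof -
    have "norm -` {..R} = (cball 0 R :: 'a set)" by auto
    then show ?thesis by (simp add: emeasure_distr emeasure_density)
  qed
  have e': "emeasure ?N {..R} = (\<integral>\<^sup>+x. ennreal (f x) * ennreal ((R\<^sup>2 - (min (norm x) R)\<^sup>2) / 2) \<partial>lborel)" for R
  proof -
    have "emeasure ?N {..R} = (\<integral>\<^sup>+t. indicator {..R} t * ennreal t * ?F t \<partial>lborel)"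
      by (simp add: emeasure_density mult_ac)
    also have "\<dots> = (\<integral>\<^sup>+x. ennreal (f x) * (\<integral>\<^sup>+t. indicator {..R} t * ennreal t * indicator {norm x<..} t \<partial>lborel) \<partial>lborel)"
      by (rule swap) measurable
    also have "(\<lambda>x::'a. \<integral>\<^sup>+t. indicator {..R} t * ennreal t * indicator {norm x<..} t \<partial>lborel)
        = (\<lambda>x. \<integral>\<^sup>+t. ennreal t * indicator {norm x<..R} t \<partial>lborel)"
      by (intro ext nn_integral_cong) (auto simp: indicator_def)
    finally show ?thesis by (simp add: nn_integral_linear_Ioc)
  qed
  have MN: "emeasure ?M {..R} = emeasure ?N {..R}" for R
  proof (cases "R > 0")
    case True
    then show ?thesis unfolding e e' using eq[OF True] by (simp add: paraboloid_def)
  next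
    case False
    have "(\<integral>\<^sup>+x. ennreal ((norm x)\<^sup>2 * p x) * indicator (cball 0 R) x \<partial>lborel) = (\<integral>\<^sup>+(x::'a). 0 \<partial>lborel)"
    proof (intro nn_integral_cong)
      fix x :: 'a
      show "ennreal ((norm x)\<^sup>2 * p x) * indicator (cball 0 R) x = 0"
      proof (cases "x = 0")
        case x: False
        then have "norm x > R" using False by (intro le_less_trans[of R 0]) auto
        then show ?thesis by simp
      qed simp
    qed
    moreover have "(R\<^sup>2 - (min (norm x) R)\<^sup>2) / 2 = 0" for x :: 'a
    proof -
      have "min (norm x) R = R" using False norm_ge_zero[of x] by linarith
      then show ?thesis by simp
    qed
    ultimately show ?thesis unfolding e e' by simp
  qed
  have "?M = ?N"
    by (rule measure_eqI_atMost) (use MN fin in \<open>auto simp: e\<close>)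
  let ?d = "\<lambda>t. c t * ennreal (1 / t\<^sup>2)"
  have "(\<integral>\<^sup>+x. c (norm x) * ennreal (p x) \<partial>lborel) = (\<integral>\<^sup>+x. ?d (norm x) * ennreal ((norm x)\<^sup>2 * p x) \<partial>lborel)"
  proof (intro nn_integral_cong_AE, use AE_lborel_singleton[of "0::'a"] in eventually_elim)
    case (elim x)
    have "ennreal (1 / (norm x)\<^sup>2) * ennreal ((norm x)\<^sup>2 * p x) = ennreal (p x)"
      using elim by (subst ennreal_mult'[symmetric]) auto
    then show ?case by (simp add: mult.assoc)
  qed
  also have "\<dots> = nn_integral ?M ?d"
    by (simp add: nn_integral_distr nn_integral_density mult.commute)
  also have "\<dots> = nn_integral ?N ?d" using \<open>?M = ?N\<close> by simp
  also have "\<dots> = (\<integral>\<^sup>+t. ?d t * ennreal t * ?F t \<partial>lborel)"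
    by (simp add: nn_integral_density mult_ac)
  also have "\<dots> = (\<integral>\<^sup>+x. ennreal (f x) * (\<integral>\<^sup>+t. ?d t * ennreal t * indicator {norm x<..} t \<partial>lborel) \<partial>lborel)"
    by (rule swap) measurable
  also have "(\<lambda>x::'a. \<integral>\<^sup>+t. ?d t * ennreal t * indicator {norm x<..} t \<partial>lborel) = layer c"
    unfolding layer_def
  proof (intro ext nn_integral_cong)
    fix x :: 'a and t
    show "?d t * ennreal t * indicator {norm x<..} t = c t * ennreal (1 / t) * indicator {norm x<..} t"
    proof (cases "norm x < t")
      case True
      then have "t > 0" using norm_ge_zero[of x] by linarith
      then have "ennreal (1 / t\<^sup>2) * ennreal t = ennreal (1 / t)"
        by (subst ennreal_mult'[symmetric]) (auto simp: power2_eq_square)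
      then show ?thesis by (simp add: mult.assoc)
    qed simp
  qed
  finally show ?thesis .
qed

text \<open>Integrating the coordinate x \<bullet> b by parts along b shows that the paraboloid has
  twice the integral of (x \<bullet> b)^2 over the ball; the dimension appears on summing over the
  basis.\<close>

lemma paraboloid_integral:
  assumes R: "R > 0"
  shows "integrable lborel (paraboloid R :: real^'n \<Rightarrow> real)"
    and "integrable lborel (\<lambda>x::real^'n. indicator (cball 0 R) x * (norm x)\<^sup>2)"
    and "real CARD('n) * (LINT x|lborel. paraboloid R (x::real^'n)) = 2 * (LINT x|lborel. indicator (cball (0::real^'n) R) x * (norm x)\<^sup>2)"
proof -
  show ip: "integrable lborel (paraboloid R :: real^'n \<Rightarrow> real)"
    using paraboloid_bounds[OF R, where 'a="real^'n"]
    by (intro integrable_cball_bounded[where R=R and B="R\<^sup>2"]) (auto simp: paraboloid_eq_0)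
  have ib: "integrable lborel (\<lambda>x::real^'n. indicator (cball 0 R) x * (x \<bullet> b)\<^sup>2)" if "b \<in> Basis" for b
  proof (rule integrable_indicator_cball[where B="R\<^sup>2"])
    fix x :: "real^'n" assume "norm x \<le> R"
    then have "\<bar>x \<bullet> b\<bar> \<le> R" using Basis_le_norm[OF that, of x] by simp
    then have "\<bar>x \<bullet> b\<bar>\<^sup>2 \<le> R\<^sup>2" by (intro power_mono) auto
    then show "\<bar>(x \<bullet> b)\<^sup>2\<bar> \<le> R\<^sup>2" by simp
  qed measurable
  show "integrable lborel (\<lambda>x::real^'n. indicator (cball 0 R) x * (norm x)\<^sup>2)"
    unfolding norm_square_Basis[where 'a="real^'n"] sum_distrib_left
    by (intro Bochner_Integration.integrable_sum ib)
  have e: "(LINT x|lborel. paraboloid R (x::real^'n)) = 2 * (LINT x|lborel. indicator (cball (0::real^'n) R) x * (x \<bullet> b)\<^sup>2)"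
    if b: "b \<in> Basis" for b
  proof -
    have "(LINT x|lborel. paraboloid R x * 1 - indicator (cball 0 R) x * (2 * (x \<bullet> b) * (x \<bullet> b))) = 0"
    proof (rule paraboloid_ibp(2)[OF R, where L=1 and B=R])
      show "\<bar>x \<bullet> b - y \<bullet> b\<bar> \<le> 1 * norm (x - y)" for x y
        using Basis_le_norm[OF b, of "x - y"] by (simp add: inner_diff_left)
      show "((\<lambda>t. (x + t *\<^sub>R b) \<bullet> b) has_real_derivative 1) (at 0)" for x
        using b by (auto intro!: derivative_eq_intros simp: inner_add_left)
      show "\<bar>x \<bullet> b\<bar> \<le> R" if "norm x \<le> R" for x
        using Basis_le_norm[OF b, of x] that by simp
    qed auto
    moreover have "indicator (cball 0 R) x * (2 * (x \<bullet> b) * (x \<bullet> b)) = 2 * (indicator (cball 0 R) x * (x \<bullet> b)\<^sup>2)" for x :: "real^'n"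
      by (simp add: power2_eq_square)
    ultimately show ?thesis
      using Bochner_Integration.integral_diff[OF ip integrable_mult_right[OF ib[OF b], of 2]] by simp
  qed
  have "real CARD('n) * (LINT x|lborel. paraboloid R (x::real^'n)) = (\<Sum>b\<in>(Basis::(real^'n) set). (LINT x|lborel. paraboloid R (x::real^'n)))"
    by simp
  also have "\<dots> = (\<Sum>b\<in>Basis. 2 * (LINT x|lborel. indicator (cball (0::real^'n) R) x * (x \<bullet> b)\<^sup>2))"
    by (intro sum.cong refl e)
  also have "\<dots> = 2 * (LINT x|lborel. (\<Sum>b\<in>Basis. indicator (cball (0::real^'n) R) x * (x \<bullet> b)\<^sup>2))"
    by (subst Bochner_Integration.integral_sum) (auto simp: ib sum_distrib_left)
  finally show "real CARD('n) * (LINT x|lborel. paraboloid R (x::real^'n)) = 2 * (LINT x|lborel. indicator (cball (0::real^'n) R) x * (norm x)\<^sup>2)"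
    by (simp add: norm_square_Basis[where 'a="real^'n"] sum_distrib_left)
qed

lemma nn_integral_indicator_real:
  fixes g :: "'a::euclidean_space \<Rightarrow> real"
  assumes "integrable lborel (\<lambda>x. indicator S x * g x)" "\<And>x. g x \<ge> 0"
  shows "(\<integral>\<^sup>+x. ennreal (g x) * indicator S x \<partial>lborel) = ennreal (LINT x|lborel. indicator S x * g x)"
  using assms by (subst nn_integral_eq_integral[symmetric])
    (auto intro!: nn_integral_cong simp: indicator_def)

lemma nn_integral_cball_finite:
  fixes g :: "'a::euclidean_space \<Rightarrow> real"
  assumes [measurable]: "g \<in> borel_measurable borel" and "\<And>x. norm x \<le> R \<Longrightarrow> g x \<le> B"
  shows "(\<integral>\<^sup>+x. ennreal (g x) * indicator (cball 0 R) x \<partial>lborel) < \<infinity>"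
proof -
  have "(\<integral>\<^sup>+x. ennreal (g x) * indicator (cball 0 R) x \<partial>lborel) \<le> (\<integral>\<^sup>+x. ennreal B * indicator (cball (0::'a) R) x \<partial>lborel)"
    using assms by (intro nn_integral_mono) (auto simp: indicator_def intro!: ennreal_leI)
  also have "\<dots> = ennreal B * emeasure lborel (cball (0::'a) R)" by (simp add: nn_integral_cmult_indicator)
  also have "\<dots> < \<infinity>"
    using emeasure_bounded_finite[of "cball (0::'a) R"] by (simp add: ennreal_mult_less_top)
  finally show ?thesis .
qed

text \<open>Formally the gradient of \<open>layer c\<close> at x is -c(|x|) x/|x|^2, so that c(|x|)
  is minus the derivative of \<open>layer c\<close> along the field x, and the dimension is the
  divergence of that field.\<close>

lemma layer_formula_const:
  assumes [measurable]: "c \<in> borel_measurable borel"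
  shows "(\<integral>\<^sup>+x. c (norm (x::real^'n)) \<partial>lborel) = of_nat CARD('n) * (\<integral>\<^sup>+x. layer c (x::real^'n) \<partial>lborel)"
proof -
  have "(\<integral>\<^sup>+x. c (norm (x::real^'n)) * ennreal 1 \<partial>lborel) = (\<integral>\<^sup>+x. ennreal (real CARD('n)) * layer c (x::real^'n) \<partial>lborel)"
  proof (rule layer_formula)
    fix R :: real
    show "(\<integral>\<^sup>+x. ennreal ((norm x)\<^sup>2 * 1) * indicator (cball 0 R) (x::real^'n) \<partial>lborel) < \<infinity>"
      by (rule nn_integral_cball_finite[where B="R\<^sup>2"]) (auto intro: power_mono)
    assume R: "R > 0"
    have "(\<integral>\<^sup>+x. ennreal ((norm x)\<^sup>2 * 1) * indicator (cball 0 R) (x::real^'n) \<partial>lborel)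
        = ennreal (LINT x|lborel. indicator (cball (0::real^'n) R) x * (norm x)\<^sup>2)"
      using paraboloid_integral(2)[OF R] by (subst nn_integral_indicator_real) auto
    also have "(LINT x|lborel. indicator (cball (0::real^'n) R) x * (norm x)\<^sup>2) = (LINT x|lborel. real CARD('n) * (paraboloid R (x::real^'n) / 2))"
      using paraboloid_integral(3)[OF R, where 'n='n] by simp
    also have "ennreal \<dots> = (\<integral>\<^sup>+x. ennreal (real CARD('n) * (paraboloid R (x::real^'n) / 2)) \<partial>lborel)"
      using paraboloid_integral(1)[OF R, where 'n='n] paraboloid_bounds[OF R, where 'a="real^'n"]
      by (intro nn_integral_eq_integral[symmetric]) auto
    also have "\<dots> = (\<integral>\<^sup>+x. ennreal (real CARD('n)) * ennreal (paraboloid R (x::real^'n) / 2) \<partial>lborel)"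
      by (intro nn_integral_cong ennreal_mult') auto
    finally show "(\<integral>\<^sup>+x. ennreal ((norm x)\<^sup>2 * 1) * indicator (cball 0 R) (x::real^'n) \<partial>lborel)
        = (\<integral>\<^sup>+x. ennreal (real CARD('n)) * ennreal (paraboloid R (x::real^'n) / 2) \<partial>lborel)" .
  qed auto
  then show ?thesis by (simp add: nn_integral_cmult ennreal_of_nat_eq_real_of_nat)
qed

text \<open>The kernel that appears when the cosine transform of \<open>layer c\<close> is
  integrated by parts in direction \<xi>: the cosine is the derivative of sin(2 pi x \<bullet>
  \<xi>) along \<xi> divided by 2 pi |\<xi>|^2, and the derivative of \<open>layer c\<close> along
  \<xi> is formally -c(|x|) (x \<bullet> \<xi>)/|x|^2.\<close>

definition cos_kernel :: "real^'n \<Rightarrow> real^'n \<Rightarrow> real" where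
  "cos_kernel \<xi> x = sin (2 * pi * (x \<bullet> \<xi>)) * (x \<bullet> \<xi>) / (2 * pi * (norm \<xi>)\<^sup>2 * (norm x)\<^sup>2)"

lemma cos_kernel_measurable[measurable]: "cos_kernel \<xi> \<in> borel_measurable borel"
  unfolding cos_kernel_def[abs_def] by measurable

lemma cos_kernel_bound: "\<bar>cos_kernel \<xi> x\<bar> \<le> 1"
proof -
  have "\<bar>sin (2 * pi * (x \<bullet> \<xi>))\<bar> * \<bar>x \<bullet> \<xi>\<bar> \<le> (2 * pi * (norm x * norm \<xi>)) * (norm x * norm \<xi>)"
  proof (intro mult_mono Cauchy_Schwarz_ineq2)
    show "\<bar>sin (2 * pi * (x \<bullet> \<xi>))\<bar> \<le> 2 * pi * (norm x * norm \<xi>)"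
      using abs_sin_x_le_abs_x[of "2 * pi * (x \<bullet> \<xi>)"] Cauchy_Schwarz_ineq2[of x \<xi>]
      by (auto simp: abs_mult intro: order_trans)
  qed auto
  then have "\<bar>sin (2 * pi * (x \<bullet> \<xi>))\<bar> * \<bar>x \<bullet> \<xi>\<bar> \<le> 2 * pi * (norm \<xi>)\<^sup>2 * (norm x)\<^sup>2"
    by (simp add: power2_eq_square mult_ac)
  then show ?thesis
    unfolding cos_kernel_def abs_divide abs_mult
    by (cases "x = 0 \<or> \<xi> = 0") (auto simp: divide_le_eq)
qed

text \<open>The summands \<open>1\<close> and \<open>CARD('n)\<close> only serve to make both integrands nonnegative; they are
  cancelled by the preceding identity.\<close>

lemma layer_formula_cos:
  fixes \<xi> :: "real^'n"
  assumes [measurable]: "c \<in> borel_measurable borel" and \<xi>: "\<xi> \<noteq> 0"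
  shows "(\<integral>\<^sup>+x. c (norm x) * ennreal (cos_kernel \<xi> x + 1) \<partial>lborel)
    = (\<integral>\<^sup>+x. ennreal (cos (2 * pi * (x \<bullet> \<xi>)) + real CARD('n)) * layer c x \<partial>lborel)"
proof (rule layer_formula)
  fix R :: real
  have g0: "cos_kernel \<xi> x + 1 \<ge> 0" and g2: "cos_kernel \<xi> x + 1 \<le> 2" for x
    using cos_kernel_bound[of \<xi> x] by auto
  have le: "(norm x)\<^sup>2 * (cos_kernel \<xi> x + 1) \<le> R\<^sup>2 * 2" if "norm x \<le> R" for x
    using g0[of x] g2[of x] that by (intro mult_mono power_mono) auto
  show "(\<integral>\<^sup>+x. ennreal ((norm x)\<^sup>2 * (cos_kernel \<xi> x + 1)) * indicator (cball 0 R) x \<partial>lborel) < \<infinity>"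
    by (rule nn_integral_cball_finite[where B="R\<^sup>2 * 2"]) (use le in auto)
  assume R: "R > 0"
  let ?c = "\<lambda>x. cos (2 * pi * (x \<bullet> \<xi>))" and ?s = "\<lambda>x. sin (2 * pi * (x \<bullet> \<xi>))"
  let ?I = "indicator (cball (0::real^'n) R) :: _ \<Rightarrow> real"
  have k: "(norm x)\<^sup>2 * cos_kernel \<xi> x = ?s x * (x \<bullet> \<xi>) / (2 * pi * (norm \<xi>)\<^sup>2)" for x
    using \<xi> by (cases "x = 0") (auto simp: cos_kernel_def)
  have ipc: "integrable lborel (\<lambda>x. paraboloid R x * ?c x)"
    by (rule integrable_integral_cong_bound[OF paraboloid_integral(1)[OF R]])
      (use paraboloid_bounds[OF R, where 'a="real^'n"] in \<open>auto simp: abs_mult mult_left_le\<close>)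
  have isk: "integrable lborel (\<lambda>x. ?I x * ((norm x)\<^sup>2 * cos_kernel \<xi> x))"
  proof (rule integrable_indicator_cball[where B="R\<^sup>2"])
    fix x :: "real^'n" assume "norm x \<le> R"
    then have "(norm x)\<^sup>2 * \<bar>cos_kernel \<xi> x\<bar> \<le> R\<^sup>2 * 1"
      by (intro mult_mono power_mono cos_kernel_bound) auto
    then show "\<bar>(norm x)\<^sup>2 * cos_kernel \<xi> x\<bar> \<le> R\<^sup>2" by (simp add: abs_mult)
  qed measurable
  \<comment> \<open>Integration by parts of sin(2 pi x \<bullet> \<xi>) along \<xi> itself, where
    its derivative is 2 pi |\<xi>|^2 times the cosine.\<close>
  have "(LINT x|lborel. paraboloid R x * (2 * pi * (norm \<xi>)\<^sup>2 * ?c x) - ?I x * (2 * (x \<bullet> \<xi>) * ?s x)) = 0"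
  proof (rule paraboloid_ibp(2)[OF R, where L="2 * pi * norm \<xi>" and B=1])
    fix x y :: "real^'n"
    have "\<bar>sin a - sin c\<bar> \<le> \<bar>a - c\<bar>" for a c :: real
      using norm_cis_diff[of a c] abs_Im_le_cmod[of "cis a - cis c"] by simp
    from this[of "2 * pi * (x \<bullet> \<xi>)" "2 * pi * (y \<bullet> \<xi>)"]
    have "\<bar>?s x - ?s y\<bar> \<le> \<bar>2 * pi * ((x - y) \<bullet> \<xi>)\<bar>"
      by (simp add: inner_diff_left right_diff_distrib)
    also have "\<dots> \<le> 2 * pi * (norm (x - y) * norm \<xi>)"
      using Cauchy_Schwarz_ineq2[of "x - y" \<xi>] by (simp add: abs_mult)
    finally show "\<bar>?s x - ?s y\<bar> \<le> 2 * pi * norm \<xi> * norm (x - y)" by (simp add: mult_ac)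
    show "((\<lambda>t. ?s (x + t *\<^sub>R \<xi>)) has_real_derivative 2 * pi * (norm \<xi>)\<^sup>2 * ?c x) (at 0)"
      by (auto intro!: derivative_eq_intros simp: inner_add_left power2_norm_eq_inner)
  qed auto
  moreover have "paraboloid R x * (2 * pi * (norm \<xi>)\<^sup>2 * ?c x) - ?I x * (2 * (x \<bullet> \<xi>) * ?s x)
      = (2 * pi * (norm \<xi>)\<^sup>2) * (paraboloid R x * ?c x - 2 * (?I x * ((norm x)\<^sup>2 * cos_kernel \<xi> x)))" for x
    using \<xi> by (simp add: k right_diff_distrib)
  ultimately have "(LINT x|lborel. paraboloid R x * ?c x - 2 * (?I x * ((norm x)\<^sup>2 * cos_kernel \<xi> x))) = 0"
    using \<xi> by simp
  then have e1: "(LINT x|lborel. paraboloid R x * ?c x) = 2 * (LINT x|lborel. ?I x * ((norm x)\<^sup>2 * cos_kernel \<xi> x))"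
    using Bochner_Integration.integral_diff[OF ipc integrable_mult_right[OF isk, of 2]] by simp
  have split: "(?c x + real CARD('n)) * (paraboloid R x / 2) = paraboloid R x * ?c x / 2 + real CARD('n) * (paraboloid R x / 2)" for x
    by (simp add: algebra_simps)
  have i1: "integrable lborel (\<lambda>x. ?I x * ((norm x)\<^sup>2 * (cos_kernel \<xi> x + 1)))"
    using Bochner_Integration.integrable_add[OF isk paraboloid_integral(2)[OF R]] by (simp add: distrib_left)
  have "(\<integral>\<^sup>+x. ennreal ((norm x)\<^sup>2 * (cos_kernel \<xi> x + 1)) * indicator (cball 0 R) x \<partial>lborel)
      = ennreal (LINT x|lborel. ?I x * ((norm x)\<^sup>2 * (cos_kernel \<xi> x + 1)))"
    by (rule nn_integral_indicator_real[OF i1]) (simp add: g0)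
  also have "(LINT x|lborel. ?I x * ((norm x)\<^sup>2 * (cos_kernel \<xi> x + 1)))
      = (LINT x|lborel. ?I x * ((norm x)\<^sup>2 * cos_kernel \<xi> x)) + (LINT x|lborel. ?I x * (norm x)\<^sup>2)"
    using Bochner_Integration.integral_add[OF isk paraboloid_integral(2)[OF R]] by (simp add: distrib_left)
  also have "\<dots> = (LINT x|lborel. paraboloid R x * ?c x) / 2 + real CARD('n) * (LINT x|lborel. paraboloid R (x::real^'n)) / 2"
    using e1 paraboloid_integral(3)[OF R, where 'n='n] by simp
  also have "\<dots> = (LINT x|lborel. (?c x + real CARD('n)) * (paraboloid R x / 2))"
    unfolding split using Bochner_Integration.integral_add[OF integrable_divide[OF ipc, of 2] integrable_mult_right[OF integrable_divide[OF paraboloid_integral(1)[OF R], of 2], of "real CARD('n)"]]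
    by simp
  also have "ennreal \<dots> = (\<integral>\<^sup>+x. ennreal ((?c x + real CARD('n)) * (paraboloid R x / 2)) \<partial>lborel)"
  proof (intro nn_integral_eq_integral[symmetric] AE_I2 mult_nonneg_nonneg)
    show "integrable lborel (\<lambda>x. (?c x + real CARD('n)) * (paraboloid R x / 2))"
      unfolding split
      using Bochner_Integration.integrable_add[OF integrable_divide[OF ipc, of 2] integrable_mult_right[OF integrable_divide[OF paraboloid_integral(1)[OF R], of 2], of "real CARD('n)"]]
      .
    show "0 \<le> ?c x + real CARD('n)" for x
      using cos_ge_minus_one[of "2 * pi * (x \<bullet> \<xi>)"] one_le_card_finite[where 'a='n] by linarith
  qed (use paraboloid_bounds[OF R, where 'a="real^'n"] in auto)
  also have "\<dots> = (\<integral>\<^sup>+x. ennreal (?c x + real CARD('n)) * ennreal (paraboloid R x / 2) \<partial>lborel)"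
    using paraboloid_bounds[OF R, where 'a="real^'n"] by (intro nn_integral_cong ennreal_mult'') auto
  finally show "(\<integral>\<^sup>+x. ennreal ((norm x)\<^sup>2 * (cos_kernel \<xi> x + 1)) * indicator (cball 0 R) x \<partial>lborel)
      = (\<integral>\<^sup>+x. ennreal (?c x + real CARD('n)) * ennreal (paraboloid R x / 2) \<partial>lborel)" .
qed auto


section \<open>Borel versions of radial kernels\<close>

lemma measurable_completion_AE_eq:
  fixes f g :: "'a \<Rightarrow> 'b::topological_space"
  assumes g: "g \<in> borel_measurable (completion M)" and ae: "AE x in M. f x = g x"
  shows "f \<in> borel_measurable (completion M)"
proof -
  obtain N where N: "{x \<in> space M. f x \<noteq> g x} \<subseteq> N" "N \<in> null_sets M"
    using ae by (auto simp: eventually_ae_filter)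
  have Nc: "N \<in> null_sets (completion M)" using N(2) by (rule null_sets_completionI)
  show ?thesis
  proof (rule measurableI)
    fix A :: "'b set" assume A: "A \<in> sets borel"
    have "f -` A \<inter> space (completion M) = (g -` A \<inter> space (completion M) - N) \<union> (f -` A \<inter> space M \<inter> N)"
      using N(1) by auto
    moreover have "f -` A \<inter> space M \<inter> N \<in> null_sets (completion M)"
      by (rule null_sets_completion_subset[OF _ Nc]) auto
    ultimately show "f -` A \<inter> space (completion M) \<in> sets (completion M)"
      using measurable_sets[OF g A] Nc by (metis sets.Un sets.Diff null_setsD2)
  qed auto
qed

lemma integral_lebesgue_AE_eq:
  fixes f g :: "'a::euclidean_space \<Rightarrow> 'b::{banach, second_countable_topology}"
  assumes g: "g \<in> borel_measurable borel" and ae: "AE x in lborel. f x = g x"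
  shows "(LINT x|lebesgue. f x) = (LINT x|lborel. g x)"
    and "integrable lebesgue f \<longleftrightarrow> integrable lborel g"
proof -
  have g': "g \<in> borel_measurable lebesgue" using g by (intro measurable_completion) simp
  have f: "f \<in> borel_measurable lebesgue" by (rule measurable_completion_AE_eq[OF g' ae])
  have ae': "AE x in lebesgue. f x = g x" using ae by (rule AE_completion)
  show "(LINT x|lebesgue. f x) = (LINT x|lborel. g x)"
    using integral_cong_AE[OF f g' ae'] g by (simp add: integral_completion)
  show "integrable lebesgue f \<longleftrightarrow> integrable lborel g"
    using integrable_cong_AE[OF f g' ae'] g by (simp add: integrable_completion)
qed

text \<open>A null set of radii gives a null set of points: the \<open>layer\<close> of its
  indicator is zero, so \<open>layer_formula_const\<close> shows that the preimage under the norm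
  has measure zero.\<close>

lemma AE_norm_of_AE:
  assumes "AE t in lborel. t > 0 \<longrightarrow> P t"
  shows "AE x in lborel. (x::real^'n) \<noteq> 0 \<longrightarrow> P (norm x)"
proof -
  obtain N where N: "{t. \<not> (t > 0 \<longrightarrow> P t)} \<subseteq> N" "N \<in> null_sets lborel"
    using assms by (auto simp: eventually_ae_filter)
  have [measurable]: "N \<in> sets borel" using N(2) by auto
  have l0: "layer (\<lambda>t. indicator N t) x = 0" for x :: "real^'n"
  proof -
    have "AE t in lborel. t \<notin> N" using N(2) by (rule AE_not_in)
    then have "AE t in lborel. indicator N t * ennreal (1 / t) * indicator {norm x<..} t = 0"
      by eventually_elim simp
    then show ?thesis by (simp add: layer_def nn_integral_0_iff_AE)
  qed
  have "(\<integral>\<^sup>+x. indicator N (norm (x::real^'n)) \<partial>lborel) = of_nat CARD('n) * (\<integral>\<^sup>+x. layer (\<lambda>t. indicator N t) (x::real^'n) \<partial>lborel)"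
    by (rule layer_formula_const) measurable
  then have "(\<integral>\<^sup>+x. indicator N (norm (x::real^'n)) \<partial>lborel) = 0" by (simp add: l0)
  then have "AE x in lborel. indicator N (norm (x::real^'n)) = (0::ennreal)"
    by (subst (asm) nn_integral_0_iff_AE) auto
  then show ?thesis
  proof eventually_elim
    case (elim x)
    then have "norm x \<notin> N" by (auto simp: indicator_def split: if_splits)
    then show ?case using N(1) zero_less_norm_iff[of x] by blast
  qed
qed

lemma radial_rep_norm:
  fixes \<rho> :: "real^'n \<Rightarrow> real"
  assumes "radial \<rho>" "x \<noteq> 0"
  shows "radial_rep \<rho> (norm x) = \<rho> x"
proof -
  define e where "e = (SOME e::real^'n. norm e = 1)"
  have "norm (axis undefined 1 :: real^'n) = 1" by simp
  then have e: "norm e = 1" unfolding e_def by (rule someI)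
  have "norm (norm x *\<^sub>R e) = norm x" "norm x *\<^sub>R e \<noteq> 0" using e assms(2) by auto
  then have "\<rho> (norm x *\<^sub>R e) = \<rho> x"
    using assms unfolding radial_def by blast
  then show ?thesis by (simp add: radial_rep_def e_def)
qed

text \<open>A Borel version of \<rho> need not be radial. Read off along one ray that meets the
  exceptional set in a null set, it yields a Borel profile, made nonnegative by the maximum with
  zero. Equality for almost every radius then lifts to almost every point by
  \<open>AE_norm_of_AE\<close>.\<close>

lemma radial_borel_version:
  fixes \<rho> :: "real^'n \<Rightarrow> real"
  assumes nonneg: "\<And>x. x \<noteq> 0 \<Longrightarrow> \<rho> x \<ge> 0" and radial: "radial \<rho>"
    and int: "integrable lebesgue (\<lambda>x. min 1 (inverse (norm x)) * \<rho> x)"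
  obtains b where "radial_kernel b (\<lambda>x::real^'n. b (norm x))"
    "AE t in lborel. t > 0 \<longrightarrow> radial_rep \<rho> t = b t" "AE x in lborel. \<rho> x = b (norm x)"
proof -
  let ?m = "\<lambda>x::real^'n. min 1 (inverse (norm x))"
  obtain h where h[measurable]: "h \<in> borel_measurable borel" and hae: "AE x in lborel. ?m x * \<rho> x = h x"
    using completion_ex_borel_measurable_real[OF borel_measurable_integrable[OF int]] by auto
  let ?h = "\<lambda>x. h x / ?m x"
  have "AE x in lborel. \<rho> x = ?h x"
    using hae AE_lborel_singleton[of 0] by eventually_elim (auto simp: field_simps min_def)
  then obtain N where N: "{x. \<rho> x \<noteq> ?h x} \<subseteq> N" "N \<in> null_sets lborel"
    by (auto simp: eventually_ae_filter)
  have [measurable]: "N \<in> sets borel" using N(2) by auto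
  \<comment> \<open>almost every ray meets the exceptional set in a null set\<close>
  have z: "(\<integral>\<^sup>+x. indicator N (s *\<^sub>R x) \<partial>lborel) = 0" if "s > 0" for s :: real
  proof -
    have "(\<integral>\<^sup>+x. indicator N x \<partial>lborel) = 0" using N(2) by (simp add: null_sets_def)
    then show ?thesis
      using nn_integral_lborel_affine[of "\<lambda>x. indicator N x" s 0] that by auto
  qed
  have "(\<integral>\<^sup>+x. (\<integral>\<^sup>+s. indicator N (s *\<^sub>R x) * indicator {0<..} s \<partial>lborel) \<partial>lborel)
      = (\<integral>\<^sup>+s. (\<integral>\<^sup>+x. indicator N (s *\<^sub>R x) * indicator {0::real<..} s \<partial>lborel) \<partial>lborel)"
    by (rule lborel_pair.Fubini') measurable
  also have "\<dots> = (\<integral>\<^sup>+(s::real). 0 \<partial>lborel)"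
    by (intro nn_integral_cong) (auto simp: indicator_def[of "{0<..}"] z)
  finally have "(\<integral>\<^sup>+x. (\<integral>\<^sup>+s. indicator N (s *\<^sub>R x) * indicator {0::real<..} s \<partial>lborel) \<partial>lborel) = 0" by simp
  then have "AE x in lborel. (\<integral>\<^sup>+s. indicator N (s *\<^sub>R x) * indicator {0::real<..} s \<partial>lborel) = 0"
    by (subst (asm) nn_integral_0_iff_AE) auto
  then have "AE x in lborel. x \<noteq> 0 \<and> (\<integral>\<^sup>+s. indicator N (s *\<^sub>R x) * indicator {0::real<..} s \<partial>lborel) = 0"
    using AE_lborel_singleton[of "0::real^'n"] by eventually_elim auto
  moreover have "ae_filter (lborel :: (real^'n) measure) \<noteq> bot"
    unfolding ae_filter_eq_bot_iff by simp
  ultimately obtain x0 where x0: "x0 \<noteq> 0" "(\<integral>\<^sup>+s. indicator N (s *\<^sub>R x0) * indicator {0::real<..} s \<partial>lborel) = 0"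
    using eventually_happens' by blast
  then have "AE s in lborel. indicator N (s *\<^sub>R x0) * indicator {0::real<..} s = (0::ennreal)"
    by (subst (asm) nn_integral_0_iff_AE) auto
  then have "AE s in lborel. s > 0 \<longrightarrow> s *\<^sub>R x0 \<notin> N"
    by eventually_elim (auto simp: indicator_def split: if_splits)
  from AE_borel_affine[OF _ _ this, of "1 / norm x0" 0]
  have ray: "AE t in lborel. t > 0 \<longrightarrow> (t / norm x0) *\<^sub>R x0 \<notin> N"
    using x0(1) by (simp add: zero_less_mult_iff zero_less_divide_iff)
  define b where "b t = max 0 (?h ((t / norm x0) *\<^sub>R x0))" for t
  have bm: "b \<in> borel_measurable borel" unfolding b_def[abs_def] by measurable
  have b: "AE t in lborel. t > 0 \<longrightarrow> radial_rep \<rho> t = b t"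
    using ray
  proof eventually_elim
    case (elim t)
    show ?case
    proof
      assume t: "t > 0"
      let ?x = "(t / norm x0) *\<^sub>R x0"
      have nx: "norm ?x = t" "?x \<noteq> 0" using t x0(1) by auto
      have "?x \<notin> N" using elim t by blast
      then have "\<rho> ?x = ?h ?x" using N(1) by blast
      moreover have "\<rho> ?x \<ge> 0" using nonneg nx(2) by blast
      ultimately show "radial_rep \<rho> t = b t"
        using radial_rep_norm[OF radial nx(2)] nx(1) by (simp add: b_def)
    qed
  qed
  have rb: "AE x in lborel. \<rho> x = b (norm x)"
    using AE_norm_of_AE[OF b, where 'n='n] AE_lborel_singleton[of "0::real^'n"]
    by eventually_elim (use radial_rep_norm[OF radial] in auto)
  show ?thesis
  proof (rule that[OF _ b rb])
    have "AE x in lborel. ?m x * \<rho> x = ?m x * b (norm x)" using rb by eventually_elim simp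
    then have "integrable lborel (\<lambda>x. ?m x * b (norm x))"
      using int bm by (subst integral_lebesgue_AE_eq(2)[symmetric]) auto
    then show "radial_kernel b (\<lambda>x::real^'n. b (norm x))"
      using bm by unfold_locales (auto simp: b_def)
  qed
qed

section \<open>The Fourier transform of Q\<close>

context radial_kernel
begin

text \<open>Q need not be integrable at infinity. Cutting the profile off at radius M gives an
  integrable function whose transform can be computed directly, and the transform of Q is reached as
  M tends to infinity.\<close>

definition trunc :: "real \<Rightarrow> real \<Rightarrow> ennreal" where
  "trunc M t = ennreal (b t * indicator {..M} t)"

lemma trunc_measurable[measurable]: "trunc M \<in> borel_measurable borel"
  unfolding trunc_def[abs_def] by measurable

definition Q :: "real^'n \<Rightarrow> real" where "Q x = enn2real (layer (\<lambda>t. ennreal (b t)) x)"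

definition QM :: "real \<Rightarrow> real^'n \<Rightarrow> real" where "QM M x = enn2real (layer (trunc M) x)"

definition rM :: "real \<Rightarrow> real^'n \<Rightarrow> real" where "rM M x = r x * indicator {..M} (norm x)"

lemma Q_measurable[measurable]: "Q \<in> borel_measurable borel"
  unfolding Q_def[abs_def] by measurable

lemma QM_measurable[measurable]: "QM M \<in> borel_measurable borel"
  unfolding QM_def[abs_def] by measurable

lemma rM_measurable[measurable]: "rM M \<in> borel_measurable borel"
  unfolding rM_def[abs_def] by measurable

lemma QM_nonneg: "QM M x \<ge> 0" and Q_nonneg: "Q x \<ge> 0"
  by (auto simp: QM_def Q_def)

lemma rM_nonneg: "rM M x \<ge> 0" by (simp add: rM_def r_nonneg)

lemma trunc_norm: "trunc M (norm x) = ennreal (rM M x)"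
  by (simp add: trunc_def rM_def r_eq)

lemma rM_integrable:
  assumes "M \<ge> 1"
  shows "integrable lborel (rM M)"
proof -
  have "integrable lborel (\<lambda>x. M * w x)" by (intro integrable_mult_right w_int)
  \<comment> \<open>The origin has to be removed before comparing, because \<open>w\<close> vanishes
    there by the convention \<open>inverse 0 = 0\<close> while \<open>rM M\<close> need not.\<close>
  then have "integrable lborel (\<lambda>x. rM M x * indicator (- {0}) x)"
  proof (rule integrable_integral_cong_bound)
    fix x :: "real^'n"
    show "norm (rM M x * indicator (- {0}) x) \<le> M * w x"
    proof (cases "x = 0 \<or> norm x > M")
      case False
      have "1 \<le> M * min 1 (inverse (norm x))"
        using False assms by (auto simp: min_def field_simps)
      from mult_right_mono[OF this r_nonneg[of x]] False show ?thesis
        by (simp add: rM_def w_def mult.assoc r_nonneg)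
    qed (use assms w_nonneg[of x] in \<open>auto simp: rM_def\<close>)
  qed measurable
  moreover have "AE x in lborel. rM M x * indicator (- {0}) x = rM M x"
    using AE_lborel_singleton[of "0::real^'n"] by eventually_elim simp
  ultimately show ?thesis by (subst (asm) integrable_cong_AE) auto
qed

lemma layer_trunc_finite:
  assumes "M \<ge> 1"
  shows "(\<integral>\<^sup>+x. layer (trunc M) (x::real^'n) \<partial>lborel) < \<infinity>"
proof -
  have "(\<integral>\<^sup>+x. trunc M (norm (x::real^'n)) \<partial>lborel) < \<infinity>"
    using rM_integrable[OF assms] rM_nonneg by (simp add: trunc_norm integrable_iff_bounded)
  then have "of_nat CARD('n) * (\<integral>\<^sup>+x. layer (trunc M) (x::real^'n) \<partial>lborel) < \<infinity>"
    by (subst (asm) layer_formula_const) auto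
  then show ?thesis by (auto simp: ennreal_mult_less_top)
qed

lemma layer_trunc_AE:
  assumes "M \<ge> 1"
  shows "AE x in lborel. layer (trunc M) (x::real^'n) = ennreal (QM M x)"
proof -
  have "AE x in lborel. layer (trunc M) (x::real^'n) \<noteq> \<infinity>"
    using layer_trunc_finite[OF assms] by (intro nn_integral_PInf_AE) auto
  then show ?thesis by eventually_elim (simp add: QM_def less_top)
qed

lemma QM_integrable:
  assumes "M \<ge> 1"
  shows "integrable lborel (QM M)"
proof (rule integrableI_bounded)
  have "(\<integral>\<^sup>+x. norm (QM M x) \<partial>lborel) = (\<integral>\<^sup>+x. layer (trunc M) (x::real^'n) \<partial>lborel)"
    using layer_trunc_AE[OF assms] by (intro nn_integral_cong_AE) (auto simp: QM_nonneg elim!: eventually_mono)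
  then show "(\<integral>\<^sup>+x. norm (QM M x) \<partial>lborel) < \<infinity>" using layer_trunc_finite[OF assms] by simp
qed measurable

text \<open>The difference of \<open>layer_formula_cos\<close> and
  \<open>layer_formula_const\<close> for the truncated profile; the truncation makes every term
  finite, so that the auxiliary summands can be cancelled.\<close>

lemma QM_fourier:
  assumes M: "M \<ge> 1" and \<xi>: "\<xi> \<noteq> 0"
  shows "(LINT x|lborel. QM M x * cos (2 * pi * (x \<bullet> \<xi>))) = (LINT x|lborel. rM M x * cos_kernel \<xi> x)"
proof -
  let ?c = "\<lambda>x. cos (2 * pi * (x \<bullet> \<xi>))" and ?n = "real CARD('n)"
  note iQ = QM_integrable[OF M] and ir = rM_integrable[OF M]
  have iQc: "integrable lborel (\<lambda>x. QM M x * ?c x)"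
    by (rule integrable_integral_cong_bound[OF iQ]) (auto simp: abs_mult QM_nonneg mult_left_le)
  have irc: "integrable lborel (\<lambda>x. rM M x * cos_kernel \<xi> x)"
    by (rule integrable_integral_cong_bound[OF ir])
      (auto simp: abs_mult rM_nonneg mult_left_le cos_kernel_bound)
  have c0: "?c x + ?n \<ge> 0" for x
    using cos_ge_minus_one[of "2 * pi * (x \<bullet> \<xi>)"] one_le_card_finite[where 'a='n] by linarith
  have k0: "cos_kernel \<xi> x + 1 \<ge> 0" for x using cos_kernel_bound[of \<xi> x] by linarith
  have "(\<integral>\<^sup>+x. ennreal (rM M x * cos_kernel \<xi> x + rM M x) \<partial>lborel) = (\<integral>\<^sup>+x. trunc M (norm x) * ennreal (cos_kernel \<xi> x + 1) \<partial>lborel)"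
    by (intro nn_integral_cong) (simp add: trunc_norm ennreal_mult'[symmetric] rM_nonneg algebra_simps)
  also have "\<dots> = (\<integral>\<^sup>+x. ennreal (?c x + ?n) * layer (trunc M) x \<partial>lborel)"
    by (rule layer_formula_cos[OF _ \<xi>]) measurable
  also have "\<dots> = (\<integral>\<^sup>+x. ennreal (QM M x * ?c x + ?n * QM M x) \<partial>lborel)"
  proof (intro nn_integral_cong_AE, use layer_trunc_AE[OF M] in eventually_elim)
    case (elim x)
    have e: "QM M x * ?c x + ?n * QM M x = (?c x + ?n) * QM M x" by (simp add: algebra_simps)
    show ?case unfolding elim e by (rule ennreal_mult'[OF c0, symmetric])
  qed
  finally have nn: "(\<integral>\<^sup>+x. ennreal (rM M x * cos_kernel \<xi> x + rM M x) \<partial>lborel) = (\<integral>\<^sup>+x. ennreal (QM M x * ?c x + ?n * QM M x) \<partial>lborel)" .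
  have i1: "integrable lborel (\<lambda>x. rM M x * cos_kernel \<xi> x + rM M x)"
    by (rule Bochner_Integration.integrable_add[OF irc ir])
  have i2: "integrable lborel (\<lambda>x. QM M x * ?c x + ?n * QM M x)"
    by (rule Bochner_Integration.integrable_add[OF iQc integrable_mult_right[OF iQ]])
  have n1: "AE x in lborel. 0 \<le> rM M x * cos_kernel \<xi> x + rM M x"
    using mult_nonneg_nonneg[OF rM_nonneg k0] by (auto simp: algebra_simps)
  have n2: "AE x in lborel. 0 \<le> QM M x * ?c x + ?n * QM M x"
    using mult_nonneg_nonneg[OF QM_nonneg c0] by (auto simp: algebra_simps)
  have "ennreal (LINT x|lborel. rM M x * cos_kernel \<xi> x + rM M x) = ennreal (LINT x|lborel. QM M x * ?c x + ?n * QM M x)"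
    using nn unfolding nn_integral_eq_integral[OF i1 n1] nn_integral_eq_integral[OF i2 n2] .
  moreover have "0 \<le> (LINT x|lborel. rM M x * cos_kernel \<xi> x + rM M x)" "0 \<le> (LINT x|lborel. QM M x * ?c x + ?n * QM M x)"
    using mult_nonneg_nonneg[OF rM_nonneg k0] mult_nonneg_nonneg[OF QM_nonneg c0]
    by (auto intro!: integral_nonneg_AE simp: algebra_simps)
  ultimately have "(LINT x|lborel. rM M x * cos_kernel \<xi> x + rM M x) = (LINT x|lborel. QM M x * ?c x + ?n * QM M x)"
    by simp
  then have eq: "(LINT x|lborel. rM M x * cos_kernel \<xi> x) + (LINT x|lborel. rM M x) = (LINT x|lborel. QM M x * ?c x) + ?n * (LINT x|lborel. QM M x)"
    using irc ir iQc iQ by simp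
  have "ennreal (LINT x|lborel. rM M x) = (\<integral>\<^sup>+x. trunc M (norm (x::real^'n)) \<partial>lborel)"
    using ir by (subst nn_integral_eq_integral[symmetric]) (auto simp: rM_nonneg trunc_norm)
  also have "\<dots> = of_nat CARD('n) * (\<integral>\<^sup>+x. layer (trunc M) (x::real^'n) \<partial>lborel)"
    by (rule layer_formula_const) measurable
  also have "(\<integral>\<^sup>+x. layer (trunc M) (x::real^'n) \<partial>lborel) = (\<integral>\<^sup>+x. ennreal (QM M x) \<partial>lborel)"
    using layer_trunc_AE[OF M] by (rule nn_integral_cong_AE)
  also have "\<dots> = ennreal (LINT x|lborel. QM M x)"
    using iQ by (intro nn_integral_eq_integral) (auto simp: QM_nonneg)
  finally have "ennreal (LINT x|lborel. rM M x) = ennreal (?n * (LINT x|lborel. QM M x))"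
    by (simp add: ennreal_mult' ennreal_of_nat_eq_real_of_nat)
  then have "(LINT x|lborel. rM M x) = ?n * (LINT x|lborel. QM M x)"
    by (subst (asm) ennreal_inj) (auto intro!: integral_nonneg_AE mult_nonneg_nonneg simp: rM_nonneg QM_nonneg)
  with eq show ?thesis by simp
qed

lemma QM_minus: "QM M (- x) = QM M x"
  by (simp add: QM_def layer_def)

lemma QM_fourier_cis:
  assumes M: "M \<ge> 1" and \<xi>: "\<xi> \<noteq> 0"
  shows "(LINT x|lborel. of_real (QM M x) * cis (- (2 * pi * (x \<bullet> \<xi>)))) = complex_of_real (LINT x|lborel. rM M x * cos_kernel \<xi> x)"
proof -
  let ?f = "\<lambda>x. of_real (QM M x) * cis (- (2 * pi * (x \<bullet> \<xi>)))"
  have i: "integrable lborel ?f"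
    using QM_integrable[OF M] by (intro integrable_mult_cis) auto
  then have i': "integrable lborel (\<lambda>x. ?f (- x))"
    using integrable_lborel_reflect[of ?f 0] by simp
  have "2 * (LINT x|lborel. ?f x) = (LINT x|lborel. ?f x) + (LINT x|lborel. ?f (- x))"
    using integral_lborel_reflect[of ?f 0] by simp
  also have "\<dots> = (LINT x|lborel. ?f x + ?f (- x))" using i i' by simp
  also have "\<dots> = (LINT x|lborel. 2 * complex_of_real (QM M x * cos (2 * pi * (x \<bullet> \<xi>))))"
    by (intro Bochner_Integration.integral_cong refl) (simp add: QM_minus complex_eq_iff algebra_simps)
  also have "\<dots> = 2 * complex_of_real (LINT x|lborel. QM M x * cos (2 * pi * (x \<bullet> \<xi>)))"
    by (simp only: integral_mult_right_zero integral_complex_of_real)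
  finally show ?thesis using QM_fourier[OF assms] by simp
qed

text \<open>For t > 1 the ball of radius t has at least t times the volume of the unit ball. Hence
  the volume of the unit ball times the one-dimensional tail is at most the integral over space of
  the corresponding \<open>layer\<close>, which \<open>layer_formula_const\<close> turns into an
  integral controlled by \<open>w\<close>.\<close>

lemma tail_finite: "(\<integral>\<^sup>+t. ennreal (b t) * ennreal (1 / t) * indicator {1<..} t \<partial>lborel) < \<infinity>"
proof -
  let ?T = "\<integral>\<^sup>+t. ennreal (b t) * ennreal (1 / t) * indicator {1<..} t \<partial>lborel"
  let ?c = "\<lambda>t. ennreal (b t) * ennreal (1 / t) * indicator {1<..} t"
  let ?B = "ball (0::real^'n) 1"
  have B0: "0 < emeasure lborel ?B" "emeasure lborel ?B < \<infinity>"
  proof -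
    have "emeasure lborel ?B \<noteq> 0"
    proof
      assume "emeasure lborel ?B = 0"
      then have "negligible ?B"
        by (simp add: negligible_iff_null_sets null_sets_completion_iff null_sets_def)
      then show False using open_not_negligible[of ?B] by simp
    qed
    then show "0 < emeasure lborel ?B" by (simp add: zero_less_iff_neq_zero)
    show "emeasure lborel ?B < \<infinity>" using emeasure_bounded_finite[of ?B] by simp
  qed
  have s: "ennreal t * emeasure lborel ?B \<le> emeasure lborel (ball (0::real^'n) t)" if t: "t > 1" for t
  proof -
    have "(\<integral>\<^sup>+x. indicator (ball (0::real^'n) t) x \<partial>lborel) = ennreal (\<bar>t\<bar> ^ DIM(real^'n)) * (\<integral>\<^sup>+x. indicator (ball (0::real^'n) t) (0 + t *\<^sub>R x) \<partial>lborel)"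
      using t by (intro nn_integral_lborel_affine borel_measurable_indicator) auto
    also have "(\<lambda>x::real^'n. indicator (ball 0 t) (0 + t *\<^sub>R x)) = (indicator ?B :: _ \<Rightarrow> ennreal)"
      using t by (auto simp: indicator_def fun_eq_iff)
    finally have "emeasure lborel (ball (0::real^'n) t) = ennreal (\<bar>t\<bar> ^ DIM(real^'n)) * emeasure lborel ?B" by simp
    moreover have "t \<le> \<bar>t\<bar> ^ DIM(real^'n)"
      using t power_increasing[of 1 "DIM(real^'n)" t] one_le_card_finite[where 'a='n] by simp
    ultimately show ?thesis by (auto intro!: mult_right_mono ennreal_leI)
  qed
  have "?T * emeasure lborel ?B = (\<integral>\<^sup>+t. ?c t * emeasure lborel ?B \<partial>lborel)"
    by (simp add: nn_integral_multc)
  also have "\<dots> \<le> (\<integral>\<^sup>+t. (\<integral>\<^sup>+x. ?c t * ennreal (1 / t) * indicator {norm (x::real^'n)<..} t \<partial>lborel) \<partial>lborel)"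
  proof (intro nn_integral_mono)
    fix t
    show "?c t * emeasure lborel ?B \<le> (\<integral>\<^sup>+x. ?c t * ennreal (1 / t) * indicator {norm (x::real^'n)<..} t \<partial>lborel)"
    proof (cases "t > 1")
      case True
      have "(\<integral>\<^sup>+x. ?c t * ennreal (1 / t) * indicator {norm (x::real^'n)<..} t \<partial>lborel)
          = (\<integral>\<^sup>+x. ?c t * ennreal (1 / t) * indicator (ball (0::real^'n) t) x \<partial>lborel)"
        by (intro nn_integral_cong arg_cong2[where f="(*)"] refl) (simp add: indicator_def)
      also have "\<dots> = ?c t * (ennreal (1 / t) * emeasure lborel (ball (0::real^'n) t))"
        by (subst nn_integral_cmult_indicator) (simp_all add: mult.assoc)
      finally have "(\<integral>\<^sup>+x. ?c t * ennreal (1 / t) * indicator {norm (x::real^'n)<..} t \<partial>lborel) = ?c t * (ennreal (1 / t) * emeasure lborel (ball (0::real^'n) t))" .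
      moreover have "emeasure lborel ?B \<le> ennreal (1 / t) * emeasure lborel (ball (0::real^'n) t)"
      proof -
        have "emeasure lborel ?B = ennreal (1 / t) * (ennreal t * emeasure lborel ?B)"
          using True by (simp add: mult.assoc[symmetric] ennreal_mult'[symmetric])
        also have "\<dots> \<le> ennreal (1 / t) * emeasure lborel (ball (0::real^'n) t)"
          by (intro mult_left_mono s True) auto
        finally show ?thesis .
      qed
      ultimately show ?thesis by (auto intro: mult_left_mono)
    qed simp
  qed
  also have "\<dots> = (\<integral>\<^sup>+x. layer ?c (x::real^'n) \<partial>lborel)"
    unfolding layer_def by (rule lborel_pair.Fubini') measurable
  finally have le: "?T * emeasure lborel ?B \<le> (\<integral>\<^sup>+x. layer ?c (x::real^'n) \<partial>lborel)" .
  have "of_nat CARD('n) * (\<integral>\<^sup>+x. layer ?c (x::real^'n) \<partial>lborel) = (\<integral>\<^sup>+x. ?c (norm (x::real^'n)) \<partial>lborel)"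
    by (rule layer_formula_const[symmetric]) measurable
  also have "\<dots> \<le> (\<integral>\<^sup>+x. norm (w x) \<partial>lborel)"
  proof (intro nn_integral_mono)
    fix x :: "real^'n"
    show "?c (norm x) \<le> ennreal (norm (w x))"
    proof (cases "norm x > 1")
      case True
      have "min 1 (inverse (norm x)) = inverse (norm x)"
        using True by (intro min_absorb2) (simp add: inverse_le_1_iff)
      then show ?thesis using True r_nonneg[of x]
        by (simp add: w_def r_eq[symmetric] ennreal_mult'[symmetric] inverse_eq_divide)
    qed simp
  qed
  also have "\<dots> < \<infinity>" using w_int by (simp add: integrable_iff_bounded)
  finally have "(\<integral>\<^sup>+x. layer ?c (x::real^'n) \<partial>lborel) < \<infinity>" by (auto simp: ennreal_mult_less_top)
  with le have "?T * emeasure lborel ?B < \<infinity>" by (rule le_less_trans)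
  then show ?thesis using B0 by (auto simp: ennreal_mult_less_top)
qed

text \<open>Almost everywhere Q is at most an integrable function, the part from radii up to 1, plus
  a constant, the tail beyond 1. This is the majorant under which Q can be paired with functions
  that are both bounded and integrable.\<close>

lemma layer_bound:
  obtains T where "T \<ge> 0" "AE x in lborel. layer (\<lambda>t. ennreal (b t)) (x::real^'n) = ennreal (Q x) \<and> Q x \<le> QM 1 x + T"
proof -
  let ?T = "\<integral>\<^sup>+t. ennreal (b t) * ennreal (1 / t) * indicator {1<..} t \<partial>lborel"
  obtain T where T: "?T = ennreal T" "T \<ge> 0"
    using tail_finite by (cases ?T rule: ennreal_cases) auto
  have le: "layer (\<lambda>t. ennreal (b t)) x \<le> layer (trunc 1) x + ?T" for x :: "real^'n"
    unfolding layer_def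
    by (subst nn_integral_add[symmetric])
      (auto intro!: nn_integral_mono simp: trunc_def indicator_def)
  have "AE x in lborel. layer (\<lambda>t. ennreal (b t)) (x::real^'n) = ennreal (Q x) \<and> Q x \<le> QM 1 x + T"
    using layer_trunc_AE[OF order_refl]
  proof eventually_elim
    case (elim x)
    have "layer (\<lambda>t. ennreal (b t)) x \<le> ennreal (QM 1 x + T)"
      using le[of x] elim T QM_nonneg by (simp add: ennreal_plus)
    moreover from this have "layer (\<lambda>t. ennreal (b t)) x < \<top>" by (rule le_less_trans) simp
    ultimately show ?case
      unfolding Q_def using T QM_nonneg[of 1 x]
      by (auto intro!: enn2real_leI)
  qed
  with T(2) show ?thesis by (rule that)
qed

lemma QM_tendsto:
  "AE x in lborel. (\<lambda>k. QM (real (Suc k)) x) \<longlonglongrightarrow> Q x \<and> (\<forall>k. QM (real (Suc k)) x \<le> Q x)"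
proof -
  obtain T where "T \<ge> 0" "AE x in lborel. layer (\<lambda>t. ennreal (b t)) (x::real^'n) = ennreal (Q x) \<and> Q x \<le> QM 1 x + T"
    by (rule layer_bound)
  from this(2) show ?thesis
  proof eventually_elim
    case (elim x)
    have "(\<lambda>k. layer (trunc (real (Suc k))) x) \<longlonglongrightarrow> layer (\<lambda>t. ennreal (b t)) x"
      unfolding layer_def
    proof (rule nn_integral_LIMSEQ)
      show "incseq (\<lambda>k t. trunc (real (Suc k)) t * ennreal (1 / t) * indicator {norm x<..} t)"
        unfolding incseq_def le_fun_def trunc_def
        by (intro allI impI mult_right_mono ennreal_leI mult_left_mono) (auto simp: indicator_def b_nonneg)
      fix t :: real
      obtain k0 where "t \<le> real k0" using real_arch_simple by blast
      then have "\<forall>\<^sub>F k in sequentially. ennreal (b t) * ennreal (1 / t) * indicator {norm x<..} t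
          = trunc (real (Suc k)) t * ennreal (1 / t) * indicator {norm x<..} t"
        by (intro eventually_sequentiallyI[of k0]) (auto simp: trunc_def indicator_def)
      then show "(\<lambda>k. trunc (real (Suc k)) t * ennreal (1 / t) * indicator {norm x<..} t)
          \<longlonglongrightarrow> ennreal (b t) * ennreal (1 / t) * indicator {norm x<..} t"
        by (rule Lim_transform_eventually[OF tendsto_const])
    qed measurable
    then have "(\<lambda>k. QM (real (Suc k)) x) \<longlonglongrightarrow> Q x"
      unfolding QM_def Q_def using elim by (intro tendsto_enn2real) auto
    moreover have "QM (real (Suc k)) x \<le> Q x" for k
      unfolding QM_def Q_def
    proof (rule enn2real_mono)
      show "layer (trunc (real (Suc k))) x \<le> layer (\<lambda>t. ennreal (b t)) x"
        unfolding layer_def trunc_def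
        by (intro nn_integral_mono mult_right_mono ennreal_leI) (auto simp: indicator_def b_nonneg)
    qed (use elim in auto)
    ultimately show ?case by blast
  qed
qed

text \<open>The candidate for the transform of Q. Since \<open>Lam \<xi>\<close> is parallel to
  \<xi>, it is the scalar for which 2 pi i \<xi> \<open>qh \<xi>\<close> equals i
  \<open>Lam \<xi>\<close>.\<close>

definition qh :: "real^'n \<Rightarrow> complex" where
  "qh \<xi> = of_real ((Lam \<xi> \<bullet> \<xi>) / (2 * pi * (norm \<xi>)\<^sup>2))"

lemma r_cos_kernel: "r x * cos_kernel \<xi> x = sin (2 * pi * (x \<bullet> \<xi>)) * kcomp \<xi> x / (2 * pi * (norm \<xi>)\<^sup>2)"
  by (simp add: cos_kernel_def kcomp_def mult_ac)

lemma cos_kernel_weight_bound: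
  assumes "\<xi> \<noteq> 0"
  shows "\<bar>r x * cos_kernel \<xi> x\<bar> \<le> (1 + 1 / norm \<xi>) * w x"
proof -
  have "\<bar>sin (2 * pi * (x \<bullet> \<xi>)) * kcomp \<xi> x\<bar> = \<bar>((sin (2 * pi * (x \<bullet> \<xi>)) * r x / (norm x)\<^sup>2) *\<^sub>R x) \<bullet> \<xi>\<bar>"
    by (simp add: kcomp_def mult_ac)
  also have "\<dots> \<le> norm ((sin (2 * pi * (x \<bullet> \<xi>)) * r x / (norm x)\<^sup>2) *\<^sub>R x) * norm \<xi>"
    by (rule Cauchy_Schwarz_ineq2)
  also have "\<dots> \<le> ((1 + 2 * pi * norm \<xi>) * w x) * norm \<xi>"
    by (intro mult_right_mono Lam_integrand_bound) auto
  finally have "\<bar>r x * cos_kernel \<xi> x\<bar> \<le> ((1 + 2 * pi * norm \<xi>) * w x) * norm \<xi> / (2 * pi * (norm \<xi>)\<^sup>2)"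
    unfolding r_cos_kernel abs_divide by (simp add: divide_right_mono)
  also have "\<dots> = (1 + 1 / (2 * pi * norm \<xi>)) * w x"
    using assms by (simp add: power2_eq_square field_simps)
  also have "\<dots> \<le> (1 + 1 / norm \<xi>) * w x"
  proof (intro mult_right_mono add_left_mono w_nonneg divide_left_mono)
    have "1 * norm \<xi> \<le> 2 * pi * norm \<xi>" using pi_ge_two by (intro mult_right_mono) auto
    then show "norm \<xi> \<le> 2 * pi * norm \<xi>" by simp
  qed (use assms in auto)
  finally show ?thesis .
qed

lemma qh_eq: "\<xi> \<noteq> 0 \<Longrightarrow> qh \<xi> = of_real (LINT x|lborel. r x * cos_kernel \<xi> x)"
  by (simp add: qh_def r_cos_kernel Lam_inner)

lemma rM_cos_kernel_tendsto:
  assumes "\<xi> \<noteq> 0"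
  shows "(\<lambda>k. complex_of_real (LINT x|lborel. rM (real (Suc k)) x * cos_kernel \<xi> x)) \<longlonglongrightarrow> qh \<xi>"
    and "\<bar>LINT x|lborel. rM M x * cos_kernel \<xi> x\<bar> \<le> (1 + 1 / norm \<xi>) * integral\<^sup>L lborel w"
proof -
  note wi = integrable_mult_right[OF w_int, of "1 + 1 / norm \<xi>"]
  have le: "norm (rM M x * cos_kernel \<xi> x) \<le> (1 + 1 / norm \<xi>) * w x" for x M
    using cos_kernel_weight_bound[OF assms, of x] assms w_nonneg[of x]
    by (auto simp: rM_def indicator_def intro!: mult_nonneg_nonneg)
  show "\<bar>LINT x|lborel. rM M x * cos_kernel \<xi> x\<bar> \<le> (1 + 1 / norm \<xi>) * integral\<^sup>L lborel w"
    using integral_norm_bound_le[OF wi le[where M=M]] by simp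
  have "(\<lambda>k. LINT x|lborel. rM (real (Suc k)) x * cos_kernel \<xi> x) \<longlonglongrightarrow> (LINT x|lborel. r x * cos_kernel \<xi> x)"
  proof (rule integral_dominated_convergence[OF _ _ wi])
    show "AE x in lborel. (\<lambda>k. rM (real (Suc k)) x * cos_kernel \<xi> x) \<longlonglongrightarrow> r x * cos_kernel \<xi> x"
    proof (rule AE_I2)
      fix x :: "real^'n"
      obtain k0 where "norm x \<le> real k0" using real_arch_simple by blast
      then have "\<forall>\<^sub>F k in sequentially. r x * cos_kernel \<xi> x = rM (real (Suc k)) x * cos_kernel \<xi> x"
        by (intro eventually_sequentiallyI[of k0]) (auto simp: rM_def indicator_def)
      then show "(\<lambda>k. rM (real (Suc k)) x * cos_kernel \<xi> x) \<longlonglongrightarrow> r x * cos_kernel \<xi> x"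
        by (rule Lim_transform_eventually[OF tendsto_const])
    qed
  qed (use le in auto)
  then show "(\<lambda>k. complex_of_real (LINT x|lborel. rM (real (Suc k)) x * cos_kernel \<xi> x)) \<longlonglongrightarrow> qh \<xi>"
    unfolding qh_eq[OF assms] by (rule tendsto_of_real)
qed

text \<open>For the truncated functions this is Fubini's theorem, and both sides converge as M tends
  to infinity. On the side of Q the majorant comes from \<open>layer_bound\<close>. On the frequency
  side it is a multiple of 1 + 1/|\<xi>|, which is bounded on the support of \<open>\<phi>\<close>
  because that support stays away from the origin.\<close>

theorem fourier_Q:
  assumes \<phi>: "test_function \<phi>" and supp: "0 \<notin> fun_support \<phi>"
  shows "(LINT x|lborel. of_real (Q x) * fourier \<phi> x) = (LINT \<xi>|lborel. qh \<xi> * \<phi> \<xi>)"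
proof -
  have [measurable]: "\<phi> \<in> borel_measurable borel" "fourier \<phi> \<in> borel_measurable borel"
    by (rule test_function_measurable[OF \<phi>], rule fourier_test_measurable[OF \<phi>])
  have [measurable]: "qh \<in> borel_measurable borel" unfolding qh_def[abs_def] by measurable
  have "open (- fun_support \<phi>)" by (simp add: fun_support_def open_Compl)
  then obtain d where d: "d > 0" "ball 0 d \<subseteq> - fun_support \<phi>"
    using supp by (auto simp: open_contains_ball)
  have \<phi>0: "\<phi> \<xi> = 0" if "norm \<xi> < d" for \<xi>
  proof -
    have "\<xi> \<in> ball 0 d" using that by simp
    with d(2) have "\<xi> \<notin> closure {x. \<phi> x \<noteq> 0}" by (auto simp: fun_support_def)
    then show ?thesis using closure_subset[of "{x. \<phi> x \<noteq> 0}"] by auto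
  qed
  have mult: "(LINT x|lborel. of_real (QM M x) * fourier \<phi> x)
      = (LINT \<xi>|lborel. complex_of_real (LINT x|lborel. rM M x * cos_kernel \<xi> x) * \<phi> \<xi>)" if M: "M \<ge> 1" for M
  proof -
    have i: "integrable (lborel \<Otimes>\<^sub>M lborel) (\<lambda>(x, \<xi>). of_real (QM M x) * (\<phi> \<xi> * cis (- (2 * pi * (\<xi> \<bullet> x)))))"
    proof (rule integrable_pair_bound[where a="QM M" and b="\<lambda>\<xi>. norm (\<phi> \<xi>)"])
      show "integrable lborel (\<lambda>\<xi>. norm (\<phi> \<xi>))"
        by (rule integrable_norm[OF test_function_integrable[OF \<phi>]])
    qed (use QM_integrable[OF M] in \<open>auto simp: norm_mult QM_nonneg\<close>)
    have "(LINT x|lborel. of_real (QM M x) * fourier \<phi> x)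
        = (LINT x|lborel. (LINT \<xi>|lborel. of_real (QM M x) * (\<phi> \<xi> * cis (- (2 * pi * (\<xi> \<bullet> x))))))"
      by (simp only: fourier_eq[OF \<open>\<phi> \<in> borel_measurable borel\<close>] integral_mult_right_zero)
    also have "\<dots> = (LINT \<xi>|lborel. (LINT x|lborel. of_real (QM M x) * (\<phi> \<xi> * cis (- (2 * pi * (\<xi> \<bullet> x))))))"
      by (rule lborel_pair.Fubini_integral[OF i, symmetric])
    also have "\<dots> = (LINT \<xi>|lborel. (LINT x|lborel. of_real (QM M x) * cis (- (2 * pi * (x \<bullet> \<xi>)))) * \<phi> \<xi>)"
    proof (intro Bochner_Integration.integral_cong refl)
      fix \<xi>
      have "(LINT x|lborel. of_real (QM M x) * (\<phi> \<xi> * cis (- (2 * pi * (\<xi> \<bullet> x)))))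
          = (LINT x|lborel. of_real (QM M x) * cis (- (2 * pi * (x \<bullet> \<xi>))) * \<phi> \<xi>)"
        by (intro Bochner_Integration.integral_cong refl) (simp add: inner_commute mult_ac)
      also have "\<dots> = (LINT x|lborel. of_real (QM M x) * cis (- (2 * pi * (x \<bullet> \<xi>)))) * \<phi> \<xi>"
        by (rule integral_mult_left_zero)
      finally show "(LINT x|lborel. of_real (QM M x) * (\<phi> \<xi> * cis (- (2 * pi * (\<xi> \<bullet> x)))))
          = (LINT x|lborel. of_real (QM M x) * cis (- (2 * pi * (x \<bullet> \<xi>)))) * \<phi> \<xi>" .
    qed
    also have "\<dots> = (LINT \<xi>|lborel. complex_of_real (LINT x|lborel. rM M x * cos_kernel \<xi> x) * \<phi> \<xi>)"
    proof (intro Bochner_Integration.integral_cong refl)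
      fix \<xi>
      show "(LINT x|lborel. of_real (QM M x) * cis (- (2 * pi * (x \<bullet> \<xi>)))) * \<phi> \<xi>
          = complex_of_real (LINT x|lborel. rM M x * cos_kernel \<xi> x) * \<phi> \<xi>"
      proof (cases "\<xi> = 0")
        case False
        then show ?thesis by (simp add: QM_fourier_cis[OF M])
      qed (use \<phi>0[of 0] d in simp)
    qed
    finally show ?thesis .
  qed
  obtain T where T: "T \<ge> 0" "AE x in lborel. layer (\<lambda>t. ennreal (b t)) (x::real^'n) = ennreal (Q x) \<and> Q x \<le> QM 1 x + T"
    by (rule layer_bound)
  obtain B where B: "\<And>x. norm (fourier \<phi> x) \<le> B"
    using norm_fourier_le[OF test_function_integrable[OF \<phi>]] by blast
  have "integrable lborel (\<lambda>x. B * QM 1 x + T * norm (fourier \<phi> x))"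
    by (intro Bochner_Integration.integrable_add integrable_mult_right QM_integrable integrable_norm integrable_fourier_test \<phi>) auto
  then have l1: "(\<lambda>k. LINT x|lborel. of_real (QM (real (Suc k)) x) * fourier \<phi> x) \<longlonglongrightarrow> (LINT x|lborel. of_real (Q x) * fourier \<phi> x)"
  proof (rule integral_dominated_convergence[rotated 2])
    show "AE x in lborel. (\<lambda>k. of_real (QM (real (Suc k)) x) * fourier \<phi> x) \<longlonglongrightarrow> of_real (Q x) * fourier \<phi> x"
      using QM_tendsto by eventually_elim (auto intro!: tendsto_intros)
    fix k
    show "AE x in lborel. norm (of_real (QM (real (Suc k)) x) * fourier \<phi> x) \<le> B * QM 1 x + T * norm (fourier \<phi> x)"
      using QM_tendsto T(2)
    proof eventually_elim
      case (elim x)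
      have "norm (of_real (QM (real (Suc k)) x) * fourier \<phi> x) = QM (real (Suc k)) x * norm (fourier \<phi> x)"
        by (simp add: norm_mult QM_nonneg)
      also have "\<dots> \<le> (QM 1 x + T) * norm (fourier \<phi> x)"
      proof (rule mult_right_mono)
        have "QM (real (Suc k)) x \<le> Q x" using elim by blast
        then show "QM (real (Suc k)) x \<le> QM 1 x + T" using elim by linarith
      qed simp
      also have "\<dots> \<le> B * QM 1 x + T * norm (fourier \<phi> x)"
        using mult_left_mono[OF B[of x] QM_nonneg[of 1 x]] by (simp add: algebra_simps)
      finally show ?case .
    qed
  qed measurable
  let ?W = "integral\<^sup>L lborel w"
  have "integrable lborel (\<lambda>\<xi>. ((1 + 1 / d) * ?W) * norm (\<phi> \<xi>))"
    by (intro integrable_mult_right integrable_norm test_function_integrable \<phi>)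
  then have l2: "(\<lambda>k. LINT \<xi>|lborel. complex_of_real (LINT x|lborel. rM (real (Suc k)) x * cos_kernel \<xi> x) * \<phi> \<xi>) \<longlonglongrightarrow> (LINT \<xi>|lborel. qh \<xi> * \<phi> \<xi>)"
  proof (rule integral_dominated_convergence[rotated 2])
    show "AE \<xi> in lborel. (\<lambda>k. complex_of_real (LINT x|lborel. rM (real (Suc k)) x * cos_kernel \<xi> x) * \<phi> \<xi>) \<longlonglongrightarrow> qh \<xi> * \<phi> \<xi>"
      using AE_lborel_singleton[of "0::real^'n"]
      by eventually_elim (intro tendsto_mult tendsto_const rM_cos_kernel_tendsto)
    fix k
    show "AE \<xi> in lborel. norm (complex_of_real (LINT x|lborel. rM (real (Suc k)) x * cos_kernel \<xi> x) * \<phi> \<xi>) \<le> ((1 + 1 / d) * ?W) * norm (\<phi> \<xi>)"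
    proof (rule AE_I2)
      fix \<xi> :: "real^'n"
      show "norm (complex_of_real (LINT x|lborel. rM (real (Suc k)) x * cos_kernel \<xi> x) * \<phi> \<xi>) \<le> ((1 + 1 / d) * ?W) * norm (\<phi> \<xi>)"
      proof (cases "norm \<xi> < d")
        case True
        then show ?thesis using \<phi>0 by simp
      next
        case False
        then have \<xi>: "\<xi> \<noteq> 0" "d \<le> norm \<xi>" using d by auto
        have "\<bar>LINT x|lborel. rM (real (Suc k)) x * cos_kernel \<xi> x\<bar> \<le> (1 + 1 / norm \<xi>) * ?W"
          by (rule rM_cos_kernel_tendsto(2)[OF \<xi>(1)])
        also have "\<dots> \<le> (1 + 1 / d) * ?W"
          using \<xi> d by (intro mult_right_mono add_left_mono divide_left_mono integral_nonneg_AE AE_I2 w_nonneg) auto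
        finally show ?thesis by (simp add: norm_mult mult_right_mono)
      qed
    qed
  qed (auto simp: cos_kernel_def[abs_def] rM_def[abs_def])
  have "(LINT x|lborel. of_real (QM (real (Suc k)) x) * fourier \<phi> x)
      = (LINT \<xi>|lborel. complex_of_real (LINT x|lborel. rM (real (Suc k)) x * cos_kernel \<xi> x) * \<phi> \<xi>)" for k
    by (rule mult) simp
  with l1 have "(\<lambda>k. LINT \<xi>|lborel. complex_of_real (LINT x|lborel. rM (real (Suc k)) x * cos_kernel \<xi> x) * \<phi> \<xi>)
      \<longlonglongrightarrow> (LINT x|lborel. of_real (Q x) * fourier \<phi> x)" by (simp only:)
  then show ?thesis using l2 by (rule LIMSEQ_unique)
qed

end

section \<open>Uniqueness of a continuous density off the origin\<close>

lemma integrable_times_test: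
  fixes g \<phi> :: "real^'n \<Rightarrow> complex"
  assumes g: "continuous_on (- {0}) g" and \<phi>: "continuous_on UNIV \<phi>"
    and C: "compact C" "0 \<notin> C" "\<And>x. x \<notin> C \<Longrightarrow> \<phi> x = 0"
  shows "integrable lborel (\<lambda>x. g x * \<phi> x)"
proof -
  have "continuous_on C (\<lambda>x. g x * \<phi> x)"
    using C(2) by (intro continuous_on_mult continuous_on_subset[OF g] continuous_on_subset[OF \<phi>]) auto
  then have "integrable lborel (\<lambda>x. indicator C x *\<^sub>R (g x * \<phi> x))"
    by (rule borel_integrable_compact[OF C(1)])
  moreover have "indicator C x *\<^sub>R (g x * \<phi> x) = g x * \<phi> x" for x
    using C(3)[of x] by (cases "x \<in> C") auto
  ultimately show ?thesis by simp
qed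

text \<open>The pairing is tested with a mollifier rescaled to a ball around \<open>x0\<close> that
  avoids the origin and on which the difference of the two densities stays within half of its value
  at \<open>x0\<close>. Its weighted average cannot vanish unless that value is zero.\<close>

lemma given_off_origin_by_unique:
  assumes g: "continuous_on (- {0}) g" "given_off_origin_by T g"
    and h: "continuous_on (- {0}) h" "given_off_origin_by T h" and x0: "x0 \<noteq> (0 :: real^'n)"
  shows "g x0 = h x0"
proof (rule ccontr)
  assume ne: "g x0 \<noteq> h x0"
  let ?d = "\<lambda>x. g x - h x"
  have "continuous_on (- {0}) ?d" by (intro continuous_intros g h)
  then have "isCont ?d x0" using x0 by (simp add: continuous_on_eq_continuous_at open_Compl)
  moreover have "norm (?d x0) / 2 > 0" using ne by simp
  ultimately obtain e where e: "e > 0" "\<And>x. dist x x0 < e \<Longrightarrow> dist (?d x) (?d x0) < norm (?d x0) / 2"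
    unfolding continuous_at_eps_delta by metis
  define \<delta> where "\<delta> = min e (norm x0) / 2"
  have \<delta>: "\<delta> > 0" "\<delta> < e" "\<delta> < norm x0" using e(1) x0 by (auto simp: \<delta>_def min_def)
  obtain \<eta> :: "real^'n \<Rightarrow> real" where \<eta>: "test_function \<eta>" "\<And>x. \<eta> x \<ge> 0"
    "\<And>x. norm x > 1 \<Longrightarrow> \<eta> x = 0" "integral\<^sup>L lborel \<eta> = 1"
    using mollifier_exists by blast
  let ?\<phi> = "\<lambda>x. \<eta> (- (x0 /\<^sub>R \<delta>) + (1 / \<delta>) *\<^sub>R x)"
  have t: "test_function ?\<phi>" using \<delta> by (intro test_function_affine \<eta>) auto
  have ti: "integrable lborel ?\<phi>" by (rule test_function_integrable[OF t])
  have tc: "test_function (\<lambda>x. complex_of_real (?\<phi> x))" by (rule test_function_of_real[OF t])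
  have z: "?\<phi> x = 0" if "x \<notin> cball x0 \<delta>" for x
  proof (rule \<eta>(3))
    have "- (x0 /\<^sub>R \<delta>) + (1 / \<delta>) *\<^sub>R x = (1 / \<delta>) *\<^sub>R (x - x0)"
      by (simp add: scaleR_diff_right inverse_eq_divide)
    then have "norm (- (x0 /\<^sub>R \<delta>) + (1 / \<delta>) *\<^sub>R x) = norm (x - x0) / \<delta>"
      using \<delta> by (simp only: norm_scaleR) simp
    then show "norm (- (x0 /\<^sub>R \<delta>) + (1 / \<delta>) *\<^sub>R x) > 1"
      using that \<delta> by (simp add: dist_norm norm_minus_commute)
  qed
  have c0: "0 \<notin> cball x0 \<delta>" using \<delta> by simp
  have "fun_support (\<lambda>x. complex_of_real (?\<phi> x)) \<subseteq> cball x0 \<delta>"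
    unfolding fun_support_def
  proof (intro closure_minimal subsetI closed_cball)
    fix x assume "x \<in> {x. complex_of_real (?\<phi> x) \<noteq> 0}"
    then have "?\<phi> x \<noteq> 0" by simp
    then show "x \<in> cball x0 \<delta>" using z[of x] by blast
  qed
  then have supp: "0 \<notin> fun_support (\<lambda>x. complex_of_real (?\<phi> x))" using c0 by blast
  have int: "integrable lborel (\<lambda>x. k x * complex_of_real (?\<phi> x))" if "continuous_on (- {0}) k" for k
    by (rule integrable_times_test[OF that test_function_imp_continuous[OF tc] compact_cball c0]) (use z in simp)
  have leb: "(LINT x|lebesgue. k x * complex_of_real (?\<phi> x)) = (LINT x|lborel. k x * complex_of_real (?\<phi> x))"
    if "continuous_on (- {0}) k" for k
    using borel_measurable_integrable[OF int[OF that]] by (simp add: integral_completion)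
  have "(LINT x|lborel. g x * complex_of_real (?\<phi> x)) = (LINT x|lborel. h x * complex_of_real (?\<phi> x))"
  proof -
    have "T (\<lambda>x. complex_of_real (?\<phi> x)) = (LINT x|lebesgue. g x * complex_of_real (?\<phi> x))"
      "T (\<lambda>x. complex_of_real (?\<phi> x)) = (LINT x|lebesgue. h x * complex_of_real (?\<phi> x))"
      using g(2) h(2) tc supp unfolding given_off_origin_by_def by simp_all
    then show ?thesis unfolding leb[OF g(1)] leb[OF h(1)] by (rule trans[OF sym])
  qed
  then have "(LINT x|lborel. ?d x * complex_of_real (?\<phi> x)) = 0"
    using int[OF g(1)] int[OF h(1)] by (simp add: left_diff_distrib)
  then have eq0: "(LINT x|lborel. ?d x * complex_of_real (?\<phi> x)) = 0" .
  have one: "(LINT x|lborel. ?\<phi> x) * (1 / \<delta>) ^ DIM(real^'n) = 1"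
    using integral_lborel_affine[of "1 / \<delta>" \<eta> "- (x0 /\<^sub>R \<delta>)"] \<eta>(4) \<delta> by (simp add: mult.commute)
  then have pos: "(LINT x|lborel. ?\<phi> x) > 0"
  proof -
    have "(LINT x|lborel. ?\<phi> x) \<noteq> 0" using one by force
    moreover have "(LINT x|lborel. ?\<phi> x) \<ge> 0" by (intro integral_nonneg_AE AE_I2 \<eta>(2))
    ultimately show ?thesis by linarith
  qed
  have di: "integrable lborel (\<lambda>x. (?d x - ?d x0) * complex_of_real (?\<phi> x))"
    by (rule int) (intro continuous_intros g h)
  have le: "norm (LINT x|lborel. (?d x - ?d x0) * complex_of_real (?\<phi> x)) \<le> (LINT x|lborel. norm (?d x0) / 2 * ?\<phi> x)"
  proof (rule integral_norm_bound_le[OF integrable_mult_right[OF ti]])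
    fix x
    show "norm ((?d x - ?d x0) * complex_of_real (?\<phi> x)) \<le> norm (?d x0) / 2 * ?\<phi> x"
    proof (cases "x \<in> cball x0 \<delta>")
      case True
      then have "dist (?d x) (?d x0) < norm (?d x0) / 2" using \<delta> by (intro e) (simp add: dist_commute)
      then have "norm (?d x - ?d x0) \<le> norm (?d x0) / 2" by (simp only: dist_norm)
      from mult_right_mono[OF this \<eta>(2)] show ?thesis by (simp only: norm_mult norm_of_real abs_of_nonneg[OF \<eta>(2)])
    next
      case False
      from z[OF this] show ?thesis by (simp only: of_real_0 mult_zero_right norm_zero order_refl)
    qed
  qed
  have "(LINT x|lborel. ?d x * complex_of_real (?\<phi> x))
      = (LINT x|lborel. (?d x - ?d x0) * complex_of_real (?\<phi> x)) + ?d x0 * of_real (LINT x|lborel. ?\<phi> x)"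
  proof -
    have "(LINT x|lborel. ?d x * complex_of_real (?\<phi> x))
        = (LINT x|lborel. (?d x - ?d x0) * complex_of_real (?\<phi> x) + ?d x0 * complex_of_real (?\<phi> x))"
      by (simp add: algebra_simps)
    also have "\<dots> = (LINT x|lborel. (?d x - ?d x0) * complex_of_real (?\<phi> x)) + (LINT x|lborel. ?d x0 * complex_of_real (?\<phi> x))"
      using ti by (intro Bochner_Integration.integral_add di) auto
    finally show ?thesis by simp
  qed
  then have "?d x0 * of_real (LINT x|lborel. ?\<phi> x) = - (LINT x|lborel. (?d x - ?d x0) * complex_of_real (?\<phi> x))"
    unfolding eq0 by (simp add: eq_neg_iff_add_eq_0 add.commute)
  then have "norm (?d x0 * of_real (LINT x|lborel. ?\<phi> x)) = norm (LINT x|lborel. (?d x - ?d x0) * complex_of_real (?\<phi> x))"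
    by (simp only: norm_minus_cancel)
  with le have "norm (?d x0 * of_real (LINT x|lborel. ?\<phi> x)) \<le> norm (?d x0) / 2 * (LINT x|lborel. ?\<phi> x)"
    by (simp only: integral_mult_right_zero)
  then show False using ne pos by (simp add: norm_mult)
qed

section \<open>Identification of the transform of Q and of the distribution K\<close>

context radial_kernel
begin

text \<open>Points where the integral diverges are no exception: the Bochner integral takes the
  default value zero there, and so does \<open>enn2real\<close> at infinity.\<close>

lemma Q_fun_eq:
  assumes ae: "AE t in lborel. t > 0 \<longrightarrow> radial_rep \<rho> t = b t"
  shows "Q_fun \<rho> x = Q x"
proof -
  let ?g = "\<lambda>t. indicator {norm x<..} t *\<^sub>R (b t / t)"
  have "AE t in lborel. indicator {norm x<..} t *\<^sub>R (radial_rep \<rho> t / t) = ?g t"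
    using ae
  proof eventually_elim
    case (elim t)
    then show ?case using norm_ge_zero[of x] by (cases "norm x < t") auto
  qed
  then have "Q_fun \<rho> x = (LINT t|lborel. ?g t)"
    unfolding Q_fun_def set_lebesgue_integral_def by (intro integral_lebesgue_AE_eq(1)) auto
  also have "\<dots> = enn2real (\<integral>\<^sup>+t. ennreal (?g t) \<partial>lborel)"
  proof (rule integral_eq_nn_integral)
    have "0 \<le> ?g t" for t
    proof (cases "norm x < t")
      case True
      then have "t > 0" using norm_ge_zero[of x] by linarith
      then show ?thesis by (simp add: b_nonneg)
    qed simp
    then show "AE t in lborel. 0 \<le> ?g t" by simp
  qed measurable
  also have "(\<integral>\<^sup>+t. ennreal (?g t) \<partial>lborel) = layer (\<lambda>t. ennreal (b t)) x"
    unfolding layer_def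
    by (intro nn_integral_cong) (auto simp: indicator_def ennreal_mult'[symmetric] b_nonneg)
  finally show ?thesis by (simp add: Q_def)
qed

lemma continuous_on_qh: "continuous_on (- {0}) qh"
  unfolding qh_def[abs_def]
  by (intro continuous_intros continuous_on_subset[OF continuous_on_Lam]) auto

lemma qh_given:
  assumes ae: "AE t in lborel. t > 0 \<longrightarrow> radial_rep \<rho> t = b t"
  shows "given_off_origin_by (fourier_distr (distr_of_fun (\<lambda>x. of_real (Q_fun \<rho> x)))) qh"
  unfolding given_off_origin_by_def
proof (intro conjI allI impI)
  have qm: "qh \<in> borel_measurable borel" unfolding qh_def[abs_def] by measurable
  show "locally_integrable_on (- {0}) qh"
    unfolding locally_integrable_on_def set_integrable_def
  proof (intro allI impI)
    fix C :: "(real^'n) set" assume C: "compact C \<and> C \<subseteq> - {0}"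
    then have "integrable lborel (\<lambda>x. indicator C x *\<^sub>R qh x)"
      by (intro borel_integrable_compact continuous_on_subset[OF continuous_on_qh]) auto
    moreover from C have "C \<in> sets borel" by (simp add: borel_compact)
    ultimately show "integrable lebesgue (\<lambda>x. indicator C x *\<^sub>R qh x)"
      using qm by (subst integrable_completion) auto
  qed
  fix \<phi> :: "real^'n \<Rightarrow> complex" assume \<phi>: "test_function \<phi> \<and> 0 \<notin> fun_support \<phi>"
  have [measurable]: "\<phi> \<in> borel_measurable borel" "fourier \<phi> \<in> borel_measurable borel"
    using \<phi> by (simp_all add: test_function_measurable fourier_test_measurable)
  have "fourier_distr (distr_of_fun (\<lambda>x. of_real (Q_fun \<rho> x))) \<phi> = (LINT x|lebesgue. of_real (Q x) * fourier \<phi> x)"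
    by (simp add: fourier_distr_def distr_of_fun_def Q_fun_eq[OF ae])
  also have "\<dots> = (LINT x|lborel. of_real (Q x) * fourier \<phi> x)"
    by (rule integral_completion) simp
  also have "\<dots> = (LINT \<xi>|lborel. qh \<xi> * \<phi> \<xi>)" using \<phi> by (intro fourier_Q) auto
  also have "\<dots> = (LINT \<xi>|lebesgue. qh \<xi> * \<phi> \<xi>)"
    by (rule integral_completion[symmetric]) (use qm in simp)
  finally show "fourier_distr (distr_of_fun (\<lambda>x. of_real (Q_fun \<rho> x))) \<phi> = (LINT \<xi>|lebesgue. qh \<xi> * \<phi> \<xi>)" .
qed

text \<open>The choice in \<open>Q_hat\<close> ranges over continuous densities; \<open>qh\<close>
  is one of them and, off the origin, any two of them agree.\<close>

lemma Q_hat_eq: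
  assumes ae: "AE t in lborel. t > 0 \<longrightarrow> radial_rep \<rho> t = b t" and \<xi>: "\<xi> \<noteq> 0"
  shows "Q_hat \<rho> \<xi> = qh \<xi>"
proof -
  let ?P = "\<lambda>g. continuous_on (- {0}) g \<and>
     given_off_origin_by (fourier_distr (distr_of_fun (\<lambda>x::real^'n. of_real (Q_fun \<rho> x)))) g"
  have q: "?P qh" using continuous_on_qh qh_given[OF ae] by blast
  then have "?P (Q_hat \<rho>)" unfolding Q_hat_def by (rule someI[of ?P])
  with q \<xi> show ?thesis using given_off_origin_by_unique by blast
qed

lemma norm_lam:
  assumes ae: "AE t in lborel. t > 0 \<longrightarrow> radial_rep \<rho> t = b t" and \<xi>: "\<xi> \<noteq> 0"
  shows "norm (lam \<rho> \<xi>) = norm (Lam \<xi>)"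
proof -
  let ?c = "2 * pi * norm (qh \<xi>)"
  have "norm (lam \<rho> \<xi>) = L2_set (\<lambda>j. ?c * \<bar>\<xi> $ j\<bar>) UNIV"
    unfolding norm_vec_def lam_def by (simp add: Q_hat_eq[OF ae \<xi>] norm_mult mult_ac)
  also have "\<dots> = ?c * norm \<xi>"
    by (simp add: norm_vec_def L2_set_right_distrib)
  also have "\<dots> = \<bar>Lam \<xi> \<bullet> \<xi>\<bar> / norm \<xi>"
    using \<xi> by (simp add: qh_def norm_divide norm_mult norm_power power2_eq_square field_simps)
  also have "\<dots> = norm (Lam \<xi>)"
    using \<xi> by (simp add: norm_Lam[symmetric])
  finally show ?thesis .
qed

lemma K_distr_eq:
  assumes ae: "AE t in lborel. t > 0 \<longrightarrow> radial_rep \<rho> t = b t" and \<phi>: "test_function \<phi>"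
  shows "K_distr \<rho> \<phi> = - (LINT \<xi>|lborel. of_real ((norm (Lam \<xi>))\<^sup>2) * fourier \<phi> (- \<xi>))"
proof -
  have [measurable]: "fourier \<phi> \<in> borel_measurable borel" by (rule fourier_test_measurable[OF \<phi>])
  have "AE \<xi> in lborel. - of_real ((norm (lam \<rho> \<xi>))\<^sup>2) * inv_fourier \<phi> \<xi> = - (of_real ((norm (Lam \<xi>))\<^sup>2) * fourier \<phi> (- \<xi>))"
    using AE_lborel_singleton[of "0::real^'n"]
    by eventually_elim (simp add: norm_lam[OF ae] inv_fourier_eq)
  then have "K_distr \<rho> \<phi> = (LINT \<xi>|lborel. - (of_real ((norm (Lam \<xi>))\<^sup>2) * fourier \<phi> (- \<xi>)))"
    unfolding K_distr_def inv_fourier_distr_def distr_of_fun_def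
    by (intro integral_lebesgue_AE_eq(1)) auto
  then show ?thesis by simp
qed

end

section \<open>Second differences of Fourier transforms\<close>

lemma norm_cis_taylor: "norm (cis (a + d) - cis a - d *\<^sub>R (\<i> * cis a)) \<le> d\<^sup>2"
proof -
  have "cis (a + d) - cis a - d *\<^sub>R (\<i> * cis a) = cis a * (iexp d - (\<Sum>k\<le>1. (\<i> * d) ^ k / fact k))"
    by (simp add: cis_conv_exp exp_add scaleR_conv_of_real algebra_simps)
  then have "norm (cis (a + d) - cis a - d *\<^sub>R (\<i> * cis a)) = norm (iexp d - (\<Sum>k\<le>1. (\<i> * d) ^ k / fact k))"
    by (simp only: norm_mult norm_cis mult_1_left)
  also have "\<dots> \<le> \<bar>d\<bar> ^ Suc 1 / fact (Suc 1)" by (rule iexp_approx1)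
  also have "\<dots> \<le> d\<^sup>2" by (simp add: power2_eq_square)
  finally show ?thesis .
qed

lemma test_function_inner_mult:
  fixes f :: "real^'n \<Rightarrow> complex"
  assumes "test_function f"
  shows "test_function (\<lambda>x. of_real (x \<bullet> v) * f x)"
  using assms smooth_bounded_linear[OF smooth_inner bounded_linear_of_real]
  by (rule test_function_mult[rotated])

lemma fourier_has_vector_derivative:
  fixes f :: "real^'n \<Rightarrow> complex"
  assumes f: "test_function f"
  shows "((\<lambda>t. fourier f (\<zeta> + t *\<^sub>R e)) has_vector_derivative
    - (2 * of_real pi * \<i>) * fourier (\<lambda>x. of_real (x \<bullet> e) * f x) (\<zeta> + t *\<^sub>R e)) (at t)"
proof -
  let ?g = "\<lambda>x. of_real (x \<bullet> e) * f x"
  have [measurable]: "f \<in> borel_measurable borel" by (rule test_function_measurable[OF f])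
  have ii: "integrable lborel (\<lambda>x. of_real (x \<bullet> e) * ?g x)"
    by (intro test_function_integrable test_function_inner_mult f)
  then have i2: "integrable lborel (\<lambda>x. (x \<bullet> e)\<^sup>2 * norm (f x))"
    using integrable_norm[OF ii] by (simp add: norm_mult power2_eq_square mult.assoc[symmetric])
  have ac: "(4 * p * q) * I = 4 * p * I * q" for p q I :: real by simp
  let ?d = "- (2 * of_real pi * \<i>) * fourier ?g (\<zeta> + t *\<^sub>R e)"
  let ?C = "4 * pi\<^sup>2 * (LINT x|lborel. (x \<bullet> e)\<^sup>2 * norm (f x))"
  have bd: "norm (fourier f (\<zeta> + (t + h) *\<^sub>R e) - fourier f (\<zeta> + t *\<^sub>R e) - h *\<^sub>R ?d) \<le> ?C * h\<^sup>2" for h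
  proof -
    let ?a = "\<lambda>x. - (2 * pi * (x \<bullet> (\<zeta> + t *\<^sub>R e)))" and ?b = "\<lambda>x. - (2 * pi * (h * (x \<bullet> e)))"
    have i: "integrable lborel (\<lambda>x. u x * cis (- (2 * pi * (x \<bullet> \<xi>))))" if "test_function u" for u \<xi>
      by (intro integrable_mult_cis test_function_integrable that) measurable
    note ig = i[OF test_function_inner_mult[OF f]]
    have "fourier f (\<zeta> + (t + h) *\<^sub>R e) - fourier f (\<zeta> + t *\<^sub>R e) - h *\<^sub>R ?d
      = (LINT x|lborel. f x * cis (- (2 * pi * (x \<bullet> (\<zeta> + (t + h) *\<^sub>R e))))) - (LINT x|lborel. f x * cis (?a x))
        - (LINT x|lborel. (- of_real h * (2 * of_real pi * \<i>)) * (?g x * cis (?a x)))"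
      by (simp add: fourier_eq scaleR_conv_of_real)
    also have "\<dots> = (LINT x|lborel. f x * cis (- (2 * pi * (x \<bullet> (\<zeta> + (t + h) *\<^sub>R e)))) - f x * cis (?a x)
        - (- of_real h * (2 * of_real pi * \<i>)) * (?g x * cis (?a x)))"
      using i[OF f] ig by simp
    also have "\<dots> = (LINT x|lborel. f x * (cis (?a x + ?b x) - cis (?a x) - ?b x *\<^sub>R (\<i> * cis (?a x))))"
      by (intro Bochner_Integration.integral_cong refl)
        (simp add: inner_add_right scaleR_conv_of_real[where 'a=complex] algebra_simps)
    finally have eq: "fourier f (\<zeta> + (t + h) *\<^sub>R e) - fourier f (\<zeta> + t *\<^sub>R e) - h *\<^sub>R ?d
      = (LINT x|lborel. f x * (cis (?a x + ?b x) - cis (?a x) - ?b x *\<^sub>R (\<i> * cis (?a x))))" .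
    have "norm (LINT x|lborel. f x * (cis (?a x + ?b x) - cis (?a x) - ?b x *\<^sub>R (\<i> * cis (?a x))))
        \<le> (LINT x|lborel. (4 * pi\<^sup>2 * h\<^sup>2) * ((x \<bullet> e)\<^sup>2 * norm (f x)))"
    proof (rule integral_norm_bound_le[OF integrable_mult_right[OF i2]])
      fix x
      have A: "norm (f x * (cis (?a x + ?b x) - cis (?a x) - ?b x *\<^sub>R (\<i> * cis (?a x)))) \<le> norm (f x) * (?b x)\<^sup>2"
        unfolding norm_mult by (intro mult_left_mono norm_cis_taylor) auto
      then show "norm (f x * (cis (?a x + ?b x) - cis (?a x) - ?b x *\<^sub>R (\<i> * cis (?a x)))) \<le> (4 * pi\<^sup>2 * h\<^sup>2) * ((x \<bullet> e)\<^sup>2 * norm (f x))"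
      proof -
        have "norm (f x) * (?b x)\<^sup>2 = (4 * pi\<^sup>2 * h\<^sup>2) * ((x \<bullet> e)\<^sup>2 * norm (f x))"
          by (simp add: power2_eq_square)
        then show ?thesis using A by linarith
      qed
    qed
    also have "\<dots> = (4 * pi\<^sup>2 * h\<^sup>2) * (LINT x|lborel. (x \<bullet> e)\<^sup>2 * norm (f x))"
      by (rule integral_mult_right_zero)
    also have "\<dots> = ?C * h\<^sup>2" by (rule ac)
    finally show ?thesis unfolding eq .
  qed
  show ?thesis
    unfolding has_vector_derivative_def has_derivative_at
  proof
    show "bounded_linear (\<lambda>x. x *\<^sub>R ?d)" by (rule bounded_linear_scaleR_left)
    show "(\<lambda>h. norm (fourier f (\<zeta> + (t + h) *\<^sub>R e) - fourier f (\<zeta> + t *\<^sub>R e) - h *\<^sub>R ?d) / norm h) \<midarrow>0\<rightarrow> 0"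
    proof (rule tendsto_sandwich[OF _ _ tendsto_const])
      show "\<forall>\<^sub>F h in at 0. norm (fourier f (\<zeta> + (t + h) *\<^sub>R e) - fourier f (\<zeta> + t *\<^sub>R e) - h *\<^sub>R ?d) / norm h \<le> ?C * norm h"
        using bd by (auto simp: eventually_at_filter divide_le_eq power2_eq_square mult.assoc abs_mult_self_eq)
      show "((\<lambda>h::real. ?C * norm h) \<longlongrightarrow> 0) (at 0)"
        by (intro tendsto_mult_right_zero tendsto_norm_zero) (simp add: tendsto_ident_at)
    qed auto
  qed
qed

text \<open>The expression is minus half the increment over [0,1] of g(t) + g(-t), whose derivative
  g'(t) - g'(-t) is at most 2B in norm; both bounds are mean value inequalities.\<close>

lemma second_difference_le:
  fixes g g' g'' :: "real \<Rightarrow> complex"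
  assumes g: "\<And>t. (g has_vector_derivative g' t) (at t)" and g': "\<And>t. (g' has_vector_derivative g'' t) (at t)"
    and B: "\<And>t. \<bar>t\<bar> \<le> 1 \<Longrightarrow> norm (g'' t) \<le> B"
  shows "norm (g 0 - g (-1) / 2 - g 1 / 2) \<le> B"
proof -
  have bd': "norm (g' t - g' (- t)) \<le> 2 * B" if t: "0 < t" "t < 1" for t
  proof -
    have "continuous_on {- t..t} g'"
      using g' by (intro continuous_at_imp_continuous_on) (auto intro: has_vector_derivative_continuous)
    moreover have "(g' has_derivative (\<lambda>h. h *\<^sub>R g'' s)) (at s)" for s
      using g' by (simp add: has_vector_derivative_def)
    ultimately obtain s where s: "s \<in> {- t<..<t}" "norm (g' t - g' (- t)) \<le> norm ((t - - t) *\<^sub>R g'' s)"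
      using mvt_general[of "- t" t g' "\<lambda>s h. h *\<^sub>R g'' s"] t by auto
    have "\<bar>s\<bar> \<le> 1" using s t by auto
    then have "t * norm (g'' s) \<le> 1 * B"
      using B[of s] t by (intro mult_mono) auto
    then have "norm ((t - - t) *\<^sub>R g'' s) \<le> 2 * B"
      using t by simp
    with s(2) show ?thesis by linarith
  qed
  let ?k = "\<lambda>t. g t + g (- t)"
  have k: "(?k has_vector_derivative (g' t - g' (- t))) (at t)" for t
  proof -
    have "((\<lambda>t::real. - t) has_vector_derivative - 1) (at t)" by (auto intro!: derivative_eq_intros)
    from vector_diff_chain_at[OF this, of g "g' (- t)"] g[of "- t"]
    have "((\<lambda>t. g (- t)) has_vector_derivative - g' (- t)) (at t)" by (simp add: o_def)
    from has_vector_derivative_add[OF g this] show ?thesis by simp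
  qed
  have "continuous_on {0..1} ?k"
    using k by (intro continuous_at_imp_continuous_on) (auto intro: has_vector_derivative_continuous)
  moreover have "(?k has_derivative (\<lambda>h. h *\<^sub>R (g' s - g' (- s)))) (at s)" for s
    using k by (simp add: has_vector_derivative_def)
  ultimately obtain s where s: "s \<in> {0<..<1}" "norm (?k 1 - ?k 0) \<le> norm ((1 - 0) *\<^sub>R (g' s - g' (- s)))"
    using mvt_general[of 0 1 ?k "\<lambda>s h. h *\<^sub>R (g' s - g' (- s))"] by auto
  then have "norm (?k 1 - ?k 0) \<le> 2 * B" using bd'[of s] by simp
  moreover have "g 0 - g (-1) / 2 - g 1 / 2 = (- 1 / 2) *\<^sub>R (?k 1 - ?k 0)"
    by (simp add: scaleR_conv_of_real field_simps)
  ultimately show ?thesis by (simp only: norm_scaleR)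
qed

text \<open>The second derivative of the transform along \<eta> is, up to a constant, the transform
  of (x \<bullet> \<eta>)^2 f, again a test function, so it decays as fast as desired. The factor
  \<open>?E\<close> compares 1 + |\<zeta>|^2 with its value at points shifted by at most
  |\<eta>|.\<close>

lemma fourier_second_difference:
  fixes f :: "real^'n \<Rightarrow> complex"
  assumes f: "test_function f"
  obtains C where "C \<ge> 0" "\<And>\<zeta> s. \<bar>s\<bar> \<le> 1 \<Longrightarrow>
    norm (fourier f \<zeta> - fourier f (\<zeta> - s *\<^sub>R \<eta>) / 2 - fourier f (\<zeta> + s *\<^sub>R \<eta>) / 2) \<le> C * s\<^sup>2 / (1 + (norm \<zeta>)\<^sup>2) ^ N"
proof -
  let ?f1 = "\<lambda>x. of_real (x \<bullet> \<eta>) * f x" and ?f2 = "\<lambda>x. of_real (x \<bullet> \<eta>) * (of_real (x \<bullet> \<eta>) * f x)"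
  have t1: "test_function ?f1" and t2: "test_function ?f2" by (intro test_function_inner_mult f)+
  obtain C where C: "C > 0" "\<And>\<xi>. norm (fourier ?f2 \<xi>) \<le> C / (1 + (norm \<xi>)\<^sup>2) ^ N"
    by (erule fourier_test_decay[OF t2, where N=N])
  let ?E = "2 * (1 + (norm \<eta>)\<^sup>2)"
  have E: "?E > 0" by (intro mult_pos_pos add_pos_nonneg) auto
  show ?thesis
  proof (rule that[of "4 * pi\<^sup>2 * C * ?E ^ N"])
    show "0 \<le> 4 * pi\<^sup>2 * C * ?E ^ N" using C E by simp
    fix \<zeta> :: "real^'n" and s :: real assume s: "\<bar>s\<bar> \<le> 1"
    let ?e = "s *\<^sub>R \<eta>" and ?c = "- (2 * complex_of_real pi * \<i>)"
    have fs: "(\<lambda>x. of_real (x \<bullet> ?e) * u x) = (\<lambda>x. s *\<^sub>R (of_real (x \<bullet> \<eta>) * u x))" for u :: "real^'n \<Rightarrow> complex"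
      by (simp add: scaleR_conv_of_real[where 'a=complex] mult.assoc)
    have fsc: "fourier (\<lambda>x. s *\<^sub>R u x) \<xi> = s *\<^sub>R fourier u \<xi>" for u :: "real^'n \<Rightarrow> complex" and \<xi>
      by (simp add: fourier_def)
    have g: "((\<lambda>t. fourier f (\<zeta> + t *\<^sub>R ?e)) has_vector_derivative ?c * (s *\<^sub>R fourier ?f1 (\<zeta> + t *\<^sub>R ?e))) (at t)" for t
      using fourier_has_vector_derivative[OF f, of \<zeta> ?e t] by (simp only: fs fsc)
    have "((\<lambda>t. fourier ?f1 (\<zeta> + t *\<^sub>R ?e)) has_vector_derivative ?c * (s *\<^sub>R fourier ?f2 (\<zeta> + t *\<^sub>R ?e))) (at t)" for t
      using fourier_has_vector_derivative[OF t1, of \<zeta> ?e t] by (simp only: fs fsc)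
    then have g': "((\<lambda>t. (?c * of_real s) * fourier ?f1 (\<zeta> + t *\<^sub>R ?e)) has_vector_derivative (?c * of_real s) * (?c * (s *\<^sub>R fourier ?f2 (\<zeta> + t *\<^sub>R ?e)))) (at t)" for t
      by (rule has_vector_derivative_mult_right)
    have "norm (fourier f (\<zeta> + 0 *\<^sub>R ?e) - fourier f (\<zeta> + (-1) *\<^sub>R ?e) / 2 - fourier f (\<zeta> + 1 *\<^sub>R ?e) / 2)
        \<le> 4 * pi\<^sup>2 * s\<^sup>2 * (C * ?E ^ N / (1 + (norm \<zeta>)\<^sup>2) ^ N)"
    proof (rule second_difference_le[where g="\<lambda>t. fourier f (\<zeta> + t *\<^sub>R ?e)", OF _ g'])
      show "((\<lambda>t. fourier f (\<zeta> + t *\<^sub>R ?e)) has_vector_derivative (?c * of_real s) * fourier ?f1 (\<zeta> + t *\<^sub>R ?e)) (at t)" for t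
        using g[of t] by (simp add: scaleR_conv_of_real mult.assoc)
      fix t :: real assume t: "\<bar>t\<bar> \<le> 1"
      let ?z = "\<zeta> + t *\<^sub>R ?e"
      have p: "1 + (norm \<zeta>)\<^sup>2 \<le> ?E * (1 + (norm ?z)\<^sup>2)"
      proof -
        have ts: "\<bar>t * s\<bar> \<le> 1" using s t by (simp add: abs_mult mult_le_one)
        have "norm \<zeta> \<le> norm ?z + norm (t *\<^sub>R ?e)" using norm_triangle_ineq4[of ?z "t *\<^sub>R ?e"] by simp
        also have "norm (t *\<^sub>R ?e) = \<bar>t * s\<bar> * norm \<eta>" by (simp add: abs_mult)
        also have "\<dots> \<le> norm \<eta>" using ts by (intro mult_left_le_one_le) auto
        finally have "(norm \<zeta>)\<^sup>2 \<le> (norm ?z + norm \<eta>)\<^sup>2" by (intro power_mono) auto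
        also have "\<dots> \<le> 2 * (norm ?z)\<^sup>2 + 2 * (norm \<eta>)\<^sup>2"
          using zero_le_power2[of "norm ?z - norm \<eta>"] by (simp add: power2_eq_square algebra_simps)
        finally have "(norm \<zeta>)\<^sup>2 \<le> 2 * (norm ?z)\<^sup>2 + 2 * (norm \<eta>)\<^sup>2" .
        moreover have "0 \<le> (norm \<eta>)\<^sup>2 * (norm ?z)\<^sup>2" by simp
        moreover have "?E * (1 + (norm ?z)\<^sup>2) = 2 + 2 * (norm ?z)\<^sup>2 + 2 * (norm \<eta>)\<^sup>2 + 2 * ((norm \<eta>)\<^sup>2 * (norm ?z)\<^sup>2)"
          by (simp only: distrib_left distrib_right mult_1_left mult_1_right mult.assoc)
        ultimately show ?thesis by linarith
      qed
      have pz: "1 + (norm ?z)\<^sup>2 > 0" "1 + (norm \<zeta>)\<^sup>2 > 0" by (intro add_pos_nonneg; simp)+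
      have "(1 + (norm \<zeta>)\<^sup>2) ^ N \<le> (?E * (1 + (norm ?z)\<^sup>2)) ^ N" using p pz by (intro power_mono) auto
      then have "C / (1 + (norm ?z)\<^sup>2) ^ N \<le> C * ?E ^ N / (1 + (norm \<zeta>)\<^sup>2) ^ N"
        using pz C(1) by (simp add: divide_le_eq power_mult_distrib pos_le_divide_eq mult.commute mult_left_mono)
      with C(2)[of ?z] have "norm (fourier ?f2 ?z) \<le> C * ?E ^ N / (1 + (norm \<zeta>)\<^sup>2) ^ N" by linarith
      then have "4 * pi\<^sup>2 * s\<^sup>2 * norm (fourier ?f2 ?z) \<le> 4 * pi\<^sup>2 * s\<^sup>2 * (C * ?E ^ N / (1 + (norm \<zeta>)\<^sup>2) ^ N)"
        by (intro mult_left_mono) auto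
      moreover have "norm ((?c * of_real s) * (?c * (s *\<^sub>R fourier ?f2 ?z))) = 4 * pi\<^sup>2 * s\<^sup>2 * norm (fourier ?f2 ?z)"
        by (simp add: norm_mult power2_eq_square mult_ac)
      ultimately show "norm ((?c * of_real s) * (?c * (s *\<^sub>R fourier ?f2 ?z))) \<le> 4 * pi\<^sup>2 * s\<^sup>2 * (C * ?E ^ N / (1 + (norm \<zeta>)\<^sup>2) ^ N)"
        by linarith
    qed
    then show "norm (fourier f \<zeta> - fourier f (\<zeta> - s *\<^sub>R \<eta>) / 2 - fourier f (\<zeta> + s *\<^sub>R \<eta>) / 2) \<le> 4 * pi\<^sup>2 * C * ?E ^ N * s\<^sup>2 / (1 + (norm \<zeta>)\<^sup>2) ^ N"
      by (simp add: mult_ac)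
  qed
qed


section \<open>The density of K and the multiplier\<close>

text \<open>\<open>\<kappa>\<close> is a Borel version of the density of K, nonnegative also at the
  origin. The pairing formula is restricted to test functions vanishing near the origin; how
  singular \<open>\<kappa>\<close> is there is left to be derived.\<close>

locale kernel_pair = radial_kernel b r for b and r :: "real^'n \<Rightarrow> real" +
  fixes \<kappa> :: "real^'n \<Rightarrow> real"
  assumes \<kappa>_measurable[measurable]: "\<kappa> \<in> borel_measurable borel" and \<kappa>_nonneg: "\<And>x. \<kappa> x \<ge> 0"
    and \<kappa>_pairing: "\<And>\<phi>. test_function \<phi> \<Longrightarrow> 0 \<notin> fun_support \<phi> \<Longrightarrow>
      integrable lborel (\<lambda>x. of_real (\<kappa> x) * \<phi> x) \<and>
      (LINT x|lborel. of_real (\<kappa> x) * \<phi> x)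
        = - (LINT \<xi>|lborel. of_real ((norm (Lam \<xi>))\<^sup>2) * fourier \<phi> (- \<xi>))"

context radial_kernel
begin

text \<open>One majorant for all dilations and shifts of bounded size, as dominated convergence
  along varying parameters demands; it rests on the quadratic growth bound for \<open>Lam\<close>
  and the decay of the transform.\<close>

lemma integrable_Lam_fourier:
  fixes f :: "real^'n \<Rightarrow> complex"
  assumes f: "test_function f"
  obtains C where "integrable lborel (\<lambda>\<zeta>. C * ((1 + (norm \<zeta>)\<^sup>2) ^ 1 * norm (fourier f \<zeta>)))"
    "\<And>s a \<zeta>. \<bar>s\<bar> \<le> S \<Longrightarrow> norm a \<le> S \<Longrightarrow>
      norm (complex_of_real ((norm (Lam (s *\<^sub>R \<zeta> + a)))\<^sup>2) * fourier f \<zeta>) \<le> C * ((1 + (norm \<zeta>)\<^sup>2) ^ 1 * norm (fourier f \<zeta>))"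
proof -
  obtain C where C: "C \<ge> 0" "\<And>\<xi>. (norm (Lam \<xi>))\<^sup>2 \<le> C * (1 + (norm \<xi>)\<^sup>2)"
    using Lam_square_bound by metis
  show ?thesis
  proof (rule that[of "C * (1 + 2 * S\<^sup>2)"])
    show "integrable lborel (\<lambda>\<zeta>. C * (1 + 2 * S\<^sup>2) * ((1 + (norm \<zeta>)\<^sup>2) ^ 1 * norm (fourier f \<zeta>)))"
      by (intro integrable_mult_right integrable_weight_fourier f)
    fix s :: real and a \<zeta> :: "real^'n" assume s: "\<bar>s\<bar> \<le> S" and a: "norm a \<le> S"
    have "norm (s *\<^sub>R \<zeta> + a) \<le> \<bar>s\<bar> * norm \<zeta> + norm a" using norm_triangle_ineq[of "s *\<^sub>R \<zeta>" a] by simp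
    also have "\<dots> \<le> S * norm \<zeta> + S" using s a by (intro add_mono mult_right_mono) auto
    finally have "(norm (s *\<^sub>R \<zeta> + a))\<^sup>2 \<le> (S * norm \<zeta> + S)\<^sup>2" by (intro power_mono) auto
    also have "\<dots> \<le> 2 * S\<^sup>2 * (1 + (norm \<zeta>)\<^sup>2)"
      using zero_le_power2[of "S * norm \<zeta> - S"] by (simp add: power2_eq_square algebra_simps)
    also have "\<dots> \<le> (1 + 2 * S\<^sup>2) * (1 + (norm \<zeta>)\<^sup>2) - 1"
      by (simp add: algebra_simps)
    finally have "1 + (norm (s *\<^sub>R \<zeta> + a))\<^sup>2 \<le> (1 + 2 * S\<^sup>2) * (1 + (norm \<zeta>)\<^sup>2)" by simp
    then have "(norm (Lam (s *\<^sub>R \<zeta> + a)))\<^sup>2 \<le> C * ((1 + 2 * S\<^sup>2) * (1 + (norm \<zeta>)\<^sup>2))"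
      using C by (meson mult_left_mono order_trans)
    then have "(norm (Lam (s *\<^sub>R \<zeta> + a)))\<^sup>2 * norm (fourier f \<zeta>) \<le> C * ((1 + 2 * S\<^sup>2) * (1 + (norm \<zeta>)\<^sup>2)) * norm (fourier f \<zeta>)"
      by (intro mult_right_mono) auto
    then show "norm (complex_of_real ((norm (Lam (s *\<^sub>R \<zeta> + a)))\<^sup>2) * fourier f \<zeta>) \<le> C * (1 + 2 * S\<^sup>2) * ((1 + (norm \<zeta>)\<^sup>2) ^ 1 * norm (fourier f \<zeta>))"
      by (simp add: norm_mult norm_power mult_ac)
  qed
qed

lemma Lam_fourier_integrable:
  fixes f :: "real^'n \<Rightarrow> complex"
  assumes f: "test_function f"
  shows "integrable lborel (\<lambda>\<zeta>. complex_of_real ((norm (Lam (s *\<^sub>R \<zeta> + a)))\<^sup>2) * fourier f \<zeta>)"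
proof -
  have [measurable]: "fourier f \<in> borel_measurable borel" by (rule fourier_test_measurable[OF f])
  obtain C where C: "integrable lborel (\<lambda>\<zeta>. C * ((1 + (norm \<zeta>)\<^sup>2) ^ 1 * norm (fourier f \<zeta>)))"
    "\<And>s' a' \<zeta>. \<bar>s'\<bar> \<le> max \<bar>s\<bar> (norm a) \<Longrightarrow> norm a' \<le> max \<bar>s\<bar> (norm a) \<Longrightarrow>
      norm (complex_of_real ((norm (Lam (s' *\<^sub>R \<zeta> + a')))\<^sup>2) * fourier f \<zeta>) \<le> C * ((1 + (norm \<zeta>)\<^sup>2) ^ 1 * norm (fourier f \<zeta>))"
    using integrable_Lam_fourier[OF f, of "max \<bar>s\<bar> (norm a)"] by blast
  show ?thesis
    by (rule integrable_integral_cong_bound[OF C(1) _ C(2)]) auto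
qed

text \<open>As the dilation factor tends to zero the multiplier freezes at its value at
  \<open>a\<close>, and the remaining integral of the transform is \<open>f 0\<close> by Fourier
  inversion.\<close>

lemma Lam_fourier_tendsto:
  fixes f :: "real^'n \<Rightarrow> complex"
  assumes f: "test_function f" and s: "s \<longlonglongrightarrow> 0" "\<And>k. \<bar>s k\<bar> \<le> 1"
  shows "(\<lambda>k. LINT \<zeta>|lborel. complex_of_real ((norm (Lam (s k *\<^sub>R \<zeta> + a)))\<^sup>2) * fourier f \<zeta>)
    \<longlonglongrightarrow> of_real ((norm (Lam a))\<^sup>2) * f 0"
proof -
  have [measurable]: "fourier f \<in> borel_measurable borel" by (rule fourier_test_measurable[OF f])
  obtain C where C: "integrable lborel (\<lambda>\<zeta>. C * ((1 + (norm \<zeta>)\<^sup>2) ^ 1 * norm (fourier f \<zeta>)))"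
    "\<And>s' a' \<zeta>. \<bar>s'\<bar> \<le> max 1 (norm a) \<Longrightarrow> norm a' \<le> max 1 (norm a) \<Longrightarrow>
      norm (complex_of_real ((norm (Lam (s' *\<^sub>R \<zeta> + a')))\<^sup>2) * fourier f \<zeta>) \<le> C * ((1 + (norm \<zeta>)\<^sup>2) ^ 1 * norm (fourier f \<zeta>))"
    using integrable_Lam_fourier[OF f, of "max 1 (norm a)"] by blast
  have "(\<lambda>k. LINT \<zeta>|lborel. complex_of_real ((norm (Lam (s k *\<^sub>R \<zeta> + a)))\<^sup>2) * fourier f \<zeta>)
    \<longlonglongrightarrow> (LINT \<zeta>|lborel. of_real ((norm (Lam a))\<^sup>2) * fourier f \<zeta>)"
  proof (rule integral_dominated_convergence[OF _ _ C(1)])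
    show "AE \<zeta> in lborel. (\<lambda>k. complex_of_real ((norm (Lam (s k *\<^sub>R \<zeta> + a)))\<^sup>2) * fourier f \<zeta>)
        \<longlonglongrightarrow> of_real ((norm (Lam a))\<^sup>2) * fourier f \<zeta>"
    proof (rule AE_I2)
      fix \<zeta> :: "real^'n"
      have "(\<lambda>k. s k *\<^sub>R \<zeta> + a) \<longlonglongrightarrow> 0 *\<^sub>R \<zeta> + a" by (intro tendsto_intros s)
      then have "(\<lambda>k. Lam (s k *\<^sub>R \<zeta> + a)) \<longlonglongrightarrow> Lam (0 *\<^sub>R \<zeta> + a)"
        using continuous_on_Lam by (intro isCont_tendsto_compose[of _ Lam]) (auto simp: continuous_on_eq_continuous_at)
      then show "(\<lambda>k. complex_of_real ((norm (Lam (s k *\<^sub>R \<zeta> + a)))\<^sup>2) * fourier f \<zeta>)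
        \<longlonglongrightarrow> of_real ((norm (Lam a))\<^sup>2) * fourier f \<zeta>"
        by (intro tendsto_intros) simp
    qed
    fix k
    have "\<bar>s k\<bar> \<le> max 1 (norm a)" using s(2)[of k] by linarith
    then show "AE \<zeta> in lborel. norm (complex_of_real ((norm (Lam (s k *\<^sub>R \<zeta> + a)))\<^sup>2) * fourier f \<zeta>)
        \<le> C * ((1 + (norm \<zeta>)\<^sup>2) ^ 1 * norm (fourier f \<zeta>))"
      by (intro AE_I2 C(2)) auto
  qed auto
  also have "(LINT \<zeta>|lborel. of_real ((norm (Lam a))\<^sup>2) * fourier f \<zeta>) = of_real ((norm (Lam a))\<^sup>2) * f 0"
    using fourier_inversion_test[OF f, of 0] by simp
  finally show ?thesis .
qed

end

text \<open>Since the cosine is the mean of two opposite characters, multiplication by 1 - cos(2 pi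
  h \<bullet> \<eta>) becomes a symmetric second difference with step \<eta> of the transform.
  Evaluating at s \<zeta> moves the dilation into the step, which becomes \<eta>/s.\<close>

lemma fourier_modulated:
  fixes f :: "real^'n \<Rightarrow> complex"
  assumes f: "test_function f" and s: "s > 0"
  shows "fourier (\<lambda>h. of_real (1 - cos (2 * pi * (h \<bullet> \<eta>))) * f (s *\<^sub>R h)) (s *\<^sub>R \<zeta>)
    = (fourier f \<zeta> - fourier f (\<zeta> - (1 / s) *\<^sub>R \<eta>) / 2 - fourier f (\<zeta> + (1 / s) *\<^sub>R \<eta>) / 2) / of_real (s ^ DIM(real^'n))"
proof -
  have [measurable]: "f \<in> borel_measurable borel" by (rule test_function_measurable[OF f])
  have tf: "test_function (\<lambda>h. f (s *\<^sub>R h))" using test_function_affine[OF f, of s 0] s by simp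
  let ?g = "\<lambda>\<xi> h. f (s *\<^sub>R h) * cis (- (2 * pi * (h \<bullet> \<xi>)))"
  have i: "integrable lborel (?g \<xi>)" for \<xi>
    by (intro integrable_mult_cis test_function_integrable tf) measurable
  have sc: "(LINT h|lborel. ?g (s *\<^sub>R \<zeta> + \<xi>) h) = fourier f (\<zeta> + (1 / s) *\<^sub>R \<xi>) / of_real (s ^ DIM(real^'n))" for \<xi>
  proof -
    have "fourier f (\<zeta> + (1 / s) *\<^sub>R \<xi>) = (\<bar>s\<bar> ^ DIM(real^'n)) *\<^sub>R (LINT h|lborel. f (0 + s *\<^sub>R h) * cis (- (2 * pi * ((0 + s *\<^sub>R h) \<bullet> (\<zeta> + (1 / s) *\<^sub>R \<xi>)))))"
      unfolding fourier_eq[OF \<open>f \<in> borel_measurable borel\<close>] using s by (intro integral_lborel_affine) auto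
    also have "(\<lambda>h. f (0 + s *\<^sub>R h) * cis (- (2 * pi * ((0 + s *\<^sub>R h) \<bullet> (\<zeta> + (1 / s) *\<^sub>R \<xi>))))) = ?g (s *\<^sub>R \<zeta> + \<xi>)"
      using s by (simp add: fun_eq_iff inner_add_right distrib_left)
    finally show ?thesis using s by (simp add: scaleR_conv_of_real)
  qed
  have "fourier (\<lambda>h. of_real (1 - cos (2 * pi * (h \<bullet> \<eta>))) * f (s *\<^sub>R h)) (s *\<^sub>R \<zeta>)
    = (LINT h|lborel. of_real (1 - cos (2 * pi * (h \<bullet> \<eta>))) * f (s *\<^sub>R h) * cis (- (2 * pi * (h \<bullet> (s *\<^sub>R \<zeta>)))))"
    by (rule fourier_eq) measurable
  also have "\<dots> = (LINT h|lborel. ?g (s *\<^sub>R \<zeta> + 0) h - ?g (s *\<^sub>R \<zeta> + - \<eta>) h / 2 - ?g (s *\<^sub>R \<zeta> + \<eta>) h / 2)"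
  proof (intro Bochner_Integration.integral_cong refl)
    fix h
    have "cis (- (2 * pi * (h \<bullet> (s *\<^sub>R \<zeta> + - \<eta>)))) + cis (- (2 * pi * (h \<bullet> (s *\<^sub>R \<zeta> + \<eta>))))
        = cis (- (2 * pi * (h \<bullet> (s *\<^sub>R \<zeta>)))) * (2 * of_real (cos (2 * pi * (h \<bullet> \<eta>))))"
    proof -
      have "2 * of_real (cos a) = cis a + cis (- a)" for a by (simp add: complex_eq_iff)
      then show ?thesis by (simp add: distrib_left cis_mult inner_add_right inner_diff_right algebra_simps)
    qed
    then have e: "of_real (cos (2 * pi * (h \<bullet> \<eta>))) * cis (- (2 * pi * (h \<bullet> (s *\<^sub>R \<zeta>))))
        = (cis (- (2 * pi * (h \<bullet> (s *\<^sub>R \<zeta> + - \<eta>)))) + cis (- (2 * pi * (h \<bullet> (s *\<^sub>R \<zeta> + \<eta>))))) / 2"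
      by simp
    have "of_real (1 - cos (2 * pi * (h \<bullet> \<eta>))) * f (s *\<^sub>R h) * cis (- (2 * pi * (h \<bullet> (s *\<^sub>R \<zeta>))))
      = f (s *\<^sub>R h) * (cis (- (2 * pi * (h \<bullet> (s *\<^sub>R \<zeta>)))) - of_real (cos (2 * pi * (h \<bullet> \<eta>))) * cis (- (2 * pi * (h \<bullet> (s *\<^sub>R \<zeta>)))))"
      by (simp add: algebra_simps)
    then show "of_real (1 - cos (2 * pi * (h \<bullet> \<eta>))) * f (s *\<^sub>R h) * cis (- (2 * pi * (h \<bullet> (s *\<^sub>R \<zeta>))))
      = ?g (s *\<^sub>R \<zeta> + 0) h - ?g (s *\<^sub>R \<zeta> + - \<eta>) h / 2 - ?g (s *\<^sub>R \<zeta> + \<eta>) h / 2"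
      unfolding e by (simp add: right_diff_distrib distrib_left add_divide_distrib)
  qed
  also have "\<dots> = (LINT h|lborel. ?g (s *\<^sub>R \<zeta> + 0) h) - (LINT h|lborel. ?g (s *\<^sub>R \<zeta> + - \<eta>) h) / 2 - (LINT h|lborel. ?g (s *\<^sub>R \<zeta> + \<eta>) h) / 2"
    by (simp only: Bochner_Integration.integral_diff Bochner_Integration.integrable_diff integrable_divide i integral_divide_zero)
  finally show ?thesis
    unfolding sc by (simp add: diff_divide_distrib mult.commute)
qed

section \<open>The squared multiplier as a functional on test functions\<close>

context radial_kernel
begin

text \<open>The negative of the pairing with K. It is used also for test functions that do not
  vanish near the origin, on which the density of K says nothing.\<close>

definition J :: "(real^'n \<Rightarrow> complex) \<Rightarrow> complex" where
  "J \<phi> = (LINT \<xi>|lborel. of_real ((norm (Lam \<xi>))\<^sup>2) * fourier \<phi> (- \<xi>))"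

lemma J_integrable:
  assumes "test_function \<phi>"
  shows "integrable lborel (\<lambda>\<xi>. complex_of_real ((norm (Lam \<xi>))\<^sup>2) * fourier \<phi> (- \<xi>))"
proof -
  have "integrable lborel (\<lambda>\<zeta>. complex_of_real ((norm (Lam (- \<zeta>)))\<^sup>2) * fourier \<phi> \<zeta>)"
    using Lam_fourier_integrable[OF assms, of "-1" 0] by simp
  from integrable_lborel_affine[OF this, of "-1" 0] show ?thesis by simp
qed

lemma J_diff:
  assumes "test_function \<phi>" "test_function \<psi>"
  shows "J (\<lambda>x. \<phi> x - \<psi> x) = J \<phi> - J \<psi>"
proof -
  have i: "integrable lborel (\<lambda>x. u x * cis (- (2 * pi * (x \<bullet> \<xi>))))" if "test_function u" for u and \<xi> :: "real^'n"
    by (intro integrable_mult_cis test_function_integrable that) measurable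
  have "fourier (\<lambda>x. \<phi> x - \<psi> x) \<xi> = fourier \<phi> \<xi> - fourier \<psi> \<xi>" for \<xi>
    using i assms test_function_diff[OF assms]
    by (simp add: fourier_eq test_function_measurable left_diff_distrib)
  then show ?thesis
    unfolding J_def
    by (simp only: right_diff_distrib Bochner_Integration.integral_diff[OF J_integrable[OF assms(1)] J_integrable[OF assms(2)]])
qed

lemma J_modulated:
  fixes f :: "real^'n \<Rightarrow> complex"
  assumes f: "test_function f" and s: "s > 0"
  shows "J (\<lambda>h. of_real (1 - cos (2 * pi * (h \<bullet> \<eta>))) * f (s *\<^sub>R h))
    = (LINT \<zeta>|lborel. of_real ((norm (Lam (s *\<^sub>R \<zeta>)))\<^sup>2) *
        (fourier f \<zeta> - fourier f (\<zeta> - (1 / s) *\<^sub>R \<eta>) / 2 - fourier f (\<zeta> + (1 / s) *\<^sub>R \<eta>) / 2))"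
proof -
  let ?T = "\<lambda>h. of_real (1 - cos (2 * pi * (h \<bullet> \<eta>))) * f (s *\<^sub>R h)"
  let ?S = "\<lambda>\<zeta>. fourier f \<zeta> - fourier f (\<zeta> - (1 / s) *\<^sub>R \<eta>) / 2 - fourier f (\<zeta> + (1 / s) *\<^sub>R \<eta>) / 2"
  let ?n = "DIM(real^'n)"
  have "J ?T = (\<bar>- s\<bar> ^ ?n) *\<^sub>R (LINT \<zeta>|lborel. of_real ((norm (Lam (0 + (- s) *\<^sub>R \<zeta>)))\<^sup>2) * fourier ?T (- (0 + (- s) *\<^sub>R \<zeta>)))"
    unfolding J_def using s by (intro integral_lborel_affine) auto
  also have "\<dots> = (s ^ ?n) *\<^sub>R (LINT \<zeta>|lborel. (of_real ((norm (Lam (s *\<^sub>R \<zeta>)))\<^sup>2) * ?S \<zeta>) / of_real (s ^ ?n))"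
    using s fourier_modulated[OF f s, of \<eta>] by (simp add: Lam_minus)
  also have "\<dots> = (LINT \<zeta>|lborel. of_real ((norm (Lam (s *\<^sub>R \<zeta>)))\<^sup>2) * ?S \<zeta>)"
    unfolding integral_divide_zero using s by (simp add: scaleR_conv_of_real)
  finally show ?thesis .
qed

text \<open>Shifting the integration variable moves the second difference from the transform to the
  multiplier. The three terms then converge to the squared multiplier at 0, \<eta> and -\<eta> with
  the weights 1, -1/2 and -1/2; the first vanishes and the other two are equal.\<close>

lemma J_modulated_dilated:
  fixes f :: "real^'n \<Rightarrow> complex"
  assumes f: "test_function f"
  shows "(\<lambda>k. J (\<lambda>h. of_real (1 - cos (2 * pi * (h \<bullet> \<eta>))) * f ((1 / real (Suc k)) *\<^sub>R h))) \<longlonglongrightarrow> - of_real ((norm (Lam \<eta>))\<^sup>2) * f 0"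
proof -
  let ?s = "\<lambda>k. 1 / real (Suc k)"
  let ?I = "\<lambda>a k. LINT \<zeta>|lborel. complex_of_real ((norm (Lam (?s k *\<^sub>R \<zeta> + a)))\<^sup>2) * fourier f \<zeta>"
  have eq: "J (\<lambda>h. of_real (1 - cos (2 * pi * (h \<bullet> \<eta>))) * f (?s k *\<^sub>R h)) = ?I 0 k - ?I \<eta> k / 2 - ?I (- \<eta>) k / 2" for k
  proof -
    let ?m = "real (Suc k)"
    note i = Lam_fourier_integrable[OF f, of "?s k"]
    have shift: "integrable lborel (\<lambda>\<zeta>. of_real ((norm (Lam (?s k *\<^sub>R \<zeta>)))\<^sup>2) * fourier f (\<zeta> + ?m *\<^sub>R a))"
      "(LINT \<zeta>|lborel. of_real ((norm (Lam (?s k *\<^sub>R \<zeta>)))\<^sup>2) * fourier f (\<zeta> + ?m *\<^sub>R a)) = ?I (- a) k" for a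
    proof -
      let ?F = "\<lambda>\<zeta>. of_real ((norm (Lam (?s k *\<^sub>R \<zeta> + - a)))\<^sup>2) * fourier f \<zeta>"
      have e: "?F (\<zeta> + ?m *\<^sub>R a) = of_real ((norm (Lam (?s k *\<^sub>R \<zeta>)))\<^sup>2) * fourier f (\<zeta> + ?m *\<^sub>R a)" for \<zeta>
        by (simp add: scaleR_add_right del: of_nat_Suc)
      show "integrable lborel (\<lambda>\<zeta>. of_real ((norm (Lam (?s k *\<^sub>R \<zeta>)))\<^sup>2) * fourier f (\<zeta> + ?m *\<^sub>R a))"
        using i[of "- a"] integrable_lborel_translate[of ?F "?m *\<^sub>R a"] unfolding e by blast
      show "(LINT \<zeta>|lborel. of_real ((norm (Lam (?s k *\<^sub>R \<zeta>)))\<^sup>2) * fourier f (\<zeta> + ?m *\<^sub>R a)) = ?I (- a) k"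
        using integral_lborel_translate[of ?F "?m *\<^sub>R a"] unfolding e .
    qed
    have "J (\<lambda>h. of_real (1 - cos (2 * pi * (h \<bullet> \<eta>))) * f (?s k *\<^sub>R h))
      = (LINT \<zeta>|lborel. of_real ((norm (Lam (?s k *\<^sub>R \<zeta>)))\<^sup>2) *
        (fourier f \<zeta> - fourier f (\<zeta> - (1 / ?s k) *\<^sub>R \<eta>) / 2 - fourier f (\<zeta> + (1 / ?s k) *\<^sub>R \<eta>) / 2))"
      by (rule J_modulated[OF f]) simp
    also have "\<dots> = (LINT \<zeta>|lborel. of_real ((norm (Lam (?s k *\<^sub>R \<zeta>)))\<^sup>2) * fourier f (\<zeta> + ?m *\<^sub>R 0)
        - of_real ((norm (Lam (?s k *\<^sub>R \<zeta>)))\<^sup>2) * fourier f (\<zeta> + ?m *\<^sub>R (- \<eta>)) / 2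
        - of_real ((norm (Lam (?s k *\<^sub>R \<zeta>)))\<^sup>2) * fourier f (\<zeta> + ?m *\<^sub>R \<eta>) / 2)"
      by (intro Bochner_Integration.integral_cong refl) (simp add: right_diff_distrib del: of_nat_Suc)
    also have "\<dots> = ?I (- 0) k - ?I (- (- \<eta>)) k / 2 - ?I (- \<eta>) k / 2"
      by (simp only: Bochner_Integration.integral_diff Bochner_Integration.integrable_diff integrable_divide shift integral_divide_zero)
    finally show ?thesis by simp
  qed
  have "?s \<longlonglongrightarrow> 0" using LIMSEQ_Suc[OF lim_1_over_n] by simp
  then have "(\<lambda>k. ?I 0 k - ?I \<eta> k / 2 - ?I (- \<eta>) k / 2) \<longlonglongrightarrow>
      of_real ((norm (Lam 0))\<^sup>2) * f 0 - of_real ((norm (Lam \<eta>))\<^sup>2) * f 0 / 2 - of_real ((norm (Lam (- \<eta>)))\<^sup>2) * f 0 / 2"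
    by (intro tendsto_intros Lam_fourier_tendsto[OF f]) auto
  moreover have "of_real ((norm (Lam 0))\<^sup>2) * f 0 - of_real ((norm (Lam \<eta>))\<^sup>2) * f 0 / 2 - of_real ((norm (Lam (- \<eta>)))\<^sup>2) * f 0 / 2
      = - of_real ((norm (Lam \<eta>))\<^sup>2) * f 0"
    by (simp add: Lam_minus)
  ultimately show ?thesis by (simp only: eq)
qed

text \<open>The second difference with step \<eta>/m is O(1/m^2) with rapid decay, while the squared
  multiplier at m \<zeta>, divided by m^2, tends to zero by \<open>Lam_sublinear\<close>. One power
  of decay beyond the dimension absorbs the growth factor 1 + |\<zeta>|^2 in the majorant.\<close>

lemma J_modulated_concentrated:
  fixes f :: "real^'n \<Rightarrow> complex"
  assumes f: "test_function f"
  shows "(\<lambda>k. J (\<lambda>h. of_real (1 - cos (2 * pi * (h \<bullet> \<eta>))) * f (real (Suc k) *\<^sub>R h))) \<longlonglongrightarrow> 0"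
proof -
  let ?m = "\<lambda>k. real (Suc k)"
  let ?S = "\<lambda>k \<zeta>. fourier f \<zeta> - fourier f (\<zeta> - (1 / ?m k) *\<^sub>R \<eta>) / 2 - fourier f (\<zeta> + (1 / ?m k) *\<^sub>R \<eta>) / 2"
  let ?N = "Suc DIM(real^'n)"
  have [measurable]: "fourier f \<in> borel_measurable borel" by (rule fourier_test_measurable[OF f])
  obtain C where C: "C \<ge> 0" "\<And>\<zeta> s. \<bar>s\<bar> \<le> 1 \<Longrightarrow>
    norm (fourier f \<zeta> - fourier f (\<zeta> - s *\<^sub>R \<eta>) / 2 - fourier f (\<zeta> + s *\<^sub>R \<eta>) / 2) \<le> C * s\<^sup>2 / (1 + (norm \<zeta>)\<^sup>2) ^ ?N"
    using fourier_second_difference[OF f] by metis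
  obtain D where D: "D \<ge> 0" "\<And>\<xi>. (norm (Lam \<xi>))\<^sup>2 \<le> D * (1 + (norm \<xi>)\<^sup>2)"
    using Lam_square_bound by metis
  have w: "integrable lborel (\<lambda>\<zeta>::real^'n. C * D * (1 / (1 + (norm \<zeta>)\<^sup>2) ^ DIM(real^'n)))"
    by (intro integrable_mult_right integrable_weight) simp
  have bd: "norm (of_real ((norm (Lam (?m k *\<^sub>R \<zeta>)))\<^sup>2) * ?S k \<zeta>) \<le> (norm (Lam (?m k *\<^sub>R \<zeta>)))\<^sup>2 / (?m k)\<^sup>2 * (C / (1 + (norm \<zeta>)\<^sup>2) ^ ?N)" for k \<zeta>
  proof -
    have "norm (?S k \<zeta>) \<le> C * (1 / ?m k)\<^sup>2 / (1 + (norm \<zeta>)\<^sup>2) ^ ?N" by (rule C(2)) simp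
    then have "(norm (Lam (?m k *\<^sub>R \<zeta>)))\<^sup>2 * norm (?S k \<zeta>) \<le> (norm (Lam (?m k *\<^sub>R \<zeta>)))\<^sup>2 * (C * (1 / ?m k)\<^sup>2 / (1 + (norm \<zeta>)\<^sup>2) ^ ?N)"
      by (intro mult_left_mono) auto
    then show ?thesis by (simp add: norm_mult norm_power power_divide mult_ac del: of_nat_Suc power_Suc)
  qed
  have "(\<lambda>k. LINT \<zeta>|lborel. of_real ((norm (Lam (?m k *\<^sub>R \<zeta>)))\<^sup>2) * ?S k \<zeta>) \<longlonglongrightarrow> (LINT \<zeta>|(lborel :: (real^'n) measure). (0::complex))"
  proof (rule integral_dominated_convergence[OF _ _ w])
    show "AE \<zeta> in lborel. (\<lambda>k. of_real ((norm (Lam (?m k *\<^sub>R \<zeta>)))\<^sup>2) * ?S k \<zeta>) \<longlonglongrightarrow> 0"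
    proof (rule AE_I2)
      fix \<zeta> :: "real^'n"
      show "(\<lambda>k. of_real ((norm (Lam (?m k *\<^sub>R \<zeta>)))\<^sup>2) * ?S k \<zeta>) \<longlonglongrightarrow> 0"
      proof (rule Lim_null_comparison[OF always_eventually])
        show "\<forall>k. norm (of_real ((norm (Lam (?m k *\<^sub>R \<zeta>)))\<^sup>2) * ?S k \<zeta>) \<le> (norm (Lam (?m k *\<^sub>R \<zeta>)))\<^sup>2 / (?m k)\<^sup>2 * (C / (1 + (norm \<zeta>)\<^sup>2) ^ ?N)"
          using bd by blast
        show "(\<lambda>k. (norm (Lam (?m k *\<^sub>R \<zeta>)))\<^sup>2 / (?m k)\<^sup>2 * (C / (1 + (norm \<zeta>)\<^sup>2) ^ ?N)) \<longlonglongrightarrow> 0"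
          by (rule tendsto_mult_left_zero[OF Lam_sublinear])
      qed
    qed
    fix k
    have "norm (of_real ((norm (Lam (?m k *\<^sub>R \<zeta>)))\<^sup>2) * ?S k \<zeta>) \<le> C * D * (1 / (1 + (norm \<zeta>)\<^sup>2) ^ DIM(real^'n))" for \<zeta>
    proof -
      have p: "1 + (norm \<zeta>)\<^sup>2 > 0" by (intro add_pos_nonneg) auto
      have "(norm (Lam (?m k *\<^sub>R \<zeta>)))\<^sup>2 / (?m k)\<^sup>2 \<le> D * (1 + (norm \<zeta>)\<^sup>2)"
      proof -
        have "1 \<le> (?m k)\<^sup>2" by (simp add: one_le_power)
        then have "1 + (norm (?m k *\<^sub>R \<zeta>))\<^sup>2 \<le> (?m k)\<^sup>2 * (1 + (norm \<zeta>)\<^sup>2)"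
          by (simp add: power_mult_distrib distrib_left del: of_nat_Suc)
        then have "(norm (Lam (?m k *\<^sub>R \<zeta>)))\<^sup>2 \<le> D * ((?m k)\<^sup>2 * (1 + (norm \<zeta>)\<^sup>2))"
          using D by (meson mult_left_mono order_trans)
        then show ?thesis by (simp add: divide_le_eq mult_ac del: of_nat_Suc)
      qed
      then have "(norm (Lam (?m k *\<^sub>R \<zeta>)))\<^sup>2 / (?m k)\<^sup>2 * (C / (1 + (norm \<zeta>)\<^sup>2) ^ ?N) \<le> D * (1 + (norm \<zeta>)\<^sup>2) * (C / (1 + (norm \<zeta>)\<^sup>2) ^ ?N)"
        using C(1) p by (intro mult_right_mono) auto
      also have "\<dots> = C * D * (1 / (1 + (norm \<zeta>)\<^sup>2) ^ DIM(real^'n))" using p by simp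
      finally show ?thesis using bd[of k \<zeta>] by linarith
    qed
    then show "AE \<zeta> in lborel. norm (of_real ((norm (Lam (?m k *\<^sub>R \<zeta>)))\<^sup>2) * ?S k \<zeta>) \<le> C * D * (1 / (1 + (norm \<zeta>)\<^sup>2) ^ DIM(real^'n))"
      by simp
  qed measurable
  moreover have "J (\<lambda>h. of_real (1 - cos (2 * pi * (h \<bullet> \<eta>))) * f (?m k *\<^sub>R h)) = (LINT \<zeta>|lborel. of_real ((norm (Lam (?m k *\<^sub>R \<zeta>)))\<^sup>2) * ?S k \<zeta>)" for k
    by (rule J_modulated[OF f]) simp
  ultimately show ?thesis by simp
qed

end

context kernel_pair
begin

theorem kernel_multiplier:
  "(\<integral>\<^sup>+h. ennreal (\<kappa> h * (1 - cos (2 * pi * (h \<bullet> \<eta>)))) \<partial>lborel) = ennreal ((norm (Lam \<eta>))\<^sup>2)"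
proof -
  obtain \<theta> :: "real^'n \<Rightarrow> real" where \<theta>: "test_function \<theta>" "\<And>x. 0 \<le> \<theta> x" "\<And>x. \<theta> x \<le> 1"
    "\<And>x. norm x \<le> 1 \<Longrightarrow> \<theta> x = 1" "\<And>x. norm x > 3 \<Longrightarrow> \<theta> x = 0"
    using cutoff_exists by blast
  have [measurable]: "\<theta> \<in> borel_measurable borel" by (rule test_function_measurable[OF \<theta>(1)])
  \<comment> \<open>Starting at 2 ensures 3 \<le> m^2: wherever \<theta>(m h) is nonzero one has |h|
    \<le> 3/m \<le> m, so \<theta>(h/m) equals one there. This makes the difference of the two
    cutoffs nonnegative.\<close>
  let ?m = "\<lambda>k. real (Suc (Suc k))"
  let ?c = "\<lambda>h. 1 - cos (2 * pi * (h \<bullet> \<eta>))"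
  let ?f = "\<lambda>x. complex_of_real (\<theta> x)"
  let ?A = "\<lambda>k h. complex_of_real (?c h) * ?f ((1 / ?m k) *\<^sub>R h)"
  let ?B = "\<lambda>k h. complex_of_real (?c h) * ?f (?m k *\<^sub>R h)"
  define \<phi> where "\<phi> k h = (\<theta> ((1 / ?m k) *\<^sub>R h) - \<theta> (?m k *\<^sub>R h)) * ?c h" for k h
  have c0: "?c h \<ge> 0" for h by simp
  have tf: "test_function ?f" by (rule test_function_of_real[OF \<theta>(1)])
  have "smooth (\<lambda>h::real^'n. ?c h)"
    using smooth_diff[OF smooth_const smooth_cos_inner[of "(2 * pi) *\<^sub>R \<eta>"], of 1] by simp
  then have "smooth (\<lambda>h::real^'n. complex_of_real (?c h))"
    using smooth_bounded_linear[OF _ bounded_linear_of_real, of "\<lambda>h. ?c h"] by simp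
  then have t: "test_function (\<lambda>h. complex_of_real (?c h) * ?f (s *\<^sub>R h))" if "s \<noteq> 0" for s
    using test_function_affine[OF tf that, of 0] by (intro test_function_mult) auto
  have tA: "test_function (?A k)" and tB: "test_function (?B k)" for k by (intro t; simp)+
  have \<phi>_eq: "complex_of_real (\<phi> k h) = ?A k h - ?B k h" for k h
    by (simp add: \<phi>_def algebra_simps)
  have t\<phi>: "test_function (\<lambda>h. complex_of_real (\<phi> k h))" for k
    unfolding \<phi>_eq by (rule test_function_diff[OF tA tB])
  have supp: "0 \<notin> fun_support (\<lambda>h. complex_of_real (\<phi> k h))" for k
  proof -
    have "\<phi> k h = 0" if "h \<in> ball 0 (1 / ?m k)" for h
    proof -
      have "norm (?m k *\<^sub>R h) \<le> 1" using that by (simp add: field_simps del: of_nat_Suc)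
      moreover have "norm ((1 / ?m k) *\<^sub>R h) \<le> norm (?m k *\<^sub>R h)"
      proof -
        have "1 / ?m k \<le> 1" by simp
        also have "1 \<le> ?m k" by simp
        finally have "1 / ?m k \<le> ?m k" .
        from mult_right_mono[OF this norm_ge_zero[of h]] show ?thesis by (simp del: of_nat_Suc)
      qed
      ultimately show ?thesis by (simp add: \<phi>_def \<theta>(4) del: norm_scaleR of_nat_Suc)
    qed
    then have "fun_support (\<lambda>h. complex_of_real (\<phi> k h)) \<subseteq> - ball 0 (1 / ?m k)"
      unfolding fun_support_def by (intro closure_minimal) (auto simp: closed_Compl)
    moreover have "(0::real^'n) \<in> ball 0 (1 / ?m k)" by simp
    ultimately show ?thesis by blast
  qed
  have \<phi>0: "0 \<le> \<phi> k h" for k h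
  proof -
    have "\<theta> (?m k *\<^sub>R h) \<le> \<theta> ((1 / ?m k) *\<^sub>R h)"
    proof (cases "norm (?m k *\<^sub>R h) > 3")
      case True
      then show ?thesis using \<theta>(5)[OF True] \<theta>(2) by simp
    next
      case False
      then have "norm h \<le> 3 / ?m k" by (simp add: field_simps del: of_nat_Suc)
      also have "\<dots> \<le> ?m k"
      proof -
        have "3 \<le> ?m k * ?m k" by (simp add: algebra_simps)
        then show ?thesis by (simp add: divide_le_eq del: of_nat_Suc)
      qed
      finally have "norm ((1 / ?m k) *\<^sub>R h) \<le> 1" by (simp add: field_simps del: of_nat_Suc)
      then show ?thesis using \<theta>(4) \<theta>(3) by metis
    qed
    then show ?thesis unfolding \<phi>_def by (intro mult_nonneg_nonneg c0) simp
  qed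
  have \<phi>1: "\<phi> k h \<le> ?c h" for k h
  proof -
    have "\<theta> ((1 / ?m k) *\<^sub>R h) - \<theta> (?m k *\<^sub>R h) \<le> 1" using \<theta>(2)[of "?m k *\<^sub>R h"] \<theta>(3)[of "(1 / ?m k) *\<^sub>R h"] by linarith
    from mult_right_mono[OF this c0] show ?thesis unfolding \<phi>_def by simp
  qed
  have lim: "(\<lambda>k. \<phi> k h) \<longlonglongrightarrow> ?c h" if "h \<noteq> 0" for h
  proof -
    obtain k1 where k1: "norm h \<le> real k1" using real_arch_simple by blast
    obtain k2 where k2: "3 / norm h \<le> real k2" using real_arch_simple by blast
    have "\<forall>\<^sub>F k in sequentially. ?c h = \<phi> k h"
    proof (rule eventually_sequentiallyI[of "max k1 k2"])
      fix k assume k: "max k1 k2 \<le> k"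
      have "norm h \<le> ?m k" using k k1 by simp
      then have "norm ((1 / ?m k) *\<^sub>R h) \<le> 1" by (simp add: field_simps del: of_nat_Suc)
      moreover have "norm (?m k *\<^sub>R h) > 3"
      proof -
        have "3 / norm h < ?m k" using k k2 by simp
        then show ?thesis using that by (simp add: divide_less_eq del: of_nat_Suc)
      qed
      ultimately show "?c h = \<phi> k h" by (simp add: \<phi>_def \<theta> del: norm_scaleR)
    qed
    then show ?thesis by (rule Lim_transform_eventually[OF tendsto_const])
  qed
  have [measurable]: "\<phi> k \<in> borel_measurable borel" for k unfolding \<phi>_def[abs_def] by measurable
  have i\<phi>: "integrable lborel (\<lambda>h. \<kappa> h * \<phi> k h)" for k
  proof -
    have "integrable lborel (\<lambda>x. complex_of_real (\<kappa> x * \<phi> k x))"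
      using \<kappa>_pairing[OF t\<phi> supp, of k] by simp
    then show ?thesis by (rule complex_of_real_integrable_eq[THEN iffD1])
  qed
  have "(\<lambda>k. J (?A k)) \<longlonglongrightarrow> - of_real ((norm (Lam \<eta>))\<^sup>2) * ?f 0"
    using LIMSEQ_Suc[OF J_modulated_dilated[OF tf, of \<eta>]] by simp
  moreover have "(\<lambda>k. J (?B k)) \<longlonglongrightarrow> 0"
    using LIMSEQ_Suc[OF J_modulated_concentrated[OF tf, of \<eta>]] by simp
  ultimately have "(\<lambda>k. - (J (?A k) - J (?B k))) \<longlonglongrightarrow> - (- of_real ((norm (Lam \<eta>))\<^sup>2) * ?f 0 - 0)"
    by (intro tendsto_intros)
  moreover have "of_real (LINT h|lborel. \<kappa> h * \<phi> k h) = - (J (?A k) - J (?B k))" for k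
  proof -
    have "of_real (LINT h|lborel. \<kappa> h * \<phi> k h) = (LINT h|lborel. of_real (\<kappa> h) * complex_of_real (\<phi> k h))"
      by (simp flip: integral_complex_of_real)
    also have "\<dots> = - J (\<lambda>h. complex_of_real (\<phi> k h))"
      using \<kappa>_pairing[OF t\<phi> supp, of k] by (simp add: J_def)
    also have "\<dots> = - (J (?A k) - J (?B k))" unfolding \<phi>_eq J_diff[OF tA tB] ..
    finally show ?thesis .
  qed
  ultimately have "(\<lambda>k. complex_of_real (LINT h|lborel. \<kappa> h * \<phi> k h)) \<longlonglongrightarrow> of_real ((norm (Lam \<eta>))\<^sup>2)"
    using \<theta>(4)[of 0] by simp
  then have L: "(\<lambda>k. LINT h|lborel. \<kappa> h * \<phi> k h) \<longlonglongrightarrow> (norm (Lam \<eta>))\<^sup>2"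
    by (rule tendsto_of_real_iff[THEN iffD1])
  have nn: "(\<integral>\<^sup>+h. ennreal (\<kappa> h * \<phi> k h) \<partial>lborel) = ennreal (LINT h|lborel. \<kappa> h * \<phi> k h)" for k
    by (intro nn_integral_eq_integral i\<phi>) (simp add: \<kappa>_nonneg \<phi>0)
  have ae: "AE h in lborel. (\<lambda>k. ennreal (\<kappa> h * \<phi> k h)) \<longlonglongrightarrow> ennreal (\<kappa> h * ?c h)"
    using AE_lborel_singleton[of "0::real^'n"]
    by eventually_elim (intro tendsto_ennrealI tendsto_mult tendsto_const lim)
  \<comment> \<open>Fatou's lemma serves to show that the limiting integral is finite; its integrand
    is then available as the majorant for dominated convergence, which gives equality.\<close>
  have "(\<integral>\<^sup>+h. ennreal (\<kappa> h * ?c h) \<partial>lborel) = (\<integral>\<^sup>+h. liminf (\<lambda>k. ennreal (\<kappa> h * \<phi> k h)) \<partial>lborel)"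
    using ae by (intro nn_integral_cong_AE) (auto elim!: eventually_mono dest: lim_imp_Liminf[rotated])
  also have "\<dots> \<le> liminf (\<lambda>k. \<integral>\<^sup>+h. ennreal (\<kappa> h * \<phi> k h) \<partial>lborel)"
    by (rule nn_integral_liminf) measurable
  also have "\<dots> = ennreal ((norm (Lam \<eta>))\<^sup>2)"
    unfolding nn by (intro lim_imp_Liminf tendsto_ennrealI L) simp
  finally have fin: "(\<integral>\<^sup>+h. ennreal (\<kappa> h * ?c h) \<partial>lborel) < \<infinity>"
    by (rule le_less_trans) simp
  have "(\<lambda>k. \<integral>\<^sup>+h. ennreal (\<kappa> h * \<phi> k h) \<partial>lborel) \<longlonglongrightarrow> (\<integral>\<^sup>+h. ennreal (\<kappa> h * ?c h) \<partial>lborel)"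
  proof (rule nn_integral_dominated_convergence[OF _ _ _ _ fin ae])
    show "AE h in lborel. ennreal (\<kappa> h * \<phi> k h) \<le> ennreal (\<kappa> h * ?c h)" for k
      by (intro AE_I2 ennreal_leI mult_left_mono \<phi>1 \<kappa>_nonneg)
  qed auto
  moreover have "(\<lambda>k. \<integral>\<^sup>+h. ennreal (\<kappa> h * \<phi> k h) \<partial>lborel) \<longlonglongrightarrow> ennreal ((norm (Lam \<eta>))\<^sup>2)"
    unfolding nn by (intro tendsto_ennrealI L)
  ultimately show ?thesis by (rule LIMSEQ_unique)
qed

end

section \<open>Square norms\<close>

text \<open>The squared L2 norm as an extended real, so that estimates carry no integrability side
  conditions. Completing the measure does not change its value, which is why it also applies to
  Lebesgue measurable functions.\<close>

definition sqnorm :: "(real^'n \<Rightarrow> 'b::real_normed_vector) \<Rightarrow> ennreal" where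
  "sqnorm f = (\<integral>\<^sup>+x. ennreal ((norm (f x))\<^sup>2) \<partial>lborel)"

lemma norm_add_square_le: "(norm (a + b))\<^sup>2 \<le> 2 * (norm a)\<^sup>2 + 2 * (norm b)\<^sup>2"
  for a b :: "'b::real_normed_vector"
proof -
  have "(norm (a + b))\<^sup>2 \<le> (norm a + norm b)\<^sup>2"
    by (intro power_mono norm_triangle_ineq) auto
  also have "\<dots> \<le> 2 * (norm a)\<^sup>2 + 2 * (norm b)\<^sup>2"
    using zero_le_power2[of "norm a - norm b"] by (simp add: power2_eq_square algebra_simps)
  finally show ?thesis .
qed

lemma sqnorm_lebesgue: "sqnorm f = (\<integral>\<^sup>+x. ennreal ((norm (f x))\<^sup>2) \<partial>lebesgue)"
  by (simp add: sqnorm_def nn_integral_completion)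

lemma sqnorm_cong_AE: "AE x in lborel. f x = g x \<Longrightarrow> sqnorm f = sqnorm g"
  unfolding sqnorm_def by (intro nn_integral_cong_AE) auto

lemma sqnorm_minus_commute: "sqnorm (\<lambda>x. f x - g x) = sqnorm (\<lambda>x. g x - f x)"
  by (simp add: sqnorm_def norm_minus_commute)

text \<open>The factors 2 come from the pointwise inequality for squares. They are the source of the
  constants 2 and 8 in the energy estimates below.\<close>

lemma sqnorm_add_le:
  fixes f g :: "real^'n \<Rightarrow> 'b::euclidean_space"
  assumes [measurable]: "f \<in> borel_measurable lebesgue" "g \<in> borel_measurable lebesgue"
  shows "sqnorm (\<lambda>x. f x + g x) \<le> 2 * sqnorm f + 2 * sqnorm g"
proof -
  have "sqnorm (\<lambda>x. f x + g x) \<le> (\<integral>\<^sup>+x. 2 * ennreal ((norm (f x))\<^sup>2) + 2 * ennreal ((norm (g x))\<^sup>2) \<partial>lebesgue)"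
    unfolding sqnorm_lebesgue
  proof (rule nn_integral_mono)
    fix x
    have "ennreal ((norm (f x + g x))\<^sup>2) \<le> ennreal (2 * (norm (f x))\<^sup>2 + 2 * (norm (g x))\<^sup>2)"
      by (intro ennreal_leI norm_add_square_le)
    then show "ennreal ((norm (f x + g x))\<^sup>2) \<le> 2 * ennreal ((norm (f x))\<^sup>2) + 2 * ennreal ((norm (g x))\<^sup>2)"
      by (simp add: ennreal_plus ennreal_mult)
  qed
  also have "\<dots> = 2 * sqnorm f + 2 * sqnorm g"
    by (simp add: nn_integral_add nn_integral_cmult sqnorm_lebesgue)
  finally show ?thesis .
qed

lemma sqnorm_diff_le:
  fixes f g :: "real^'n \<Rightarrow> 'b::euclidean_space"
  assumes "f \<in> borel_measurable lebesgue" "g \<in> borel_measurable lebesgue"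
  shows "sqnorm (\<lambda>x. f x - g x) \<le> 2 * sqnorm f + 2 * sqnorm g"
  using sqnorm_add_le[OF assms(1) borel_measurable_uminus[OF assms(2)]] by (simp add: sqnorm_def)

lemma sqnorm_triangle:
  fixes f g h :: "real^'n \<Rightarrow> 'b::euclidean_space"
  assumes [measurable]: "f \<in> borel_measurable lebesgue" "g \<in> borel_measurable lebesgue" "h \<in> borel_measurable lebesgue"
  shows "sqnorm (\<lambda>x. f x - h x) \<le> 2 * sqnorm (\<lambda>x. f x - g x) + 2 * sqnorm (\<lambda>x. g x - h x)"
  using sqnorm_add_le[of "\<lambda>x. f x - g x" "\<lambda>x. g x - h x"] by simp

lemma sqnorm_translate:
  fixes f :: "real^'n \<Rightarrow> 'b::euclidean_space"
  assumes [measurable]: "f \<in> borel_measurable borel"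
  shows "sqnorm (\<lambda>x. f (x - h)) = sqnorm f"
  using nn_integral_lborel_translate[of "\<lambda>x. ennreal ((norm (f x))\<^sup>2)" "- h"] by (simp add: sqnorm_def)

lemma sqnorm_dominated:
  fixes f :: "nat \<Rightarrow> real^'n \<Rightarrow> 'b::euclidean_space"
  assumes [measurable]: "\<And>k. f k \<in> borel_measurable borel" "g \<in> borel_measurable borel"
    and le: "\<And>k x. norm (f k x) \<le> norm (g x)" and g: "sqnorm g < \<infinity>"
    and lim: "AE x in lborel. (\<lambda>k. f k x) \<longlonglongrightarrow> 0"
  shows "(\<lambda>k. sqnorm (f k)) \<longlonglongrightarrow> 0"
proof -
  have "(\<lambda>k. sqnorm (f k)) \<longlonglongrightarrow> (\<integral>\<^sup>+(x::real^'n). 0 \<partial>lborel)"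
    unfolding sqnorm_def
  proof (rule nn_integral_dominated_convergence[where w="\<lambda>x. ennreal ((norm (g x))\<^sup>2)"])
    show "AE x in lborel. ennreal ((norm (f k x))\<^sup>2) \<le> ennreal ((norm (g x))\<^sup>2)" for k
      by (intro AE_I2 ennreal_leI power_mono le) auto
    show "(\<integral>\<^sup>+x. ennreal ((norm (g x))\<^sup>2) \<partial>lborel) < \<infinity>" using g by (simp add: sqnorm_def)
    show "AE x in lborel. (\<lambda>k. ennreal ((norm (f k x))\<^sup>2)) \<longlonglongrightarrow> 0"
      using lim
    proof eventually_elim
      case (elim x)
      then have "(\<lambda>k. ennreal ((norm (f k x))\<^sup>2)) \<longlonglongrightarrow> ennreal ((norm (0::'b))\<^sup>2)"
        by (intro tendsto_intros tendsto_ennrealI)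
      then show ?case by simp
    qed
  qed auto
  then show ?thesis by simp
qed

lemma ennreal_tendsto_0_comparison:
  fixes X Y Z :: "nat \<Rightarrow> ennreal"
  assumes "X \<longlonglongrightarrow> 0" "Y \<longlonglongrightarrow> 0" "\<And>k. Z k \<le> 2 * X k + 2 * Y k"
  shows "Z \<longlonglongrightarrow> 0"
proof (rule tendsto_sandwich[OF _ _ tendsto_const])
  have "(\<lambda>k. 2 * X k + 2 * Y k) \<longlonglongrightarrow> 2 * 0 + 2 * 0"
    using assms by (intro tendsto_add ennreal_tendsto_cmult) auto
  then show "(\<lambda>k. 2 * X k + 2 * Y k) \<longlonglongrightarrow> 0" by simp
qed (use assms(3) in auto)

lemma liminf_ennreal_le:
  fixes X :: "nat \<Rightarrow> ennreal"
  assumes "\<forall>\<^sub>F k in sequentially. X k \<le> B"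
  shows "liminf X \<le> B"
  using Liminf_le_Limsup[of sequentially X] Limsup_bounded[OF assms] by simp

text \<open>The squared increments remain summable after multiplication by 2^k, since 2^k / 8^k =
  4^(-k), and 2t \<le> 2^k t^2 + 2^(-k) then makes the increments themselves summable almost
  everywhere. Fatou's lemma identifies the pointwise limit as the limit in L2.\<close>

lemma sqnorm_complete:
  fixes F :: "nat \<Rightarrow> real^'n \<Rightarrow> 'b::euclidean_space"
  assumes [measurable]: "\<And>k. F k \<in> borel_measurable borel"
    and cauchy: "\<And>k j. k \<le> j \<Longrightarrow> sqnorm (\<lambda>x. F k x - F j x) \<le> ennreal ((1/8) ^ k)"
  obtains v where "v \<in> borel_measurable borel" "(\<lambda>k. sqnorm (\<lambda>x. F k x - v x)) \<longlonglongrightarrow> 0"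
proof -
  let ?d = "\<lambda>k x. norm (F (Suc k) x - F k x)"
  have "(\<integral>\<^sup>+x. (\<Sum>k. ennreal (2 ^ k * (?d k x)\<^sup>2)) \<partial>lborel) = (\<Sum>k. \<integral>\<^sup>+x. ennreal (2 ^ k * (?d k x)\<^sup>2) \<partial>lborel)"
    by (rule nn_integral_suminf) measurable
  also have "\<dots> \<le> (\<Sum>k. ennreal ((1/4) ^ k))"
  proof (intro suminf_le allI)
    fix k
    have "(\<integral>\<^sup>+x. ennreal (2 ^ k * (?d k x)\<^sup>2) \<partial>lborel) = ennreal (2 ^ k) * sqnorm (\<lambda>x. F k x - F (Suc k) x)"
      by (simp add: sqnorm_def ennreal_mult nn_integral_cmult norm_minus_commute)
    also have "\<dots> \<le> ennreal (2 ^ k) * ennreal ((1/8) ^ k)"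
      by (intro mult_left_mono cauchy) auto
    also have "\<dots> = ennreal ((1/4) ^ k)"
      by (simp flip: ennreal_mult power_mult_distrib)
    finally show "(\<integral>\<^sup>+x. ennreal (2 ^ k * (?d k x)\<^sup>2) \<partial>lborel) \<le> ennreal ((1/4) ^ k)" .
  qed auto
  also have "\<dots> < \<infinity>"
    by (subst suminf_ennreal2) (auto simp: summable_geometric)
  finally have "AE x in lborel. (\<Sum>k. ennreal (2 ^ k * (?d k x)\<^sup>2)) \<noteq> \<infinity>"
    by (intro nn_integral_PInf_AE) auto
  then have lim: "AE x in lborel. (\<lambda>k. F k x) \<longlonglongrightarrow> lim (\<lambda>k. F k x)"
  proof eventually_elim
    case (elim x)
    have "summable (\<lambda>k. 2 ^ k * (?d k x)\<^sup>2)"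
      using elim by (intro summable_suminf_not_top) auto
    then have s: "summable (\<lambda>k. (2 ^ k * (?d k x)\<^sup>2 + (1/2) ^ k) / 2)"
      by (intro summable_divide summable_add) (auto simp: summable_geometric)
    have "norm (F (Suc k) x - F k x) \<le> (2 ^ k * (?d k x)\<^sup>2 + (1/2) ^ k) / 2" for k
    proof -
      have "0 \<le> (2 ^ k * ?d k x - 1)\<^sup>2 / 2 ^ k" by simp
      also have "\<dots> = 2 ^ k * (?d k x)\<^sup>2 + (1/2) ^ k - 2 * ?d k x"
        by (simp add: power2_eq_square field_simps)
      finally show ?thesis by simp
    qed
    then have "summable (\<lambda>k. F (Suc k) x - F k x)"
      by (intro summable_comparison_test'[OF s]) auto
    then obtain L where "(\<lambda>k. F k x - F 0 x) \<longlonglongrightarrow> L"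
      using sum_lessThan_telescope[of "\<lambda>k. F k x"] by (auto simp: summable_iff_convergent convergent_def)
    from tendsto_add[OF this tendsto_const[of "F 0 x"]] have "convergent (\<lambda>k. F k x)"
      by (auto simp: convergent_def)
    then show ?case by (simp add: convergent_LIMSEQ_iff)
  qed
  let ?v = "\<lambda>x. lim (\<lambda>k. F k x)"
  have [measurable]: "?v \<in> borel_measurable borel" by measurable
  have le: "sqnorm (\<lambda>x. F k x - ?v x) \<le> ennreal ((1/8) ^ k)" for k
  proof -
    have "sqnorm (\<lambda>x. F k x - ?v x) = (\<integral>\<^sup>+x. liminf (\<lambda>j. ennreal ((norm (F k x - F j x))\<^sup>2)) \<partial>lborel)"
      unfolding sqnorm_def
    proof (rule nn_integral_cong_AE, use lim in eventually_elim)
      case (elim x)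
      then have "(\<lambda>j. ennreal ((norm (F k x - F j x))\<^sup>2)) \<longlonglongrightarrow> ennreal ((norm (F k x - ?v x))\<^sup>2)"
        by (intro tendsto_intros tendsto_ennrealI)
      then show ?case by (rule lim_imp_Liminf[OF sequentially_bot, symmetric])
    qed
    also have "\<dots> \<le> liminf (\<lambda>j. sqnorm (\<lambda>x. F k x - F j x))"
      unfolding sqnorm_def by (rule nn_integral_liminf) measurable
    also have "\<dots> \<le> ennreal ((1/8) ^ k)"
      by (intro liminf_ennreal_le eventually_sequentiallyI[of k] cauchy)
    finally show ?thesis .
  qed
  have "(\<lambda>k. ennreal ((1/8) ^ k)) \<longlonglongrightarrow> ennreal 0"
    by (intro tendsto_ennrealI LIMSEQ_power_zero) auto
  then have z: "(\<lambda>k. ennreal ((1/8) ^ k)) \<longlonglongrightarrow> 0" by simp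
  have "(\<lambda>k. sqnorm (\<lambda>x. F k x - ?v x)) \<longlonglongrightarrow> 0"
    by (rule tendsto_sandwich[OF _ _ tendsto_const z]) (simp, rule always_eventually, rule allI, rule le)
  then show ?thesis by (intro that[of ?v]) auto
qed


section \<open>Continuity of translations and mollification\<close>

lemma translation_limit:
  fixes f :: "real^'n \<Rightarrow> real"
  assumes [measurable]: "\<And>n. g n \<in> borel_measurable borel" "f \<in> borel_measurable borel"
    and g: "(\<lambda>n. sqnorm (\<lambda>x. f x - g n x)) \<longlonglongrightarrow> 0"
    and trans: "\<And>n. (\<lambda>k. sqnorm (\<lambda>x. g n (x - h k) - g n x)) \<longlonglongrightarrow> 0"
  shows "(\<lambda>k. sqnorm (\<lambda>x. f (x - h k) - f x)) \<longlonglongrightarrow> 0"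
proof (rule tendsto_zero_ennreal)
  fix e :: real assume e: "e > 0"
  \<comment> \<open>The three error terms below enter with the factors 2, 4 and 4, so that e/16
    leaves a total of 10 e/16.\<close>
  then obtain n where n: "sqnorm (\<lambda>x. f x - g n x) < ennreal (e / 16)"
    using order_tendstoD(2)[OF g, of "ennreal (e / 16)"] eventually_happens by fastforce
  have "\<forall>\<^sub>F k in sequentially. sqnorm (\<lambda>x. g n (x - h k) - g n x) < ennreal (e / 16)"
    using order_tendstoD(2)[OF trans[of n], of "ennreal (e / 16)"] e by simp
  then show "\<forall>\<^sub>F k in sequentially. sqnorm (\<lambda>x. f (x - h k) - f x) < ennreal e"
  proof eventually_elim
    case (elim k)
    let ?a = "\<lambda>x. f x - g n x" and ?b = "\<lambda>x. g n (x - h k) - g n x"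
    have "sqnorm (\<lambda>x. ?a (x - h k) - (?a x - ?b x)) \<le> 2 * sqnorm (\<lambda>x. ?a (x - h k)) + 2 * sqnorm (\<lambda>x. ?a x - ?b x)"
      by (intro sqnorm_diff_le measurable_completion) measurable
    also have "sqnorm (\<lambda>x. ?a (x - h k)) = sqnorm ?a"
      by (rule sqnorm_translate) measurable
    also have "sqnorm (\<lambda>x. ?a x - ?b x) \<le> 2 * sqnorm ?a + 2 * sqnorm ?b"
      by (intro sqnorm_diff_le measurable_completion) measurable
    also have "2 * sqnorm ?a + 2 * (2 * sqnorm ?a + 2 * sqnorm ?b)
      \<le> 2 * ennreal (e / 16) + 2 * (2 * ennreal (e / 16) + 2 * ennreal (e / 16))"
      using n elim by (intro add_mono mult_left_mono) auto
    also have "\<dots> = ennreal (10 * (e / 16))"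
      using e by (simp add: ennreal_mult' flip: ennreal_plus ennreal_numeral ennreal_mult)
    also have "\<dots> < ennreal e" using e by (intro ennreal_lessI) auto
    finally show ?case by (simp add: add_left_mono mult_left_mono)
  qed
qed

lemma indicator_cball_measurable: "(\<lambda>x::real^'n. B * indicator (cball 0 R) x :: real) \<in> borel_measurable borel"
  by (intro borel_measurable_times borel_measurable_const borel_measurable_indicator) auto

lemma sqnorm_indicator_cball: "sqnorm (\<lambda>x::real^'n. B * indicator (cball 0 R) x :: real) < \<infinity>"
proof -
  have "sqnorm (\<lambda>x::real^'n. B * indicator (cball 0 R) x :: real)
    = (\<integral>\<^sup>+(x::real^'n). ennreal (B\<^sup>2) * indicator (cball 0 R) x \<partial>lborel)"
    unfolding sqnorm_def by (intro nn_integral_cong) (simp add: indicator_def)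
  also have "\<dots> < \<infinity>" by (rule nn_integral_cball_finite[where B="B\<^sup>2"]) auto
  finally show ?thesis .
qed

lemma translation_continuous:
  fixes f :: "real^'n \<Rightarrow> real"
  assumes c: "continuous_on UNIV f" and f0: "\<And>x. norm x > R \<Longrightarrow> f x = 0" and h: "h \<longlonglongrightarrow> 0"
  shows "(\<lambda>k. sqnorm (\<lambda>x. f (x - h k) - f x)) \<longlonglongrightarrow> 0"
proof -
  have [measurable]: "f \<in> borel_measurable borel" by (rule borel_measurable_continuous_onI[OF c])
  obtain B where B: "B > 0" "\<And>x. norm (f x) \<le> B"
    using compactly_supported_bounded[OF c f0] by blast
  have "Bseq h" using h convergentI convergent_imp_Bseq by blast
  then obtain S where S: "\<And>k. norm (h k) \<le> S" unfolding Bseq_def by blast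
  let ?g = "\<lambda>x::real^'n. 2 * B * indicator (cball 0 (R + S)) x :: real"
  show ?thesis
  proof (rule sqnorm_dominated[where g="?g"])
    show "sqnorm ?g < \<infinity>" by (rule sqnorm_indicator_cball)
    fix k x
    show "norm (f (x - h k) - f x) \<le> norm (?g x)"
    proof (cases "norm x \<le> R + S")
      case True
      have "norm (f (x - h k) - f x) \<le> 2 * B"
        using norm_triangle_ineq4[of "f (x - h k)" "f x"] B(2)[of x] B(2)[of "x - h k"] by linarith
      then show ?thesis using True B by simp
    next
      case False
      have "norm x \<le> norm (x - h k) + norm (h k)" using norm_triangle_ineq[of "x - h k" "h k"] by simp
      then have "norm (x - h k) > R" using False S[of k] by linarith
      moreover have "0 \<le> S" using S[of k] norm_ge_zero[of "h k"] by linarith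
      then have "norm x > R" using False by linarith
      ultimately show ?thesis using f0 by simp
    qed
  next
    have "isCont f x" for x using c by (simp add: continuous_on_eq_continuous_at)
    then have "(\<lambda>k. f (x - h k)) \<longlonglongrightarrow> f (x - 0)" for x
      by (intro isCont_tendsto_compose[of _ f] tendsto_intros h)
    from LIM_zero[OF this] have "(\<lambda>k. f (x - h k) - f x) \<longlonglongrightarrow> 0" for x by simp
    then show "AE x in lborel. (\<lambda>k. f (x - h k) - f x) \<longlonglongrightarrow> 0" by simp
    show "?g \<in> borel_measurable borel" by (rule indicator_cball_measurable)
  qed measurable
qed

text \<open>Measurability supplies continuous functions that converge to \<open>f\<close> almost
  everywhere. Clamped to [-M, M] and multiplied by a cutoff equal to one on the ball of radius R,
  they have a common square integrable majorant and converge in L2, so the continuous case applies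
  through \<open>translation_limit\<close>.\<close>

lemma translation_bounded:
  fixes f :: "real^'n \<Rightarrow> real"
  assumes f[measurable]: "f \<in> borel_measurable borel" and M: "\<And>x. \<bar>f x\<bar> \<le> M" and R: "R > 0"
    and f0: "\<And>x. norm x > R \<Longrightarrow> f x = 0" and h: "h \<longlonglongrightarrow> 0"
  shows "(\<lambda>k. sqnorm (\<lambda>x. f (x - h k) - f x)) \<longlonglongrightarrow> 0"
proof -
  have M0: "M \<ge> 0" using M[of 0] by linarith
  have "f measurable_on UNIV"
    by (intro lebesgue_measurable_imp_measurable_on measurable_completion) auto
  then obtain N g where N: "negligible N" and g: "\<And>n. continuous_on UNIV (g n)"
    and lim: "\<And>x. x \<notin> N \<Longrightarrow> (\<lambda>n. g n x) \<longlonglongrightarrow> f x"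
    unfolding measurable_on_def by auto
  obtain \<theta> :: "real^'n \<Rightarrow> real" where \<theta>: "test_function \<theta>" "\<And>x. 0 \<le> \<theta> x" "\<And>x. \<theta> x \<le> 1"
    "\<And>x. norm x \<le> 1 \<Longrightarrow> \<theta> x = 1" "\<And>x. norm x > 3 \<Longrightarrow> \<theta> x = 0"
    using cutoff_exists by blast
  let ?t = "\<lambda>x. \<theta> ((1 / R) *\<^sub>R x)" and ?c = "\<lambda>s. max (- M) (min M s)"
  define p where "p n x = ?t x * ?c (g n x)" for n x
  have c\<theta>: "continuous_on UNIV ?t"
    using test_function_imp_continuous[OF test_function_affine[OF \<theta>(1), of "1 / R" 0]] R by simp
  have cp: "continuous_on UNIV (p n)" for n
    unfolding p_def[abs_def] by (intro continuous_intros c\<theta> g)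
  have [measurable]: "p n \<in> borel_measurable borel" for n
    by (rule borel_measurable_continuous_onI[OF cp])
  have p0: "p n x = 0" if "norm x > 3 * R" for n x
    using that R \<theta>(5)[of "(1 / R) *\<^sub>R x"] by (simp add: p_def field_simps)
  show ?thesis
  proof (rule translation_limit[where g=p])
    show "(\<lambda>k. sqnorm (\<lambda>x. p n (x - h k) - p n x)) \<longlonglongrightarrow> 0" for n
      by (rule translation_continuous[OF cp p0 h])
    show "(\<lambda>n. sqnorm (\<lambda>x. f x - p n x)) \<longlonglongrightarrow> 0"
    proof (rule sqnorm_dominated[where g="\<lambda>x. 2 * M * indicator (cball 0 (3 * R)) x"])
      fix n x
      show "norm (f x - p n x) \<le> norm (2 * M * indicator (cball 0 (3 * R)) x :: real)"
      proof (cases "norm x \<le> 3 * R")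
        case True
        have "\<bar>p n x\<bar> \<le> 1 * M"
          unfolding p_def abs_mult using \<theta>(2,3) M0 by (intro mult_mono) auto
        then show ?thesis using True M[of x] M0 by (simp add: abs_mult)
      next
        case False
        then show ?thesis using f0[of x] p0[of x] R by simp
      qed
    next
      have "AE x in lebesgue. x \<notin> N"
        using N by (intro AE_not_in) (simp add: negligible_iff_null_sets)
      then have "AE x in lborel. x \<notin> N" by (simp only: AE_completion_iff)
      then show "AE x in lborel. (\<lambda>n. f x - p n x) \<longlonglongrightarrow> 0"
      proof eventually_elim
        case (elim x)
        then have "(\<lambda>n. f x - p n x) \<longlonglongrightarrow> f x - ?t x * ?c (f x)"
          unfolding p_def by (intro tendsto_intros lim)
        moreover have "?c (f x) = f x" using M[of x] by auto
        moreover have "?t x * f x = f x"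
          using f0[of x] \<theta>(4)[of "(1 / R) *\<^sub>R x"] R by (cases "norm x \<le> R") (auto simp: field_simps)
        ultimately show ?case by simp
      qed
    qed (simp_all only: sqnorm_indicator_cball indicator_cball_measurable, measurable)
  qed auto
qed

lemma translation_L2:
  fixes f :: "real^'n \<Rightarrow> real"
  assumes f[measurable]: "f \<in> borel_measurable borel" and fin: "sqnorm f < \<infinity>" and h: "h \<longlonglongrightarrow> 0"
  shows "(\<lambda>k. sqnorm (\<lambda>x. f (x - h k) - f x)) \<longlonglongrightarrow> 0"
proof -
  define g where "g n x = (if norm x \<le> real (Suc n) \<and> \<bar>f x\<bar> \<le> real (Suc n) then f x else 0)" for n x
  have [measurable]: "g n \<in> borel_measurable borel" for n unfolding g_def[abs_def] by measurable
  show ?thesis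
  proof (rule translation_limit[where g=g])
    show "(\<lambda>k. sqnorm (\<lambda>x. g n (x - h k) - g n x)) \<longlonglongrightarrow> 0" for n
      by (rule translation_bounded[where R="real (Suc n)" and M="real (Suc n)"]) (auto simp: g_def h)
    show "(\<lambda>n. sqnorm (\<lambda>x. f x - g n x)) \<longlonglongrightarrow> 0"
    proof (rule sqnorm_dominated[where g=f])
      have "(\<lambda>n. f x - g n x) \<longlonglongrightarrow> 0" for x
      proof (rule tendsto_eventually)
        obtain m where m: "max (norm x) \<bar>f x\<bar> \<le> real m" using real_arch_simple by blast
        then show "\<forall>\<^sub>F n in sequentially. f x - g n x = 0"
          by (intro eventually_sequentiallyI[of m]) (auto simp: g_def)
      qed
      then show "AE x in lborel. (\<lambda>n. f x - g n x) \<longlonglongrightarrow> 0" by simp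
    qed (use fin in \<open>auto simp: g_def\<close>)
  qed auto
qed

text \<open>Cauchy-Schwarz with |F| split into two square roots, that is, Jensen's inequality for
  the measure with density |F|. It is used for mollifiers and, through Fourier inversion, for
  increments of a cutoff. If the product is not integrable, the left side is zero by
  default.\<close>

lemma norm_integral_mult_square_le:
  fixes F m :: "'a \<Rightarrow> 'b::{real_normed_field, banach, second_countable_topology}"
  assumes [measurable]: "F \<in> borel_measurable M" "m \<in> borel_measurable M"
  shows "ennreal ((norm (LINT x|M. F x * m x))\<^sup>2)
    \<le> (\<integral>\<^sup>+x. ennreal (norm (F x)) \<partial>M) * (\<integral>\<^sup>+x. ennreal (norm (F x) * (norm (m x))\<^sup>2) \<partial>M)"
proof (cases "integrable M (\<lambda>x. F x * m x)")
  case True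
  have "ennreal ((norm (LINT x|M. F x * m x))\<^sup>2) = (ennreal (norm (LINT x|M. F x * m x)))\<^sup>2"
    by (simp add: ennreal_power)
  also have "\<dots> \<le> (\<integral>\<^sup>+x. ennreal (norm (F x * m x)) \<partial>M)\<^sup>2"
    by (intro power_mono integral_norm_bound_ennreal True) auto
  also have "\<dots> = (\<integral>\<^sup>+x. ennreal (sqrt (norm (F x))) * ennreal (sqrt (norm (F x)) * norm (m x)) \<partial>M)\<^sup>2"
    by (simp add: norm_mult flip: ennreal_mult mult.assoc)
  also have "\<dots> \<le> (\<integral>\<^sup>+x. (ennreal (sqrt (norm (F x))))\<^sup>2 \<partial>M) * (\<integral>\<^sup>+x. (ennreal (sqrt (norm (F x)) * norm (m x)))\<^sup>2 \<partial>M)"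
    by (intro Cauchy_Schwarz_nn_integral) measurable
  also have "\<dots> = (\<integral>\<^sup>+x. ennreal (norm (F x)) \<partial>M) * (\<integral>\<^sup>+x. ennreal (norm (F x) * (norm (m x))\<^sup>2) \<partial>M)"
    by (simp add: ennreal_power power_mult_distrib)
  finally show ?thesis .
qed (simp add: not_integrable_integral_eq)

section \<open>Mollification and the averaged modulus of continuity\<close>

locale mollifier =
  fixes \<eta> :: "real^'n \<Rightarrow> real"
  assumes \<eta>_test: "test_function \<eta>" and \<eta>_nonneg: "\<And>x. \<eta> x \<ge> 0"
    and \<eta>_0: "\<And>x. norm x > 1 \<Longrightarrow> \<eta> x = 0" and \<eta>_integral: "integral\<^sup>L lborel \<eta> = 1"
begin

lemma \<eta>_measurable[measurable]: "\<eta> \<in> borel_measurable borel"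
  by (rule test_function_measurable[OF \<eta>_test])

lemma nn_integral_\<eta>: "(\<integral>\<^sup>+x. ennreal (\<eta> x) \<partial>lborel) = 1"
  using nn_integral_eq_integral[OF test_function_integrable[OF \<eta>_test]] \<eta>_nonneg \<eta>_integral by simp

definition moll :: "real \<Rightarrow> (real^'n \<Rightarrow> real) \<Rightarrow> real^'n \<Rightarrow> real" where
  "moll c f x = (LINT y|lborel. \<eta> y * f (x - c *\<^sub>R y))"

text \<open>The average over the mollifier of the squared L2 distance to a translate. It bounds the
  mollification error and is stable enough to be integrated against the kernel, being at most 4
  \<open>sqnorm f\<close> for every scale.\<close>

definition modulus :: "real \<Rightarrow> (real^'n \<Rightarrow> real) \<Rightarrow> ennreal" where
  "modulus c f = (\<integral>\<^sup>+y. ennreal (\<eta> y) * sqnorm (\<lambda>x. f (x - c *\<^sub>R y) - f x) \<partial>lborel)"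

lemma moll_integrable:
  assumes f: "integrable lborel f" and c: "c \<noteq> 0"
  shows "integrable lborel (\<lambda>y. \<eta> y * f (x - c *\<^sub>R y))"
proof -
  obtain B where B: "B > 0" "\<And>x. norm (\<eta> x) \<le> B" using test_function_bounded[OF \<eta>_test] by blast
  have i: "integrable lborel (\<lambda>y. f (x - c *\<^sub>R y))"
    using integrable_lborel_affine[OF f, of "- c" x] c by simp
  show ?thesis
    by (rule integrable_integral_cong_bound[OF integrable_mult_right[OF integrable_norm[OF i], of B]])
      (use borel_measurable_integrable[OF i] B in \<open>auto simp: abs_mult intro!: mult_right_mono\<close>)
qed

lemma moll_test_function:
  assumes f: "integrable lborel f" and supp: "\<And>x. norm x > R \<Longrightarrow> f x = 0" and c: "c > 0"
  shows "test_function (moll c f)"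
proof -
  let ?g = "\<lambda>x. (1 / c ^ DIM(real^'n)) *\<^sub>R \<eta> (0 + (1 / c) *\<^sub>R x)"
  have "test_function ?g"
    using c by (intro test_function_scaleR test_function_affine \<eta>_test) auto
  from test_function_convolution[OF f this supp]
  have "test_function (\<lambda>x. LINT y|lborel. f y * ?g (x - y))" .
  also have "(\<lambda>x. LINT y|lborel. f y * ?g (x - y)) = moll c f"
  proof
    fix x
    have "(LINT y|lborel. f y * ?g (x - y)) = (\<bar>- c\<bar> ^ DIM(real^'n)) *\<^sub>R (LINT y|lborel. f (x + (- c) *\<^sub>R y) * ?g (x - (x + (- c) *\<^sub>R y)))"
      using c by (intro integral_lborel_affine) auto
    also have "\<dots> = (c ^ DIM(real^'n)) * (LINT y|lborel. (1 / c ^ DIM(real^'n)) * (\<eta> y * f (x - c *\<^sub>R y)))"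
      using c by (simp add: mult_ac)
    also have "\<dots> = moll c f x"
      unfolding moll_def using c by (subst integral_mult_right_zero) simp
    finally show "(LINT y|lborel. f y * ?g (x - y)) = moll c f x" .
  qed
  finally show ?thesis .
qed

lemma moll_diff:
  assumes "integrable lborel f" "integrable lborel g" "c \<noteq> 0"
  shows "moll c (\<lambda>x. f x - g x) x = moll c f x - moll c g x"
  using moll_integrable[OF assms(1,3), of x] moll_integrable[OF assms(2,3), of x]
  by (simp add: moll_def right_diff_distrib)

lemma moll_translate: "moll c (\<lambda>x. f (x - h)) x = moll c f (x - h)"
  by (simp add: moll_def algebra_simps)

text \<open>Jensen's inequality for the probability density \<open>\<eta>\<close>, followed by
  Tonelli.\<close>

lemma sqnorm_moll_le:
  assumes f: "integrable lborel f" and c: "c \<noteq> 0"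
  shows "sqnorm (\<lambda>x. moll c f x - f x) \<le> modulus c f"
proof -
  have [measurable]: "f \<in> borel_measurable borel" using borel_measurable_integrable[OF f] by simp
  have "ennreal ((norm (moll c f x - f x))\<^sup>2) \<le> (\<integral>\<^sup>+y. ennreal (\<eta> y) * ennreal ((norm (f (x - c *\<^sub>R y) - f x))\<^sup>2) \<partial>lborel)" for x
  proof -
    have "moll c f x - f x = (LINT y|lborel. \<eta> y * f (x - c *\<^sub>R y)) - (LINT y|lborel. \<eta> y * f x)"
      using \<eta>_integral by (simp add: moll_def)
    also have "\<dots> = (LINT y|lborel. \<eta> y * (f (x - c *\<^sub>R y) - f x))"
      using moll_integrable[OF f c, of x] test_function_integrable[OF \<eta>_test] by (simp add: right_diff_distrib)
    finally have "ennreal ((norm (moll c f x - f x))\<^sup>2) = ennreal ((norm (LINT y|lborel. \<eta> y * (f (x - c *\<^sub>R y) - f x)))\<^sup>2)" by simp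
    also have "\<dots> \<le> (\<integral>\<^sup>+y. ennreal (norm (\<eta> y)) \<partial>lborel) * (\<integral>\<^sup>+y. ennreal (norm (\<eta> y) * (norm (f (x - c *\<^sub>R y) - f x))\<^sup>2) \<partial>lborel)"
      by (rule norm_integral_mult_square_le) measurable
    finally show ?thesis using nn_integral_\<eta> \<eta>_nonneg by (simp add: ennreal_mult)
  qed
  then have "sqnorm (\<lambda>x. moll c f x - f x)
      \<le> (\<integral>\<^sup>+x. \<integral>\<^sup>+y. ennreal (\<eta> y) * ennreal ((norm (f (x - c *\<^sub>R y) - f x))\<^sup>2) \<partial>lborel \<partial>lborel)"
    unfolding sqnorm_def by (intro nn_integral_mono)
  also have "\<dots> = (\<integral>\<^sup>+y. \<integral>\<^sup>+x. ennreal (\<eta> y) * ennreal ((norm (f (x - c *\<^sub>R y) - f x))\<^sup>2) \<partial>lborel \<partial>lborel)"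
    by (rule lborel_pair.Fubini') measurable
  also have "\<dots> = modulus c f"
    by (simp add: modulus_def sqnorm_def nn_integral_cmult)
  finally show ?thesis .
qed

lemma modulus_integrand_le:
  fixes f :: "real^'n \<Rightarrow> real"
  assumes [measurable]: "f \<in> borel_measurable borel"
  shows "ennreal (\<eta> y) * sqnorm (\<lambda>x. f (x - h) - f x) \<le> ennreal (\<eta> y) * (4 * sqnorm f)"
proof (intro mult_left_mono)
  have "sqnorm (\<lambda>x. f (x - h) - f x) \<le> 2 * sqnorm (\<lambda>x. f (x - h)) + 2 * sqnorm f"
    by (intro sqnorm_diff_le measurable_completion) measurable
  also have "\<dots> = (2 + 2) * sqnorm f" unfolding sqnorm_translate[OF assms] by (rule distrib_right[symmetric])
  finally show "sqnorm (\<lambda>x. f (x - h) - f x) \<le> 4 * sqnorm f" by simp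
qed auto

lemma nn_integral_\<eta>_const: "(\<integral>\<^sup>+y. ennreal (\<eta> y) * C \<partial>lborel) = C"
  by (simp add: nn_integral_multc nn_integral_\<eta>)

lemma modulus_le:
  assumes [measurable]: "f \<in> borel_measurable borel"
  shows "modulus c f \<le> 4 * sqnorm f"
proof -
  have "modulus c f \<le> (\<integral>\<^sup>+y. ennreal (\<eta> y) * (4 * sqnorm f) \<partial>lborel)"
    unfolding modulus_def by (intro nn_integral_mono modulus_integrand_le assms)
  then show ?thesis by (simp only: nn_integral_\<eta>_const)
qed

lemma modulus_tendsto:
  assumes [measurable]: "f \<in> borel_measurable borel" and fin: "sqnorm f < \<infinity>" and c: "c \<longlonglongrightarrow> 0"
  shows "(\<lambda>k. modulus (c k) f) \<longlonglongrightarrow> 0"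
proof -
  have "(\<lambda>k. modulus (c k) f) \<longlonglongrightarrow> (\<integral>\<^sup>+(y::real^'n). 0 \<partial>lborel)"
    unfolding modulus_def
  proof (rule nn_integral_dominated_convergence[where w="\<lambda>y. ennreal (\<eta> y) * (4 * sqnorm f)"])
    show "(\<integral>\<^sup>+y. ennreal (\<eta> y) * (4 * sqnorm f) \<partial>lborel) < \<infinity>"
      using fin by (simp only: nn_integral_\<eta>_const) (simp add: ennreal_mult_less_top)
    show "AE y in lborel. ennreal (\<eta> y) * sqnorm (\<lambda>x. f (x - c k *\<^sub>R y) - f x) \<le> ennreal (\<eta> y) * (4 * sqnorm f)" for k
      by (intro AE_I2 modulus_integrand_le assms)
    show "AE y in lborel. (\<lambda>k. ennreal (\<eta> y) * sqnorm (\<lambda>x. f (x - c k *\<^sub>R y) - f x)) \<longlonglongrightarrow> 0"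
    proof (rule AE_I2)
      fix y :: "real^'n"
      have "(\<lambda>k. c k *\<^sub>R y) \<longlonglongrightarrow> 0 *\<^sub>R y" by (intro tendsto_intros c)
      then have "(\<lambda>k. ennreal (\<eta> y) * sqnorm (\<lambda>x. f (x - c k *\<^sub>R y) - f x)) \<longlonglongrightarrow> ennreal (\<eta> y) * 0"
        using translation_L2[OF assms(1) fin, of "\<lambda>k. c k *\<^sub>R y"] by (intro ennreal_tendsto_cmult) auto
      then show "(\<lambda>k. ennreal (\<eta> y) * sqnorm (\<lambda>x. f (x - c k *\<^sub>R y) - f x)) \<longlonglongrightarrow> 0" by simp
    qed
  qed (auto simp: sqnorm_def)
  then show ?thesis by simp
qed

end

section \<open>The energy of a kernel\<close>

lemma ennreal_tendsto_zero_cmult: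
  fixes X :: "nat \<Rightarrow> ennreal"
  assumes "X \<longlonglongrightarrow> 0" "c < \<infinity>"
  shows "(\<lambda>k. c * X k) \<longlonglongrightarrow> 0"
  using ennreal_tendsto_cmult[OF _ assms(1), of c] assms(2) by simp

lemma sqnorm_difference_measurable:
  fixes u :: "real^'n \<Rightarrow> real"
  assumes [measurable]: "u \<in> borel_measurable borel"
  shows "(\<lambda>h. sqnorm (\<lambda>x. u x - u (x - h))) \<in> borel_measurable borel"
  unfolding sqnorm_def by measurable

lemma sqnorm_difference_le:
  fixes u :: "real^'n \<Rightarrow> real"
  assumes [measurable]: "u \<in> borel_measurable borel"
  shows "sqnorm (\<lambda>x. u x - u (x - h)) \<le> 4 * sqnorm u"
proof -
  have "sqnorm (\<lambda>x. u x - u (x - h)) \<le> 2 * sqnorm u + 2 * sqnorm (\<lambda>x. u (x - h))"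
    by (intro sqnorm_diff_le measurable_completion) measurable
  also have "\<dots> = (2 + 2) * sqnorm u" unfolding sqnorm_translate[OF assms] by (rule distrib_right[symmetric])
  finally show ?thesis by simp
qed

context kernel_pair
begin

text \<open>The Gagliardo form in the difference variable h = x - y. Written as a superposition over
  h of squared L2 norms of increments, it inherits estimates that hold for each fixed h.\<close>

definition En :: "(real^'n \<Rightarrow> real) \<Rightarrow> ennreal" where
  "En u = (\<integral>\<^sup>+h. ennreal (\<kappa> h) * sqnorm (\<lambda>x. u x - u (x - h)) \<partial>lborel)"

lemma En_minus_commute: "En (\<lambda>x. u x - v x) = En (\<lambda>x. v x - u x)"
proof -
  have "sqnorm (\<lambda>x. (u x - v x) - (u (x - h) - v (x - h))) = sqnorm (\<lambda>x. (v x - u x) - (v (x - h) - u (x - h)))" for h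
    unfolding sqnorm_def by (intro nn_integral_cong arg_cong[where f=ennreal]) (simp add: power2_eq_square algebra_simps)
  then show ?thesis by (simp add: En_def)
qed

lemma En_add_le:
  assumes [measurable]: "u \<in> borel_measurable borel" "v \<in> borel_measurable borel"
  shows "En (\<lambda>x. u x + v x) \<le> 2 * En u + 2 * En v"
proof -
  note [measurable] = sqnorm_difference_measurable[OF assms(1)] sqnorm_difference_measurable[OF assms(2)]
  let ?a = "\<lambda>h. sqnorm (\<lambda>x. u x - u (x - h))" and ?b = "\<lambda>h. sqnorm (\<lambda>x. v x - v (x - h))"
  have "En (\<lambda>x. u x + v x) \<le> (\<integral>\<^sup>+h. 2 * (ennreal (\<kappa> h) * ?a h) + 2 * (ennreal (\<kappa> h) * ?b h) \<partial>lborel)"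
    unfolding En_def
  proof (rule nn_integral_mono)
    fix h
    have "sqnorm (\<lambda>x. u x + v x - (u (x - h) + v (x - h))) = sqnorm (\<lambda>x. (u x - u (x - h)) + (v x - v (x - h)))"
      by (simp add: algebra_simps)
    also have "\<dots> \<le> 2 * ?a h + 2 * ?b h"
      by (intro sqnorm_add_le measurable_completion) measurable
    finally have "ennreal (\<kappa> h) * sqnorm (\<lambda>x. u x + v x - (u (x - h) + v (x - h))) \<le> ennreal (\<kappa> h) * (2 * ?a h + 2 * ?b h)"
      by (intro mult_left_mono) auto
    then show "ennreal (\<kappa> h) * sqnorm (\<lambda>x. u x + v x - (u (x - h) + v (x - h))) \<le> 2 * (ennreal (\<kappa> h) * ?a h) + 2 * (ennreal (\<kappa> h) * ?b h)"
      by (simp only: distrib_left mult_ac)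
  qed
  also have "\<dots> = 2 * En u + 2 * En v"
    by (simp add: En_def nn_integral_add nn_integral_cmult)
  finally show ?thesis .
qed

lemma En_triangle:
  assumes [measurable]: "f \<in> borel_measurable borel" "g \<in> borel_measurable borel" "h \<in> borel_measurable borel"
  shows "En (\<lambda>x. f x - h x) \<le> 2 * En (\<lambda>x. f x - g x) + 2 * En (\<lambda>x. g x - h x)"
  using En_add_le[of "\<lambda>x. f x - g x" "\<lambda>x. g x - h x"] by simp

text \<open>Replacing \<open>u\<close> by \<open>U k\<close> costs 8 \<open>?e k\<close> at every h,
  and \<open>\<kappa>\<close> may have infinite integral, so this error cannot be integrated. It is
  therefore subtracted first, in the truncated sense of the extended reals; it disappears in the
  pointwise limit, and Fatou's lemma does the rest. The factor 2 is the price of splitting the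
  square.\<close>

lemma En_le_of_limit:
  assumes [measurable]: "u \<in> borel_measurable borel" "\<And>k. U k \<in> borel_measurable borel"
    and fin: "sqnorm u < \<infinity>" and lim: "(\<lambda>k. sqnorm (\<lambda>x. U k x - u x)) \<longlonglongrightarrow> 0"
    and B: "\<forall>\<^sub>F k in sequentially. En (U k) \<le> B"
  shows "En u \<le> 2 * B"
proof -
  let ?D = "\<lambda>h. sqnorm (\<lambda>x. u x - u (x - h))" and ?a = "\<lambda>k h. sqnorm (\<lambda>x. U k x - U k (x - h))"
  let ?e = "\<lambda>k. sqnorm (\<lambda>x. U k x - u x)"
  note [measurable] = sqnorm_difference_measurable[OF assms(1)] sqnorm_difference_measurable[OF assms(2)]
  have D: "?D h \<le> 8 * ?e k + 2 * ?a k h" for k h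
  proof -
    have "?D h = sqnorm (\<lambda>x. (U k x - U k (x - h)) - ((U k x - u x) - (U k (x - h) - u (x - h))))"
      by simp
    also have "\<dots> \<le> 2 * ?a k h + 2 * sqnorm (\<lambda>x. (U k x - u x) - (U k (x - h) - u (x - h)))"
      by (intro sqnorm_diff_le measurable_completion) measurable
    also have "\<dots> \<le> 2 * ?a k h + 2 * (4 * ?e k)"
      by (intro add_left_mono mult_left_mono sqnorm_difference_le[of "\<lambda>x. U k x - u x"]) auto
    finally show ?thesis by (simp add: add.commute mult.assoc[symmetric])
  qed
  have fD: "?D h < \<infinity>" for h
    using sqnorm_difference_le[OF assms(1), of h] fin
    by (intro le_less_trans[OF sqnorm_difference_le[OF assms(1)]]) (simp add: ennreal_mult_less_top)
  have "(\<lambda>k. ennreal (\<kappa> h) * (?D h - 8 * ?e k)) \<longlonglongrightarrow> ennreal (\<kappa> h) * (?D h - 0)" for h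
    using fD[of h] ennreal_tendsto_zero_cmult[OF lim, of 8]
    by (intro ennreal_tendsto_cmult tendsto_diff_ennreal tendsto_const) auto
  then have L: "liminf (\<lambda>k. ennreal (\<kappa> h) * (?D h - 8 * ?e k)) = ennreal (\<kappa> h) * ?D h" for h
    by (intro lim_imp_Liminf) auto
  have "En u = (\<integral>\<^sup>+h. liminf (\<lambda>k. ennreal (\<kappa> h) * (?D h - 8 * ?e k)) \<partial>lborel)"
    unfolding En_def L ..
  also have "\<dots> \<le> liminf (\<lambda>k. \<integral>\<^sup>+h. ennreal (\<kappa> h) * (?D h - 8 * ?e k) \<partial>lborel)"
    by (rule nn_integral_liminf) measurable
  also have "\<dots> \<le> 2 * B"
  proof (rule liminf_ennreal_le, use B in eventually_elim)
    case (elim k)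
    have "?D h - 8 * ?e k \<le> 2 * ?a k h" for h
      using D[of h k] fD[of h] by (intro ennreal_minus_le_iff[THEN iffD2]) auto
    then have "(\<integral>\<^sup>+h. ennreal (\<kappa> h) * (?D h - 8 * ?e k) \<partial>lborel) \<le> (\<integral>\<^sup>+h. ennreal (\<kappa> h) * (2 * ?a k h) \<partial>lborel)"
      by (intro nn_integral_mono mult_left_mono) auto
    also have "\<dots> = (\<integral>\<^sup>+h. 2 * (ennreal (\<kappa> h) * ?a k h) \<partial>lborel)"
      by (simp only: mult_ac)
    also have "\<dots> = 2 * En (U k)"
      unfolding En_def by (rule nn_integral_cmult) measurable
    also have "\<dots> \<le> 2 * B" using elim by (intro mult_left_mono) auto
    finally show ?case .
  qed
  finally show ?thesis .
qed

text \<open>For fixed h, Plancherel turns the increment into the factor |1 - cis|^2 = 2 (1 - cos),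
  which is where the 2 comes from; after Tonelli the integral over h is the one computed in
  \<open>kernel_multiplier\<close>.\<close>

lemma En_test:
  assumes u: "test_function u"
  shows "En u = 2 * sqnorm (G u)"
proof -
  let ?U = "\<lambda>x. complex_of_real (u x)"
  have U: "test_function ?U" by (rule test_function_of_real[OF u])
  have [measurable]: "fourier ?U \<in> borel_measurable borel" by (rule fourier_test_measurable[OF U])
  let ?c = "\<lambda>h \<xi>. 1 - cos (2 * pi * (h \<bullet> \<xi>))"
  have sq: "sqnorm (\<lambda>x. u x - u (x - h)) = (\<integral>\<^sup>+\<xi>. ennreal (2 * (norm (fourier ?U \<xi>))\<^sup>2) * ennreal (?c h \<xi>) \<partial>lborel)" for h
  proof -
    have "sqnorm (\<lambda>x. u x - u (x - h)) = (\<integral>\<^sup>+x. ennreal ((norm (?U x - ?U (x - h)))\<^sup>2) \<partial>lborel)"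
      unfolding sqnorm_def by (simp flip: of_real_diff)
    also have "\<dots> = ennreal (LINT x|lborel. (norm (?U x - ?U (x - h)))\<^sup>2)"
      by (intro nn_integral_eq_integral difference_plancherel(1)[OF U]) auto
    also have "\<dots> = ennreal (LINT \<xi>|lborel. (norm (fourier ?U \<xi> * (1 - cis (- (2 * pi * (h \<bullet> \<xi>))))))\<^sup>2)"
      by (simp only: difference_plancherel(3)[OF U])
    also have "\<dots> = (\<integral>\<^sup>+\<xi>. ennreal ((norm (fourier ?U \<xi> * (1 - cis (- (2 * pi * (h \<bullet> \<xi>))))))\<^sup>2) \<partial>lborel)"
      by (intro nn_integral_eq_integral[symmetric] difference_plancherel(2)[OF U]) auto
    also have "\<dots> = (\<integral>\<^sup>+\<xi>. ennreal (2 * (norm (fourier ?U \<xi>))\<^sup>2) * ennreal (?c h \<xi>) \<partial>lborel)"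
    proof (rule nn_integral_cong)
      fix \<xi>
      have "(norm (fourier ?U \<xi> * (1 - cis (- (2 * pi * (h \<bullet> \<xi>))))))\<^sup>2 = 2 * (norm (fourier ?U \<xi>))\<^sup>2 * ?c h \<xi>"
        by (simp only: norm_mult power_mult_distrib norm_one_minus_cis_square mult.assoc mult.left_commute[of _ 2])
      then show "ennreal ((norm (fourier ?U \<xi> * (1 - cis (- (2 * pi * (h \<bullet> \<xi>))))))\<^sup>2) = ennreal (2 * (norm (fourier ?U \<xi>))\<^sup>2) * ennreal (?c h \<xi>)"
        by (simp only:) (rule ennreal_mult, simp_all)
    qed
    finally show ?thesis .
  qed
  have "En u = (\<integral>\<^sup>+h. \<integral>\<^sup>+\<xi>. ennreal (\<kappa> h) * (ennreal (2 * (norm (fourier ?U \<xi>))\<^sup>2) * ennreal (?c h \<xi>)) \<partial>lborel \<partial>lborel)"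
    unfolding En_def sq by (intro nn_integral_cong nn_integral_cmult[symmetric]) measurable
  also have "\<dots> = (\<integral>\<^sup>+\<xi>. \<integral>\<^sup>+h. ennreal (\<kappa> h) * (ennreal (2 * (norm (fourier ?U \<xi>))\<^sup>2) * ennreal (?c h \<xi>)) \<partial>lborel \<partial>lborel)"
    by (rule lborel_pair.Fubini') measurable
  also have "\<dots> = (\<integral>\<^sup>+\<xi>. ennreal (2 * (norm (fourier ?U \<xi>))\<^sup>2) * (\<integral>\<^sup>+h. ennreal (\<kappa> h * ?c h \<xi>) \<partial>lborel) \<partial>lborel)"
  proof (rule nn_integral_cong)
    fix \<xi>
    have "(\<integral>\<^sup>+h. ennreal (\<kappa> h) * (ennreal (2 * (norm (fourier ?U \<xi>))\<^sup>2) * ennreal (?c h \<xi>)) \<partial>lborel)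
      = (\<integral>\<^sup>+h. ennreal (2 * (norm (fourier ?U \<xi>))\<^sup>2) * ennreal (\<kappa> h * ?c h \<xi>) \<partial>lborel)"
      by (intro nn_integral_cong) (simp add: \<kappa>_nonneg ennreal_mult mult_ac)
    then show "(\<integral>\<^sup>+h. ennreal (\<kappa> h) * (ennreal (2 * (norm (fourier ?U \<xi>))\<^sup>2) * ennreal (?c h \<xi>)) \<partial>lborel)
      = ennreal (2 * (norm (fourier ?U \<xi>))\<^sup>2) * (\<integral>\<^sup>+h. ennreal (\<kappa> h * ?c h \<xi>) \<partial>lborel)"
      by (simp add: nn_integral_cmult)
  qed
  also have "\<dots> = (\<integral>\<^sup>+\<xi>. 2 * ennreal ((norm (fourier ?U \<xi>))\<^sup>2 * (norm (Lam \<xi>))\<^sup>2) \<partial>lborel)"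
    unfolding kernel_multiplier by (simp add: ennreal_mult mult.assoc)
  also have "\<dots> = 2 * ennreal (LINT \<xi>|lborel. (norm (fourier ?U \<xi>))\<^sup>2 * (norm (Lam \<xi>))\<^sup>2)"
    using nn_integral_eq_integral[OF G_plancherel(2)[OF u]] by (simp add: nn_integral_cmult)
  also have "\<dots> = 2 * sqnorm (G u)"
    using nn_integral_eq_integral[OF G_plancherel(1)[OF u]] by (simp add: sqnorm_def G_plancherel(3)[OF u])
  finally show ?thesis .
qed

lemma En_test_diff:
  assumes "test_function u" "test_function v"
  shows "En (\<lambda>x. u x - v x) = 2 * sqnorm (\<lambda>x. G u x - G v x)"
proof -
  have "G (\<lambda>x. u x - v x) = (\<lambda>x. G u x - G v x)" by (rule ext) (rule G_diff[OF assms])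
  with En_test[OF test_function_diff[OF assms]] show ?thesis by simp
qed

text \<open>The first bound is \<open>En_le_of_limit\<close>, since the energy of
  \<open>\<phi> k\<close> is at most 4 \<open>sqnorm v\<close> plus a vanishing error. For the
  second, semicontinuity points the wrong way. Instead the energy of
  \<open>\<phi> N - \<phi> j\<close> is uniformly small for j \<ge> N, and letting j tend to
  infinity shows that \<open>\<phi> N\<close> approximates \<open>u\<close> in energy as
  well.\<close>

lemma energy_of_closure:
  assumes u[measurable]: "u \<in> borel_measurable borel" and fin: "sqnorm u < \<infinity>"
    and v: "v \<in> borel_measurable lebesgue" and \<phi>: "\<And>k. test_function (\<phi> k)"
    and lim: "(\<lambda>k. sqnorm (\<lambda>x. \<phi> k x - u x)) \<longlonglongrightarrow> 0"
    and glim: "(\<lambda>k. sqnorm (\<lambda>x. G (\<phi> k) x - v x)) \<longlonglongrightarrow> 0"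
  shows "En u \<le> 8 * sqnorm v" "sqnorm v \<le> 2 * En u"
proof -
  have m\<phi>[measurable]: "\<phi> k \<in> borel_measurable borel" for k by (rule test_function_measurable[OF \<phi>])
  have mG: "G (\<phi> k) \<in> borel_measurable lebesgue" for k
    by (rule measurable_completion) (simp add: G_measurable[OF \<phi>])
  let ?g = "\<lambda>k. sqnorm (\<lambda>x. G (\<phi> k) x - v x)"
  have ev: "\<forall>\<^sub>F k in sequentially. ?g k < ennreal d" if "d > 0" for d
    using order_tendstoD(2)[OF glim, of "ennreal d"] that by simp
  have E\<phi>: "En (\<phi> k) \<le> 4 * ?g k + 4 * sqnorm v" for k
  proof -
    have "sqnorm (\<lambda>x. (G (\<phi> k) x - v x) + v x) \<le> 2 * ?g k + 2 * sqnorm v"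
      by (intro sqnorm_add_le borel_measurable_diff mG v)
    then have "2 * sqnorm (G (\<phi> k)) \<le> 2 * (2 * ?g k + 2 * sqnorm v)"
      by (intro mult_left_mono) auto
    then show ?thesis by (simp add: En_test[OF \<phi>] distrib_left mult.assoc[symmetric])
  qed
  show "En u \<le> 8 * sqnorm v"
  proof (rule ennreal_le_epsilon)
    fix e :: real assume e: "0 < e"
    have "\<forall>\<^sub>F k in sequentially. En (\<phi> k) \<le> 4 * ennreal (e / 8) + 4 * sqnorm v"
      using ev[of "e / 8"] e by (auto elim!: eventually_mono intro!: order_trans[OF E\<phi>] add_right_mono mult_left_mono)
    from En_le_of_limit[OF u m\<phi> fin lim this]
    have "En u \<le> 2 * (4 * ennreal (e / 8) + 4 * sqnorm v)" .
    also have "\<dots> = 8 * sqnorm v + 8 * ennreal (e / 8)"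
      by (simp add: distrib_left mult.assoc[symmetric] add.commute)
    also have "8 * ennreal (e / 8) = ennreal e"
      using ennreal_mult'[of 8 "e / 8"] e by simp
    finally show "En u \<le> 8 * sqnorm v + ennreal e" .
  qed
  show "sqnorm v \<le> 2 * En u"
  proof (rule ennreal_le_epsilon)
    fix e :: real assume e: "0 < e"
    \<comment> \<open>34 = 32 + 2: the Cauchy bound 8 \<open>?d\<close> is doubled by semicontinuity
      and doubled again when the energy of \<open>\<phi> N\<close> is split; the gradient error
      contributes another 2 \<open>?d\<close>.\<close>
    let ?d = "ennreal (e / 34)"
    obtain N where N: "\<And>k. k \<ge> N \<Longrightarrow> ?g k < ?d"
      using ev[of "e / 34"] e by (auto simp: eventually_sequentially)
    have "En (\<lambda>x. \<phi> N x - \<phi> j x) \<le> 8 * ?d" if j: "j \<ge> N" for j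
    proof -
      have "En (\<lambda>x. \<phi> N x - \<phi> j x) \<le> 2 * (2 * ?g N + 2 * sqnorm (\<lambda>x. v x - G (\<phi> j) x))"
        unfolding En_test_diff[OF \<phi> \<phi>] by (intro mult_left_mono sqnorm_triangle mG v) auto
      also have "\<dots> = 2 * (2 * ?g N + 2 * ?g j)" by (subst (2) sqnorm_minus_commute) simp
      also have "\<dots> \<le> 2 * (2 * ?d + 2 * ?d)"
        using N[of N] N[OF j] by (intro mult_left_mono add_mono) auto
      also have "\<dots> = 8 * ?d" by (simp add: distrib_left flip: mult.assoc distrib_right)
      finally show ?thesis .
    qed
    then have ev8: "\<forall>\<^sub>F j in sequentially. En (\<lambda>x. \<phi> N x - \<phi> j x) \<le> 8 * ?d"
      by (auto simp: eventually_sequentially)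
    have finN: "sqnorm (\<lambda>x. \<phi> N x - u x) < \<infinity>"
    proof -
      have "sqnorm (\<phi> N) < \<infinity>"
        using nn_integral_eq_integral[OF test_function_integrable[OF test_function_mult[OF conjunct1[OF \<phi>[unfolded test_function_def]] \<phi>]], of N N]
        by (simp add: sqnorm_def power2_eq_square flip: power2_eq_square)
      moreover have "sqnorm (\<lambda>x. \<phi> N x - u x) \<le> 2 * sqnorm (\<phi> N) + 2 * sqnorm u"
        by (intro sqnorm_diff_le measurable_completion) auto
      ultimately show ?thesis using fin by (auto intro: le_less_trans simp: ennreal_mult_less_top)
    qed
    have lim': "(\<lambda>j. sqnorm (\<lambda>x. (\<phi> N x - \<phi> j x) - (\<phi> N x - u x))) \<longlonglongrightarrow> 0"
    proof -
      have "(\<lambda>x. (\<phi> N x - \<phi> j x) - (\<phi> N x - u x)) = (\<lambda>x. u x - \<phi> j x)" for j by auto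
      then show ?thesis using lim by (simp add: sqnorm_minus_commute[of u])
    qed
    have E1: "En (\<lambda>x. \<phi> N x - u x) \<le> 2 * (8 * ?d)"
      by (rule En_le_of_limit[OF _ _ finN lim' ev8]) measurable
    have "En (\<lambda>x. (\<phi> N x - u x) + u x) \<le> 2 * En (\<lambda>x. \<phi> N x - u x) + 2 * En u"
      by (rule En_add_le) measurable
    also have "\<dots> \<le> 2 * (2 * (8 * ?d)) + 2 * En u"
      by (intro add_right_mono mult_left_mono E1) auto
    finally have En: "En (\<phi> N) \<le> 2 * (2 * (8 * ?d)) + 2 * En u" by simp
    have "sqnorm (\<lambda>x. G (\<phi> N) x - (G (\<phi> N) x - v x)) \<le> 2 * sqnorm (G (\<phi> N)) + 2 * ?g N"
      by (intro sqnorm_diff_le borel_measurable_diff mG v)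
    then have "sqnorm v \<le> En (\<phi> N) + 2 * ?g N" by (simp add: En_test[OF \<phi>])
    also have "\<dots> \<le> (2 * (2 * (8 * ?d)) + 2 * En u) + 2 * ?d"
      using En N[of N] by (intro add_mono mult_left_mono) auto
    also have "\<dots> = 2 * En u + (32 * ?d + 2 * ?d)" by (simp add: add_ac flip: mult.assoc)
    also have "32 * ?d + 2 * ?d = ennreal e"
      using e ennreal_mult'[of 34 "e / 34"] by (simp flip: distrib_right)
    finally show "sqnorm v \<le> 2 * En u + ennreal e" .
  qed
qed


subsection \<open>Truncation\<close>

text \<open>Fourier inversion writes the increment of the dilated function as a superposition of
  increments of characters. Cauchy-Schwarz with the weight |\<open>fourier f\<close>| turns their
  squares into 2 (1 - cos), which \<open>\<kappa>\<close> integrates to the squared multiplier by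
  \<open>kernel_multiplier\<close>. The bound is uniform in \<open>x\<close>, which is what the
  commutator estimate requires.\<close>

lemma kernel_difference_square_le:
  fixes f :: "real^'n \<Rightarrow> complex"
  assumes f: "test_function f"
  shows "(\<integral>\<^sup>+h. ennreal (\<kappa> h) * ennreal ((norm (f (s *\<^sub>R (x + h)) - f (s *\<^sub>R x)))\<^sup>2) \<partial>lborel)
    \<le> (\<integral>\<^sup>+\<xi>. ennreal (norm (fourier f \<xi>)) \<partial>lborel)
      * (\<integral>\<^sup>+\<xi>. ennreal (norm (fourier f \<xi>)) * (2 * ennreal ((norm (Lam (s *\<^sub>R \<xi>)))\<^sup>2)) \<partial>lborel)"
proof -
  have [measurable]: "fourier f \<in> borel_measurable borel" by (rule fourier_test_measurable[OF f])
  let ?c = "\<lambda>h \<xi>. 1 - cos (2 * pi * (h \<bullet> (s *\<^sub>R \<xi>)))"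
  let ?I = "\<integral>\<^sup>+\<xi>. ennreal (norm (fourier f \<xi>)) \<partial>lborel"
  have i: "integrable lborel (\<lambda>\<xi>. fourier f \<xi> * cis (2 * pi * (y \<bullet> \<xi>)))" for y
    by (intro integrable_mult_cis integrable_fourier_test[OF f]) measurable
  have le: "ennreal ((norm (f (s *\<^sub>R (x + h)) - f (s *\<^sub>R x)))\<^sup>2)
    \<le> ?I * (\<integral>\<^sup>+\<xi>. ennreal (norm (fourier f \<xi>)) * (2 * ennreal (?c h \<xi>)) \<partial>lborel)" for h
  proof -
    let ?m = "\<lambda>\<xi>. cis (2 * pi * ((s *\<^sub>R (x + h)) \<bullet> \<xi>)) - cis (2 * pi * ((s *\<^sub>R x) \<bullet> \<xi>))"
    have m: "(norm (?m \<xi>))\<^sup>2 = 2 * ?c h \<xi>" for \<xi>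
    proof -
      have "?m \<xi> = - cis (2 * pi * ((s *\<^sub>R x) \<bullet> \<xi>)) * (1 - cis (- (- (2 * pi * (h \<bullet> (s *\<^sub>R \<xi>))))))"
        by (simp add: right_diff_distrib cis_mult inner_add_left scaleR_right_distrib distrib_left)
      then have "norm (?m \<xi>) = norm (1 - cis (- (- (2 * pi * (h \<bullet> (s *\<^sub>R \<xi>))))))"
        by (simp only: norm_mult norm_minus_cancel norm_cis mult_1_left)
      then show ?thesis by (simp only: norm_one_minus_cis_square cos_minus)
    qed
    have "f (s *\<^sub>R (x + h)) - f (s *\<^sub>R x) = (LINT \<xi>|lborel. fourier f \<xi> * ?m \<xi>)"
      unfolding fourier_inversion_test[OF f, of "s *\<^sub>R (x + h)"] fourier_inversion_test[OF f, of "s *\<^sub>R x"] right_diff_distrib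
      by (rule Bochner_Integration.integral_diff[symmetric]) (rule i)+
    then have "ennreal ((norm (f (s *\<^sub>R (x + h)) - f (s *\<^sub>R x)))\<^sup>2) = ennreal ((norm (LINT \<xi>|lborel. fourier f \<xi> * ?m \<xi>))\<^sup>2)" by simp
    also have "\<dots> \<le> ?I * (\<integral>\<^sup>+\<xi>. ennreal (norm (fourier f \<xi>) * (norm (?m \<xi>))\<^sup>2) \<partial>lborel)"
      by (rule norm_integral_mult_square_le) measurable
    also have "(\<integral>\<^sup>+\<xi>. ennreal (norm (fourier f \<xi>) * (norm (?m \<xi>))\<^sup>2) \<partial>lborel) = (\<integral>\<^sup>+\<xi>. ennreal (norm (fourier f \<xi>)) * (2 * ennreal (?c h \<xi>)) \<partial>lborel)"
    proof -
      have "ennreal (a * (2 * c)) = ennreal a * (2 * ennreal c)" if "a \<ge> 0" "c \<ge> 0" for a c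
        using that by (simp add: ennreal_mult)
      then have "ennreal (norm (fourier f \<xi>) * (2 * ?c h \<xi>)) = ennreal (norm (fourier f \<xi>)) * (2 * ennreal (?c h \<xi>))" for \<xi>
        by (metis norm_ge_zero cos_le_one diff_ge_0_iff_ge)
      then show ?thesis unfolding m by (simp only:)
    qed
    finally show ?thesis .
  qed
  have "(\<integral>\<^sup>+h. ennreal (\<kappa> h) * ennreal ((norm (f (s *\<^sub>R (x + h)) - f (s *\<^sub>R x)))\<^sup>2) \<partial>lborel)
    \<le> (\<integral>\<^sup>+h. ?I * (ennreal (\<kappa> h) * (\<integral>\<^sup>+\<xi>. ennreal (norm (fourier f \<xi>)) * (2 * ennreal (?c h \<xi>)) \<partial>lborel)) \<partial>lborel)"
  proof (rule nn_integral_mono)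
    fix h
    show "ennreal (\<kappa> h) * ennreal ((norm (f (s *\<^sub>R (x + h)) - f (s *\<^sub>R x)))\<^sup>2)
      \<le> ?I * (ennreal (\<kappa> h) * (\<integral>\<^sup>+\<xi>. ennreal (norm (fourier f \<xi>)) * (2 * ennreal (?c h \<xi>)) \<partial>lborel))"
      using mult_left_mono[OF le[of h], of "ennreal (\<kappa> h)"] by (simp only: mult.left_commute zero_le)
  qed
  also have "\<dots> = ?I * (\<integral>\<^sup>+h. \<integral>\<^sup>+\<xi>. ennreal (\<kappa> h) * (ennreal (norm (fourier f \<xi>)) * (2 * ennreal (?c h \<xi>))) \<partial>lborel \<partial>lborel)"
    by (simp add: nn_integral_cmult)
  also have "(\<integral>\<^sup>+h. \<integral>\<^sup>+\<xi>. ennreal (\<kappa> h) * (ennreal (norm (fourier f \<xi>)) * (2 * ennreal (?c h \<xi>))) \<partial>lborel \<partial>lborel)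
    = (\<integral>\<^sup>+\<xi>. \<integral>\<^sup>+h. ennreal (\<kappa> h) * (ennreal (norm (fourier f \<xi>)) * (2 * ennreal (?c h \<xi>))) \<partial>lborel \<partial>lborel)"
    by (rule lborel_pair.Fubini') measurable
  also have "\<dots> = (\<integral>\<^sup>+\<xi>. ennreal (norm (fourier f \<xi>)) * (2 * ennreal ((norm (Lam (s *\<^sub>R \<xi>)))\<^sup>2)) \<partial>lborel)"
  proof (rule nn_integral_cong)
    fix \<xi>
    have "(\<integral>\<^sup>+h. ennreal (\<kappa> h) * (ennreal (norm (fourier f \<xi>)) * (2 * ennreal (?c h \<xi>))) \<partial>lborel)
      = (\<integral>\<^sup>+h. (ennreal (norm (fourier f \<xi>)) * 2) * ennreal (\<kappa> h * ?c h \<xi>) \<partial>lborel)"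
      by (intro nn_integral_cong) (simp add: \<kappa>_nonneg ennreal_mult mult_ac)
    also have "\<dots> = (ennreal (norm (fourier f \<xi>)) * 2) * (\<integral>\<^sup>+h. ennreal (\<kappa> h * ?c h \<xi>) \<partial>lborel)"
      by (rule nn_integral_cmult) measurable
    finally show "(\<integral>\<^sup>+h. ennreal (\<kappa> h) * (ennreal (norm (fourier f \<xi>)) * (2 * ennreal (?c h \<xi>))) \<partial>lborel)
      = ennreal (norm (fourier f \<xi>)) * (2 * ennreal ((norm (Lam (s *\<^sub>R \<xi>)))\<^sup>2))"
      unfolding kernel_multiplier by (simp only: mult.assoc)
  qed
  finally show ?thesis .
qed

lemma Lam_dilated_tendsto:
  fixes f :: "real^'n \<Rightarrow> complex"
  assumes f: "test_function f" and s: "s \<longlonglongrightarrow> 0" "\<And>k. \<bar>s k\<bar> \<le> 1"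
  shows "(\<lambda>k. \<integral>\<^sup>+\<xi>. ennreal (norm (fourier f \<xi>)) * (2 * ennreal ((norm (Lam (s k *\<^sub>R \<xi>)))\<^sup>2)) \<partial>lborel) \<longlonglongrightarrow> 0"
proof -
  have [measurable]: "fourier f \<in> borel_measurable borel" by (rule fourier_test_measurable[OF f])
  obtain C where C: "integrable lborel (\<lambda>\<zeta>. C * ((1 + (norm \<zeta>)\<^sup>2) ^ 1 * norm (fourier f \<zeta>)))"
    "\<And>s' a' \<zeta>. \<bar>s'\<bar> \<le> 1 \<Longrightarrow> norm a' \<le> 1 \<Longrightarrow>
      norm (complex_of_real ((norm (Lam (s' *\<^sub>R \<zeta> + a')))\<^sup>2) * fourier f \<zeta>) \<le> C * ((1 + (norm \<zeta>)\<^sup>2) ^ 1 * norm (fourier f \<zeta>))"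
    using integrable_Lam_fourier[OF f, of 1] by blast
  have e: "ennreal (norm (fourier f \<xi>)) * (2 * ennreal ((norm (Lam (s k *\<^sub>R \<xi>)))\<^sup>2))
      = ennreal (2 * ((norm (Lam (s k *\<^sub>R \<xi>)))\<^sup>2 * norm (fourier f \<xi>)))" for k \<xi>
    by (simp add: ennreal_mult mult_ac)
  let ?w = "\<lambda>\<xi>. 2 * (C * ((1 + (norm \<xi>)\<^sup>2) ^ 1 * norm (fourier f \<xi>)))"
  have iw: "integrable lborel ?w" by (rule integrable_mult_right[OF C(1)])
  have le: "2 * ((norm (Lam (s k *\<^sub>R \<xi>)))\<^sup>2 * norm (fourier f \<xi>)) \<le> ?w \<xi>" for k \<xi>
    using C(2)[OF s(2)[of k], of 0 \<xi>] by (simp add: norm_mult norm_power)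
  have "(\<lambda>k. \<integral>\<^sup>+\<xi>. ennreal (2 * ((norm (Lam (s k *\<^sub>R \<xi>)))\<^sup>2 * norm (fourier f \<xi>))) \<partial>lborel)
      \<longlonglongrightarrow> (\<integral>\<^sup>+(\<xi>::real^'n). 0 \<partial>lborel)"
  proof (rule nn_integral_dominated_convergence[where w="\<lambda>\<xi>. ennreal (?w \<xi>)"])
    show "(\<integral>\<^sup>+\<xi>. ennreal (?w \<xi>) \<partial>lborel) < \<infinity>"
      using integrableD(2)[OF iw] by (simp add: real_integrable_def less_top)
    show "AE \<xi> in lborel. ennreal (2 * ((norm (Lam (s k *\<^sub>R \<xi>)))\<^sup>2 * norm (fourier f \<xi>))) \<le> ennreal (?w \<xi>)" for k
      by (intro AE_I2 ennreal_leI le)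
    show "AE \<xi> in lborel. (\<lambda>k. ennreal (2 * ((norm (Lam (s k *\<^sub>R \<xi>)))\<^sup>2 * norm (fourier f \<xi>)))) \<longlonglongrightarrow> 0"
    proof (rule AE_I2)
      fix \<xi> :: "real^'n"
      have "(\<lambda>k. s k *\<^sub>R \<xi>) \<longlonglongrightarrow> 0 *\<^sub>R \<xi>" by (intro tendsto_intros s)
      then have "(\<lambda>k. Lam (s k *\<^sub>R \<xi>)) \<longlonglongrightarrow> Lam (0 *\<^sub>R \<xi>)"
        using continuous_on_Lam by (intro isCont_tendsto_compose[of _ Lam]) (auto simp: continuous_on_eq_continuous_at)
      then have "(\<lambda>k. ennreal (2 * ((norm (Lam (s k *\<^sub>R \<xi>)))\<^sup>2 * norm (fourier f \<xi>))))
          \<longlonglongrightarrow> ennreal (2 * ((norm (Lam (0 *\<^sub>R \<xi>)))\<^sup>2 * norm (fourier f \<xi>)))"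
        by (intro tendsto_ennrealI tendsto_intros)
      then show "(\<lambda>k. ennreal (2 * ((norm (Lam (s k *\<^sub>R \<xi>)))\<^sup>2 * norm (fourier f \<xi>)))) \<longlonglongrightarrow> 0" by simp
    qed
  qed measurable
  then show ?thesis unfolding e by simp
qed

text \<open>With \<psi> = 1 - \<theta>(s x), the product rule for increments splits the energy of
  \<psi> u in two. In \<open>A\<close> the factor \<psi> multiplies increments of \<open>u\<close>,
  and the finite energy of \<open>u\<close> dominates. In \<open>B\<close> the increments fall on
  \<psi>, and \<open>kernel_difference_square_le\<close> bounds it by the squared norm of
  \<open>u\<close> times a quantity that vanishes because the multiplier is continuous and zero at
  the origin.\<close>

lemma En_truncated_tendsto:
  fixes u \<theta> :: "real^'n \<Rightarrow> real"
  assumes [measurable]: "u \<in> borel_measurable borel" and fin: "sqnorm u < \<infinity>" "En u < \<infinity>"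
    and \<theta>: "test_function \<theta>" "\<And>x. 0 \<le> \<theta> x" "\<And>x. \<theta> x \<le> 1" "\<And>x. norm x \<le> 1 \<Longrightarrow> \<theta> x = 1"
  shows "(\<lambda>k. sqnorm (\<lambda>x. u x - \<theta> ((1 / real (Suc k)) *\<^sub>R x) * u x)) \<longlonglongrightarrow> 0"
    and "(\<lambda>k. En (\<lambda>x. u x - \<theta> ((1 / real (Suc k)) *\<^sub>R x) * u x)) \<longlonglongrightarrow> 0"
proof -
  have [measurable]: "\<theta> \<in> borel_measurable borel" by (rule test_function_measurable[OF \<theta>(1)])
  define s where "s k = 1 / real (Suc k)" for k
  have s: "s \<longlonglongrightarrow> 0" "\<And>k. \<bar>s k\<bar> \<le> 1"
    unfolding s_def using LIMSEQ_Suc[OF lim_1_over_n[where 'a=real]] by auto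
  define \<psi> where "\<psi> k x = 1 - \<theta> (s k *\<^sub>R x)" for k x
  have [measurable]: "\<psi> k \<in> borel_measurable borel" for k unfolding \<psi>_def[abs_def] by measurable
  have \<psi>01: "0 \<le> \<psi> k x" "\<psi> k x \<le> 1" for k x using \<theta>(2,3)[of "s k *\<^sub>R x"] by (auto simp: \<psi>_def)
  have \<psi>lim: "(\<lambda>k. \<psi> k x) \<longlonglongrightarrow> 0" for x
  proof (rule tendsto_eventually)
    obtain m where m: "norm x \<le> real m" using real_arch_simple by blast
    show "\<forall>\<^sub>F k in sequentially. \<psi> k x = 0"
    proof (rule eventually_sequentiallyI[of m])
      fix k assume "m \<le> k"
      then have "norm x \<le> real (Suc k)" using m by simp
      then have "norm (s k *\<^sub>R x) \<le> 1" by (simp add: s_def divide_le_eq del: of_nat_Suc)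
      then show "\<psi> k x = 0" by (simp add: \<psi>_def \<theta>(4) del: norm_scaleR)
    qed
  qed
  have eq: "(\<lambda>x. u x - \<theta> ((1 / real (Suc k)) *\<^sub>R x) * u x) = (\<lambda>x. \<psi> k x * u x)" for k
    by (simp add: \<psi>_def s_def algebra_simps)
  have cut: "(\<lambda>k. sqnorm (\<lambda>x. \<psi> k x * f x)) \<longlonglongrightarrow> 0"
    if [measurable]: "f \<in> borel_measurable borel" and "sqnorm f < \<infinity>" for f :: "real^'n \<Rightarrow> real"
  proof (rule sqnorm_dominated[OF _ _ _ that(2)])
    show "norm (\<psi> k x * f x) \<le> norm (f x)" for k x
      using \<psi>01[of k x] by (simp add: abs_mult mult_left_le_one_le)
    show "AE x in lborel. (\<lambda>k. \<psi> k x * f x) \<longlonglongrightarrow> 0"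
      using tendsto_mult_right[OF \<psi>lim] by (auto intro!: tendsto_mult_left_zero \<psi>lim)
  qed measurable
  have cut_le: "sqnorm (\<lambda>x. \<psi> k x * f x) \<le> sqnorm f" for k and f :: "real^'n \<Rightarrow> real"
    unfolding sqnorm_def using \<psi>01[of k]
    by (intro nn_integral_mono ennreal_leI power_mono) (auto simp: abs_mult mult_left_le_one_le)
  show "(\<lambda>k. sqnorm (\<lambda>x. u x - \<theta> ((1 / real (Suc k)) *\<^sub>R x) * u x)) \<longlonglongrightarrow> 0"
    unfolding eq by (rule cut) (use fin in auto)
  let ?D = "\<lambda>h x. u x - u (x - h)"
  note [measurable] = sqnorm_difference_measurable[OF assms(1)]
  have fD: "sqnorm (?D h) < \<infinity>" for h
    using fin by (intro le_less_trans[OF sqnorm_difference_le[OF assms(1)]]) (simp add: ennreal_mult_less_top)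
  define A where "A k = (\<integral>\<^sup>+h. ennreal (\<kappa> h) * sqnorm (\<lambda>x. \<psi> k x * ?D h x) \<partial>lborel)" for k
  define B where "B k = (\<integral>\<^sup>+h. ennreal (\<kappa> h) * sqnorm (\<lambda>x. (\<psi> k x - \<psi> k (x - h)) * u (x - h)) \<partial>lborel)" for k
  have mA[measurable]: "(\<lambda>h. sqnorm (\<lambda>x. \<psi> k x * ?D h x)) \<in> borel_measurable borel" for k
    unfolding sqnorm_def by measurable
  have mB[measurable]: "(\<lambda>h. sqnorm (\<lambda>x. (\<psi> k x - \<psi> k (x - h)) * u (x - h))) \<in> borel_measurable borel" for k
    unfolding sqnorm_def by measurable
  have le: "En (\<lambda>x. \<psi> k x * u x) \<le> 2 * A k + 2 * B k" for k
  proof -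
    have "En (\<lambda>x. \<psi> k x * u x) \<le> (\<integral>\<^sup>+h. 2 * (ennreal (\<kappa> h) * sqnorm (\<lambda>x. \<psi> k x * ?D h x))
        + 2 * (ennreal (\<kappa> h) * sqnorm (\<lambda>x. (\<psi> k x - \<psi> k (x - h)) * u (x - h))) \<partial>lborel)"
      unfolding En_def
    proof (rule nn_integral_mono)
      fix h
      have "sqnorm (\<lambda>x. \<psi> k x * u x - \<psi> k (x - h) * u (x - h)) = sqnorm (\<lambda>x. \<psi> k x * ?D h x + (\<psi> k x - \<psi> k (x - h)) * u (x - h))"
        by (simp add: algebra_simps)
      also have "\<dots> \<le> 2 * sqnorm (\<lambda>x. \<psi> k x * ?D h x) + 2 * sqnorm (\<lambda>x. (\<psi> k x - \<psi> k (x - h)) * u (x - h))"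
        by (intro sqnorm_add_le measurable_completion) measurable
      finally have "ennreal (\<kappa> h) * sqnorm (\<lambda>x. \<psi> k x * u x - \<psi> k (x - h) * u (x - h))
        \<le> ennreal (\<kappa> h) * (2 * sqnorm (\<lambda>x. \<psi> k x * ?D h x) + 2 * sqnorm (\<lambda>x. (\<psi> k x - \<psi> k (x - h)) * u (x - h)))"
        by (intro mult_left_mono) auto
      then show "ennreal (\<kappa> h) * sqnorm (\<lambda>x. \<psi> k x * u x - \<psi> k (x - h) * u (x - h))
        \<le> 2 * (ennreal (\<kappa> h) * sqnorm (\<lambda>x. \<psi> k x * ?D h x)) + 2 * (ennreal (\<kappa> h) * sqnorm (\<lambda>x. (\<psi> k x - \<psi> k (x - h)) * u (x - h)))"
        by (simp only: distrib_left mult.left_commute)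
    qed
    also have "\<dots> = 2 * A k + 2 * B k"
      unfolding A_def B_def by (simp add: nn_integral_add nn_integral_cmult)
    finally show ?thesis .
  qed
  have A: "A \<longlonglongrightarrow> 0"
  proof -
    have "(\<lambda>k. \<integral>\<^sup>+h. ennreal (\<kappa> h) * sqnorm (\<lambda>x. \<psi> k x * ?D h x) \<partial>lborel) \<longlonglongrightarrow> (\<integral>\<^sup>+(h::real^'n). 0 \<partial>lborel)"
    proof (rule nn_integral_dominated_convergence[where w="\<lambda>h. ennreal (\<kappa> h) * sqnorm (?D h)"])
      show "(\<integral>\<^sup>+h. ennreal (\<kappa> h) * sqnorm (?D h) \<partial>lborel) < \<infinity>" using fin(2) by (simp add: En_def)
      show "AE h in lborel. ennreal (\<kappa> h) * sqnorm (\<lambda>x. \<psi> k x * ?D h x) \<le> ennreal (\<kappa> h) * sqnorm (?D h)" for k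
        by (intro AE_I2 mult_left_mono cut_le) auto
      show "AE h in lborel. (\<lambda>k. ennreal (\<kappa> h) * sqnorm (\<lambda>x. \<psi> k x * ?D h x)) \<longlonglongrightarrow> 0"
        by (intro AE_I2 ennreal_tendsto_zero_cmult cut fD) auto
    qed measurable
    then show ?thesis by (simp add: A_def[abs_def])
  qed
  have B: "B \<longlonglongrightarrow> 0"
  proof -
    let ?f = "\<lambda>x. complex_of_real (\<theta> x)"
    have tf: "test_function ?f" by (rule test_function_of_real[OF \<theta>(1)])
    let ?I = "\<integral>\<^sup>+\<xi>. ennreal (norm (fourier ?f \<xi>)) \<partial>lborel"
    let ?e = "\<lambda>k. \<integral>\<^sup>+\<xi>. ennreal (norm (fourier ?f \<xi>)) * (2 * ennreal ((norm (Lam (s k *\<^sub>R \<xi>)))\<^sup>2)) \<partial>lborel"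
    have I: "?I < \<infinity>"
      using integrableD(2)[OF integrable_norm[OF integrable_fourier_test[OF tf]]] by (simp add: real_integrable_def less_top)
    have Bk: "B k \<le> (sqnorm u * ?I) * ?e k" for k
    proof -
      \<comment> \<open>Translating by h for each fixed h frees the factor \<open>u\<close> from h,
        so that after Tonelli the inner integral over h concerns the cutoff alone.\<close>
      have "B k = (\<integral>\<^sup>+h. \<integral>\<^sup>+x. ennreal (\<kappa> h) * (ennreal ((norm (?f (s k *\<^sub>R (x + h)) - ?f (s k *\<^sub>R x)))\<^sup>2) * ennreal ((norm (u x))\<^sup>2)) \<partial>lborel \<partial>lborel)"
        unfolding B_def
      proof (rule nn_integral_cong)
        fix h
        have "sqnorm (\<lambda>x. (\<psi> k x - \<psi> k (x - h)) * u (x - h)) = sqnorm (\<lambda>x. (\<lambda>x. (\<psi> k (x + h) - \<psi> k x) * u x) (x - h))"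
          by simp
        also have "\<dots> = sqnorm (\<lambda>x. (\<psi> k (x + h) - \<psi> k x) * u x)"
          by (rule sqnorm_translate) measurable
        also have "\<dots> = (\<integral>\<^sup>+x. ennreal ((norm (?f (s k *\<^sub>R (x + h)) - ?f (s k *\<^sub>R x)))\<^sup>2) * ennreal ((norm (u x))\<^sup>2) \<partial>lborel)"
          unfolding sqnorm_def
        proof (rule nn_integral_cong)
          fix x
          have "norm (?f (s k *\<^sub>R (x + h)) - ?f (s k *\<^sub>R x)) = norm (\<psi> k (x + h) - \<psi> k x)"
            unfolding \<psi>_def of_real_diff[symmetric] norm_of_real by simp
          then show "ennreal ((norm ((\<psi> k (x + h) - \<psi> k x) * u x))\<^sup>2) = ennreal ((norm (?f (s k *\<^sub>R (x + h)) - ?f (s k *\<^sub>R x)))\<^sup>2) * ennreal ((norm (u x))\<^sup>2)"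
            by (simp only: norm_mult power_mult_distrib ennreal_mult zero_le_power2)
        qed
        finally show "ennreal (\<kappa> h) * sqnorm (\<lambda>x. (\<psi> k x - \<psi> k (x - h)) * u (x - h))
          = (\<integral>\<^sup>+x. ennreal (\<kappa> h) * (ennreal ((norm (?f (s k *\<^sub>R (x + h)) - ?f (s k *\<^sub>R x)))\<^sup>2) * ennreal ((norm (u x))\<^sup>2)) \<partial>lborel)"
          by (simp add: nn_integral_cmult)
      qed
      also have "\<dots> = (\<integral>\<^sup>+x. \<integral>\<^sup>+h. ennreal (\<kappa> h) * (ennreal ((norm (?f (s k *\<^sub>R (x + h)) - ?f (s k *\<^sub>R x)))\<^sup>2) * ennreal ((norm (u x))\<^sup>2)) \<partial>lborel \<partial>lborel)"
        by (rule lborel_pair.Fubini') measurable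
      also have "\<dots> \<le> (\<integral>\<^sup>+x. ennreal ((norm (u x))\<^sup>2) * (?I * ?e k) \<partial>lborel)"
      proof (rule nn_integral_mono)
        fix x
        have "(\<integral>\<^sup>+h. ennreal (\<kappa> h) * (ennreal ((norm (?f (s k *\<^sub>R (x + h)) - ?f (s k *\<^sub>R x)))\<^sup>2) * ennreal ((norm (u x))\<^sup>2)) \<partial>lborel)
          = (\<integral>\<^sup>+h. ennreal ((norm (u x))\<^sup>2) * (ennreal (\<kappa> h) * ennreal ((norm (?f (s k *\<^sub>R (x + h)) - ?f (s k *\<^sub>R x)))\<^sup>2)) \<partial>lborel)"
          by (intro nn_integral_cong) (simp only: mult_ac)
        also have "\<dots> = ennreal ((norm (u x))\<^sup>2) * (\<integral>\<^sup>+h. ennreal (\<kappa> h) * ennreal ((norm (?f (s k *\<^sub>R (x + h)) - ?f (s k *\<^sub>R x)))\<^sup>2) \<partial>lborel)"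
          by (rule nn_integral_cmult) measurable
        also have "\<dots> \<le> ennreal ((norm (u x))\<^sup>2) * (?I * ?e k)"
          by (intro mult_left_mono kernel_difference_square_le tf) auto
        finally show "(\<integral>\<^sup>+h. ennreal (\<kappa> h) * (ennreal ((norm (?f (s k *\<^sub>R (x + h)) - ?f (s k *\<^sub>R x)))\<^sup>2) * ennreal ((norm (u x))\<^sup>2)) \<partial>lborel)
          \<le> ennreal ((norm (u x))\<^sup>2) * (?I * ?e k)" .
      qed
      also have "\<dots> = sqnorm u * (?I * ?e k)"
        unfolding sqnorm_def by (rule nn_integral_multc) measurable
      finally show ?thesis by (simp only: mult.assoc)
    qed
    have "(\<lambda>k. (sqnorm u * ?I) * ?e k) \<longlonglongrightarrow> 0"
      using I fin(1) by (intro ennreal_tendsto_zero_cmult Lam_dilated_tendsto tf s) (simp add: ennreal_mult_less_top)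
    from tendsto_sandwich[OF _ _ tendsto_const this] show ?thesis using Bk by simp
  qed
  show "(\<lambda>k. En (\<lambda>x. u x - \<theta> ((1 / real (Suc k)) *\<^sub>R x) * u x)) \<longlonglongrightarrow> 0"
    unfolding eq by (rule ennreal_tendsto_0_comparison[OF A B le])
qed

text \<open>Mollification commutes with translations, so the increments of the error are the
  mollification errors of the increments of \<open>u\<close>. Each is bounded by a
  \<open>modulus\<close>, which tends to zero and is at most four times the integrand of the energy.
  Integrability of \<open>u\<close> is at hand in the application because truncation comes before
  mollification.\<close>

lemma En_mollified_tendsto:
  fixes \<eta> u :: "real^'n \<Rightarrow> real"
  assumes \<eta>: "mollifier \<eta>" and i: "integrable lborel u" and fin: "sqnorm u < \<infinity>" "En u < \<infinity>"
    and c: "c \<longlonglongrightarrow> 0" "\<And>k. c k > 0"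
  shows "(\<lambda>k. sqnorm (\<lambda>x. mollifier.moll \<eta> (c k) u x - u x)) \<longlonglongrightarrow> 0"
    and "(\<lambda>k. En (\<lambda>x. mollifier.moll \<eta> (c k) u x - u x)) \<longlonglongrightarrow> 0"
proof -
  interpret mollifier \<eta> by (rule \<eta>)
  have [measurable]: "u \<in> borel_measurable borel" using borel_measurable_integrable[OF i] by simp
  have c0: "c k \<noteq> 0" for k using c(2)[of k] by simp
  let ?D = "\<lambda>h x. u x - u (x - h)"
  note [measurable] = sqnorm_difference_measurable[OF \<open>u \<in> borel_measurable borel\<close>]
  have fD: "sqnorm (?D h) < \<infinity>" for h
    using fin by (intro le_less_trans[OF sqnorm_difference_le]) (auto simp: ennreal_mult_less_top)
  have iT: "integrable lborel (\<lambda>x. u (x - h))" for h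
    using i integrable_lborel_translate[of u "- h"] by simp
  have iD: "integrable lborel (?D h)" for h
    by (intro Bochner_Integration.integrable_diff i iT)
  show "(\<lambda>k. sqnorm (\<lambda>x. moll (c k) u x - u x)) \<longlonglongrightarrow> 0"
    by (rule tendsto_sandwich[OF _ _ tendsto_const modulus_tendsto[OF _ fin(1) c(1)]])
      (use sqnorm_moll_le[OF i c0] in auto)
  have mm[measurable]: "(\<lambda>h. modulus (c k) (?D h)) \<in> borel_measurable borel" for k
    unfolding modulus_def sqnorm_def by measurable
  have le: "En (\<lambda>x. moll (c k) u x - u x) \<le> (\<integral>\<^sup>+h. ennreal (\<kappa> h) * modulus (c k) (?D h) \<partial>lborel)" for k
    unfolding En_def
  proof (intro nn_integral_mono mult_left_mono)
    fix h
    have "moll (c k) (?D h) x = moll (c k) u x - moll (c k) u (x - h)" for x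
      unfolding moll_diff[OF i iT c0] moll_translate ..
    then have "moll (c k) u x - u x - (moll (c k) u (x - h) - u (x - h)) = moll (c k) (?D h) x - ?D h x" for x
      by simp
    then have "sqnorm (\<lambda>x. moll (c k) u x - u x - (moll (c k) u (x - h) - u (x - h))) = sqnorm (\<lambda>x. moll (c k) (?D h) x - ?D h x)"
      by (simp only:)
    also have "\<dots> \<le> modulus (c k) (?D h)" by (rule sqnorm_moll_le[OF iD c0])
    finally show "sqnorm (\<lambda>x. moll (c k) u x - u x - (moll (c k) u (x - h) - u (x - h))) \<le> modulus (c k) (?D h)" .
  qed auto
  have "(\<lambda>k. \<integral>\<^sup>+h. ennreal (\<kappa> h) * modulus (c k) (?D h) \<partial>lborel) \<longlonglongrightarrow> (\<integral>\<^sup>+(h::real^'n). 0 \<partial>lborel)"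
  proof (rule nn_integral_dominated_convergence[where w="\<lambda>h. 4 * (ennreal (\<kappa> h) * sqnorm (?D h))"])
    have "(\<integral>\<^sup>+h. 4 * (ennreal (\<kappa> h) * sqnorm (?D h)) \<partial>lborel) = 4 * En u"
      unfolding En_def by (rule nn_integral_cmult) measurable
    then show "(\<integral>\<^sup>+h. 4 * (ennreal (\<kappa> h) * sqnorm (?D h)) \<partial>lborel) < \<infinity>"
      using fin(2) by (simp add: ennreal_mult_less_top)
    show "AE h in lborel. ennreal (\<kappa> h) * modulus (c k) (?D h) \<le> 4 * (ennreal (\<kappa> h) * sqnorm (?D h))" for k
    proof (rule AE_I2)
      fix h
      have "ennreal (\<kappa> h) * modulus (c k) (?D h) \<le> ennreal (\<kappa> h) * (4 * sqnorm (?D h))"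
        by (intro mult_left_mono modulus_le) auto
      then show "ennreal (\<kappa> h) * modulus (c k) (?D h) \<le> 4 * (ennreal (\<kappa> h) * sqnorm (?D h))"
        by (simp only: mult.left_commute)
    qed
    show "AE h in lborel. (\<lambda>k. ennreal (\<kappa> h) * modulus (c k) (?D h)) \<longlonglongrightarrow> 0"
      by (intro AE_I2 ennreal_tendsto_zero_cmult modulus_tendsto fD c) auto
  qed measurable
  then have z: "(\<lambda>k. \<integral>\<^sup>+h. ennreal (\<kappa> h) * modulus (c k) (?D h) \<partial>lborel) \<longlonglongrightarrow> 0" by simp
  show "(\<lambda>k. En (\<lambda>x. moll (c k) u x - u x)) \<longlonglongrightarrow> 0"
    by (rule tendsto_sandwich[OF _ _ tendsto_const z]) (use le in auto)
qed

lemma test_function_approximation: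
  fixes u :: "real^'n \<Rightarrow> real"
  assumes u[measurable]: "u \<in> borel_measurable borel" and fin: "sqnorm u < \<infinity>" "En u < \<infinity>" and e: "e > 0"
  shows "\<exists>\<phi>. test_function \<phi> \<and> sqnorm (\<lambda>x. \<phi> x - u x) < ennreal e \<and> En (\<lambda>x. \<phi> x - u x) < ennreal e"
proof -
  obtain \<theta> :: "real^'n \<Rightarrow> real" where \<theta>: "test_function \<theta>" "\<And>x. 0 \<le> \<theta> x" "\<And>x. \<theta> x \<le> 1"
    "\<And>x. norm x \<le> 1 \<Longrightarrow> \<theta> x = 1" "\<And>x. norm x > 3 \<Longrightarrow> \<theta> x = 0"
    using cutoff_exists by blast
  have [measurable]: "\<theta> \<in> borel_measurable borel" by (rule test_function_measurable[OF \<theta>(1)])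
  obtain \<eta> :: "real^'n \<Rightarrow> real" where "test_function \<eta>" "\<And>x. \<eta> x \<ge> 0" "\<And>x. norm x > 1 \<Longrightarrow> \<eta> x = 0" "integral\<^sup>L lborel \<eta> = 1"
    using mollifier_exists by blast
  then have \<eta>: "mollifier \<eta>" unfolding mollifier_def by blast
  interpret mollifier \<eta> by (rule \<eta>)
  have e8: "0 < ennreal (e / 8)" using e by simp
  have small: "2 * X + 2 * Y < ennreal e" if "X < ennreal (e / 8)" "Y < ennreal (e / 8)" for X Y
  proof -
    have "2 * X + 2 * Y \<le> 2 * ennreal (e / 8) + 2 * ennreal (e / 8)"
      using that by (intro add_mono mult_left_mono) auto
    also have "\<dots> = ennreal (4 * (e / 8))"
      using e by (simp add: ennreal_mult' flip: ennreal_plus ennreal_numeral ennreal_mult)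
    also have "\<dots> < ennreal e" using e by (intro ennreal_lessI) auto
    finally show ?thesis .
  qed
  note trunc = En_truncated_tendsto[OF u fin \<theta>(1-4)]
  obtain k where k: "sqnorm (\<lambda>x. u x - \<theta> ((1 / real (Suc k)) *\<^sub>R x) * u x) < ennreal (e / 8)"
    "En (\<lambda>x. u x - \<theta> ((1 / real (Suc k)) *\<^sub>R x) * u x) < ennreal (e / 8)"
    using eventually_happens[OF eventually_conj[OF order_tendstoD(2)[OF trunc(1) e8] order_tendstoD(2)[OF trunc(2) e8]]]
    by auto
  define w where "w x = \<theta> ((1 / real (Suc k)) *\<^sub>R x) * u x" for x
  have [measurable]: "w \<in> borel_measurable borel" unfolding w_def[abs_def] by measurable
  have w0: "w x = 0" if "norm x > 3 * real (Suc k)" for x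
  proof -
    have "norm ((1 / real (Suc k)) *\<^sub>R x) > 3" using that by (simp add: less_divide_eq del: of_nat_Suc)
    then show ?thesis by (simp add: w_def \<theta>(5) del: norm_scaleR)
  qed
  have "sqnorm (\<lambda>x. u x - (u x - w x)) \<le> 2 * sqnorm u + 2 * sqnorm (\<lambda>x. u x - w x)"
    by (intro sqnorm_diff_le measurable_completion) measurable
  also have "\<dots> < \<infinity>"
    using fin(1) less_trans[OF k(1) ennreal_less_top] by (simp add: w_def ennreal_mult_less_top)
  finally have fw: "sqnorm w < \<infinity>" by simp
  have "En (\<lambda>x. (w x - u x) + u x) \<le> 2 * En (\<lambda>x. w x - u x) + 2 * En u"
    by (rule En_add_le) measurable
  also have "\<dots> < \<infinity>"
    using fin(2) less_trans[OF k(2) ennreal_less_top] En_minus_commute[of w u] by (simp add: w_def ennreal_mult_less_top)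
  finally have Ew: "En w < \<infinity>" by simp
  \<comment> \<open>The truncated function has bounded support and is square integrable, so |t|
    \<le> 1 + t^2 on a ball gives integrability.\<close>
  have iw: "integrable lborel w"
  proof -
    have sq: "integrable lborel (\<lambda>x. (w x)\<^sup>2)"
      using fw by (intro integrableI_bounded) (auto simp: sqnorm_def)
    let ?R = "3 * real (Suc k)"
    have "integrable lborel (\<lambda>x::real^'n. indicator (cball 0 ?R) x :: real)"
      using emeasure_bounded_finite[OF bounded_cball] by (intro integrable_real_indicator) auto
    from Bochner_Integration.integrable_add[OF this sq] show ?thesis
    proof (rule integrable_integral_cong_bound)
      fix x
      have "\<bar>t\<bar> \<le> 1 + t\<^sup>2" for t :: real
      proof -
        have "0 \<le> (\<bar>t\<bar> - 1)\<^sup>2" by simp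
        then have "2 * \<bar>t\<bar> \<le> 1 + t\<^sup>2" by (simp add: power2_diff)
        then show ?thesis by (smt (verit) abs_ge_zero)
      qed
      then show "norm (w x) \<le> indicator (cball 0 ?R) x + (w x)\<^sup>2"
        using w0[of x] by (cases "norm x \<le> ?R") (auto simp del: of_nat_Suc)
    qed simp
  qed
  let ?c = "\<lambda>k. 1 / real (Suc k)"
  have c: "?c \<longlonglongrightarrow> 0" "\<And>k. ?c k > 0" using LIMSEQ_Suc[OF lim_1_over_n[where 'a=real]] by auto
  note mollified = En_mollified_tendsto[OF \<eta> iw fw Ew c]
  obtain j where j: "sqnorm (\<lambda>x. moll (?c j) w x - w x) < ennreal (e / 8)" "En (\<lambda>x. moll (?c j) w x - w x) < ennreal (e / 8)"
    using eventually_happens[OF eventually_conj[OF order_tendstoD(2)[OF mollified(1) e8] order_tendstoD(2)[OF mollified(2) e8]]]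
    by auto
  let ?p = "moll (?c j) w"
  have tp: "test_function ?p" by (rule moll_test_function[OF iw w0 c(2)])
  have [measurable]: "?p \<in> borel_measurable borel" by (rule test_function_measurable[OF tp])
  have k': "sqnorm (\<lambda>x. w x - u x) < ennreal (e / 8)" "En (\<lambda>x. w x - u x) < ennreal (e / 8)"
    using k by (simp_all add: w_def sqnorm_minus_commute[of _ u] En_minus_commute[of _ u])
  have "sqnorm (\<lambda>x. ?p x - u x) \<le> 2 * sqnorm (\<lambda>x. ?p x - w x) + 2 * sqnorm (\<lambda>x. w x - u x)"
    by (intro sqnorm_triangle measurable_completion) measurable
  from le_less_trans[OF this small[OF j(1) k'(1)]] have "sqnorm (\<lambda>x. ?p x - u x) < ennreal e" .
  moreover have "En (\<lambda>x. ?p x - u x) \<le> 2 * En (\<lambda>x. ?p x - w x) + 2 * En (\<lambda>x. w x - u x)"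
    by (rule En_triangle) measurable
  from le_less_trans[OF this small[OF j(2) k'(2)]] have "En (\<lambda>x. ?p x - u x) < ennreal e" .
  ultimately show ?thesis using tp by blast
qed

lemma finite_energy_imp_closure:
  fixes u :: "real^'n \<Rightarrow> real"
  assumes u[measurable]: "u \<in> borel_measurable borel" and fin: "sqnorm u < \<infinity>" "En u < \<infinity>"
  obtains \<phi> v where "\<And>k. test_function (\<phi> k)" "v \<in> borel_measurable borel" "sqnorm v < \<infinity>"
    "(\<lambda>k. sqnorm (\<lambda>x. \<phi> k x - u x)) \<longlonglongrightarrow> 0" "(\<lambda>k. sqnorm (\<lambda>x. G (\<phi> k) x - v x)) \<longlonglongrightarrow> 0"
proof -
  \<comment> \<open>This rate makes the energy of \<open>\<phi> k - \<phi> j\<close> at most 2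
    (1/8)^k; as it is twice the squared distance of the gradients, these satisfy exactly the Cauchy
    condition of \<open>sqnorm_complete\<close>.\<close>
  let ?e = "\<lambda>k. (1/8) ^ k / 2 :: real"
  have "\<forall>k. \<exists>\<phi>. test_function \<phi> \<and> sqnorm (\<lambda>x. \<phi> x - u x) < ennreal (?e k) \<and> En (\<lambda>x. \<phi> x - u x) < ennreal (?e k)"
    by (intro allI test_function_approximation u fin) simp
  then obtain \<phi> where \<phi>: "\<And>k. test_function (\<phi> k)" "\<And>k. sqnorm (\<lambda>x. \<phi> k x - u x) < ennreal (?e k)"
    "\<And>k. En (\<lambda>x. \<phi> k x - u x) < ennreal (?e k)"
    by metis
  have m\<phi>[measurable]: "\<phi> k \<in> borel_measurable borel" for k by (rule test_function_measurable[OF \<phi>(1)])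
  have mG: "G (\<phi> k) \<in> borel_measurable borel" for k by (rule G_measurable[OF \<phi>(1)])
  have "(\<lambda>k. ?e k) \<longlonglongrightarrow> 0 / 2" by (intro tendsto_divide LIMSEQ_power_zero tendsto_const) auto
  then have "(\<lambda>k. ennreal (?e k)) \<longlonglongrightarrow> ennreal (0 / 2)" by (rule tendsto_ennrealI)
  then have z: "(\<lambda>k. ennreal (?e k)) \<longlonglongrightarrow> 0" by simp
  have lim: "(\<lambda>k. sqnorm (\<lambda>x. \<phi> k x - u x)) \<longlonglongrightarrow> 0"
    by (rule tendsto_sandwich[OF _ _ tendsto_const z]) (auto intro!: always_eventually less_imp_le[OF \<phi>(2)])
  have cauchy: "sqnorm (\<lambda>x. G (\<phi> k) x - G (\<phi> j) x) \<le> ennreal ((1/8) ^ k)" if "k \<le> j" for k j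
  proof -
    have "2 * sqnorm (\<lambda>x. G (\<phi> k) x - G (\<phi> j) x) = En (\<lambda>x. \<phi> k x - \<phi> j x)"
      by (rule En_test_diff[OF \<phi>(1) \<phi>(1), symmetric])
    also have "\<dots> \<le> 2 * En (\<lambda>x. \<phi> k x - u x) + 2 * En (\<lambda>x. u x - \<phi> j x)"
      by (rule En_triangle) measurable
    also have "\<dots> = 2 * En (\<lambda>x. \<phi> k x - u x) + 2 * En (\<lambda>x. \<phi> j x - u x)"
      by (simp only: En_minus_commute[of u])
    also have "\<dots> \<le> 2 * ennreal (?e k) + 2 * ennreal (?e k)"
    proof (intro add_mono mult_left_mono)
      have "?e j \<le> ?e k" using that by (intro divide_right_mono power_decreasing) auto
      then show "En (\<lambda>x. \<phi> j x - u x) \<le> ennreal (?e k)"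
        using \<phi>(3)[of j] by (meson ennreal_leI less_imp_le order_trans)
    qed (use \<phi>(3)[of k] in auto)
    also have "\<dots> = 2 * ennreal ((1/8) ^ k)"
    proof -
      have "ennreal (?e k) + ennreal (?e k) = ennreal ((1/8) ^ k)"
        by (simp flip: ennreal_plus)
      then show ?thesis by (simp only: distrib_left[symmetric])
    qed
    finally show ?thesis by (simp add: ennreal_mult_le_mult_iff)
  qed
  obtain v where v: "v \<in> borel_measurable borel" "(\<lambda>k. sqnorm (\<lambda>x. G (\<phi> k) x - v x)) \<longlonglongrightarrow> 0"
    using sqnorm_complete[OF mG cauchy] by blast
  have "sqnorm v \<le> 2 * En u"
    by (rule energy_of_closure(2)[OF u fin(1) measurable_completion \<phi>(1) lim v(2)]) (simp add: v(1))
  also have "\<dots> < \<infinity>" using fin(2) by (simp add: ennreal_mult_less_top)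
  finally show ?thesis using that[OF \<phi>(1) v(1) _ lim v(2)] by blast
qed

end

section \<open>Equality of the two spaces\<close>

lemma AE_lborel_reflect:
  fixes t :: "'a::euclidean_space"
  assumes "AE y in lborel. P y"
  shows "AE y in lborel. P (t - y)"
proof -
  obtain N where N: "N \<in> null_sets lborel" "{y. \<not> P y} \<subseteq> N"
    using assms by (auto simp: eventually_ae_filter)
  then have [measurable]: "N \<in> sets borel" by (auto simp: null_sets_def)
  have "(\<integral>\<^sup>+y. indicator N (t - y) \<partial>lborel) = (\<integral>\<^sup>+y. indicator N y \<partial>lborel)"
    by (rule nn_integral_lborel_reflect) measurable
  also have "\<dots> = 0" using N(1) by (simp add: null_sets_def)
  finally have "AE y in lborel. indicator N (t - y) = (0::ennreal)"
    by (subst (asm) nn_integral_0_iff_AE) measurable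
  then show ?thesis using N(2) by (auto elim!: eventually_mono split: split_indicator_asm)
qed

lemma L2_tendsto_iff: "L2_tendsto F f \<longleftrightarrow> (\<lambda>k. sqnorm (\<lambda>x. F k x - f x)) \<longlonglongrightarrow> 0"
  by (simp add: L2_tendsto_def sqnorm_lebesgue)

lemma square_integrable_iff:
  "square_integrable f \<longleftrightarrow> f \<in> borel_measurable lebesgue \<and> sqnorm f < \<infinity>"
  unfolding square_integrable_def sqnorm_lebesgue
  by (auto simp: integrable_iff_bounded)

lemma sqnorm_eq_L2_norm: "square_integrable f \<Longrightarrow> sqnorm f = ennreal ((L2_norm f)\<^sup>2)"
  unfolding square_integrable_def sqnorm_lebesgue L2_norm_def
  by (subst nn_integral_eq_integral) auto

lemma square_integrable_borel_version:
  fixes u :: "real^'n \<Rightarrow> real"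
  assumes "square_integrable u"
  obtains u' where "u' \<in> borel_measurable borel" "AE x in lborel. u x = u' x" "sqnorm u' < \<infinity>"
proof -
  have "u \<in> borel_measurable lebesgue" and fin: "sqnorm u < \<infinity>"
    using assms by (auto simp: square_integrable_iff)
  then obtain u' where u': "u' \<in> borel_measurable lborel" "AE x in lborel. u x = u' x"
    using completion_ex_borel_measurable_real by blast
  moreover have "sqnorm u' < \<infinity>" using sqnorm_cong_AE[OF u'(2)] fin by simp
  ultimately show ?thesis using that[of u'] by simp
qed

context radial_kernel
begin

lemma nonlocal_grad_eq:
  assumes ae: "AE x in lborel. \<rho> x = r x" and u: "test_function u"
  shows "nonlocal_grad \<rho> u = G u"
proof
  fix x :: "real^'n"
  have [measurable]: "u \<in> borel_measurable borel" by (rule test_function_measurable[OF u])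
  let ?g = "\<lambda>y. ((u x - u y) * r (x - y) / (norm (x - y))\<^sup>2) *\<^sub>R (x - y)"
  have "nonlocal_grad \<rho> u x = (LINT y|lborel. ?g y)"
    unfolding nonlocal_grad_def
  proof (rule integral_lebesgue_AE_eq(1))
    show "AE y in lborel. ((u x - u y) / norm (x - y) * \<rho> (x - y)) *\<^sub>R ((x - y) /\<^sub>R norm (x - y)) = ?g y"
      using AE_lborel_reflect[OF ae, of x]
      by eventually_elim (simp add: power2_eq_square divide_inverse mult_ac)
  qed measurable
  also have "\<dots> = (LINT z|lborel. ?g (x - z))"
    by (rule integral_lborel_reflect[symmetric])
  also have "\<dots> = G u x" by (simp add: G_def)
  finally show "nonlocal_grad \<rho> u x = G u x" .
qed

text \<open>Local integrability gives measurability of K only on compact subsets of the punctured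
  space. The annuli \<open>C n\<close> exhaust that space, so the limit, set to zero at the origin,
  is measurable and has a Borel version; its positive part is \<open>\<kappa>\<close>.\<close>

lemma kernel_density_exists:
  fixes K :: "real^'n \<Rightarrow> real"
  assumes ae: "AE t in lborel. t > 0 \<longrightarrow> radial_rep \<rho> t = b t"
    and K: "given_off_origin_by (K_distr \<rho>) (\<lambda>x. complex_of_real (K x))"
    and K_nonneg: "\<And>x. x \<noteq> 0 \<Longrightarrow> K x \<ge> 0"
  obtains \<kappa> where "kernel_pair b r \<kappa>" "AE x in lborel. K x = \<kappa> x"
proof -
  have li: "set_integrable lebesgue C (\<lambda>x. complex_of_real (K x))" if "compact C" "C \<subseteq> - {0}" for C
    using K that by (auto simp: given_off_origin_by_def locally_integrable_on_def)
  define C :: "nat \<Rightarrow> (real^'n) set" where "C n = cball 0 (real (Suc n)) - ball 0 (1 / real (Suc n))" for n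
  define K0 where "K0 x = (if x = 0 then 0 else K x)" for x
  have "compact (C n)" "C n \<subseteq> - {0}" for n
    unfolding C_def by (auto intro: compact_diff)
  from li[OF this] have "integrable lebesgue (\<lambda>x. Re (indicator (C n) x *\<^sub>R complex_of_real (K x)))" for n
    unfolding set_integrable_def by (rule integrable_Re)
  then have mC: "(\<lambda>x. indicator (C n) x * K x) \<in> borel_measurable lebesgue" for n
    by (intro borel_measurable_integrable) simp
  have "K0 \<in> borel_measurable lebesgue"
  proof (rule borel_measurable_LIMSEQ_real[OF _ mC])
    fix x :: "real^'n"
    show "(\<lambda>n. indicator (C n) x * K x) \<longlonglongrightarrow> K0 x"
    proof (cases "x = 0")
      case True
      then have "x \<notin> C n" for n by (simp add: C_def del: of_nat_Suc)
      then show ?thesis using True by (simp add: K0_def)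
    next
      case False
      obtain m where m: "max (norm x) (1 / norm x) \<le> real m" using real_arch_simple by blast
      have "\<forall>\<^sub>F n in sequentially. indicator (C n) x * K x = K0 x"
      proof (rule eventually_sequentiallyI[of m])
        fix n assume n: "m \<le> n"
        have "norm x \<le> real (Suc n)" "1 / norm x \<le> real (Suc n)" using m n by auto
        moreover from this have "1 / real (Suc n) \<le> norm x"
          using False by (simp add: divide_le_eq mult.commute del: of_nat_Suc)
        ultimately have "x \<in> C n" by (simp add: C_def not_less del: of_nat_Suc)
        then show "indicator (C n) x * K x = K0 x" using False by (simp add: K0_def)
      qed
      then show ?thesis by (rule tendsto_eventually)
    qed
  qed
  then obtain \<kappa>0 where \<kappa>0[measurable]: "\<kappa>0 \<in> borel_measurable lborel" and eq: "AE x in lborel. K0 x = \<kappa>0 x"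
    using completion_ex_borel_measurable_real by blast
  define \<kappa> where "\<kappa> x = max 0 (\<kappa>0 x)" for x
  have m\<kappa>[measurable]: "\<kappa> \<in> borel_measurable borel" unfolding \<kappa>_def[abs_def] using \<kappa>0 by simp
  have K\<kappa>: "AE x in lborel. K x = \<kappa> x"
    using eq AE_lborel_singleton[of "0::real^'n"]
  proof eventually_elim
    case (elim x)
    then show ?case using K_nonneg[of x] by (simp add: K0_def \<kappa>_def)
  qed
  have "integrable lborel (\<lambda>x. of_real (\<kappa> x) * \<phi> x) \<and>
      (LINT x|lborel. of_real (\<kappa> x) * \<phi> x) = - (LINT \<xi>|lborel. of_real ((norm (Lam \<xi>))\<^sup>2) * fourier \<phi> (- \<xi>))"
    if \<phi>: "test_function \<phi>" "0 \<notin> fun_support \<phi>" for \<phi> :: "real^'n \<Rightarrow> complex"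
  proof -
    have [measurable]: "\<phi> \<in> borel_measurable borel" by (rule test_function_measurable[OF \<phi>(1)])
    let ?S = "fun_support \<phi>"
    have S: "compact ?S" "?S \<subseteq> - {0}" using \<phi> by (auto simp: test_function_def)
    have S0: "\<phi> x = 0" if "x \<notin> ?S" for x
      using that closure_subset[of "{x. \<phi> x \<noteq> 0}"] by (auto simp: fun_support_def)
    have AEeq: "AE x in lborel. complex_of_real (K x) * \<phi> x = of_real (\<kappa> x) * \<phi> x"
      using K\<kappa> by eventually_elim simp
    have mm: "(\<lambda>x. complex_of_real (\<kappa> x) * \<phi> x) \<in> borel_measurable borel" by measurable
    obtain B where B: "B > 0" "\<And>x. norm (\<phi> x) \<le> B" using test_function_bounded[OF \<phi>(1)] by blast
    have "integrable lebesgue (\<lambda>x. complex_of_real (K x) * \<phi> x)"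
    proof (rule Bochner_Integration.integrable_bound)
      show "integrable lebesgue (\<lambda>x. B * norm (indicator ?S x *\<^sub>R complex_of_real (K x)))"
        using li[OF S] unfolding set_integrable_def by (intro integrable_mult_right integrable_norm)
      show "(\<lambda>x. complex_of_real (K x) * \<phi> x) \<in> borel_measurable lebesgue"
        by (rule measurable_completion_AE_eq[OF measurable_completion AEeq]) (use mm in simp)
      have "norm (complex_of_real (K x) * \<phi> x) \<le> norm (B * norm (indicator ?S x *\<^sub>R complex_of_real (K x)))" for x
        using S0[of x] B(2)[of x] B(1) by (cases "x \<in> ?S") (auto simp: norm_mult mult.commute[of B] intro!: mult_left_mono)
      then show "AE x in lebesgue. norm (complex_of_real (K x) * \<phi> x) \<le> norm (B * norm (indicator ?S x *\<^sub>R complex_of_real (K x)))"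
        by simp
    qed
    then have "integrable lborel (\<lambda>x. complex_of_real (\<kappa> x) * \<phi> x)"
      using integral_lebesgue_AE_eq(2)[OF mm AEeq] by simp
    moreover have "K_distr \<rho> \<phi> = (LINT x|lebesgue. complex_of_real (K x) * \<phi> x)"
      using K \<phi> by (simp add: given_off_origin_by_def)
    ultimately show ?thesis
      using integral_lebesgue_AE_eq(1)[OF mm AEeq] K_distr_eq[OF ae \<phi>(1)] by simp
  qed
  then have "kernel_pair b r \<kappa>"
    by (intro kernel_pair.intro kernel_pair_axioms.intro radial_kernel_axioms m\<kappa>) (auto simp: \<kappa>_def)
  then show ?thesis using K\<kappa> by (rule that)
qed

end

context kernel_pair
begin

text \<open>For each x the reflection y -> x - y preserves null sets, so changing K or
  \<open>u\<close> on a null set changes the inner integrand only on a null set, for almost every x.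
  The rest is the substitution h = x - y and Tonelli.\<close>

lemma gagliardo_eq:
  assumes K: "AE x in lborel. K x = \<kappa> x" and u: "AE x in lborel. u x = f x"
    and [measurable]: "f \<in> borel_measurable borel"
  shows "gagliardo K u = En f"
proof -
  have "gagliardo K u = (\<integral>\<^sup>+x. \<integral>\<^sup>+y. ennreal (\<bar>u x - u y\<bar>\<^sup>2 * K (x - y)) \<partial>lborel \<partial>lborel)"
    unfolding gagliardo_def nn_integral_completion ..
  also have "\<dots> = (\<integral>\<^sup>+x. \<integral>\<^sup>+y. ennreal (\<bar>f x - f y\<bar>\<^sup>2 * \<kappa> (x - y)) \<partial>lborel \<partial>lborel)"
  proof (rule nn_integral_cong_AE, use u in eventually_elim)
    case (elim x)
    show ?case
    proof (rule nn_integral_cong_AE, use u AE_lborel_reflect[OF K, of x] in eventually_elim)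
      case (elim y)
      then show ?case using \<open>u x = f x\<close> by simp
    qed
  qed
  also have "\<dots> = (\<integral>\<^sup>+x. \<integral>\<^sup>+h. ennreal ((norm (f x - f (x - h)))\<^sup>2 * \<kappa> h) \<partial>lborel \<partial>lborel)"
  proof (rule nn_integral_cong)
    fix x
    show "(\<integral>\<^sup>+y. ennreal (\<bar>f x - f y\<bar>\<^sup>2 * \<kappa> (x - y)) \<partial>lborel) = (\<integral>\<^sup>+h. ennreal ((norm (f x - f (x - h)))\<^sup>2 * \<kappa> h) \<partial>lborel)"
      using nn_integral_lborel_reflect[of "\<lambda>y. ennreal (\<bar>f x - f y\<bar>\<^sup>2 * \<kappa> (x - y))" x] by simp
  qed
  also have "\<dots> = (\<integral>\<^sup>+h. \<integral>\<^sup>+x. ennreal ((norm (f x - f (x - h)))\<^sup>2 * \<kappa> h) \<partial>lborel \<partial>lborel)"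
    by (rule lborel_pair.Fubini') measurable
  also have "\<dots> = En f"
    unfolding En_def sqnorm_def
  proof (rule nn_integral_cong)
    fix h
    have "(\<integral>\<^sup>+x. ennreal ((norm (f x - f (x - h)))\<^sup>2 * \<kappa> h) \<partial>lborel) = (\<integral>\<^sup>+x. ennreal (\<kappa> h) * ennreal ((norm (f x - f (x - h)))\<^sup>2) \<partial>lborel)"
      by (intro nn_integral_cong) (simp only: ennreal_mult zero_le_power2 \<kappa>_nonneg mult.commute)
    also have "\<dots> = ennreal (\<kappa> h) * (\<integral>\<^sup>+x. ennreal ((norm (f x - f (x - h)))\<^sup>2) \<partial>lborel)"
      by (rule nn_integral_cmult) measurable
    finally show "(\<integral>\<^sup>+x. ennreal ((norm (f x - f (x - h)))\<^sup>2 * \<kappa> h) \<partial>lborel) = ennreal (\<kappa> h) * (\<integral>\<^sup>+x. ennreal ((norm (f x - f (x - h)))\<^sup>2) \<partial>lborel)" .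
  qed
  finally show ?thesis .
qed

lemma sqnorm_cong_AE_limit:
  assumes "AE x in lborel. u x = f x"
  shows "sqnorm (\<lambda>x. g x - u x) = sqnorm (\<lambda>x. g x - f x)"
  using assms by (intro sqnorm_cong_AE) (auto elim: eventually_mono)

lemma grad_closure_energy:
  assumes \<rho>: "AE x in lborel. \<rho> x = r x" and K: "AE x in lborel. K x = \<kappa> x"
    and cl: "grad_closure \<rho> u v"
  shows "gagliardo K u \<le> 8 * sqnorm v" "sqnorm v \<le> 2 * gagliardo K u"
proof -
  obtain \<phi> where \<phi>: "\<And>k. test_function (\<phi> k)" "L2_tendsto \<phi> u" "L2_tendsto (\<lambda>k. nonlocal_grad \<rho> (\<phi> k)) v"
    using cl by (auto simp: grad_closure_def)
  have u: "square_integrable u" and v: "v \<in> borel_measurable lebesgue"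
    using cl by (auto simp: grad_closure_def square_integrable_iff)
  obtain f where f: "f \<in> borel_measurable borel" "AE x in lborel. u x = f x" "sqnorm f < \<infinity>"
    using square_integrable_borel_version[OF u] by blast
  have lim: "(\<lambda>k. sqnorm (\<lambda>x. \<phi> k x - f x)) \<longlonglongrightarrow> 0"
    using \<phi>(2) by (simp only: L2_tendsto_iff sqnorm_cong_AE_limit[OF f(2)])
  have glim: "(\<lambda>k. sqnorm (\<lambda>x. G (\<phi> k) x - v x)) \<longlonglongrightarrow> 0"
    using \<phi>(3) by (simp only: L2_tendsto_iff nonlocal_grad_eq[OF \<rho> \<phi>(1)])
  show "gagliardo K u \<le> 8 * sqnorm v" "sqnorm v \<le> 2 * gagliardo K u"
    unfolding gagliardo_eq[OF K f(2,1)]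
    by (rule energy_of_closure[OF f(1,3) v \<phi>(1) lim glim])+
qed

lemma grad_closure_exists:
  assumes \<rho>: "AE x in lborel. \<rho> x = r x" and K: "AE x in lborel. K x = \<kappa> x"
    and u: "square_integrable u" and fin: "gagliardo K u < \<infinity>"
  shows "\<exists>v. grad_closure \<rho> u v"
proof -
  obtain f where f: "f \<in> borel_measurable borel" "AE x in lborel. u x = f x" "sqnorm f < \<infinity>"
    using square_integrable_borel_version[OF u] by blast
  have "En f < \<infinity>" using fin gagliardo_eq[OF K f(2,1)] by simp
  then obtain \<phi> v where \<phi>: "\<And>k. test_function (\<phi> k)" and v: "v \<in> borel_measurable borel" "sqnorm v < \<infinity>"
    and lim: "(\<lambda>k. sqnorm (\<lambda>x. \<phi> k x - f x)) \<longlonglongrightarrow> 0" and glim: "(\<lambda>k. sqnorm (\<lambda>x. G (\<phi> k) x - v x)) \<longlonglongrightarrow> 0"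
    using finite_energy_imp_closure[OF f(1,3)] by blast
  have "L2_tendsto \<phi> u"
    using lim by (simp only: L2_tendsto_iff sqnorm_cong_AE_limit[OF f(2)])
  moreover have "L2_tendsto (\<lambda>k. nonlocal_grad \<rho> (\<phi> k)) v"
    using glim by (simp only: L2_tendsto_iff nonlocal_grad_eq[OF \<rho> \<phi>])
  moreover have "square_integrable v"
    using v by (simp add: square_integrable_iff measurable_completion)
  ultimately show ?thesis using u \<phi> unfolding grad_closure_def by blast
qed

end

theorem theorem4p9:
  fixes \<rho> K :: "real^'n \<Rightarrow> real"
  assumes nonneg: "\<And>x. x \<noteq> 0 \<Longrightarrow> \<rho> x \<ge> 0"
    and radial: "radial \<rho>"
    and loc_int: "locally_integrable_on UNIV \<rho>"
    and int: "integrable lebesgue (\<lambda>x. min 1 (inverse (norm x)) * \<rho> x)"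
    and inf_pos: "\<exists>\<epsilon>>0. (INF x\<in>cball 0 \<epsilon> - {0}. \<rho> x) > 0"
    and K_restr: "given_off_origin_by (K_distr \<rho>) (\<lambda>x. complex_of_real (K x))"
    and K_nonneg: "\<And>x. x \<noteq> 0 \<Longrightarrow> K x \<ge> 0"
  shows "W_space K = H_space \<rho> \<and>
    (\<exists>c>0. \<exists>C>0. \<forall>u\<in>H_space \<rho>. c * H_norm \<rho> u \<le> W_norm K u \<and> W_norm K u \<le> C * H_norm \<rho> u)"
proof -
  obtain b where "radial_kernel b (\<lambda>x::real^'n. b (norm x))"
    and ae: "AE t in lborel. t > 0 \<longrightarrow> radial_rep \<rho> t = b t" and \<rho>: "AE x in lborel. \<rho> x = b (norm x)"
    using radial_borel_version[OF nonneg radial int] by blast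
  then interpret R: radial_kernel b "\<lambda>x::real^'n. b (norm x)" by blast
  obtain \<kappa> where "kernel_pair b (\<lambda>x::real^'n. b (norm x)) \<kappa>" and K: "AE x in lborel. K x = \<kappa> x"
    using R.kernel_density_exists[OF ae K_restr K_nonneg] by blast
  then interpret kernel_pair b "\<lambda>x::real^'n. b (norm x)" \<kappa> by blast
  note energy = grad_closure_energy[OF \<rho> K]
  \<comment> \<open>Finiteness yields the inclusion of the closure in the Gagliardo space, and it
    ensures that \<open>enn2real\<close> in \<open>W_norm\<close> returns the true value of the
    form.\<close>
  have fin: "gagliardo K u < \<infinity>" if "grad_closure \<rho> u v" for u v
  proof -
    have "sqnorm v < \<infinity>" using that by (simp add: grad_closure_def square_integrable_iff)
    then show ?thesis
      by (intro le_less_trans[OF energy(1)[OF that]]) (simp add: ennreal_mult_less_top)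
  qed
  have "W_space K = H_space \<rho>"
  proof (intro equalityI subsetI)
    fix u assume "u \<in> W_space K"
    then show "u \<in> H_space \<rho>"
      using grad_closure_exists[OF \<rho> K, of u] by (simp add: W_space_def H_space_def)
  next
    fix u assume "u \<in> H_space \<rho>"
    then obtain v where v: "grad_closure \<rho> u v" by (auto simp: H_space_def)
    then have "square_integrable u" by (simp add: grad_closure_def)
    then show "u \<in> W_space K" using fin[OF v] by (simp add: W_space_def)
  qed
  \<comment> \<open>Write a and d for the L2 norms of \<open>u\<close> and its gradient, E for the
    form and S for \<open>W_norm\<close>. Then d^2 \<le> 2E gives d \<le> 2S, hence a + d \<le> 3S;
    and E \<le> 8 d^2 gives S^2 \<le> a^2 + 8 d^2 \<le> 9 (a + d)^2.\<close>
  moreover have "1 / 3 * H_norm \<rho> u \<le> W_norm K u \<and> W_norm K u \<le> 3 * H_norm \<rho> u" if "u \<in> H_space \<rho>" for u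
  proof -
    define v where "v = nonlocal_grad_ext \<rho> u"
    \<comment> \<open>The energy bounds hold for every admissible gradient, in particular for the
      one selected by \<open>nonlocal_grad_ext\<close>.\<close>
    have cl: "grad_closure \<rho> u v"
      using that unfolding v_def nonlocal_grad_ext_def H_space_def by (auto intro: someI[of "grad_closure \<rho> u"])
    define a d E where "a = L2_norm u" and "d = L2_norm v" and "E = enn2real (gagliardo K u)"
    have [simp]: "a \<ge> 0" "d \<ge> 0" "E \<ge> 0" by (simp_all add: a_def d_def E_def L2_norm_def)
    have "gagliardo K u = ennreal E" using fin[OF cl] by (simp add: E_def)
    moreover have "sqnorm v = ennreal (d\<^sup>2)"
      unfolding d_def using cl by (intro sqnorm_eq_L2_norm) (simp add: grad_closure_def)
    ultimately have "ennreal E \<le> ennreal (8 * d\<^sup>2)" "ennreal (d\<^sup>2) \<le> ennreal (2 * E)"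
      using energy[OF cl] by (simp_all add: ennreal_mult)
    then have E: "E \<le> 8 * d\<^sup>2" "d\<^sup>2 \<le> 2 * E" by (simp_all add: ennreal_le_iff)
    have W: "W_norm K u = sqrt (a\<^sup>2 + E)" and H: "H_norm \<rho> u = a + d"
      by (simp_all add: W_norm_def H_norm_def a_def d_def E_def v_def)
    have "a \<le> sqrt (a\<^sup>2 + E)" by (intro real_le_rsqrt) simp
    moreover have "d\<^sup>2 \<le> 4 * a\<^sup>2 + 4 * E" using E(2) zero_le_power2[of a] \<open>E \<ge> 0\<close> by linarith
    then have "d \<le> sqrt (2\<^sup>2 * (a\<^sup>2 + E))" by (intro real_le_rsqrt) (simp add: distrib_left)
    then have "d \<le> 2 * sqrt (a\<^sup>2 + E)" by (simp only: real_sqrt_mult real_sqrt_abs abs_numeral)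
    moreover have "sqrt (a\<^sup>2 + E) \<le> 3 * (a + d)"
    proof (rule real_le_lsqrt)
      have "0 \<le> 8 * a\<^sup>2 + 18 * (a * d) + d\<^sup>2" by simp
      moreover have "(3 * (a + d))\<^sup>2 = 9 * a\<^sup>2 + 18 * (a * d) + 9 * d\<^sup>2"
        by (simp add: power2_eq_square algebra_simps)
      ultimately show "a\<^sup>2 + E \<le> (3 * (a + d))\<^sup>2" using E(1) by linarith
    qed simp
    moreover have "1 / 3 * (x + y) \<le> S" if "x \<le> S" "y \<le> 2 * S" for x y S :: real
      using that by (simp add: field_simps)
    ultimately show ?thesis unfolding W H by blast
  qed
  ultimately show ?thesis by (intro conjI exI[of _ "1 / 3"] exI[of _ 3]) auto
qed



end
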